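(* Let $\Omega$, $\Omega_1$, $\Omega_0$, $\Gamma$, $T$, $M$, $u_0$, $f$ and $D_\epsilon$ be as in the context, and for $\epsilon>0$ let $u^\epsilon$ be the unique weak solution of $$u_t=\nabla\cdot(D_\epsilon\nabla u)+f(u)\ \text{in }(0,T)\times\Omega,\qquad \mathbf n\cdot\nabla u=0\ \text{on }(0,T)\times\partial\Omega,\qquad u(0,x)=u_0(x),\ x\in\Omega.$$ Then, as $\epsilon\to0$, $u^\epsilon$ converges strongly in $L^2((0,T)\times\Omega_1)$ to the unique solution $u$ of the Neumann problem $$u_t=\Delta u+f(u)\ \text{in }(0,T)\times\Omega_1,\qquad \nu\cdot\nabla u=0\ \text{on }(0,T)\times\partial\Omega_1,\qquad u(0,x)=u_0(x),\ x\in\Omega_1,$$ where $\nu$ is the outward unit normal to $\Gamma=\partial\Omega_1$.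
   Context: Let $\Omega\subset\mathbb R^n$ be a bounded open set with smooth boundary $\partial\Omega$ and outward unit normal $\mathbf n$. Let $\Omega_1$ be a connected open set with smooth boundary $\Gamma=\partial\Omega_1$ and $\overline{\Omega}_1\subset\Omega$, and let $\Omega_0=\Omega\setminus\overline{\Omega}_1$, which is open and connected. Fix $T>0$. Let $u_0\in C(\overline\Omega)$ with $0\le u_0(x)\le M$ for $x\in\Omega$, where $M\ge 1$. Let $f$ be continuously differentiable and bistable: for some $\alpha\in(0,1)$, $f(0)=f(\alpha)=f(1)=0$, $f'(0)<0$, $f'(1)<0$, $f'(\alpha)>0$, $f(u)<0$ for $u\in(0,\alpha)\cup(1,\infty)$ and $f(u)>0$ for $u\in(\alpha,1)$. For $\epsilon>0$ let $D_\epsilon(x)=1$ for $x\in\Omega_1\cup\Gamma$ and $D_\epsilon(x)=\epsilon$ for $x\in\Omega_0$. A weak solution of the $\epsilon$-problem is a function $u\in C([0,T];L^2(\Omega))\cap L^2(0,T;H^1(\Omega))\cap L^\infty((0,T)\times\Omega)$ such that $\int_0^T\!\int_\Omega(-u\phi_t+D_\epsilon\nabla u\cdot\nabla\phi-f(u)\phi)\,dx\,dt=\int_\Omega u_0(x)\phi(0,x)\,dx-\int_\Omega u(T,x)\phi(T,x)\,dx$ for all $\phi\in H^1((0,T)\times\Omega)$; such a solution exists and is unique. A weak solution of the Neumann problem on $\Omega_1$ is a function $u\in C([0,T];L^2(\Omega_1))\cap L^2(0,T;H^1(\Omega_1))\cap L^\infty((0,T)\times\Omega_1)$ such that $\int_0^T\!\int_{\Omega_1}(-u\phi_t+\nabla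 u\cdot\nabla\phi-f(u)\phi)\,dx\,dt=\int_{\Omega_1}u_0(x)\phi(0,x)\,dx-\int_{\Omega_1}u(T,x)\phi(T,x)\,dx$ for all $\phi\in H^1((0,T)\times\Omega_1)$; it is unique (and classical). *)

theory Defs
  imports "HOL-Analysis.Analysis"
begin

fun Ck :: "nat \<Rightarrow> ('b::euclidean_space \<Rightarrow> real) \<Rightarrow> bool" where
  "Ck 0 g = continuous_on UNIV g"
| "Ck (Suc k) g = ((\<forall>x. g differentiable (at x)) \<and>
                   (\<forall>v. Ck k (\<lambda>x. frechet_derivative g (at x) v)))"

definition smooth_fun :: "('b::euclidean_space \<Rightarrow> real) \<Rightarrow> bool" where
  "smooth_fun g \<longleftrightarrow> (\<forall>k. Ck k g)"

definition smooth_boundary :: "'b::euclidean_space set \<Rightarrow> bool" where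
  "smooth_boundary \<Omega> \<longleftrightarrow>
     (\<forall>p\<in>frontier \<Omega>. \<exists>U g. open U \<and> p \<in> U \<and> smooth_fun g \<and>
        (\<forall>x\<in>U. frechet_derivative g (at x) \<noteq> (\<lambda>_. 0)) \<and>
        \<Omega> \<inter> U = {x\<in>U. g x < 0})"

definition sq_int :: "'b::euclidean_space set \<Rightarrow> ('b \<Rightarrow> real) \<Rightarrow> bool" where
  "sq_int S g \<longleftrightarrow> g \<in> borel_measurable (lebesgue_on S) \<and>
                  integrable (lebesgue_on S) (\<lambda>x. (g x)\<^sup>2)"

definition sq_int_vec :: "'b::euclidean_space set \<Rightarrow> ('b \<Rightarrow> 'c::euclidean_space) \<Rightarrow> bool" where
  "sq_int_vec S G \<longleftrightarrow> G \<in> borel_measurable (lebesgue_on S) \<and>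
                  integrable (lebesgue_on S) (\<lambda>x. (norm (G x))\<^sup>2)"

definition test_fun :: "'b::euclidean_space set \<Rightarrow> ('b \<Rightarrow> real) \<Rightarrow> bool" where
  "test_fun U \<psi> \<longleftrightarrow> smooth_fun \<psi> \<and> compact (closure {x. \<psi> x \<noteq> 0}) \<and> closure {x. \<psi> x \<noteq> 0} \<subseteq> U"

definition weak_grad :: "'b::euclidean_space set \<Rightarrow> ('b \<Rightarrow> real) \<Rightarrow> ('b \<Rightarrow> 'b) \<Rightarrow> bool" where
  "weak_grad U g G \<longleftrightarrow>
     (\<forall>\<psi>. test_fun U \<psi> \<longrightarrow> (\<forall>i\<in>Basis.
        (LINT x|lebesgue_on U. g x * frechet_derivative \<psi> (at x) i)
          = - (LINT x|lebesgue_on U. (G x \<bullet> i) * \<psi> x)))"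

definition H1_with_grad :: "'b::euclidean_space set \<Rightarrow> ('b \<Rightarrow> real) \<Rightarrow> ('b \<Rightarrow> 'b) \<Rightarrow> bool" where
  "H1_with_grad U g G \<longleftrightarrow> sq_int U g \<and> sq_int_vec U G \<and> weak_grad U g G"

definition cyl :: "real \<Rightarrow> 'a::euclidean_space set \<Rightarrow> (real \<times> 'a) set" where
  "cyl T U = {0<..<T} \<times> U"

definition C_L2 :: "real \<Rightarrow> 'a::euclidean_space set \<Rightarrow> (real \<Rightarrow> 'a \<Rightarrow> real) \<Rightarrow> bool" where
  "C_L2 T U w \<longleftrightarrow> (\<forall>t\<in>{0..T}. sq_int U (w t)) \<and>
     (\<forall>t\<in>{0..T}. ((\<lambda>s. LINT x|lebesgue_on U. (w s x - w t x)\<^sup>2) \<longlongrightarrow> 0) (at t within {0..T}))"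

text \<open>Test functions of the weak formulation: \<phi> \<in> H^1((0,T) x U) with space-time weak gradient
  (\<Phi>t, \<Phi>x); the representative is taken continuous from [0,T] into L^2(U) (such a
  representative always exists), so that \<phi> 0 and \<phi> T are the traces.\<close>
definition H1_test :: "real \<Rightarrow> 'a::euclidean_space set \<Rightarrow> (real \<Rightarrow> 'a \<Rightarrow> real)
      \<Rightarrow> (real \<Rightarrow> 'a \<Rightarrow> real) \<Rightarrow> (real \<Rightarrow> 'a \<Rightarrow> 'a) \<Rightarrow> bool" where
  "H1_test T U \<phi> \<Phi>t \<Phi>x \<longleftrightarrow>
     H1_with_grad (cyl T U) (\<lambda>z. \<phi> (fst z) (snd z)) (\<lambda>z. (\<Phi>t (fst z) (snd z), \<Phi>x (fst z) (snd z)))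
     \<and> C_L2 T U \<phi>"

text \<open>Weak solution on U of u_t = div(D grad u) + f(u) with homogeneous Neumann condition
  and initial datum u0, on the time interval (0,T).\<close>
definition weak_sol :: "'a::euclidean_space set \<Rightarrow> ('a \<Rightarrow> real) \<Rightarrow> (real \<Rightarrow> real) \<Rightarrow> ('a \<Rightarrow> real)
      \<Rightarrow> real \<Rightarrow> (real \<Rightarrow> 'a \<Rightarrow> real) \<Rightarrow> bool" where
  "weak_sol U D f u0 T u \<longleftrightarrow>
     C_L2 T U u \<and>
     (\<lambda>z. u (fst z) (snd z)) \<in> borel_measurable (lebesgue_on (cyl T U)) \<and>
     (\<exists>C. AE z in lebesgue_on (cyl T U). \<bar>u (fst z) (snd z)\<bar> \<le> C) \<and>
     (\<exists>G :: real \<Rightarrow> 'a \<Rightarrow> 'a.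
        sq_int_vec (cyl T U) (\<lambda>z. G (fst z) (snd z)) \<and>
        (AE t in lebesgue_on {0<..<T}. weak_grad U (u t) (G t)) \<and>
        (\<forall>\<phi> \<Phi>t \<Phi>x. H1_test T U \<phi> \<Phi>t \<Phi>x \<longrightarrow>
           (LINT z|lebesgue_on (cyl T U).
               - u (fst z) (snd z) * \<Phi>t (fst z) (snd z)
               + D (snd z) * (G (fst z) (snd z) \<bullet> \<Phi>x (fst z) (snd z))
               - f (u (fst z) (snd z)) * \<phi> (fst z) (snd z))
           = (LINT x|lebesgue_on U. u0 x * \<phi> 0 x) - (LINT x|lebesgue_on U. u T x * \<phi> T x)))"

definition Deps :: "'a::euclidean_space set \<Rightarrow> real \<Rightarrow> 'a \<Rightarrow> real" where
  "Deps \<Omega>1 \<epsilon> x = (if x \<in> closure \<Omega>1 then 1 else \<epsilon>)"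

definition bistable :: "(real \<Rightarrow> real) \<Rightarrow> real \<Rightarrow> bool" where
  "bistable f \<alpha> \<longleftrightarrow> 0 < \<alpha> \<and> \<alpha> < 1 \<and> f C1_differentiable_on UNIV \<and>
     f 0 = 0 \<and> f \<alpha> = 0 \<and> f 1 = 0 \<and>
     deriv f 0 < 0 \<and> deriv f 1 < 0 \<and> deriv f \<alpha> > 0 \<and>
     (\<forall>u. (0 < u \<and> u < \<alpha>) \<or> 1 < u \<longrightarrow> f u < 0) \<and>
     (\<forall>u. \<alpha> < u \<and> u < 1 \<longrightarrow> f u > 0)"

end

(* The limit is proved by a direct energy estimate, without compactness. Let v solve the
epsilon-problem and let z approximate the solution of the Neumann problem on the inner domain: z is
obtained by averaging forward in time and by mollifying in space along the inward cones of a partition of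
unity, so it is defined and Lipschitz everywhere and solves the Neumann problem on the inner domain up
to a residual that is small in L2. Let X be a smooth cut-off that is 1 on the closed inner domain and
vanishes outside a layer of small measure. Testing the epsilon-problem with X^2 (v - z) bounds the
growth of the integral of X^2 (v - z)^2 / 2 by a multiple of itself, the residual, a constant times the
measure of the layer, and epsilon times a constant that depends on z and X. The reaction term is harmless
although v has no bound uniform in epsilon: v is nonnegative and f is negative on (1, infinity), so
(f a - f b) (a - b) <= L (a - b)^2 for a >= 0 and bounded b. Gronwall's inequality and the choice of
z, then X, then epsilon give the result. *)
theory Submission
  imports Defs
begin

text \<open>The obstacle: u lives on \<open>\<Omega>1\<close> only, and its zero extension in
  general jumps across the boundary, so the two weak formulations cannot be subtracted from one
  another. Hence the detour through a z given on the whole space. The bounds of z, of its time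
  derivative and of its gradient may blow up as the residual tends to 0, and the gradient of X may
  blow up as the layer shrinks; this dictates the order of choices. The weight is the square X^2
  because the cross term with the gradient of X can then be absorbed by the diffusion, even where
  its coefficient is only \<epsilon>. No time derivative of v is at hand: the growth of the energy
  comes from convexity, from the equation between two times and from backward averages. Two bounds
  for v are needed beforehand: v >= 0, and an L2 bound at each time that does not depend on
  \<epsilon>.\<close>

abbreviation "ind \<equiv> indicator"
abbreviation "borel_fun \<equiv> borel_measurable borel"

lemmas lintegrable_add = Bochner_Integration.integrable_add
lemmas lintegrable_bound = Bochner_Integration.integrable_bound
lemmas lintegrable_diff = Bochner_Integration.integrable_diff
lemmas lint_add = Bochner_Integration.integral_add
lemmas lint_cong = Bochner_Integration.integral_cong
lemmas lint_diff = Bochner_Integration.integral_diff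
lemmas lint_dominated_convergence = Bochner_Integration.integral_dominated_convergence
lemmas lint_minus = Bochner_Integration.integral_minus
lemmas lint_sum = Bochner_Integration.integral_sum

section \<open>Square-integrable functions\<close>

text \<open>Everything is done with Borel functions on the whole space, functions on a domain being
  extended by 0. Translations, products and Fubini then need no side conditions about the
  domain.\<close>

definition L2 :: "('n::euclidean_space => 'b::euclidean_space) => bool" where
 "L2 g \<longleftrightarrow> g \<in> borel_fun \<and> integrable lborel (%x. (norm (g x))\<^sup>2)"

definition sqn :: "('n::euclidean_space => 'b::euclidean_space) => real" where
 "sqn g = (LBINT x. (norm (g x))\<^sup>2)"

lemma sqn_nonneg [simp]: "0 \<le> sqn g"
 unfolding sqn_def by simp

lemma L2_measurable [measurable_dest]: "L2 g ==> g \<in> borel_fun"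
 and L2_integrable: "L2 g ==> integrable lborel (%x. (norm (g x))\<^sup>2)"
 unfolding L2_def by auto

lemma L2_integrable_real: "L2 (g :: 'n::euclidean_space => real) ==> integrable lborel (%x. (g x)\<^sup>2)"
 unfolding L2_def by simp

lemma sqn_real: "sqn (g :: 'n::euclidean_space => real) = (LBINT x. (g x)\<^sup>2)"
 unfolding sqn_def by simp

lemma norm_add_sq_le: "(norm (a + b :: 'b::real_inner))\<^sup>2 \<le> 2 * (norm a)\<^sup>2 + 2 * (norm b)\<^sup>2"
proof -
 have "0 \<le> (norm (a - b))\<^sup>2" by simp
 then show ?thesis
  by (simp add: power2_norm_eq_inner inner_add_left inner_add_right inner_diff_left inner_diff_right inner_commute)
qed

lemma norm_inner_le_sq: "\<bar>(a::'b::real_inner) \<bullet> b\<bar> \<le> ((norm a)\<^sup>2 + (norm b)\<^sup>2) / 2"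
proof -
 have "\<bar>a \<bullet> b\<bar> \<le> norm a * norm b" by (rule Cauchy_Schwarz_ineq2)
 also have "\<dots> \<le> ((norm a)\<^sup>2 + (norm b)\<^sup>2) / 2"
  using sum_squares_bound[of "norm a" "norm b"] by simp
 finally show ?thesis .
qed

lemma L2_bound:
 assumes "f \<in> borel_fun" "integrable lborel h" "!!x. (norm (f x))\<^sup>2 \<le> h x"
 shows "L2 f"
 unfolding L2_def
proof
 show "integrable lborel (%x. (norm (f x))\<^sup>2)"
  by (rule lintegrable_bound[OF assms(2)])
    (use assms in \<open>auto intro!: AE_I2 order_trans[OF assms(3)]\<close>)
qed (use assms in simp)

lemma L2_add: assumes "L2 f" "L2 g" shows "L2 (%x. f x + g x)"
proof (rule L2_bound)
 show "integrable lborel (%x. 2 * (norm (f x))\<^sup>2 + 2 * (norm (g x))\<^sup>2)"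
  using assms by (auto intro!: integrable_add integrable_mult_right simp: L2_integrable)
qed (use assms norm_add_sq_le in \<open>auto dest: L2_measurable\<close>)

lemma L2_mult_bounded:
 fixes c :: "'n::euclidean_space => real" and g :: "'n => 'b::euclidean_space"
 assumes "L2 g" "c \<in> borel_fun" "!!x. \<bar>c x\<bar> \<le> C"
 shows "L2 (%x. c x *\<^sub>R g x)"
proof (rule L2_bound)
 show "integrable lborel (%x. C\<^sup>2 * (norm (g x))\<^sup>2)"
  using assms by (auto intro!: integrable_mult_right simp: L2_integrable)
 show "(norm (c x *\<^sub>R g x))\<^sup>2 \<le> C\<^sup>2 * (norm (g x))\<^sup>2" for x
  by (simp add: power_mult_distrib)
    (metis abs_ge_zero abs_le_square_iff assms(3) abs_of_nonneg mult_right_mono order_trans zero_le_power2)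
qed (use assms in \<open>auto dest: L2_measurable\<close>)

lemma L2_mult_bounded_real:
 fixes c g :: "'n::euclidean_space => real"
 assumes "L2 g" "c \<in> borel_fun" "!!x. \<bar>c x\<bar> \<le> C"
 shows "L2 (%x. c x * g x)"
 using L2_mult_bounded[OF assms] by simp

lemma L2_scaleR: "L2 g ==> L2 (%x. c *\<^sub>R g x)"
 using L2_mult_bounded[of g "%_. c" "\<bar>c\<bar>"] by simp

lemma L2_cmult: "L2 g ==> L2 (%x. c * g x :: real)"
 using L2_scaleR[of g c] by simp

lemma L2_minus: "L2 g ==> L2 (%x. - g x)"
 using L2_scaleR[of g "-1"] by simp

lemma L2_diff: "L2 f ==> L2 g ==> L2 (%x. f x - g x)"
 using L2_add[of f "%x. - g x"] L2_minus by auto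

lemma L2_zero [simp]: "L2 (%x. 0)"
 unfolding L2_def by simp

lemma L2_sum: "(!!i. i \<in> I ==> L2 (f i)) ==> L2 (%x. \<Sum>i\<in>I. f i x)"
 by (induction I rule: infinite_finite_induct) (auto intro: L2_add)

lemma L2_inner_integrable:
 assumes "L2 f" "L2 g" shows "integrable lborel (%x. f x \<bullet> g x)"
proof (rule lintegrable_bound)
 show "integrable lborel (%x. ((norm (f x))\<^sup>2 + (norm (g x))\<^sup>2)/2)"
  using assms by (auto simp: L2_integrable)
qed (use assms norm_inner_le_sq in \<open>auto dest: L2_measurable intro!: AE_I2\<close>)

lemma L2_mult_integrable:
 fixes f g :: "'n::euclidean_space => real"
 shows "L2 f ==> L2 g ==> integrable lborel (%x. f x * g x)"
 using L2_inner_integrable[of f g] by simp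

text \<open>Cauchy-Schwarz by the discriminant: the quadratic in t is \<open>sqn\<close> of f - t g
  and hence nonnegative.\<close>

lemma L2_inner_le:
 assumes "L2 f" "L2 g" shows "\<bar>LBINT x. f x \<bullet> g x\<bar> \<le> sqrt (sqn f) * sqrt (sqn g)"
proof -
 let ?I = "LBINT x. f x \<bullet> g x"
 have q: "0 \<le> sqn f - 2 * t * ?I + t\<^sup>2 * sqn g" for t
 proof -
  have "0 \<le> (LBINT x. (norm (f x - t *\<^sub>R g x))\<^sup>2)" by simp
  also have "\<dots> = (LBINT x. (norm (f x))\<^sup>2 - 2 * t * (f x \<bullet> g x) + t\<^sup>2 * (norm (g x))\<^sup>2)"
   by (intro lint_cong refl)
     (simp add: power2_norm_eq_inner inner_diff_left inner_diff_right inner_commute power2_eq_square[of t] algebra_simps)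
  also have "\<dots> = sqn f - 2 * t * ?I + t\<^sup>2 * sqn g"
   using assms by (simp add: sqn_def L2_integrable L2_inner_integrable)
  finally show ?thesis .
 qed
 have "?I\<^sup>2 \<le> sqn f * sqn g"
 proof (cases "sqn g = 0")
  case True
  have "?I = 0"
  proof (rule ccontr)
   assume "?I \<noteq> 0"
   \<comment> \<open>With \<open>sqn g = 0\<close> the quadratic is affine in t, and this t gives it
     the value -1.\<close>
   then show False using q[of "(sqn f + 1) / (2 * ?I)"] True by simp
  qed
  then show ?thesis by simp
 next
  case False
  then have "0 < sqn g" using sqn_nonneg[of g] by linarith
  then show ?thesis using q[of "?I / sqn g"]
   by (simp add: power2_eq_square field_simps)
 qed
 then have "sqrt (?I\<^sup>2) \<le> sqrt (sqn f * sqn g)" by (rule real_sqrt_le_mono)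
 then show ?thesis by (simp add: real_sqrt_mult)
qed

lemma sqn_add_le:
 assumes "L2 f" "L2 g" shows "sqn (%x. f x + g x) \<le> 2 * sqn f + 2 * sqn g"
proof -
 have "sqn (%x. f x + g x) \<le> (LBINT x. 2 * (norm (f x))\<^sup>2 + 2 * (norm (g x))\<^sup>2)"
  unfolding sqn_def
  by (rule integral_mono) (use assms L2_add[OF assms] norm_add_sq_le in \<open>auto simp: L2_integrable\<close>)
 then show ?thesis using assms by (simp add: sqn_def L2_integrable)
qed

lemma sqn_minus: "sqn (%x. - f x) = sqn f"
 by (simp add: sqn_def)

lemma sqn_diff_le:
 assumes "L2 f" "L2 g" shows "sqn (%x. f x - g x) \<le> 2 * sqn f + 2 * sqn g"
 using sqn_add_le[OF assms(1) L2_minus[OF assms(2)]] by (simp add: sqn_minus)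

lemma sqn_sum_le:
 assumes "finite I" "!!i. i \<in> I ==> L2 (f i)"
 shows "sqn (%x. \<Sum>i\<in>I. f i x) \<le> real (card I) * (\<Sum>i\<in>I. sqn (f i))"
proof -
 have *: "(norm (\<Sum>i\<in>I. f i x))\<^sup>2 \<le> real (card I) * (\<Sum>i\<in>I. (norm (f i x))\<^sup>2)" for x
 proof -
  have "(norm (\<Sum>i\<in>I. f i x))\<^sup>2 \<le> (\<Sum>i\<in>I. norm (f i x))\<^sup>2"
   by (intro power_mono norm_sum) simp
  also have "\<dots> \<le> real (card I) * (\<Sum>i\<in>I. (norm (f i x))\<^sup>2)"
   using Cauchy_Schwarz_ineq_sum[of "%_. 1" "%i. norm (f i x)" I] by simp
  finally show ?thesis .
 qed
 have "sqn (%x. \<Sum>i\<in>I. f i x) \<le> (LBINT x. real (card I) * (\<Sum>i\<in>I. (norm (f i x))\<^sup>2))"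
  unfolding sqn_def
  by (rule integral_mono) (use assms L2_sum[of I f] * in \<open>auto simp: L2_integrable\<close>)
 also have "\<dots> = real (card I) * (\<Sum>i\<in>I. sqn (f i))"
  using assms by (simp add: sqn_def L2_integrable)
 finally show ?thesis .
qed

lemma sqn_mono:
 assumes "L2 g" "f \<in> borel_fun" "!!x. norm (f x) \<le> norm (g x)"
 shows "sqn f \<le> sqn g"
proof -
 have "(norm (f x))\<^sup>2 \<le> (norm (g x))\<^sup>2" for x using assms(3) by (intro power_mono) auto
 moreover then have "L2 f" using assms by (intro L2_bound[of f "%x. (norm (g x))\<^sup>2"]) (auto simp: L2_integrable)
 ultimately show ?thesis using assms unfolding sqn_def by (intro integral_mono) (auto simp: L2_integrable)
qed

lemma sqn_mult_bounded:
 fixes c :: "'n::euclidean_space => real" and g :: "'n => 'b::euclidean_space"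
 assumes "L2 g" "c \<in> borel_fun" "!!x. \<bar>c x\<bar> \<le> C"
 shows "sqn (%x. c x *\<^sub>R g x) \<le> C\<^sup>2 * sqn g"
proof -
 have "sqn (%x. c x *\<^sub>R g x) \<le> sqn (%x. C *\<^sub>R g x)"
  by (rule sqn_mono) (use assms order_trans[OF assms(3) abs_ge_self] in \<open>auto intro!: L2_scaleR mult_right_mono dest: L2_measurable\<close>)
 also have "\<dots> = C\<^sup>2 * sqn g" by (simp add: sqn_def power_mult_distrib)
 finally show ?thesis .
qed

lemma integrable_indicator_cball:
 "integrable lborel (%x. c * ind (cball a r) x :: real)"
proof -
 have "integrable lborel (%x. ind (cball a r) x :: real)"
  by (rule integrable_real_indicator[OF _ emeasure_lborel_cball_finite]) simp
 then show ?thesis by simp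
qed

lemma integrable_bounded_support:
 fixes f :: "'n::euclidean_space => 'b::euclidean_space"
 assumes "f \<in> borel_fun" "!!x. norm (f x) \<le> C" "bounded S" "!!x. x \<notin> S ==> f x = 0"
 shows "integrable lborel f"
proof -
 obtain r where r: "!!x. x \<in> S ==> norm x \<le> r" using assms(3) unfolding bounded_iff by blast
 have "integrable lborel (%x. C * ind (cball 0 r) x :: real)"
  by (rule integrable_indicator_cball)
 then show ?thesis
 proof (rule lintegrable_bound)
  show "AE x in lborel. norm (f x) \<le> norm (C * ind (cball 0 r) x)"
  proof (intro AE_I2)
   fix x show "norm (f x) \<le> norm (C * ind (cball 0 r) x)"
    using assms(2)[of x] assms(4)[of x] r[of x] abs_ge_self[of C] by (cases "x \<in> cball 0 r") auto
  qed
 qed (use assms in simp)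
qed

lemma L2_bounded_support:
 fixes f :: "'n::euclidean_space => 'b::euclidean_space"
 assumes "f \<in> borel_fun" "!!x. norm (f x) \<le> C" "bounded S" "!!x. x \<notin> S ==> f x = 0"
 shows "L2 f"
 unfolding L2_def
proof
 show "integrable lborel (%x. (norm (f x))\<^sup>2)"
  by (rule integrable_bounded_support[of _ "C\<^sup>2" S]) (use assms in \<open>auto intro!: power_mono\<close>)
qed (use assms in simp)

lemma integrable_L2_bounded_support:
 fixes f :: "'n::euclidean_space => real"
 assumes "L2 f" "bounded S" "!!x. x \<notin> S ==> f x = 0"
 shows "integrable lborel f"
proof -
 obtain r where r: "!!x. x \<in> S ==> norm x \<le> r" using assms(2) unfolding bounded_iff by blast
 have "L2 (%x. ind (cball 0 r) x :: real)"
  by (rule L2_bounded_support[of _ 1 "cball 0 r"]) (auto simp: indicator_def)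
 then have "integrable lborel (%x. f x * ind (cball 0 r) x)"
  using assms by (intro L2_mult_integrable) auto
 moreover have "(%x. f x * ind (cball 0 r) x) = f"
 proof
  fix x show "f x * ind (cball 0 r) x = f x"
   using r[of x] assms(3)[of x] by (cases "x \<in> cball 0 r") auto
 qed
 ultimately show ?thesis by simp
qed

lemma integral_lborel_shift:
 fixes f :: "'n::euclidean_space => 'b::{banach, second_countable_topology}"
 assumes "f \<in> borel_fun"
 shows "(LBINT x. f (x + s)) = (LBINT x. f x)"
proof -
 have "(LBINT x. f x) = (LINT x|distr lborel borel ((+) s). f x)"
  using lborel_distr_plus[of s] by simp
 also have "\<dots> = (LBINT x. f (s + x))"
  using assms by (intro integral_distr) auto
 finally show ?thesis by (simp add: add.commute)
qed

lemma integrable_lborel_shift: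
 fixes f :: "'n::euclidean_space => 'b::{banach, second_countable_topology}"
 assumes "integrable lborel f"
 shows "integrable lborel (%x. f (x + s))"
proof -
 have "integrable (distr lborel borel ((+) s)) f"
  using assms lborel_distr_plus[of s] by simp
 then have "integrable lborel (%x. f (s + x))"
  using assms by (subst (asm) integrable_distr_eq) auto
 then show ?thesis by (simp add: add.commute)
qed

lemma L2_shift: "L2 g ==> L2 (%x. g (x + s))"
 unfolding L2_def using integrable_lborel_shift[of "%x. (norm (g x))\<^sup>2" s] by auto

lemma sqn_shift: "L2 g ==> sqn (%x. g (x + s)) = sqn g"
 unfolding sqn_def using integral_lborel_shift[of "%x. (norm (g x))\<^sup>2" s] by (auto simp: L2_def)

section \<open>Continuity of translations in L2\<close>

definition shift_cont :: "('n::euclidean_space => 'b::euclidean_space) => bool" where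
 "shift_cont g \<longleftrightarrow> (\<forall>e>0. \<exists>d>0. \<forall>s. norm s \<le> d --> sqn (%x. g (x + s) - g x) \<le> e)"

text \<open>Translations are isometries of L2, so the error of an approximant enters the increment
  of \<open>g\<close> only with a fixed factor: the property passes to L2 limits. The general case
  is thereby reduced to bounded functions, and these to continuous ones.\<close>

lemma shift_cont_approx:
 assumes g: "L2 g" and a: "!!e. e > 0 ==> \<exists>g'. L2 g' \<and> shift_cont g' \<and> sqn (%x. g x - g' x) \<le> e"
 shows "shift_cont g"
 unfolding shift_cont_def
proof (intro allI impI)
 fix e :: real assume e: "e > 0"
 \<comment> \<open>The increment of g - g' costs 2 * (2 + 2) * e/16 = e/2 and that of g' costs 2 *
   e/4 = e/2.\<close>
 obtain g' where g': "L2 g'" "shift_cont g'" "sqn (%x. g x - g' x) \<le> e/16"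
  using a[of "e/16"] e by auto
 obtain d where d: "d > 0" "!!s. norm s \<le> d ==> sqn (%x. g' (x + s) - g' x) \<le> e/4"
  using g'(2)[unfolded shift_cont_def, rule_format, of "e/4"] e by auto
 have "sqn (%x. g (x + s) - g x) \<le> e" if s: "norm s \<le> d" for s
 proof -
  let ?h = "%x. g x - g' x"
  have h: "L2 ?h" using g g' by (intro L2_diff) auto
  have hs: "L2 (%x. ?h (x + s))" by (rule L2_shift[OF h])
  have gs: "L2 (%x. g' (x + s) - g' x)" using g' by (intro L2_diff L2_shift)
  have "sqn (%x. g (x + s) - g x) = sqn (%x. (?h (x + s) - ?h x) + (g' (x + s) - g' x))"
   by (simp add: algebra_simps)
  also have "\<dots> \<le> 2 * sqn (%x. ?h (x + s) - ?h x) + 2 * sqn (%x. g' (x + s) - g' x)"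
   by (rule sqn_add_le[OF L2_diff[OF hs h] gs])
  also have "sqn (%x. ?h (x + s) - ?h x) \<le> 2 * sqn (%x. ?h (x + s)) + 2 * sqn ?h"
   by (rule sqn_diff_le[OF hs h])
  also have "sqn (%x. ?h (x + s)) = sqn ?h" by (rule sqn_shift[OF h])
  finally show ?thesis using g'(3) d(2)[OF s] by simp
 qed
 then show "\<exists>d>0. \<forall>s. norm s \<le> d --> sqn (%x. g (x + s) - g x) \<le> e" using d(1) by blast
qed

text \<open>Uniform continuity bounds the increment pointwise; it vanishes outside a ball, and the
  finite measure of the ball turns the pointwise bound into one in L2.\<close>

lemma shift_cont_compact_support:
 fixes g :: "'n::euclidean_space => real"
 assumes c: "continuous_on UNIV g" and z: "!!x. norm x > R ==> g x = 0"
 shows "shift_cont g"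
 unfolding shift_cont_def
proof (intro allI impI)
 fix e :: real assume e: "e > 0"
 \<comment> \<open>Leaves room for shifts of length at most 1: outside this ball \<open>g\<close>
   vanishes both at x and at x + s.\<close>
 define R' where "R' = \<bar>R\<bar> + 1"
 define m where "m = measure lborel (cball (0::'n) R')"
 have m: "m \<ge> 0" unfolding m_def by simp
 define e' where "e' = sqrt (e / (m + 1))"
 have e': "e' > 0" unfolding e'_def using e m by simp
 have "uniformly_continuous_on (cball 0 (R' + 1)) g"
  by (rule compact_uniformly_continuous) (auto intro: continuous_on_subset[OF c])
 then obtain d where d: "d > 0" "!!x y. x \<in> cball 0 (R' + 1) ==> y \<in> cball 0 (R' + 1) ==> dist y x < d ==> dist (g y) (g x) < e'"
  unfolding uniformly_continuous_on_def using e' by metis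
 define d' where "d' = min (d/2) 1"
 have bm: "g \<in> borel_fun" using c by (rule borel_measurable_continuous_onI)
 have "sqn (%x. g (x + s) - g x) \<le> e" if s: "norm s \<le> d'" for s
 proof -
  have s1: "norm s \<le> 1" and s2: "norm s < d" using s d(1) unfolding d'_def by auto
  have pt: "(norm (g (x + s) - g x))\<^sup>2 \<le> e'\<^sup>2 * ind (cball 0 R') x" for x
  proof (cases "x \<in> cball 0 R'")
   case True
   have n: "norm (x + s) \<le> R' + 1" using norm_triangle_ineq[of x s] True s1 by simp
   have dd: "dist (x + s) x < d" using s2 by (simp add: dist_norm)
   have "dist (g (x + s)) (g x) < e'"
    using True n dd by (intro d(2)) auto
   then show ?thesis using True e' by (simp add: dist_norm abs_le_square_iff[symmetric])
  next
   case False
   then have "norm x > R'" by simp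
   then have "g x = 0" "g (x + s) = 0"
    using z[of x] z[of "x+s"] norm_diff_ineq[of x s] s1 unfolding R'_def by auto
   then show ?thesis by simp
  qed
  have int: "integrable lborel (%x::'n. e'\<^sup>2 * ind (cball 0 R') x)"
   by (rule integrable_indicator_cball)
  have "L2 (%x. g (x + s) - g x)"
   by (rule L2_bound[OF _ int]) (use pt bm in auto)
  then have "sqn (%x. g (x + s) - g x) \<le> (LBINT x. e'\<^sup>2 * ind (cball (0::'n) R') x)"
   unfolding sqn_real using pt int by (intro integral_mono) (auto simp: L2_integrable_real)
  also have "\<dots> = e'\<^sup>2 * m" by (simp add: m_def)
  also have "\<dots> = e * (m / (m + 1))" unfolding e'_def using e m by simp
  also have "\<dots> \<le> e * 1" using e m by (intro mult_left_mono) auto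
  finally show ?thesis by simp
 qed
 moreover have "d' > 0" unfolding d'_def using d by auto
 ultimately show "\<exists>d>0. \<forall>s. norm s \<le> d --> sqn (%x. g (x + s) - g x) \<le> e" by blast
qed

lemma tendsto_0_ex_le:
 fixes a :: "nat => real"
 assumes "a \<longlonglongrightarrow> 0" "e > 0" shows "\<exists>n. a n \<le> e"
proof -
 have "\<forall>\<^sub>F n in sequentially. a n < e" using assms by (rule order_tendstoD)
 then obtain n where "a n < e" using eventually_happens' sequentially_bot by blast
 then show ?thesis by (intro exI[of _ n]) simp
qed

lemma sqn_tendsto_0:
 fixes g :: "'n::euclidean_space => real"
 assumes [measurable]: "!!n. G n \<in> borel_fun" "g \<in> borel_fun"
  and lim: "AE x in lborel. (%n. G n x) \<longlonglongrightarrow> g x"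
  and int: "integrable lborel h" and bd: "!!n x. (g x - G n x)\<^sup>2 \<le> h x"
 shows "(%n. sqn (%x. g x - G n x)) \<longlonglongrightarrow> 0"
proof -
 have "(%n. LBINT x. (g x - G n x)\<^sup>2) \<longlonglongrightarrow> (LBINT x::'n. 0 :: real)"
 proof (rule lint_dominated_convergence[where w = h])
  show "AE x in lborel. (%n. (g x - G n x)\<^sup>2) \<longlonglongrightarrow> 0"
   using lim
  proof eventually_elim
   case (elim x)
   have "(%n. (g x - G n x)\<^sup>2) \<longlonglongrightarrow> (g x - g x)\<^sup>2" by (intro tendsto_intros elim)
   then show ?case by simp
  qed
 qed (use int bd in auto)
 then show ?thesis by (simp add: sqn_def)
qed

text \<open>A measurable function is an almost everywhere limit of continuous ones. Clamping these
  to [-C, C] and multiplying by the cut-off \<open>\<theta>\<close>, which is 1 on the ball of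
  radius R, preserves the limit and provides a dominating function, so that the convergence holds in
  L2.\<close>

lemma shift_cont_bounded:
 fixes g :: "'n::euclidean_space => real"
 assumes m[measurable]: "g \<in> borel_fun" and C: "!!x. \<bar>g x\<bar> \<le> C" and z: "!!x. norm x > R ==> g x = 0"
 shows "shift_cont g"
proof (rule shift_cont_approx)
 have C0: "0 \<le> C" using C[of 0] by linarith
 show g: "L2 g" by (rule L2_bounded_support[of _ C "cball 0 R"]) (use assms in \<open>auto simp: not_le\<close>)
 have "g \<in> borel_measurable lebesgue" using m by (simp add: borel_measurable_if_I measurable_completion)
 then have "g measurable_on UNIV" by (simp add: measurable_on_iff_borel_measurable)
 then obtain N G where N: "negligible N" and G: "!!n. continuous_on UNIV (G n)"
  and lim: "!!x. x \<notin> N ==> (%n. G n x) \<longlonglongrightarrow> g x"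
  unfolding measurable_on_def by auto
 define \<theta> :: "'n => real" where "\<theta> x = max 0 (min 1 (R + 1 - norm x))" for x
 define F where "F n x = \<theta> x * max (-C) (min C (G n x))" for n x
 have cF: "continuous_on UNIV (F n)" for n
  unfolding F_def \<theta>_def by (intro continuous_intros G)
 have [measurable]: "F n \<in> borel_fun" for n
  using cF by (rule borel_measurable_continuous_onI)
 have F0: "F n x = 0" if "norm x > R + 1" for n x
  using that by (simp add: F_def \<theta>_def)
 have Fb: "\<bar>F n x\<bar> \<le> C" for n x
 proof -
  have "\<bar>F n x\<bar> \<le> 1 * C" unfolding F_def abs_mult using C0
   by (intro mult_mono) (auto simp: \<theta>_def)
  then show ?thesis by simp
 qed
 have AEN: "AE x in lborel. x \<notin> N"
 proof -
  have "AE x in lebesgue. x \<notin> N" using N by (simp add: AE_not_in negligible_iff_null_sets)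
  then show ?thesis by (simp add: AE_completion_iff)
 qed
 have gF: "\<bar>g x - F n x\<bar> \<le> 2 * C" for n x using C[of x] Fb[of n x] by linarith
 have sq: "(g x - F n x)\<^sup>2 \<le> (2*C)\<^sup>2 * ind (cball 0 (R + 1)) x" for n x
 proof (cases "norm x > R + 1")
  case True then show ?thesis using z[of x] F0[of x n] by simp
 next
  case False
  then show ?thesis using gF[of x n] C0 abs_le_square_iff[of "g x - F n x" "2 * C"] by simp
 qed
 have "(%n. sqn (%x. g x - F n x)) \<longlonglongrightarrow> 0"
 proof (rule sqn_tendsto_0[OF _ _ _ _ sq])
  show "AE x in lborel. (%n. F n x) \<longlonglongrightarrow> g x"
   using AEN
  proof eventually_elim
   case (elim x)
   have "(%n. F n x) \<longlonglongrightarrow> \<theta> x * max (-C) (min C (g x))"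
    unfolding F_def by (intro tendsto_intros lim elim)
   moreover have "\<theta> x * max (-C) (min C (g x)) = g x"
    using C[of x] z[of x] by (cases "norm x > R") (auto simp: \<theta>_def)
   ultimately show ?case by simp
  qed
  show "integrable lborel (%x::'n. (2 * C)\<^sup>2 * ind (cball 0 (R + 1)) x)"
   by (rule integrable_indicator_cball)
 qed auto
 then have "\<exists>n. sqn (%x. g x - F n x) \<le> e" if "e > 0" for e
  by (rule tendsto_0_ex_le[OF _ that])
 moreover have "L2 (F n)" for n
  by (rule L2_bounded_support[of _ C "cball 0 (R+1)"]) (use Fb F0 in \<open>auto simp: not_le\<close>)
 moreover have "shift_cont (F n)" for n
  by (rule shift_cont_compact_support[of _ "R+1"]) (use cF F0 in auto)
 ultimately show "!!e. e > 0 ==> \<exists>g'. L2 g' \<and> shift_cont g' \<and> sqn (%x. g x - g' x) \<le> e" by blast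
qed

text \<open>Truncation in size and in support; g^2 itself dominates the squared errors.\<close>

lemma shift_cont_real:
 fixes g :: "'n::euclidean_space => real"
 assumes g: "L2 g" shows "shift_cont g"
proof (rule shift_cont_approx[OF g])
 note [measurable] = L2_measurable[OF g]
 define F where "F n x = (if norm x \<le> real n \<and> \<bar>g x\<bar> \<le> real n then g x else 0)" for n x
 have [measurable]: "F n \<in> borel_fun" for n unfolding F_def by measurable
 have "(%n. sqn (%x. g x - F n x)) \<longlonglongrightarrow> 0"
 proof (rule sqn_tendsto_0)
  show "AE x in lborel. (%n. F n x) \<longlonglongrightarrow> g x"
  proof (intro AE_I2 tendsto_eventually)
   fix x
   obtain N :: nat where "max (norm x) \<bar>g x\<bar> \<le> real N" using real_arch_simple by blast
   then show "\<forall>\<^sub>F n in sequentially. F n x = g x"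
    unfolding eventually_sequentially F_def by (intro exI[of _ N]) auto
  qed
  show "integrable lborel (%x. (norm (g x))\<^sup>2)" by (rule L2_integrable[OF g])
 qed (auto simp: F_def)
 then have "\<exists>n. sqn (%x. g x - F n x) \<le> e" if "e > 0" for e
  by (rule tendsto_0_ex_le[OF _ that])
 moreover have "L2 (F n)" for n
  by (rule L2_bounded_support[of _ "real n" "cball 0 (real n)"]) (auto simp: F_def)
 moreover have "shift_cont (F n)" for n
  by (rule shift_cont_bounded[of _ "real n" "real n"]) (auto simp: F_def)
 ultimately show "!!e. e > 0 ==> \<exists>g'. L2 g' \<and> shift_cont g' \<and> sqn (%x. g x - g' x) \<le> e" by blast
qed

lemma L2_component: "L2 g ==> i \<in> Basis ==> L2 (%x. g x \<bullet> i)"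
 by (rule L2_bound[of _ "%x. (norm (g x))\<^sup>2"])
   (auto simp: L2_integrable Basis_le_norm abs_le_square_iff[symmetric] dest: L2_measurable)

lemma L2_componentwise:
 assumes "!!i. i \<in> Basis ==> L2 (%x. g x \<bullet> i)" shows "L2 g"
proof -
 have "L2 (%x. \<Sum>i\<in>Basis. (g x \<bullet> i) *\<^sub>R i)"
 proof (rule L2_sum)
  fix i :: 'a assume i: "i \<in> Basis"
  show "L2 (%x. (g x \<bullet> i) *\<^sub>R i)"
  proof (rule L2_bound[OF _ L2_integrable[OF assms[OF i]]])
   show "(%x. (g x \<bullet> i) *\<^sub>R i) \<in> borel_fun"
    using L2_measurable[OF assms[OF i]] by simp
  qed (simp add: i)
 qed
 then show ?thesis by (simp add: euclidean_representation)
qed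

lemma sqn_componentwise:
 assumes "L2 g" shows "sqn g = (\<Sum>i\<in>Basis. sqn (%x. g x \<bullet> i))"
proof -
 have "(norm (g x))\<^sup>2 = (\<Sum>i\<in>Basis. (norm (g x \<bullet> i))\<^sup>2)" for x
  by (simp add: euclidean_inner[of "g x" "g x"] power2_norm_eq_inner) (simp add: power2_eq_square)
 then show ?thesis
  unfolding sqn_def using L2_component[OF assms]
  by (subst lint_sum[symmetric]) (auto simp: L2_integrable simp del: real_norm_def)
qed

lemma shift_cont_L2:
 fixes g :: "'n::euclidean_space => 'b::euclidean_space"
 assumes "L2 g" shows "shift_cont g"
 unfolding shift_cont_def
proof (intro allI impI)
 fix e :: real assume e: "e > 0"
 let ?D = "real (DIM('b))"
 have "\<forall>i\<in>Basis. \<exists>d>0. \<forall>s. norm s \<le> d --> sqn (%x. g (x + s) \<bullet> i - g x \<bullet> i) \<le> e / ?D"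
 proof
  fix i :: 'b assume "i \<in> Basis"
  then have "shift_cont (%x. g x \<bullet> i)" using assms by (intro shift_cont_real L2_component)
  moreover have "e / ?D > 0" using e by simp
  ultimately show "\<exists>d>0. \<forall>s. norm s \<le> d --> sqn (%x. g (x + s) \<bullet> i - g x \<bullet> i) \<le> e / ?D"
   unfolding shift_cont_def by blast
 qed
 then obtain d where d: "!!i. i \<in> Basis ==> d i > 0"
  "!!i s. i \<in> Basis ==> norm s \<le> d i ==> sqn (%x. g (x + s) \<bullet> i - g x \<bullet> i) \<le> e / ?D" by metis
 define d' where "d' = Min (d ` (Basis :: 'b set))"
 have d': "d' > 0" "!!i. i \<in> Basis ==> d' \<le> d i" unfolding d'_def using d by auto
 have "sqn (%x. g (x + s) - g x) \<le> e" if "norm s \<le> d'" for s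
 proof -
  have "sqn (%x. g (x + s) - g x) = (\<Sum>i\<in>Basis. sqn (%x. g (x + s) \<bullet> i - g x \<bullet> i))"
   using assms by (subst sqn_componentwise) (auto intro: L2_diff L2_shift simp: inner_diff_left)
  also have "\<dots> \<le> (\<Sum>i\<in>(Basis::'b set). e / ?D)"
   using that d'(2) d(2) by (intro sum_mono) force
  also have "\<dots> = e" by simp
  finally show ?thesis .
 qed
 then show "\<exists>d>0. \<forall>s. norm s \<le> d --> sqn (%x. g (x + s) - g x) \<le> e" using d'(1) by blast
qed

section \<open>Slices, averages and Gronwall inequality\<close>

lemma borel_measurable_pairI:
 fixes f :: "'m::euclidean_space \<times> 'n::euclidean_space => 'c::topological_space"
 assumes "f \<in> borel_fun"
 shows "f \<in> borel_measurable (lborel \<Otimes>\<^sub>M lborel)" "f \<in> borel_measurable (borel \<Otimes>\<^sub>M borel)"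
 using assms by (simp_all add: lborel_prod borel_prod)

lemma measurable_fst_borel [measurable]: "fst \<in> borel_measurable (borel :: ('m::euclidean_space \<times> 'n::euclidean_space) measure)"
 and measurable_snd_borel [measurable]: "snd \<in> borel_measurable (borel :: ('m::euclidean_space \<times> 'n::euclidean_space) measure)"
 by (intro borel_measurable_continuous_onI continuous_intros)+

lemma measurable_slice:
 fixes f :: "'m::euclidean_space \<times> 'n::euclidean_space => 'c::topological_space"
 assumes [measurable]: "f \<in> borel_fun"
 shows "(%x. f (r, x)) \<in> borel_fun" "(%r. f (r, x)) \<in> borel_fun"
 by measurable

lemma L2_slice:
 fixes V :: "'m::euclidean_space \<times> 'n::euclidean_space => 'c::euclidean_space"
 assumes "L2 V"
 shows "AE r in lborel. L2 (%x. V (r, x))" "AE x in lborel. L2 (%r. V (r, x))"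
  and "integrable lborel (%r. sqn (%x. V (r, x)))" "sqn V = (LBINT r. sqn (%x. V (r, x)))"
proof -
 have i: "integrable (lborel \<Otimes>\<^sub>M lborel) (%z. (norm (V z))\<^sup>2)"
  using L2_integrable[OF assms] by (simp add: lborel_prod)
 have [measurable]: "V \<in> borel_fun" by (rule L2_measurable[OF assms])
 show "AE r in lborel. L2 (%x. V (r, x))"
  using lborel_pair.AE_integrable_fst'[OF i] by eventually_elim (simp add: L2_def measurable_slice)
 have i2: "integrable (lborel \<Otimes>\<^sub>M lborel) (%z. (norm (V (snd z, fst z)))\<^sup>2)"
  using lborel_pair.integrable_product_swap[OF i] by (simp add: case_prod_unfold)
 show "AE x in lborel. L2 (%r. V (r, x))"
  using lborel_pair.AE_integrable_fst'[OF i2] by eventually_elim (simp add: L2_def measurable_slice)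
 show "integrable lborel (%r. sqn (%x. V (r, x)))"
  unfolding sqn_def by (rule lborel_pair.integrable_fst'[OF i])
 show "sqn V = (LBINT r. sqn (%x. V (r, x)))"
  unfolding sqn_def using lborel_pair.integral_fst'[OF i] by (simp add: lborel_prod)
qed

lemma integral_slice:
 fixes f :: "'m::euclidean_space \<times> 'n::euclidean_space => 'c::euclidean_space"
 assumes "integrable lborel f"
 shows "(LBINT z. f z) = (LBINT r. LBINT x. f (r, x))"
  "integrable lborel (%r. LBINT x. f (r, x))"
  "AE r in lborel. integrable lborel (%x. f (r, x))"
proof -
 have i: "integrable (lborel \<Otimes>\<^sub>M lborel) f" using assms by (simp add: lborel_prod)
 show "(LBINT z. f z) = (LBINT r. LBINT x. f (r, x))"
  using lborel_pair.integral_fst'[OF i] by (simp add: lborel_prod)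
 show "integrable lborel (%r. LBINT x. f (r, x))" by (rule lborel_pair.integrable_fst'[OF i])
 show "AE r in lborel. integrable lborel (%x. f (r, x))" by (rule lborel_pair.AE_integrable_fst'[OF i])
qed

lemma integral_swap:
 fixes f :: "'m::euclidean_space \<times> 'n::euclidean_space => 'c::euclidean_space"
 assumes "integrable lborel f"
 shows "(LBINT r. LBINT x. f (r, x)) = (LBINT x. LBINT r. f (r, x))"
proof -
 have i: "integrable (lborel \<Otimes>\<^sub>M lborel) (%(r, x). f (r, x))" using assms by (simp add: lborel_prod)
 show ?thesis using lborel_pair.Fubini_integral[of "%r x. f (r, x)"] i by simp
qed

lemma AE_slice:
 fixes P :: "'m::euclidean_space \<times> 'n::euclidean_space => bool"
 assumes "AE z in lborel. P z"
 shows "AE r in lborel. AE x in lborel. P (r, x)"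
 by (rule lborel_pair.AE_pair, subst lborel_prod, rule assms)

lemma AE_slice':
 assumes "AE x in lborel. P x"
 shows "AE z in (lborel :: ('m::euclidean_space \<times> 'n::euclidean_space) measure). P (snd z)"
  and "AE z in (lborel :: ('n \<times> 'm) measure). P (fst z)"
proof -
 obtain N where N: "{x. \<not> P x} \<subseteq> N" "N \<in> sets borel" "emeasure lborel N = 0"
  using assms by (auto elim!: AE_E)
 have "emeasure (lborel \<Otimes>\<^sub>M lborel) ((UNIV::'m set) \<times> N) = 0"
  using N by (subst lborel.emeasure_pair_measure_Times) auto
 then have "(UNIV::'m set) \<times> N \<in> null_sets lborel"
  using N by (auto simp: null_sets_def lborel_prod borel_Times)
 then show "AE z in (lborel :: ('m::euclidean_space \<times> 'n::euclidean_space) measure). P (snd z)"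
  by (rule AE_I') (use N in auto)
 have "emeasure (lborel \<Otimes>\<^sub>M lborel) (N \<times> (UNIV::'m set)) = 0"
  using N by (subst lborel.emeasure_pair_measure_Times) auto
 then have "N \<times> (UNIV::'m set) \<in> null_sets lborel"
  using N by (auto simp: null_sets_def lborel_prod borel_Times)
 then show "AE z in (lborel :: ('n \<times> 'm) measure). P (fst z)"
  by (rule AE_I') (use N in auto)
qed

text \<open>Stated with a nonnegative integral on the right, so that no integrability of k |h|^2 has
  to be known: if it fails, the right side is infinite. Tonelli can then be applied to the right
  side at once.\<close>

lemma Jensen_square:
 fixes k :: "'m::euclidean_space => real" and h :: "'m => 'b::euclidean_space"
 assumes k: "k \<in> borel_fun" "!!y. 0 \<le> k y" "integrable lborel k" "(LBINT y. k y) = 1"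
  and h: "h \<in> borel_fun"
 shows "ennreal ((norm (LBINT y. k y *\<^sub>R h y))\<^sup>2) \<le> (\<integral>\<^sup>+y. ennreal (k y * (norm (h y))\<^sup>2) \<partial>lborel)"
proof (cases "integrable lborel (%y. k y * (norm (h y))\<^sup>2)")
 case True
 note [measurable] = k(1) h
 have "integrable lborel (%y. k y + k y * (norm (h y))\<^sup>2)" using True k by simp
 then have i: "integrable lborel (%y. k y * norm (h y))"
 proof (rule lintegrable_bound)
  show "AE y in lborel. norm (k y * norm (h y)) \<le> norm (k y + k y * (norm (h y))\<^sup>2)"
  proof (intro AE_I2)
   fix y
   have "norm (h y) \<le> 1 + (norm (h y))\<^sup>2"
    using sum_squares_bound[of 1 "norm (h y)"] norm_ge_zero[of "h y"] by (simp del: norm_ge_zero)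
   then have "k y * norm (h y) \<le> k y * (1 + (norm (h y))\<^sup>2)" using k(2) by (intro mult_left_mono)
   then show "norm (k y * norm (h y)) \<le> norm (k y + k y * (norm (h y))\<^sup>2)" using k(2)[of y] by (simp add: algebra_simps)
  qed
 qed measurable
 define m where "m = (LBINT y. k y * norm (h y))"
 \<comment> \<open>The variance of \<open>norm (h y)\<close> under the probability density
   k.\<close>
 have "0 \<le> (LBINT y. k y * (norm (h y) - m)\<^sup>2)" using k by (intro integral_nonneg_AE) auto
 also have "\<dots> = (LBINT y. k y * (norm (h y))\<^sup>2 - 2 * m * (k y * norm (h y)) + m\<^sup>2 * k y)"
  by (intro lint_cong refl) (simp add: power2_eq_square algebra_simps)
 also have "\<dots> = (LBINT y. k y * (norm (h y))\<^sup>2) - m\<^sup>2"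
  using True i k by (simp add: m_def[symmetric] power2_eq_square)
 finally have "m\<^sup>2 \<le> (LBINT y. k y * (norm (h y))\<^sup>2)" by simp
 moreover have "norm (LBINT y. k y *\<^sub>R h y) \<le> m"
  unfolding m_def using integral_norm_bound[of lborel "%y. k y *\<^sub>R h y"] k(2) by simp
 then have "(norm (LBINT y. k y *\<^sub>R h y))\<^sup>2 \<le> m\<^sup>2" by (intro power_mono) auto
 ultimately have "(norm (LBINT y. k y *\<^sub>R h y))\<^sup>2 \<le> (LBINT y. k y * (norm (h y))\<^sup>2)" by linarith
 moreover have "(\<integral>\<^sup>+y. ennreal (k y * (norm (h y))\<^sup>2) \<partial>lborel) = ennreal (LBINT y. k y * (norm (h y))\<^sup>2)"
  using True k by (intro nn_integral_eq_integral) auto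
 ultimately show ?thesis by (simp add: ennreal_leI)
next
 case False
 note [measurable] = k(1) h
 have "(%y. k y * (norm (h y))\<^sup>2) \<in> borel_measurable lborel" by measurable
 with False have "(\<integral>\<^sup>+y. ennreal (norm (k y * (norm (h y))\<^sup>2)) \<partial>lborel) = \<infinity>"
  unfolding integrable_iff_bounded by (simp add: less_top[symmetric])
 then show ?thesis using k(2) by simp
qed

text \<open>Jensen for each x, then Tonelli: a weighted mean of translation errors is no worse than
  the worst of them. All averages below, backward or forward in time, along a segment or over a
  ball, are estimated by this lemma together with the continuity of translations.\<close>

lemma sqn_average:
 fixes g :: "'n::euclidean_space => 'b::euclidean_space" and k :: "'m::euclidean_space => real"
 assumes g: "L2 g" and k: "k \<in> borel_fun" "!!y. 0 \<le> k y" "integrable lborel k" "(LBINT y. k y) = 1"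
  and s: "\<sigma> \<in> borel_fun"
  and e: "!!y. k y \<noteq> 0 ==> sqn (%x. g (x + \<sigma> y) - g x) \<le> e" and e0: "0 \<le> e"
 shows "L2 (%x. LBINT y. k y *\<^sub>R (g (x + \<sigma> y) - g x))"
  and "sqn (%x. LBINT y. k y *\<^sub>R (g (x + \<sigma> y) - g x)) \<le> e"
proof -
 let ?A = "%x. LBINT y. k y *\<^sub>R (g (x + \<sigma> y) - g x)"
 note [measurable] = k(1) s L2_measurable[OF g]
 have mA[measurable]: "?A \<in> borel_fun"
  by (rule sigma_finite_measure.borel_measurable_lebesgue_integral) (auto simp: lborel.sigma_finite_measure_axioms)
 have "(\<integral>\<^sup>+x. ennreal ((norm (?A x))\<^sup>2) \<partial>lborel)
   \<le> (\<integral>\<^sup>+x. (\<integral>\<^sup>+y. ennreal (k y * (norm (g (x + \<sigma> y) - g x))\<^sup>2) \<partial>lborel) \<partial>lborel)"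
  by (intro nn_integral_mono Jensen_square k) measurable
 also have "\<dots> = (\<integral>\<^sup>+y. (\<integral>\<^sup>+x. ennreal (k y * (norm (g (x + \<sigma> y) - g x))\<^sup>2) \<partial>lborel) \<partial>lborel)"
  by (rule lborel_pair.Fubini'[symmetric]) measurable
 also have "\<dots> \<le> (\<integral>\<^sup>+y. ennreal (k y * e) \<partial>lborel)"
 proof (rule nn_integral_mono)
  fix y
  show "(\<integral>\<^sup>+x. ennreal (k y * (norm (g (x + \<sigma> y) - g x))\<^sup>2) \<partial>lborel) \<le> ennreal (k y * e)"
  proof (cases "k y = 0")
   case False
   have d: "L2 (%x. g (x + \<sigma> y) - g x)" using g by (intro L2_diff L2_shift)
   have "(\<integral>\<^sup>+x. ennreal (k y * (norm (g (x + \<sigma> y) - g x))\<^sup>2) \<partial>lborel) = ennreal (LBINT x. k y * (norm (g (x + \<sigma> y) - g x))\<^sup>2)"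
    using k(2) L2_integrable[OF d] by (intro nn_integral_eq_integral) auto
   also have "\<dots> = ennreal (k y * sqn (%x. g (x + \<sigma> y) - g x))" by (simp add: sqn_def)
   also have "\<dots> \<le> ennreal (k y * e)" using e[OF False] k(2) by (intro ennreal_leI mult_left_mono)
   finally show ?thesis .
  qed simp
 qed
 also have "\<dots> = ennreal (LBINT y. k y * e)"
  using k e0 by (intro nn_integral_eq_integral) auto
 also have "\<dots> = ennreal e" using k by simp
 finally have le: "(\<integral>\<^sup>+x. ennreal ((norm (?A x))\<^sup>2) \<partial>lborel) \<le> ennreal e" .
 then have i: "integrable lborel (%x. (norm (?A x))\<^sup>2)"
  unfolding integrable_iff_bounded using le_less_trans[OF le ennreal_less_top] by simp
 then show "L2 ?A" unfolding L2_def by simp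
 have "ennreal (sqn ?A) = (\<integral>\<^sup>+x. ennreal ((norm (?A x))\<^sup>2) \<partial>lborel)"
  unfolding sqn_def using i by (intro nn_integral_eq_integral[symmetric]) auto
 then have "ennreal (sqn ?A) \<le> ennreal e" using le by (simp only:)
 then show "sqn ?A \<le> e" using ennreal_le_iff[OF e0] by blast
qed

section \<open>Antiderivatives and Gronwall's inequality\<close>

lemma continuous_antiderivative:
 fixes E :: "real => real"
 assumes "continuous_on UNIV E"
 obtains F where "!!x. x \<in> {a<..<b} ==> (F has_real_derivative E x) (at x)"
proof (rule that[of "%x. integral {a..x} E"])
 fix x assume x: "x \<in> {a<..<b}"
 have "((%x. integral {a..x} E) has_real_derivative E x) (at x within {a..b})"
  using x assms by (intro integral_has_real_derivative) (auto intro: continuous_on_subset)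
 then have "((%x. integral {a..x} E) has_real_derivative E x) (at x within {a<..<b})"
  by (rule DERIV_subset) auto
 then show "((%x. integral {a..x} E) has_real_derivative E x) (at x)"
  using x at_within_open[of x "{a<..<b}"] by simp
qed

lemma lborel_FTC:
 fixes E F :: "real => real"
 assumes "a \<le> b" "!!x. x \<in> {a..b} ==> (F has_real_derivative E x) (at x)" "continuous_on {a..b} E"
 shows "(LBINT x:{a..b}. E x) = F b - F a"
 unfolding set_lebesgue_integral_def
 by (rule integral_FTC_atLeastAtMost)
   (use assms in \<open>auto simp: has_real_derivative_iff_has_vector_derivative intro: has_vector_derivative_at_within\<close>)

text \<open>With F an antiderivative of E, the quantity (c + L (F s - F 0)) exp (- L s) is
  nonincreasing; this is the hypothesis multiplied by L exp (- L s).\<close>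

lemma Gronwall:
 fixes E :: "real => real"
 assumes cont: "continuous_on UNIV E" and L: "0 \<le> L"
  and le: "!!t. t \<in> {0..T} ==> E t \<le> c + L * (LBINT r:{0..t}. E r)" and t: "t \<in> {0..T}"
 shows "E t \<le> c * exp (L * t)"
proof -
 \<comment> \<open>The larger interval makes the derivative two-sided at 0 and at T as well.\<close>
 obtain F where F: "!!x. x \<in> {-1<..<T+1} ==> (F has_real_derivative E x) (at x)"
  using continuous_antiderivative[OF cont] by blast
 have I: "(LBINT r:{0..s}. E r) = F s - F 0" if "s \<in> {0..T}" for s
  using that by (intro lborel_FTC F) (auto intro: continuous_on_subset[OF cont])
 define y where "y s = (c + L * (F s - F 0)) * exp (- L * s)" for s
 have "y t \<le> y 0"
 proof (rule DERIV_nonpos_imp_nonincreasing[of 0 t y])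
  show "0 \<le> t" using t by simp
  fix s assume s: "0 \<le> s" "s \<le> t"
  have "(y has_real_derivative (L * E s) * exp (- L * s) + (c + L * (F s - F 0)) * (exp (- L * s) * (- L))) (at s)"
   unfolding y_def using s t by (auto intro!: derivative_eq_intros F)
  moreover have "(L * E s) * exp (- L * s) + (c + L * (F s - F 0)) * (exp (- L * s) * (- L)) \<le> 0"
  proof -
   have "E s \<le> c + L * (F s - F 0)" using le[of s] I[of s] s t by simp
   then have "(E s - (c + L * (F s - F 0))) * (L * exp (- L * s)) \<le> 0"
    using L by (intro mult_nonpos_nonneg) auto
   then show ?thesis by (simp add: algebra_simps)
  qed
  ultimately show "\<exists>y'. (y has_real_derivative y') (at s) \<and> y' \<le> 0" by blast
 qed
 then have "(c + L * (F t - F 0)) * exp (- L * t) \<le> c" unfolding y_def by simp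
 then have "(c + L * (F t - F 0)) * exp (- L * t) * exp (L * t) \<le> c * exp (L * t)" by (intro mult_right_mono) auto
 then have "c + L * (F t - F 0) \<le> c * exp (L * t)" by (simp add: mult.assoc flip: exp_add)
 then show ?thesis using le[OF t] I[OF t] by simp
qed


lemma L2_mult_indicator:
 fixes g :: "'n::euclidean_space => 'b::euclidean_space"
 assumes "L2 g" "A \<in> sets borel"
 shows "L2 (%x. ind A x *\<^sub>R g x)" "sqn (%x. ind A x *\<^sub>R g x) \<le> sqn g"
proof -
 show "L2 (%x. ind A x *\<^sub>R g x)"
  by (rule L2_mult_bounded[of _ _ 1]) (use assms in \<open>auto simp: indicator_def\<close>)
 show "sqn (%x. ind A x *\<^sub>R g x) \<le> sqn g"
  by (rule sqn_mono) (use assms in \<open>auto simp: indicator_def dest: L2_measurable\<close>)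
qed

lemma L2_set_integrable:
 fixes v :: "real => 'c::euclidean_space"
 assumes "L2 v" "bounded A" "A \<in> sets borel"
 shows "integrable lborel (%r. ind A r *\<^sub>R v r)"
proof (rule lintegrable_bound)
 have 1: "L2 (%x. ind A x :: real)"
  by (rule L2_bounded_support[of _ 1 A]) (use assms in \<open>auto simp: indicator_def\<close>)
 show "integrable lborel (%r. ind A r * ind A r + (norm (v r))\<^sup>2)"
  by (intro lintegrable_add L2_mult_integrable 1 L2_integrable assms)
 show "AE r in lborel. norm (ind A r *\<^sub>R v r) \<le> norm (ind A r * ind A r + (norm (v r))\<^sup>2)"
 proof (intro AE_I2)
  fix r
  have "norm (v r) \<le> 1 + (norm (v r))\<^sup>2"
   using sum_squares_bound[of 1 "norm (v r)"] norm_ge_zero[of "v r"] by (simp del: norm_ge_zero)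
  then show "norm (ind A r *\<^sub>R v r) \<le> norm (ind A r * ind A r + (norm (v r))\<^sup>2)"
   by (simp add: indicator_def)
 qed
qed (use assms in \<open>auto dest: L2_measurable\<close>)

text \<open>The averages of \<^term>\<open>V\<close> over \<^term>\<open>{r - h..r}\<close> converge to \<^term>\<open>V\<close> in L2 as
 \<^term>\<open>h\<close> tends to 0; this replaces a differentiation of \<^term>\<open>E\<close> in time.\<close>

lemma energy_inequality:
 fixes V R :: "real \<times> 'n::euclidean_space => 'c::euclidean_space" and E :: "real => real"
 assumes V: "L2 V" and R: "L2 R" and cont: "continuous_on UNIV E"
  and key: "AE r in lborel. r \<in> {0<..<T} --> (\<forall>s\<in>{0..r}. E r - E s \<le>
    (LBINT x. (LBINT \<sigma>:{s..r}. V (\<sigma>, x)) \<bullet> R (r, x)))"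
  and t: "t \<in> {0..T}"
 shows "E t - E 0 \<le> (LBINT z. ind {0..t} (fst z) * (V z \<bullet> R z))"
proof (cases "t = 0")
 case True
 have "AE z in lborel. ind {0..0} (fst z :: real) * (V z \<bullet> R z) = 0"
 proof -
  have "AE r in lborel. r \<noteq> (0::real)" by (rule AE_lborel_singleton)
  from AE_slice'(2)[OF this, where 'm = 'n] show ?thesis
   by eventually_elim (auto simp: indicator_def)
 qed
 then have "(LBINT z. ind {0..0} (fst z :: real) * (V z \<bullet> R z)) = 0"
  by (rule integral_eq_zero_AE)
 then show ?thesis using True by simp
next
 case False
 then have tp: "0 < t" "t \<le> T" using t by auto
 note [measurable] = L2_measurable[OF V] L2_measurable[OF R]
 obtain F where F: "!!x. x \<in> {-1<..<t+1} ==> (F has_real_derivative E x) (at x)"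
  using continuous_antiderivative[OF cont] by blast
 \<comment> \<open>H h is the integral over [h, t] of E r - E (r - h), written with the
   antiderivative; its derivative at 0 is E t - E 0. So an upper bound for H h / h that survives h
   -> 0 suffices.\<close>
 define H where "H h = (F t - F h) - (F (t - h) - F 0)" for h
 have dH: "(H has_real_derivative E t - E 0) (at 0)"
 proof -
  have "((%h. F (t - h)) has_real_derivative E (t - 0) * (0 - 1)) (at 0)"
   by (rule DERIV_chain2[of F]) (use F tp in \<open>auto intro!: derivative_eq_intros\<close>)
  moreover have "(F has_real_derivative E 0) (at 0)" using F tp by auto
  ultimately show ?thesis unfolding H_def by (auto intro!: derivative_eq_intros)
 qed
 have cE: "continuous_on A E" for A using cont by (rule continuous_on_subset) simp
 have Hint: "(LBINT r:{h..t}. E r - E (r - h)) = H h" if h: "0 < h" "h < t" for h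
 proof -
  have "((%r. F r - F (r - h)) has_real_derivative E r - E (r - h)) (at r)" if "r \<in> {h..t}" for r
  proof -
   have "((%r. F (r - h)) has_real_derivative E (r - h) * (1 - 0)) (at r)"
    by (rule DERIV_chain2[of F]) (use F that h in \<open>auto intro!: derivative_eq_intros\<close>)
   then show ?thesis using F[of r] that h by (auto intro!: derivative_eq_intros)
  qed
  moreover have "continuous_on {h..t} (%r. E r - E (r - h))"
   by (intro continuous_intros cE continuous_on_compose2[OF cont]) auto
  ultimately have "(LBINT r:{h..t}. E r - E (r - h)) = (F t - F (t - h)) - (F h - F (h - h))"
   using h by (intro lborel_FTC) auto
  then show ?thesis by (simp add: H_def)
 qed
 \<comment> \<open>The error of the backward average of V over a time interval of length h.\<close>
 define D where "D h z = (LBINT \<theta>. (ind {0..h} \<theta> / h) *\<^sub>R (V (z + (- \<theta>, 0)) - V z))" for h and z :: "real \<times> 'n"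
 let ?K = "%z. V z \<bullet> R z"
 have iK: "integrable lborel ?K" by (rule L2_inner_integrable[OF V R])
 have step: "H h / h \<le> (LBINT z. ind {h..t} (fst z) * ?K z) + sqrt e * sqrt (sqn R)"
  if h: "0 < h" "h < t" and e: "!!s. norm s \<le> h ==> sqn (%x. V (x + s) - V x) \<le> e" for h e
 proof -
  have e0: "0 \<le> e" using order_trans[OF sqn_nonneg e[of 0]] h by simp
  have k1: "integrable lborel (%\<theta>. ind {0..h} \<theta> / h)" using h by simp
  have k2: "(LBINT \<theta>. ind {0..h} \<theta> / h) = 1" using h by simp
  have ms: "(%\<theta>. (- \<theta>, 0 :: 'n)) \<in> borel_measurable (borel :: real measure)" by measurable
  have ee: "sqn (%x. V (x + (- \<theta>, 0)) - V x) \<le> e" if "ind {0..h} \<theta> / h \<noteq> 0" for \<theta>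
   using that by (intro e) (auto simp: norm_Pair indicator_def split: if_splits)
  have LD: "L2 (D h)" and sD: "sqn (D h) \<le> e"
   unfolding D_def using h
   by (intro sqn_average[OF V _ _ k1 k2 ms ee e0]; simp)+
  let ?W = "%z. D h z + V z"
  have W: "L2 ?W" by (intro L2_add LD V)
  have good: "AE x in lborel. \<forall>r. (LBINT \<sigma>:{r-h..r}. V (\<sigma>, x)) = h *\<^sub>R ?W (r, x)"
   using L2_slice(2)[OF V]
  proof eventually_elim
   case (elim x)
   show ?case
   proof
    fix r
    have i0: "L2 (%\<theta>. V (r - \<theta>, x))"
    proof -
     have "integrable lborel (%s. (norm (V (s, x)))\<^sup>2)" by (rule L2_integrable[OF elim])
     from lborel_integrable_real_affine[OF this, of "-1" r] show ?thesis by (simp add: L2_def)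
    qed
    have i1: "integrable lborel (%\<theta>. ind {0..h} \<theta> *\<^sub>R V (r - \<theta>, x))"
     by (rule L2_set_integrable[OF i0]) auto
    have "(LBINT \<sigma>:{r-h..r}. V (\<sigma>, x)) = (LBINT \<theta>. ind {r-h..r} (r + (-1) * \<theta>) *\<^sub>R V (r + (-1) * \<theta>, x))"
     unfolding set_lebesgue_integral_def
     using lborel_integral_real_affine[of "-1" "%\<sigma>. ind {r-h..r} \<sigma> *\<^sub>R V (\<sigma>, x)" r] by simp
    also have "\<dots> = (LBINT \<theta>. ind {0..h} \<theta> *\<^sub>R V (r - \<theta>, x))"
     by (intro lint_cong refl) (auto simp: indicator_def)
    finally have I: "(LBINT \<sigma>:{r-h..r}. V (\<sigma>, x)) = \<dots>" .
    have "D h (r, x) = (LBINT \<theta>. (1/h) *\<^sub>R (ind {0..h} \<theta> *\<^sub>R V (r - \<theta>, x)) - (ind {0..h} \<theta> / h) *\<^sub>R V (r, x))"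
     unfolding D_def by (intro lint_cong refl) (simp add: scaleR_diff_right)
    also have "\<dots> = (1/h) *\<^sub>R (LBINT \<theta>. ind {0..h} \<theta> *\<^sub>R V (r - \<theta>, x)) - (LBINT \<theta>. ind {0..h} \<theta> / h) *\<^sub>R V (r, x)"
    proof -
     have i2: "integrable lborel (%\<theta>. (1/h) *\<^sub>R (ind {0..h} \<theta> *\<^sub>R V (r - \<theta>, x)))"
      by (rule integrable_scaleR_right) (rule i1)
     have i3: "integrable lborel (%\<theta>. (ind {0..h} \<theta> / h) *\<^sub>R V (r, x))"
      by (rule integrable_scaleR_left) (rule k1)
     show ?thesis
      by (simp only: lint_diff[OF i2 i3] integral_scaleR_right integral_scaleR_left[OF k1])
    qed
    finally have "D h (r, x) = (1/h) *\<^sub>R (LBINT \<theta>. ind {0..h} \<theta> *\<^sub>R V (r - \<theta>, x)) - V (r, x)"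
     unfolding k2 by simp
    then show "(LBINT \<sigma>:{r-h..r}. V (\<sigma>, x)) = h *\<^sub>R ?W (r, x)"
     using h I by simp
   qed
  qed
  have iW: "integrable lborel (%z. ?W z \<bullet> R z)" by (rule L2_inner_integrable[OF W R])
  have b: "ind {h..t} (fst z) *\<^sub>R R z = ind ({h..t} \<times> UNIV) z *\<^sub>R R z" for z
   by (cases z) (simp add: indicator_def)
  have sb: "{h..t} \<times> (UNIV :: 'n set) \<in> sets borel" by (intro borel_Times) auto
  have LR: "L2 (%z. ind {h..t} (fst z) *\<^sub>R R z)" "sqn (%z. ind {h..t} (fst z) *\<^sub>R R z) \<le> sqn R"
   unfolding b by (rule L2_mult_indicator[OF R sb])+
  have iW2: "integrable lborel (%z. ind {h..t} (fst z) * (?W z \<bullet> R z))"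
   using L2_inner_integrable[OF W LR(1)] by simp
  have ae: "AE r in lborel. ind {h..t} r * (E r - E (r - h)) \<le> h * (LBINT x. ind {h..t} r * (?W (r, x) \<bullet> R (r, x)))"
   \<comment> \<open>The hypothesis is applied with s = r - h. It concerns the open interval only,
     so the time r = t, which may equal T, is removed as a null set.\<close>
   using key AE_lborel_singleton[of t]
  proof eventually_elim
   case (elim r)
   show ?case
   proof (cases "r \<in> {h..t}")
    case True
    then have "E r - E (r - h) \<le> (LBINT x. (LBINT \<sigma>:{r-h..r}. V (\<sigma>, x)) \<bullet> R (r, x))"
     using elim h tp by auto
    also have "\<dots> = (LBINT x. h * (?W (r, x) \<bullet> R (r, x)))"
    proof (rule integral_cong_AE)
     show "AE x in lborel. (LBINT \<sigma>:{r-h..r}. V (\<sigma>, x)) \<bullet> R (r, x) = h * (?W (r, x) \<bullet> R (r, x))"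
      using good by eventually_elim simp
     show "(%x. (LBINT \<sigma>:{r-h..r}. V (\<sigma>, x)) \<bullet> R (r, x)) \<in> borel_measurable lborel"
      unfolding set_lebesgue_integral_def by measurable
     show "(%x. h * (?W (r, x) \<bullet> R (r, x))) \<in> borel_measurable lborel"
      using L2_measurable[OF LD] by measurable
    qed
    finally show ?thesis using True by simp
   qed simp
  qed
  have "H h = (LBINT r. ind {h..t} r * (E r - E (r - h)))"
   using Hint[OF h] by (simp add: set_lebesgue_integral_def)
  also have "\<dots> \<le> (LBINT r. h * (LBINT x. ind {h..t} r * (?W (r, x) \<bullet> R (r, x))))"
  proof (rule integral_mono_AE)
   have "set_integrable lborel {h..t} (%r. E r - E (r - h))"
    by (intro borel_integrable_atLeastAtMost' continuous_intros cE continuous_on_compose2[OF cont]) auto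
   then show "integrable lborel (%r. ind {h..t} r * (E r - E (r - h)))"
    by (simp add: set_integrable_def)
   show "integrable lborel (%r. h * (LBINT x. ind {h..t} r * (?W (r, x) \<bullet> R (r, x))))"
    using integral_slice(2)[OF iW2] by simp
  qed (rule ae)
  also have "\<dots> = h * (LBINT z. ind {h..t} (fst z) * (?W z \<bullet> R z))"
   using integral_slice(1)[OF iW2] by simp
  finally have "H h / h \<le> (LBINT z. ind {h..t} (fst z) * (?W z \<bullet> R z))"
   using h by (simp add: divide_le_eq mult.commute)
  also have "\<dots> = (LBINT z. D h z \<bullet> (ind {h..t} (fst z) *\<^sub>R R z)) + (LBINT z. ind {h..t} (fst z) * ?K z)"
   using L2_inner_integrable[OF LD LR(1)] L2_inner_integrable[OF V LR(1)]
   by (simp add: inner_add_left distrib_left)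
  also have "(LBINT z. D h z \<bullet> (ind {h..t} (fst z) *\<^sub>R R z)) \<le> sqrt (sqn (D h)) * sqrt (sqn (%z. ind {h..t} (fst z) *\<^sub>R R z))"
   using L2_inner_le[OF LD LR(1)] by linarith
  also have "\<dots> \<le> sqrt e * sqrt (sqn R)"
   using sD LR(2) e0 by (intro mult_mono) auto
  finally show ?thesis by simp
 qed
 obtain d where d: "!!e. e > 0 ==> d e > 0" "!!e s. e > 0 ==> norm s \<le> d e ==> sqn (%x. V (x + s) - V x) \<le> e"
  using shift_cont_L2[OF V] unfolding shift_cont_def by metis
 define e where "e n = inverse (real (Suc n))" for n
 define h where "h n = min (d (e n)) (min (t / 2) (inverse (real (Suc n))))" for n
 have e: "e n > 0" for n by (simp add: e_def)
 have h: "0 < h n" "h n < t" "norm s \<le> h n ==> sqn (%x. V (x + s) - V x) \<le> e n" for n s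
  using d(1)[OF e[of n]] d(2)[OF e[of n], of s] tp unfolding h_def by auto
 have e_lim: "e \<longlonglongrightarrow> 0" unfolding e_def by (rule LIMSEQ_inverse_real_of_nat)
 have h_lim: "h \<longlonglongrightarrow> 0"
  by (rule tendsto_sandwich[OF _ _ tendsto_const LIMSEQ_inverse_real_of_nat])
    (use h(1) in \<open>auto simp: h_def less_imp_le intro!: always_eventually\<close>)
 have "((%h. H h / h) \<longlongrightarrow> E t - E 0) (at 0)"
  using dH unfolding has_field_derivative_iff by (simp add: H_def)
 then have l1: "(%n. H (h n) / h n) \<longlonglongrightarrow> E t - E 0"
 proof (rule filterlim_compose)
  show "filterlim h (at 0) sequentially"
   unfolding filterlim_at using h_lim order_less_imp_not_eq2[OF h(1)] by simp
 qed
 have l2: "(%n. LBINT z. ind {h n..t} (fst z) * ?K z) \<longlonglongrightarrow> (LBINT z. ind {0..t} (fst z) * ?K z)"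
 proof (rule lint_dominated_convergence[where w = "%z. norm (?K z)"])
  have "AE z in lborel. fst (z :: real \<times> 'n) \<noteq> 0"
   using AE_slice'(2)[OF AE_lborel_singleton[of "0::real"], where 'm = 'n] .
  then show "AE z in lborel. (%n. ind {h n..t} (fst z) * ?K z) \<longlonglongrightarrow> ind {0..t} (fst z) * ?K z"
  proof eventually_elim
   case (elim z)
   have "\<forall>\<^sub>F n in sequentially. ind {h n..t} (fst z) = (ind {0..t} (fst z) :: real)"
   proof (cases "fst z > 0")
    case True
    then have "\<forall>\<^sub>F n in sequentially. h n < fst z" using h_lim by (rule order_tendstoD(2)[rotated])
    then show ?thesis by eventually_elim (use True in \<open>auto simp: indicator_def\<close>)
   next
    case False
    then have "\<not> 0 \<le> fst z" "\<not> h n \<le> fst z" for n using elim h(1)[of n] by auto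
    then show ?thesis by (intro always_eventually) (simp add: indicator_def)
   qed
   then show ?case by (intro tendsto_mult tendsto_const tendsto_eventually)
  qed
  show "AE z in lborel. norm (ind {h n..t} (fst z) * ?K z) \<le> norm (?K z)" for n
   by (intro AE_I2) (auto simp: indicator_def)
 qed (use iK in auto)
 have l3: "(%n. (LBINT z. ind {h n..t} (fst z) * ?K z) + sqrt (e n) * sqrt (sqn R))
   \<longlonglongrightarrow> (LBINT z. ind {0..t} (fst z) * ?K z) + sqrt 0 * sqrt (sqn R)"
  by (intro tendsto_intros l2 e_lim)
 have "E t - E 0 \<le> (LBINT z. ind {0..t} (fst z) * ?K z) + sqrt 0 * sqrt (sqn R)"
  by (rule LIMSEQ_le[OF l1 l3]) (use step[OF h] in auto)
 then show ?thesis by simp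
qed

section \<open>Smooth functions\<close>

abbreviation dd :: "('n::euclidean_space => real) => 'n => 'n => real" where
 "dd g x v \<equiv> frechet_derivative g (at x) v"

lemma dd_eq: "(g has_derivative g') (at x) ==> dd g x v = g' v"
 using frechet_derivative_at by metis

text \<open>\<open>Ck\<close> is defined through \<open>frechet_derivative\<close>. By uniqueness of
  the derivative any explicit formula may be used in its place, which turns the closure properties
  below into inductions on the order.\<close>

lemma Ck_SucI:
 assumes "!!x. (g has_derivative g' x) (at x)" "!!v. Ck k (%x. g' x v)"
 shows "Ck (Suc k) g"
proof -
 have "dd g x v = g' x v" for x v using dd_eq[OF assms(1)] .
 then show ?thesis using assms by (auto simp: differentiable_def)
qed

lemma Ck_Suc_has_derivative: "Ck (Suc k) g ==> (g has_derivative frechet_derivative g (at x)) (at x)"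
 using frechet_derivative_works by auto

lemma Ck_Suc_dd: "Ck (Suc k) g ==> Ck k (%x. dd g x v)"
 by simp

lemma Ck_SucD: "Ck (Suc k) g ==> Ck k g"
proof (induction k arbitrary: g)
 case 0
 then have "g differentiable (at x)" for x by simp
 then show ?case by (simp add: differentiable_imp_continuous_within continuous_on_eq_continuous_at)
next
 case (Suc k)
 have 1: "\<forall>x. g differentiable (at x)" and 2: "!!v. Ck (Suc k) (%x. dd g x v)"
  using Suc.prems by simp_all
 show ?case unfolding Ck.simps(2)[of k] using 1 Suc.IH[OF 2] by blast
qed

lemma Ck_continuous: "Ck k g ==> continuous_on UNIV g"
 by (induction k) (auto dest!: Ck_SucD simp del: Ck.simps(2))

lemma Ck_const: "Ck k (%x. c)"
proof (induction k arbitrary: c)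
 case (Suc k)
 show ?case by (rule Ck_SucI[where g' = "%x v. 0"]) (auto simp: Suc)
qed simp

lemma Ck_linear: "bounded_linear g ==> Ck k g"
proof (cases k)
 case (Suc m)
 assume "bounded_linear g"
 then show ?thesis unfolding Suc
  by (intro Ck_SucI[where g' = "%x. g"] Ck_const bounded_linear_imp_has_derivative)
qed (simp add: linear_continuous_on)

lemma Ck_add: "Ck k f ==> Ck k g ==> Ck k (%x. f x + g x)"
proof (induction k arbitrary: f g)
 case (Suc k)
 show ?case
  by (rule Ck_SucI[where g' = "%x v. dd f x v + dd g x v"])
    (use Suc.prems in \<open>auto intro!: derivative_eq_intros Ck_Suc_has_derivative Suc.IH simp del: Ck.simps(2) dest: Ck_Suc_dd\<close>)
qed (auto intro: continuous_intros)

lemma Ck_mult: "Ck k f ==> Ck k g ==> Ck k (%x. f x * g x)"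
proof (induction k arbitrary: f g)
 case (Suc k)
 show ?case
  by (rule Ck_SucI[where g' = "%x v. f x * dd g x v + dd f x v * g x"])
    (use Suc.prems in \<open>auto intro!: derivative_eq_intros Ck_Suc_has_derivative Suc.IH Ck_add simp del: Ck.simps(2) dest: Ck_Suc_dd Ck_SucD\<close>)
qed (auto intro: continuous_intros)

lemma Ck_sum: "(!!i. i \<in> I ==> Ck k (f i)) ==> Ck k (%x. \<Sum>i\<in>I. f i x)"
 by (induction I rule: infinite_finite_induct) (auto intro: Ck_add Ck_const)

text \<open>The outer function has one real variable, so its derivative is multiplication by a
  number and the chain rule yields a product of two functions to which the induction hypothesis and
  \<open>Ck_mult\<close> apply.\<close>

lemma Ck_compose_real:
 fixes b :: "real => real"
 shows "Ck k b ==> Ck k p ==> Ck k (%x. b (p x))"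
proof (induction k arbitrary: b p)
 case 0
 then show ?case by (auto intro: continuous_on_compose2)
next
 case (Suc k)
 show ?case
 proof (rule Ck_SucI)
  fix x
  have b: "(b has_derivative (%v. v * dd b (p x) 1)) (at (p x))"
  proof -
   have "(b has_derivative frechet_derivative b (at (p x))) (at (p x))" by (rule Ck_Suc_has_derivative[OF Suc.prems(1)])
   moreover have "frechet_derivative b (at (p x)) = (%v. v * dd b (p x) 1)"
   proof
    fix v :: real
    have "linear (frechet_derivative b (at (p x)))" using Suc.prems(1) by (intro linear_frechet_derivative) simp
    from linear_scale[OF this, of v 1] show "dd b (p x) v = v * dd b (p x) 1" by simp
   qed
   ultimately show ?thesis by simp
  qed
  show "((%x. b (p x)) has_derivative (%v. dd p x v * dd b (p x) 1)) (at x)"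
   by (rule has_derivative_compose[OF Ck_Suc_has_derivative[OF Suc.prems(2)] b])
 next
  fix v
  show "Ck k (%x. dd p x v * dd b (p x) 1)"
   by (intro Ck_mult Ck_Suc_dd[OF Suc.prems(2)] Suc.IH[OF Ck_Suc_dd[OF Suc.prems(1)] Ck_SucD[OF Suc.prems(2)]])
 qed
qed

lemma Ck_compose_affine:
 fixes L :: "'m::euclidean_space => 'n::euclidean_space"
 assumes L: "bounded_linear L"
 shows "Ck k g ==> Ck k (%x. g (L x + a))"
proof (induction k arbitrary: g)
 case 0
 then show ?case
  by (auto intro!: continuous_on_compose2[of UNIV g] continuous_intros linear_continuous_on[OF L])
next
 case (Suc k)
 show ?case
 proof (rule Ck_SucI)
  fix x
  have "((%x. L x + a) has_derivative L) (at x)"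
   using bounded_linear_imp_has_derivative[OF L] by (auto intro!: derivative_eq_intros)
  then show "((%x. g (L x + a)) has_derivative (%v. dd g (L x + a) (L v))) (at x)"
   by (rule has_derivative_compose[OF _ Ck_Suc_has_derivative[OF Suc.prems]])
 qed (rule Suc.IH[OF Ck_Suc_dd[OF Suc.prems]])
qed

lemma Ck_inverse: "Ck k p ==> (!!x. p x \<noteq> 0) ==> Ck k (%x. inverse (p x))"
proof (induction k arbitrary: p)
 case (Suc k)
 show ?case
 proof (rule Ck_SucI)
  show "((%x. inverse (p x)) has_derivative (%v. (- 1) * ((inverse (p x) * dd p x v) * inverse (p x)))) (at x)" for x
   using Suc.prems by (auto intro!: derivative_eq_intros Ck_Suc_has_derivative simp del: Ck.simps(2))
  show "Ck k (%x. (- 1) * ((inverse (p x) * dd p x v) * inverse (p x)))" for v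
   by (intro Ck_mult Ck_const Suc.IH[OF Ck_SucD[OF Suc.prems(1)]] Ck_Suc_dd[OF Suc.prems(1)] Suc.prems(2))
 qed
qed (auto intro: continuous_intros)

lemma smooth_const: "smooth_fun (%x. c)"
 and smooth_linear: "bounded_linear g ==> smooth_fun g"
 and smooth_add: "smooth_fun f ==> smooth_fun g ==> smooth_fun (%x. f x + g x)"
 and smooth_mult: "smooth_fun f ==> smooth_fun g ==> smooth_fun (%x. f x * g x)"
 and smooth_sum: "(!!i. i \<in> I ==> smooth_fun (h i)) ==> smooth_fun (%x. \<Sum>i\<in>I. h i x)"
 and smooth_compose_real: "smooth_fun b ==> smooth_fun f ==> smooth_fun (%x. b (f x :: real))"
 and smooth_inverse: "smooth_fun f ==> (!!x. f x \<noteq> 0) ==> smooth_fun (%x. inverse (f x))"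
 by (auto simp: smooth_fun_def intro: Ck_const Ck_linear Ck_add Ck_mult Ck_sum Ck_compose_real Ck_inverse)

lemma smooth_compose_affine:
 "bounded_linear L ==> smooth_fun g ==> smooth_fun (%x. g (L x + a))"
 by (auto simp: smooth_fun_def intro: Ck_compose_affine)

lemma smooth_diff: "smooth_fun f ==> smooth_fun g ==> smooth_fun (%x. f x - g x)"
 using smooth_add[of f "%x. -1 * g x"] smooth_mult[OF smooth_const[of "-1"], of g] by simp

lemma smooth_dd: "smooth_fun g ==> smooth_fun (%x. dd g x v)"
 unfolding smooth_fun_def using Ck_Suc_dd by blast

lemma smooth_continuous: "smooth_fun g ==> continuous_on A g"
 unfolding smooth_fun_def using Ck_continuous continuous_on_subset by blast

lemma smooth_has_derivative: "smooth_fun g ==> (g has_derivative frechet_derivative g (at x)) (at x)"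
 unfolding smooth_fun_def using Ck_Suc_has_derivative by blast

lemma smooth_measurable: "smooth_fun g ==> g \<in> borel_fun"
 using smooth_continuous borel_measurable_continuous_onI by blast

lemma smooth_norm_sq: "smooth_fun (%x::'n::euclidean_space. (x - p) \<bullet> (x - p))"
proof -
 have "smooth_fun (%x::'n. \<Sum>i\<in>Basis. (x \<bullet> i - p \<bullet> i) * (x \<bullet> i - p \<bullet> i))"
  by (intro smooth_sum smooth_mult smooth_diff smooth_linear smooth_const bounded_linear_inner_left)
 then show ?thesis by (subst euclidean_inner) (simp add: inner_diff_left)
qed

lemma dd_mult:
 assumes "smooth_fun f" "smooth_fun g"
 shows "dd (%x. f x * g x) x v = f x * dd g x v + dd f x v * g x"
 by (rule dd_eq) (auto intro!: derivative_eq_intros smooth_has_derivative assms)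

lemma dd_compose_affine:
 assumes "bounded_linear L" "smooth_fun g"
 shows "dd (%x. g (L x + a)) x v = dd g (L x + a) (L v)"
proof -
 have "((%x. L x + a) has_derivative L) (at x)"
  using bounded_linear_imp_has_derivative[OF assms(1)] by (auto intro!: derivative_eq_intros)
 from dd_eq[OF has_derivative_compose[OF this smooth_has_derivative[OF assms(2)]]] show ?thesis by simp
qed

lemma dd_directional:
 assumes "smooth_fun g"
 shows "((%s. g (x + s *\<^sub>R e)) has_real_derivative dd g (x + s *\<^sub>R e) e) (at s)"
proof -
 have "((%s. x + s *\<^sub>R e) has_derivative (%s. s *\<^sub>R e)) (at s)" by (auto intro!: derivative_eq_intros)
 from has_derivative_compose[OF this smooth_has_derivative[OF assms]]
 have "((%s. g (x + s *\<^sub>R e)) has_derivative (%t. dd g (x + s *\<^sub>R e) (t *\<^sub>R e))) (at s)" .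
 moreover have "(%t. dd g (x + s *\<^sub>R e) (t *\<^sub>R e)) = (*) (dd g (x + s *\<^sub>R e) e)"
  using linear_scale[OF has_derivative_linear[OF smooth_has_derivative[OF assms]]] by (simp add: fun_eq_iff)
 ultimately show ?thesis unfolding has_field_derivative_def by simp
qed

section \<open>A flat function, bumps and partitions of unity\<close>

definition flat :: "nat => real => real" where
 "flat m s = (if s > 0 then inverse s ^ m / exp (inverse s) else 0)"

lemma flat_tendsto_0: "(flat m \<longlongrightarrow> 0) (at 0)"
proof -
 have "((%s::real. inverse s ^ m / exp (inverse s)) \<longlongrightarrow> 0) (at_right 0)"
  by (rule filterlim_compose[OF tendsto_power_div_exp_0 filterlim_inverse_at_top_right])
 then have "(flat m \<longlongrightarrow> 0) (at_right 0)"
  by (rule Lim_transform_eventually) (auto simp: eventually_at_filter flat_def)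
 moreover have "(flat m \<longlongrightarrow> 0) (at_left 0)"
  by (rule tendsto_eventually) (auto simp: eventually_at_filter flat_def)
 ultimately show ?thesis by (simp add: filterlim_split_at)
qed

text \<open>\<open>flat 0\<close> is the classical exp (- 1/s), extended by 0. The powers of 1/s are
  carried along because the derivatives then stay in the linear span of the family, and smoothness
  becomes a single induction.\<close>

lemma flat_has_derivative: "(flat m has_real_derivative (flat (m + 2) s - real m * flat (m + 1) s)) (at s)"
proof -
 consider "s > 0" | "s < 0" | "s = 0" by linarith
 then show ?thesis
 proof cases
  case 1
  have "((%s. inverse s ^ m * exp (- inverse s)) has_real_derivative
    (real m * (- (inverse s * inverse s)) * inverse s ^ (m - 1)) * exp (- inverse s)
    + inverse s ^ m * (exp (- inverse s) * (inverse s * inverse s))) (at s)"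
   using 1 by (auto intro!: derivative_eq_intros simp: power2_eq_square)
  moreover have "(real m * (- (inverse s * inverse s)) * inverse s ^ (m - 1)) * exp (- inverse s)
    + inverse s ^ m * (exp (- inverse s) * (inverse s * inverse s)) = flat (m + 2) s - real m * flat (m + 1) s"
   using 1 by (cases m) (simp_all add: flat_def exp_minus field_simps)
  ultimately have "((%s. inverse s ^ m * exp (- inverse s)) has_real_derivative (flat (m + 2) s - real m * flat (m + 1) s)) (at s)"
   by simp
  then show ?thesis
   by (rule has_field_derivative_transform_within_open[of _ _ _ "{0<..}"]) (use 1 in \<open>auto simp: flat_def exp_minus field_simps\<close>)
 next
  case 2
  have "((%s. 0) has_real_derivative 0) (at s)" by simp
  then have "(flat m has_real_derivative 0) (at s)"
   by (rule has_field_derivative_transform_within_open[of _ _ _ "{..<0}"]) (use 2 in \<open>auto simp: flat_def\<close>)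
  then show ?thesis using 2 by (simp add: flat_def)
 next
  case 3
  \<comment> \<open>The difference quotient at 0 is \<open>flat (m + 1)\<close> itself.\<close>
  have "((%h. flat m h / h) \<longlongrightarrow> 0) (at 0)"
   by (rule Lim_transform_eventually[OF flat_tendsto_0[of "m + 1"]])
     (auto simp: eventually_at_filter flat_def field_simps)
  then show ?thesis using 3 by (simp add: has_field_derivative_iff flat_def)
 qed
qed

lemma Ck_flat: "Ck k (flat m)"
proof (induction k arbitrary: m)
 case 0
 then show ?case
  by (simp add: continuous_on_eq_continuous_at) (metis DERIV_isCont flat_has_derivative)
next
 case (Suc k)
 show ?case
 proof (rule Ck_SucI)
  show "(flat m has_derivative (%v. (flat (m + 2) s + (- real m) * flat (m + 1) s) * v)) (at s)" for s
   using flat_has_derivative[of m s] by (simp add: has_field_derivative_def)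
  show "Ck k (%s. (flat (m + 2) s + (- real m) * flat (m + 1) s) * v)" for v
   by (intro Ck_mult Ck_add Ck_const Suc)
 qed
qed

lemma smooth_flat: "smooth_fun (flat m)"
 by (simp add: smooth_fun_def Ck_flat)

lemma flat_nonneg: "0 \<le> flat m s" and flat_pos_iff: "0 < flat m s \<longleftrightarrow> 0 < s"
 by (auto simp: flat_def)

text \<open>The squared distance is a polynomial, so there is no singularity at the centre, and
  positivity holds on the open ball exactly.\<close>

definition bump :: "'n::euclidean_space => real => 'n => real" where
 "bump p r x = flat 0 (r\<^sup>2 - (x - p) \<bullet> (x - p))"

lemma smooth_bump: "smooth_fun (bump p r)"
 unfolding bump_def[abs_def]
 by (intro smooth_compose_real[OF smooth_flat] smooth_diff smooth_const smooth_norm_sq)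

lemma bump_nonneg: "0 \<le> bump p r x"
 by (simp add: bump_def flat_nonneg)

lemma bump_pos_iff: assumes "r > 0" shows "0 < bump p r x \<longleftrightarrow> x \<in> ball p r"
proof -
 have "(x - p) \<bullet> (x - p) = (dist p x)\<^sup>2" by (simp add: dist_norm power2_norm_eq_inner[symmetric] norm_minus_commute)
 moreover have "(dist p x)\<^sup>2 < r\<^sup>2 \<longleftrightarrow> dist p x < r"
  using assms power2_less_imp_less[of "dist p x" r] power_strict_mono[of "dist p x" r 2] by auto
 ultimately show ?thesis by (simp add: bump_def flat_pos_iff)
qed

text \<open>Finitely many bumps cover K; dividing them by their sum N would fail where N vanishes.
  The denominator is therefore modified, but only where N lies below its minimum on K. This gives
  sum 1 on K and sum at most 1 elsewhere.\<close>

lemma smooth_partition: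
 fixes K :: "'n::euclidean_space set"
 assumes K: "compact K" and r: "!!p. p \<in> K ==> r p > 0"
 obtains I \<zeta> where "finite I" "I \<subseteq> K" "!!p. p \<in> I ==> smooth_fun (\<zeta> p)" "!!p x. 0 \<le> \<zeta> p x"
  "!!p x. p \<in> I ==> \<zeta> p x \<noteq> 0 ==> x \<in> ball p (r p)" "!!x. x \<in> K ==> (\<Sum>p\<in>I. \<zeta> p x) = 1"
  "!!x. (\<Sum>p\<in>I. \<zeta> p x) \<le> 1"
proof -
 obtain I where I: "I \<subseteq> K" "finite I" "K \<subseteq> (\<Union>p\<in>I. ball p (r p))"
 proof (rule compactE_image[OF K, of K "%p. ball p (r p)"])
  show "K \<subseteq> (\<Union>p\<in>K. ball p (r p))" using r by auto
 qed auto
 define N where "N x = (\<Sum>p\<in>I. bump p (r p) x)" for x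
 have N: "smooth_fun N" unfolding N_def[abs_def] by (intro smooth_sum smooth_bump)
 have N0: "0 \<le> N x" for x unfolding N_def by (intro sum_nonneg bump_nonneg)
 have NK: "N x > 0" if xK: "x \<in> K" for x
 proof -
  obtain p where p: "p \<in> I" "x \<in> ball p (r p)" using I xK by blast
  then have "0 < bump p (r p) x" using bump_pos_iff[of "r p" p x] r I by blast
  also have "\<dots> \<le> N x" unfolding N_def using p I by (intro member_le_sum bump_nonneg) auto
  finally show ?thesis .
 qed
 obtain c where c: "c > 0" "!!x. x \<in> K ==> c \<le> N x"
 proof (cases "K = {}")
  case False
  obtain y where "y \<in> K" "!!x. x \<in> K ==> N y \<le> N x"
   using continuous_attains_inf[OF K False smooth_continuous[OF N]] by blast
  then show ?thesis using that NK by blast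
 qed (use that[of 1] in auto)
 \<comment> \<open>The added term is 0 where N >= c, in particular on K, and positive where N < c,
   in particular where N = 0.\<close>
 define N' where "N' x = N x + flat 0 (c - N x)" for x
 have N': "smooth_fun N'" unfolding N'_def[abs_def]
  by (intro smooth_add N smooth_compose_real[OF smooth_flat] smooth_diff smooth_const)
 have N'0: "N' x > 0" for x
  using N0[of x] c(1) flat_nonneg[of 0 "c - N x"] flat_pos_iff[of 0 "c - N x"] unfolding N'_def by (cases "N x = 0") auto
 define \<zeta> where "\<zeta> p x = bump p (r p) x * inverse (N' x)" for p x
 show thesis
 proof (rule that[of I \<zeta>])
  show "finite I" "I \<subseteq> K" using I by auto
  show "smooth_fun (\<zeta> p)" for p unfolding \<zeta>_def[abs_def]
   by (intro smooth_mult smooth_bump smooth_inverse N') (simp add: order_less_imp_not_eq2[OF N'0])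
  show "0 \<le> \<zeta> p x" for p x unfolding \<zeta>_def using bump_nonneg[of p "r p" x] N'0[of x] by simp
  show "x \<in> ball p (r p)" if "p \<in> I" "\<zeta> p x \<noteq> 0" for p x
  proof -
   have "0 < bump p (r p) x" using that(2) bump_nonneg[of p "r p" x] unfolding \<zeta>_def by fastforce
   then show ?thesis using bump_pos_iff[of "r p" p x] r I that(1) by blast
  qed
  have s: "(\<Sum>p\<in>I. \<zeta> p x) = N x / N' x" for x
   unfolding \<zeta>_def N_def by (simp add: sum_distrib_right[symmetric] divide_inverse)
  show "(\<Sum>p\<in>I. \<zeta> p x) = 1" if "x \<in> K" for x
  proof -
   have "flat 0 (c - N x) = 0" using c(2)[OF that] by (simp add: flat_def)
   then show ?thesis using s[of x] N'0[of x] unfolding N'_def by simp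
  qed
  show "(\<Sum>p\<in>I. \<zeta> p x) \<le> 1" for x
   using s[of x] N'0[of x] flat_nonneg[of 0 "c - N x"] unfolding N'_def by simp
 qed
qed

section \<open>Weak gradients\<close>

lemma lborel_FTC_directional:
 fixes f D :: "'n::euclidean_space => real"
 assumes D: "continuous_on UNIV D" and d: "!!x s. ((%s. f (x + s *\<^sub>R e)) has_real_derivative D (x + s *\<^sub>R e)) (at s)"
 shows "(LBINT \<theta>:{0..1}. D (x + \<theta> *\<^sub>R e)) = f (x + e) - f x"
proof -
 have "continuous_on {0..1} (%s. D (x + s *\<^sub>R e))"
  by (rule continuous_on_compose2[OF D]) (auto intro!: continuous_intros)
 from lborel_FTC[OF _ d this] show ?thesis by simp
qed

lemma bounded_shift_set:
 fixes e :: "'n::euclidean_space"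
 assumes "bounded S" shows "bounded ({0..1::real} \<times> {x - \<theta> *\<^sub>R e |x \<theta>. x \<in> S \<and> \<theta> \<in> {0..1}})"
proof -
 obtain B where B: "!!x. x \<in> S ==> norm x \<le> B" using assms unfolding bounded_iff by blast
 have "norm (x - \<theta> *\<^sub>R e) \<le> B + norm e" if "x \<in> S" "\<theta> \<in> {0..1}" for x \<theta>
 proof -
  have "norm (x - \<theta> *\<^sub>R e) \<le> norm x + norm (\<theta> *\<^sub>R e)" by (rule norm_triangle_ineq4)
  also have "norm (\<theta> *\<^sub>R e) \<le> norm e" using that by (simp add: mult_left_le_one_le)
  finally show ?thesis using B[OF that(1)] by linarith
 qed
 then have "bounded {x - \<theta> *\<^sub>R e |x \<theta>. x \<in> S \<and> \<theta> \<in> {0..1}}" unfolding bounded_iff by blast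
 then show ?thesis by (intro bounded_Times) auto
qed

text \<open>f (x + e) - f x is the integral of D over the segment from x to x + e. Its integral over
  x is 0 by translation invariance, and after exchanging the integrals each parameter in [0, 1]
  contributes the same number, the integral of D.\<close>

lemma integral_directional_zero:
 fixes f D :: "'n::euclidean_space => real"
 assumes f: "continuous_on UNIV f" and D: "continuous_on UNIV D"
  and d: "!!x s. ((%s. f (x + s *\<^sub>R e)) has_real_derivative D (x + s *\<^sub>R e)) (at s)"
  and S: "compact S" and fz: "!!x. x \<notin> S ==> f x = 0" and Dz: "!!x. x \<notin> S ==> D x = 0"
 shows "(LBINT x. D x) = 0"
proof -
 have [measurable]: "f \<in> borel_fun" "D \<in> borel_fun"
  using f D by (auto intro: borel_measurable_continuous_onI)
 have bd: "\<exists>C. \<forall>x. norm (g x) \<le> C" if "continuous_on UNIV g" "!!x. x \<notin> S ==> g x = 0" for g :: "'n => real"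
 proof -
  have "bounded (g ` S)" using that(1) S by (intro compact_imp_bounded compact_continuous_image) (auto intro: continuous_on_subset)
  then obtain C where "!!x. x \<in> S ==> norm (g x) \<le> C" unfolding bounded_iff by blast
  then have "norm (g x) \<le> \<bar>C\<bar>" for x using that(2)[of x] by (cases "x \<in> S") force+
  then show ?thesis by blast
 qed
 obtain C where C: "!!x. norm (D x) \<le> C" using bd[OF D Dz] by blast
 obtain C' where C': "!!x. norm (f x) \<le> C'" using bd[OF f fz] by blast
 have C0: "0 \<le> C" using norm_ge_zero C order_trans by blast
 have bS: "bounded S" using S by (rule compact_imp_bounded)
 have fi: "integrable lborel f" by (rule integrable_bounded_support[OF _ C' bS fz]) auto
 define P where "P z = ind {0..1} (fst z) * D (snd z + fst z *\<^sub>R e)" for z :: "real \<times> 'n"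
 have Pm: "P \<in> borel_fun" unfolding P_def by measurable
 have Pz: "P z = 0" if "z \<notin> {0..1} \<times> {x - \<theta> *\<^sub>R e |x \<theta>. x \<in> S \<and> \<theta> \<in> {0..1}}" for z
 proof (rule ccontr)
  assume "P z \<noteq> 0"
  then have "fst z \<in> {0..1}" "snd z + fst z *\<^sub>R e \<in> S" using Dz unfolding P_def by (auto simp: indicator_def split: if_splits)
  moreover then have "snd z = (snd z + fst z *\<^sub>R e) - fst z *\<^sub>R e" by simp
  ultimately have "snd z \<in> {x - \<theta> *\<^sub>R e |x \<theta>. x \<in> S \<and> \<theta> \<in> {0..1}}" by blast
  then show False using that \<open>fst z \<in> {0..1}\<close> by (simp add: mem_Times_iff)
 qed
 have Pi: "integrable lborel P"
  by (rule integrable_bounded_support[OF Pm _ bounded_shift_set[OF bS] Pz]) (use C C0 in \<open>auto simp: P_def indicator_def\<close>)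
 have "(LBINT x. LBINT \<theta>. P (\<theta>, x)) = (LBINT x. f (x + e) - f x)"
  using lborel_FTC_directional[OF D d] by (simp add: P_def set_lebesgue_integral_def)
 also have "\<dots> = 0"
  using fi integrable_lborel_shift[OF fi, of e] integral_lborel_shift[of f e] by simp
 finally have "(LBINT \<theta>. LBINT x. P (\<theta>, x)) = 0"
  using integral_swap[OF Pi] by simp
 moreover have "(LBINT x. P (\<theta>, x)) = ind {0..1} \<theta> * (LBINT x. D x)" for \<theta>
  unfolding P_def by (simp add: integral_lborel_shift)
 ultimately show ?thesis by simp
qed

section \<open>Test functions\<close>

lemma test_fun_smooth: "test_fun U g ==> smooth_fun g"
 and test_fun_compact: "test_fun U g ==> compact (closure {x. g x \<noteq> 0})"
 and test_fun_subset: "test_fun U g ==> closure {x. g x \<noteq> 0} \<subseteq> U"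
 by (auto simp: test_fun_def)

lemma test_fun_zero: "x \<notin> closure {x. g x \<noteq> 0} ==> g x = 0"
 using closure_subset[of "{x. g x \<noteq> 0}"] by blast

lemma test_fun_dd_zero:
 assumes "x \<notin> closure {x. g x \<noteq> 0}" shows "dd g x v = 0"
proof -
 have "((%x. 0 :: real) has_derivative (%v. 0)) (at x)" by simp
 then have "(g has_derivative (%v. 0)) (at x)"
 proof (rule has_derivative_transform_within_open[of _ _ _ UNIV "- closure {x. g x \<noteq> 0}"])
  show "open (- closure {x. g x \<noteq> 0})" by (intro open_Compl closed_closure)
  show "0 = g y" if "y \<in> - closure {x. g x \<noteq> 0}" for y
   by (rule test_fun_zero[symmetric]) (use that in blast)
 qed (use assms in simp)
 then show ?thesis by (rule dd_eq)
qed

lemma test_funI: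
 assumes "smooth_fun g" "compact K" "K \<subseteq> U" "!!x. x \<notin> K ==> g x = 0"
 shows "test_fun U g"
proof -
 have "closure {x. g x \<noteq> 0} \<subseteq> K" using assms by (intro closure_minimal compact_imp_closed) auto
 moreover then have "compact (closure {x. g x \<noteq> 0})"
  using compact_Int_closed[OF assms(2) closed_closure] by (metis inf.absorb2)
 ultimately show ?thesis using assms unfolding test_fun_def by blast
qed

lemma test_fun_mono: "test_fun V g ==> V \<subseteq> U ==> test_fun U g"
 by (auto simp: test_fun_def)

lemma test_fun_dd: "test_fun U g ==> test_fun U (%x. dd g x v)"
 by (rule test_funI[OF smooth_dd[OF test_fun_smooth] test_fun_compact test_fun_subset test_fun_dd_zero])

lemma test_fun_mult: "test_fun U g ==> smooth_fun h ==> test_fun U (%x. h x * g x)"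
 by (rule test_funI[OF smooth_mult[OF _ test_fun_smooth] test_fun_compact test_fun_subset])
   (auto dest: test_fun_zero)

lemma test_fun_bounded: assumes "test_fun U g" shows "\<exists>C. \<forall>x. \<bar>g x\<bar> \<le> C"
proof -
 let ?S = "closure {x. g x \<noteq> 0}"
 have "bounded (g ` ?S)"
  by (intro compact_imp_bounded compact_continuous_image smooth_continuous test_fun_smooth[OF assms] test_fun_compact[OF assms])
 then obtain C where C: "!!x. x \<in> ?S ==> norm (g x) \<le> C" unfolding bounded_iff by blast
 have "\<bar>g x\<bar> \<le> \<bar>C\<bar>" for x using C[of x] test_fun_zero[of x g] by (cases "x \<in> ?S") auto
 then show ?thesis by blast
qed

lemma test_fun_measurable: "test_fun U g ==> g \<in> borel_fun"
 by (rule smooth_measurable[OF test_fun_smooth])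

lemma test_fun_L2: assumes "test_fun U g" shows "L2 g"
proof -
 obtain C where C: "!!x. \<bar>g x\<bar> \<le> C" using test_fun_bounded[OF assms] by blast
 show ?thesis
 proof (rule L2_bounded_support[OF test_fun_measurable[OF assms] _ compact_imp_bounded[OF test_fun_compact[OF assms]]])
  show "norm (g x) \<le> C" for x using C by simp
 qed (rule test_fun_zero)
qed

lemma test_fun_integrable: assumes "test_fun U g" shows "integrable lborel g"
 by (rule integrable_L2_bounded_support[OF test_fun_L2[OF assms] compact_imp_bounded[OF test_fun_compact[OF assms]]]) (rule test_fun_zero)

lemma test_fun_shift:
 assumes "test_fun V g" "!!x. x \<in> V ==> x + a \<in> U" shows "test_fun U (%x. g (x - a))"
proof (rule test_funI[where K = "(%x. x + a) ` closure {x. g x \<noteq> 0}"])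
 show "smooth_fun (%x. g (x - a))"
  using smooth_compose_affine[OF bounded_linear_ident test_fun_smooth[OF assms(1)], of "- a"] by simp
 show "compact ((%x. x + a) ` closure {x. g x \<noteq> 0})"
  using test_fun_compact[OF assms(1)] by (intro compact_continuous_image continuous_intros)
 show "(%x. x + a) ` closure {x. g x \<noteq> 0} \<subseteq> U" using test_fun_subset[OF assms(1)] assms(2) by auto
 show "g (x - a) = 0" if "x \<notin> (%x. x + a) ` closure {x. g x \<noteq> 0}" for x
 proof (rule test_fun_zero[of _ g], rule notI)
  assume "x - a \<in> closure {x. g x \<noteq> 0}"
  then have "(x - a) + a \<in> (%x. x + a) ` closure {x. g x \<noteq> 0}" by (rule imageI)
  then show False using that by simp
 qed
qed

lemma integral_test_dd:
 assumes "test_fun U g" shows "(LBINT x. dd g x e) = 0"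
 by (rule integral_directional_zero[OF smooth_continuous smooth_continuous dd_directional test_fun_compact test_fun_zero test_fun_dd_zero])
   (use assms in \<open>auto intro: test_fun_smooth smooth_dd\<close>)

definition gradf :: "('n::euclidean_space => real) => 'n => 'n" where
 "gradf g x = (\<Sum>i\<in>Basis. dd g x i *\<^sub>R i)"

lemma gradf_inner: "i \<in> Basis ==> gradf g x \<bullet> i = dd g x i"
 unfolding gradf_def by (simp add: inner_sum_left inner_Basis if_distrib sum.If_cases cong: if_cong)

lemma gradf_measurable: "smooth_fun g ==> gradf g \<in> borel_fun"
 unfolding gradf_def[abs_def]
 by (intro borel_measurable_sum borel_measurable_scaleR borel_measurable_const smooth_measurable smooth_dd)

lemma gradf_continuous: "smooth_fun g ==> continuous_on A (gradf g)"
 unfolding gradf_def[abs_def] by (intro continuous_intros smooth_continuous smooth_dd)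

text \<open>The integrals run over the whole space: test functions and their derivatives vanish
  outside \<open>U\<close>, so values of g and G outside \<open>U\<close> do not enter.\<close>

definition wgrad :: "'n::euclidean_space set => ('n => real) => ('n => 'n) => bool" where
 "wgrad U g G \<longleftrightarrow> (\<forall>\<psi>. test_fun U \<psi> --> (\<forall>i\<in>Basis.
   (LBINT x. g x * dd \<psi> x i) = - (LBINT x. (G x \<bullet> i) * \<psi> x)))"

lemma wgradD: "wgrad U g G ==> test_fun U \<psi> ==> i \<in> Basis ==>
  (LBINT x. g x * dd \<psi> x i) = - (LBINT x. (G x \<bullet> i) * \<psi> x)"
 by (simp add: wgrad_def)

lemma wgrad_mono: "wgrad U g G ==> V \<subseteq> U ==> wgrad V g G"
 unfolding wgrad_def using test_fun_mono by blast

text \<open>Square integrability refers to the whole space, the gradient identity to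
  \<open>U\<close> only. The zero extension of a Sobolev function on \<open>U\<close> therefore
  belongs to this class, and a test function for a Neumann problem may jump at the boundary.\<close>

definition H1 :: "'n::euclidean_space set => ('n => real) => ('n => 'n) => bool" where
 "H1 U g G \<longleftrightarrow> L2 g \<and> L2 G \<and> wgrad U g G"

lemma H1_add: assumes "H1 U f F" "H1 U g G" shows "H1 U (%x. f x + g x) (%x. F x + G x)"
 unfolding H1_def wgrad_def
proof (intro conjI allI impI ballI)
 fix \<psi> i assume p: "test_fun U \<psi>" and i: "i \<in> (Basis :: 'a set)"
 have L: "L2 f" "L2 F" "L2 g" "L2 G" "L2 \<psi>" "L2 (%x. dd \<psi> x i)"
  using assms p by (auto simp: H1_def intro: test_fun_L2[OF p] test_fun_L2[OF test_fun_dd[OF p]])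
 have I: "integrable lborel (%x. f x * dd \<psi> x i)" "integrable lborel (%x. g x * dd \<psi> x i)"
  "integrable lborel (%x. (F x \<bullet> i) * \<psi> x)" "integrable lborel (%x. (G x \<bullet> i) * \<psi> x)"
  by (intro L2_mult_integrable L L2_component i)+
 have w: "(LBINT x. f x * dd \<psi> x i) = - (LBINT x. (F x \<bullet> i) * \<psi> x)"
  "(LBINT x. g x * dd \<psi> x i) = - (LBINT x. (G x \<bullet> i) * \<psi> x)"
  using assms p i by (auto simp: H1_def intro!: wgradD)
 have "(LBINT x. (f x + g x) * dd \<psi> x i) = (LBINT x. f x * dd \<psi> x i) + (LBINT x. g x * dd \<psi> x i)"
  by (simp only: distrib_right lint_add[OF I(1,2)])
 also have "\<dots> = - ((LBINT x. (F x \<bullet> i) * \<psi> x) + (LBINT x. (G x \<bullet> i) * \<psi> x))"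
  using w by simp
 also have "\<dots> = - (LBINT x. ((F x + G x) \<bullet> i) * \<psi> x)"
  by (simp only: inner_add_left distrib_right lint_add[OF I(3,4)])
 finally show "(LBINT x. (f x + g x) * dd \<psi> x i) = - (LBINT x. ((F x + G x) \<bullet> i) * \<psi> x)" .
qed (use assms in \<open>auto simp: H1_def intro: L2_add\<close>)

lemma H1_minus: "H1 U g G ==> H1 U (%x. - g x) (%x. - G x)"
 unfolding H1_def wgrad_def by (auto intro: L2_minus)

lemma H1_diff: "H1 U f F ==> H1 U g G ==> H1 U (%x. f x - g x) (%x. F x - G x)"
 using H1_add[OF _ H1_minus] by simp

text \<open>The product rule by testing the gradient of g with h * \<psi>, again a test
  function.\<close>

lemma H1_mult_smooth:
 assumes g: "H1 U g G" and h: "smooth_fun h" and C: "!!x. \<bar>h x\<bar> \<le> C" "!!x. norm (gradf h x) \<le> C"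
 shows "H1 U (%x. h x * g x) (%x. h x *\<^sub>R G x + g x *\<^sub>R gradf h x)"
 unfolding H1_def wgrad_def
proof (intro conjI allI impI ballI)
 have L: "L2 g" "L2 G" using g by (auto simp: H1_def)
 note hm = smooth_measurable[OF h] gradf_measurable[OF h]
 show "L2 (%x. h x * g x)" by (rule L2_mult_bounded_real[OF L(1) hm(1) C(1)])
 have b: "(norm (g x *\<^sub>R gradf h x))\<^sup>2 \<le> C\<^sup>2 * (norm (g x))\<^sup>2" for x
 proof -
  have "(norm (gradf h x))\<^sup>2 \<le> C\<^sup>2" using C(2) by (intro power_mono) auto
  then have "(norm (gradf h x))\<^sup>2 * (g x)\<^sup>2 \<le> C\<^sup>2 * (g x)\<^sup>2" by (intro mult_right_mono) auto
  then show ?thesis by (simp add: power_mult_distrib mult.commute)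
 qed
 have L3: "L2 (%x. g x *\<^sub>R gradf h x)"
  by (rule L2_bound[OF _ _ b]) (use L hm in \<open>auto simp: L2_integrable_real dest: L2_measurable\<close>)
 then show "L2 (%x. h x *\<^sub>R G x + g x *\<^sub>R gradf h x)"
  by (intro L2_add L2_mult_bounded[OF L(2) hm(1) C(1)])
 fix \<psi> i assume p: "test_fun U \<psi>" and i: "i \<in> (Basis :: 'a set)"
 have tp: "test_fun U (%x. h x * \<psi> x)" by (rule test_fun_mult[OF p h])
 note Lp = test_fun_L2[OF p] test_fun_L2[OF test_fun_dd[OF tp], of i] test_fun_L2[OF tp]
 have L4: "L2 (%x. g x * dd h x i)" using L2_component[OF L3 i] by (simp add: gradf_inner[OF i])
 have I: "integrable lborel (%x. g x * dd (%x. h x * \<psi> x) x i)" "integrable lborel (%x. (g x * dd h x i) * \<psi> x)"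
  "integrable lborel (%x. (G x \<bullet> i) * (h x * \<psi> x))"
  by (intro L2_mult_integrable L Lp L4 L2_component i)+
 have "(LBINT x. (h x * g x) * dd \<psi> x i) = (LBINT x. g x * dd (%x. h x * \<psi> x) x i - (g x * dd h x i) * \<psi> x)"
  by (intro lint_cong refl) (simp only: dd_mult[OF h test_fun_smooth[OF p]], simp add: algebra_simps)
 also have "\<dots> = (LBINT x. g x * dd (%x. h x * \<psi> x) x i) - (LBINT x. (g x * dd h x i) * \<psi> x)"
  by (rule lint_diff[OF I(1,2)])
 also have "(LBINT x. g x * dd (%x. h x * \<psi> x) x i) = - (LBINT x. (G x \<bullet> i) * (h x * \<psi> x))"
  using g tp i by (auto simp: H1_def intro!: wgradD)
 also have "- (LBINT x. (G x \<bullet> i) * (h x * \<psi> x)) - (LBINT x. (g x * dd h x i) * \<psi> x)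
   = - (LBINT x. (G x \<bullet> i) * (h x * \<psi> x) + (g x * dd h x i) * \<psi> x)"
  by (simp only: lint_add[OF I(3,2)])
 also have "\<dots> = - (LBINT x. ((h x *\<^sub>R G x + g x *\<^sub>R gradf h x) \<bullet> i) * \<psi> x)"
  by (simp add: inner_add_left gradf_inner[OF i] algebra_simps)
 finally show "(LBINT x. (h x * g x) * dd \<psi> x i) = - (LBINT x. ((h x *\<^sub>R G x + g x *\<^sub>R gradf h x) \<bullet> i) * \<psi> x)" .
qed

lemma smooth_test_by_parts:
 assumes h: "smooth_fun h" and p: "test_fun U \<psi>"
 shows "(LBINT x. h x * dd \<psi> x i) = - (LBINT x. dd h x i * \<psi> x)"
proof -
 have t: "test_fun U (%x. h x * dd \<psi> x i)" "test_fun U (%x. dd h x i * \<psi> x)"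
  by (intro test_fun_mult test_fun_dd p h smooth_dd)+
 have "0 = (LBINT x. dd (%x. h x * \<psi> x) x i)"
  using integral_test_dd[OF test_fun_mult[OF p h]] by simp
 also have "\<dots> = (LBINT x. h x * dd \<psi> x i + dd h x i * \<psi> x)"
  by (simp add: dd_mult[OF h test_fun_smooth[OF p]])
 also have "\<dots> = (LBINT x. h x * dd \<psi> x i) + (LBINT x. dd h x i * \<psi> x)"
  by (rule lint_add[OF test_fun_integrable[OF t(1)] test_fun_integrable[OF t(2)]])
 finally show ?thesis by simp
qed

lemma H1_test_fun: assumes "test_fun V g" shows "H1 U g (gradf g)"
 unfolding H1_def
proof (intro conjI)
 show "L2 g" by (rule test_fun_L2[OF assms])
 show "L2 (gradf g)"
  by (rule L2_componentwise) (use test_fun_L2[OF test_fun_dd[OF assms]] in \<open>simp add: gradf_inner\<close>)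
 show "wgrad U g (gradf g)"
  unfolding wgrad_def
 proof (intro allI impI ballI)
  fix \<psi> i assume p: "test_fun U \<psi>" and i: "i \<in> (Basis :: 'a set)"
  show "(LBINT x. g x * dd \<psi> x i) = - (LBINT x. (gradf g x \<bullet> i) * \<psi> x)"
   unfolding gradf_inner[OF i] by (rule smooth_test_by_parts[OF test_fun_smooth[OF assms] p])
 qed
qed

section \<open>Mollification and difference quotients\<close>

lemma bump_test_fun: "r > 0 ==> test_fun UNIV (bump p r)"
 by (rule test_funI[OF smooth_bump, of "cball p r"])
   (use bump_pos_iff[of r p] bump_nonneg[of p r] in \<open>auto simp: less_le\<close>)

lemma integral_bump_pos: "0 < (LBINT y. bump 0 1 (y :: 'n::euclidean_space))"
proof -
 have i: "integrable lborel (bump (0::'n) 1)" by (rule test_fun_integrable[OF bump_test_fun]) simp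
 have "(LBINT y. bump 0 1 (y :: 'n)) \<noteq> 0"
 proof
  assume "(LBINT y. bump 0 1 (y :: 'n)) = 0"
  then have "AE y in lborel. bump 0 1 (y :: 'n) = 0"
   using integral_nonneg_eq_0_iff_AE[OF i] bump_nonneg by auto
  then have "AE y in lborel. (y :: 'n) \<notin> ball 0 1"
   by eventually_elim (use bump_pos_iff[of 1 "0::'n"] in force)
  then have "emeasure lborel (ball (0::'n) 1) = 0"
   by (subst (asm) AE_iff_measurable[where N = "ball 0 1"]) auto
  moreover have "measure lborel (ball (0::'n) 1) > 0" by (rule content_ball_pos) simp
  ultimately show False by (simp add: measure_def)
 qed
 moreover have "0 \<le> (LBINT y. bump 0 1 (y :: 'n))" by (intro integral_nonneg_AE AE_I2 bump_nonneg)
 ultimately show ?thesis by linarith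
qed

definition rho :: "'n::euclidean_space => real" where
 "rho x = bump 0 1 x * inverse (LBINT y. bump 0 1 (y :: 'n))"

lemma rho_smooth: "smooth_fun rho"
 unfolding rho_def[abs_def] by (intro smooth_mult smooth_bump smooth_const)

lemma rho_measurable [measurable]: "rho \<in> borel_fun"
 by (rule smooth_measurable[OF rho_smooth])

lemma rho_nonneg: "0 \<le> rho x"
 unfolding rho_def using bump_nonneg integral_bump_pos by (intro mult_nonneg_nonneg) (auto simp: less_imp_le)

lemma rho_zero: assumes "1 \<le> norm x" shows "rho x = 0"
proof -
 have "\<not> 0 < bump 0 1 x" using assms bump_pos_iff[of 1 0 x] by simp
 then show ?thesis using bump_nonneg[of 0 1 x] by (simp add: rho_def)
qed

lemma rho_test_fun: "test_fun UNIV rho"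
proof (rule test_funI[OF rho_smooth])
 show "compact (cball (0 :: 'a) 1)" by simp
qed (auto intro: rho_zero)

lemma rho_integrable: "integrable lborel rho"
 by (rule test_fun_integrable[OF rho_test_fun])

lemma rho_integral: "(LBINT y. rho (y :: 'n::euclidean_space)) = 1"
 using integral_bump_pos[where 'n = 'n] unfolding rho_def by simp

lemma integral_affine:
 fixes f :: "'n::euclidean_space => 'b::{banach, second_countable_topology}"
 assumes [measurable]: "f \<in> borel_fun" and c: "c > 0"
 shows "(LBINT x. f x) = c ^ DIM('n) *\<^sub>R (LBINT x. f (a + c *\<^sub>R x))"
proof -
 have "(LBINT x. f x) = (LINT x|density (distr lborel borel (%x. a + c *\<^sub>R x)) (%_. ennreal (\<bar>c\<bar> ^ DIM('n))). f x)"
  using lborel_affine[of c a] c by (simp add: ennreal_power)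
 also have "\<dots> = (LINT x|distr lborel borel (%x. a + c *\<^sub>R x). (\<bar>c\<bar> ^ DIM('n)) *\<^sub>R f x)"
  by (rule integral_density) auto
 also have "\<dots> = (LBINT x. (\<bar>c\<bar> ^ DIM('n)) *\<^sub>R f (a + c *\<^sub>R x))"
  by (rule integral_distr) auto
 finally show ?thesis using c by simp
qed

lemma integrable_affine:
 fixes f :: "'n::euclidean_space => 'b::{banach, second_countable_topology}"
 assumes i: "integrable lborel f" and c: "c > 0"
 shows "integrable lborel (%x. f (a + c *\<^sub>R x))"
proof -
 have [measurable]: "f \<in> borel_fun" using i by simp
 have "integrable (density (distr lborel borel (%x. a + c *\<^sub>R x)) (%_. ennreal (\<bar>c\<bar> ^ DIM('n)))) f"
  using i lborel_affine[of c a] c by (simp add: ennreal_power)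
 then have "integrable (distr lborel borel (%x. a + c *\<^sub>R x)) (%x. (\<bar>c\<bar> ^ DIM('n)) *\<^sub>R f x)"
  by (subst (asm) integrable_density) auto
 then have "integrable lborel (%x. (\<bar>c\<bar> ^ DIM('n)) *\<^sub>R f (a + c *\<^sub>R x))"
  by (subst (asm) integrable_distr_eq) auto
 then have "integrable lborel (%x. inverse (c ^ DIM('n)) *\<^sub>R ((\<bar>c\<bar> ^ DIM('n)) *\<^sub>R f (a + c *\<^sub>R x)))"
  by (rule integrable_scaleR_right)
 then show ?thesis using c by simp
qed

lemma L2_affine:
 assumes "L2 g" "c > 0" shows "L2 (%x. g (a + c *\<^sub>R x))"
 unfolding L2_def using integrable_affine[OF L2_integrable[OF assms(1)] assms(2), of a] L2_measurable[OF assms(1)] by simp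

section \<open>Mollification with a displaced centre\<close>

definition kern :: "real => 'n::euclidean_space => 'n => 'n => real" where
 "kern t v x y = rho ((1/t) *\<^sub>R (y - x) - v) * inverse (t ^ DIM('n))"

text \<open>A weighted mean of g over the ball of radius t about x + t v. With v pointing inward
  this ball stays in the domain even when x is close to the boundary. In the variable of g the same
  mean has the kernel \<open>kern t v x\<close>.\<close>

definition avg :: "real => 'n::euclidean_space => ('n => 'b::euclidean_space) => 'n => 'b" where
 "avg t v g x = (LBINT y. rho y *\<^sub>R g (x + t *\<^sub>R (v + y)))"

lemma kern_measurable [measurable]: "(%z. kern t v (fst z) (snd z)) \<in> borel_fun"
 "kern t v x \<in> borel_fun"
 unfolding kern_def[abs_def] by measurable

lemma avg_kern:
 assumes t: "t > 0" and [measurable]: "g \<in> borel_fun"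
 shows "avg t v g x = (LBINT y. kern t v x y *\<^sub>R g y)"
proof -
 have e: "(x + t *\<^sub>R v) + t *\<^sub>R y - x = t *\<^sub>R (v + y)" "(x + t *\<^sub>R v) + t *\<^sub>R y = x + t *\<^sub>R (v + y)" for y
  by (simp_all add: scaleR_add_right)
 have "(LBINT y. kern t v x y *\<^sub>R g y)
  = t ^ DIM('a) *\<^sub>R (LBINT y. kern t v x ((x + t *\<^sub>R v) + t *\<^sub>R y) *\<^sub>R g ((x + t *\<^sub>R v) + t *\<^sub>R y))"
  by (rule integral_affine[OF _ t]) measurable
 also have "\<dots> = (LBINT y. rho y *\<^sub>R g (x + t *\<^sub>R (v + y)))"
  using t unfolding kern_def e by (simp add: mult.left_commute[of "t ^ DIM('a)"] flip: integral_scaleR_right)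
 finally show ?thesis by (simp add: avg_def)
qed

lemma kern_smooth_snd: "smooth_fun (kern t v x)"
proof -
 have "smooth_fun (%y. rho ((1/t) *\<^sub>R y + (- (1/t) *\<^sub>R x - v)) * inverse (t ^ DIM('a)))"
  by (intro smooth_mult smooth_const smooth_compose_affine[OF bounded_linear_scaleR_right rho_smooth])
 then show ?thesis by (simp add: kern_def[abs_def] scaleR_diff_right algebra_simps)
qed

lemma kern_smooth_fst: "smooth_fun (%x. kern t v x y)"
proof -
 have "smooth_fun (%x. rho ((- (1/t)) *\<^sub>R x + ((1/t) *\<^sub>R y - v)) * inverse (t ^ DIM('a)))"
  by (intro smooth_mult smooth_const smooth_compose_affine[OF bounded_linear_scaleR_right rho_smooth])
 then show ?thesis by (simp add: kern_def[abs_def] scaleR_diff_right algebra_simps)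
qed

lemma kern_dd_snd: "dd (kern t v x) y i = dd rho ((1/t) *\<^sub>R (y - x) - v) ((1/t) *\<^sub>R i) * inverse (t ^ DIM('n))"
 for x :: "'n::euclidean_space"
proof -
 have "((%y. (1/t) *\<^sub>R (y - x) - v) has_derivative (%i. (1/t) *\<^sub>R i)) (at y)"
  by (auto intro!: derivative_eq_intros)
 from has_derivative_compose[OF this smooth_has_derivative[OF rho_smooth]]
 have "((%y. rho ((1/t) *\<^sub>R (y - x) - v) * inverse (t ^ DIM('n))) has_derivative
   (%i. dd rho ((1/t) *\<^sub>R (y - x) - v) ((1/t) *\<^sub>R i) * inverse (t ^ DIM('n)))) (at y)"
  by (rule has_derivative_mult_left)
 then show ?thesis unfolding kern_def[abs_def] by (rule dd_eq)
qed

lemma kern_dd_fst: "dd (%x. kern t v x y) x i = - dd (kern t v x) y i"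
 for x :: "'n::euclidean_space"
proof -
 have "((%x. (1/t) *\<^sub>R (y - x) - v) has_derivative (%i. - ((1/t) *\<^sub>R i))) (at x)"
  by (auto intro!: derivative_eq_intros)
 from has_derivative_compose[OF this smooth_has_derivative[OF rho_smooth]]
 have "((%x. rho ((1/t) *\<^sub>R (y - x) - v) * inverse (t ^ DIM('n))) has_derivative
   (%i. dd rho ((1/t) *\<^sub>R (y - x) - v) (- ((1/t) *\<^sub>R i)) * inverse (t ^ DIM('n)))) (at x)"
  by (rule has_derivative_mult_left)
 then have "dd (%x. kern t v x y) x i = dd rho ((1/t) *\<^sub>R (y - x) - v) (- ((1/t) *\<^sub>R i)) * inverse (t ^ DIM('n))"
  unfolding kern_def[abs_def] by (rule dd_eq)
 also have "dd rho ((1/t) *\<^sub>R (y - x) - v) (- ((1/t) *\<^sub>R i)) = - dd rho ((1/t) *\<^sub>R (y - x) - v) ((1/t) *\<^sub>R i)"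
  by (rule linear_neg[OF has_derivative_linear[OF smooth_has_derivative[OF rho_smooth]]])
 finally show ?thesis unfolding kern_dd_snd by simp
qed

lemma kern_test_fun:
 assumes t: "t > 0" and U: "!!y. norm y \<le> 1 ==> x + t *\<^sub>R (v + y) \<in> U"
 shows "test_fun U (kern t v x)"
proof (rule test_funI[OF kern_smooth_snd])
 let ?K = "(%y. x + t *\<^sub>R (v + y)) ` cball 0 1"
 show "compact ?K" by (intro compact_continuous_image continuous_intros) auto
 show "?K \<subseteq> U" using U by auto
 show "kern t v x y = 0" if "y \<notin> ?K" for y
 proof -
  have "y = x + t *\<^sub>R (v + ((1/t) *\<^sub>R (y - x) - v))" using t by simp
  then have "(1/t) *\<^sub>R (y - x) - v \<notin> cball 0 1" using that by blast
  then show ?thesis using rho_zero[of "(1/t) *\<^sub>R (y - x) - v"] by (simp add: kern_def)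
 qed
qed

text \<open>The kernel depends on y - x only, so its x-derivative is minus its y-derivative. As a
  function of y it is a test function of \<open>U\<close>, hence the weak gradient takes over the
  derivative.\<close>

lemma avg_wgrad:
 assumes t: "t > 0" and U: "!!y. norm y \<le> 1 ==> x + t *\<^sub>R (v + y) \<in> U" and i: "i \<in> Basis"
  and w: "wgrad U g G" and [measurable]: "G \<in> borel_fun"
 shows "(LBINT y. dd (%x. kern t v x y) x i * g y) = avg t v (%y. G y \<bullet> i) x"
proof -
 have "(LBINT y. dd (%x. kern t v x y) x i * g y) = - (LBINT y. g y * dd (kern t v x) y i)"
  by (simp add: kern_dd_fst mult.commute)
 also have "\<dots> = (LBINT y. (G y \<bullet> i) * kern t v x y)"
  using wgradD[OF w kern_test_fun[OF t U] i] by simp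
 also have "\<dots> = avg t v (%y. G y \<bullet> i) x"
  by (subst avg_kern[OF t]) (simp_all add: mult.commute)
 finally show ?thesis .
qed

lemma rho_L2_integrable:
 fixes h :: "'n::euclidean_space => 'b::euclidean_space"
 assumes "L2 h" shows "integrable lborel (%y. rho y *\<^sub>R h y)"
proof (rule lintegrable_bound)
 show "integrable lborel (%y. (rho y)\<^sup>2 + (norm (h y))\<^sup>2)"
  using L2_integrable_real[OF test_fun_L2[OF rho_test_fun]] L2_integrable[OF assms] by (rule lintegrable_add)
 show "AE y in lborel. norm (rho y *\<^sub>R h y) \<le> norm ((rho y)\<^sup>2 + (norm (h y))\<^sup>2)"
 proof (intro AE_I2)
  fix y
  have "2 * (\<bar>rho y\<bar> * norm (h y)) \<le> \<bar>rho y\<bar>\<^sup>2 + (norm (h y))\<^sup>2" using sum_squares_bound[of "\<bar>rho y\<bar>" "norm (h y)"] by (simp add: mult.assoc)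
  moreover have "0 \<le> \<bar>rho y\<bar> * norm (h y)" by simp
  ultimately have "\<bar>rho y\<bar> * norm (h y) \<le> (rho y)\<^sup>2 + (norm (h y))\<^sup>2" unfolding power2_abs by linarith
  then show "norm (rho y *\<^sub>R h y) \<le> norm ((rho y)\<^sup>2 + (norm (h y))\<^sup>2)" by simp
 qed
qed (use L2_measurable[OF assms] in measurable)

lemma avg_minus:
 assumes g: "L2 g" and t: "t > 0"
 shows "(LBINT y. rho y *\<^sub>R (g (x + t *\<^sub>R (v + y)) - g x)) = avg t v g x - g x"
proof -
 have "L2 (%y. g (x + t *\<^sub>R (v + y)))"
  using L2_affine[OF g t, of "x + t *\<^sub>R v"] by (simp add: scaleR_add_right add.assoc)
 then have i: "integrable lborel (%y. rho y *\<^sub>R g (x + t *\<^sub>R (v + y)))" by (rule rho_L2_integrable)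
 have j: "integrable lborel (%y. rho y *\<^sub>R g x)" by (rule integrable_scaleR_left) (rule rho_integrable)
 show ?thesis
  unfolding avg_def scaleR_diff_right lint_diff[OF i j] integral_scaleR_left[OF rho_integrable] rho_integral
  by simp
qed

text \<open>All displacements t (v + y) with |y| <= 1 have length at most t (|v| + 1), so only
  translation errors of that size occur.\<close>

lemma avg_approx:
 assumes g: "L2 g" and t: "t > 0" and e: "!!s. norm s \<le> t * (norm v + 1) ==> sqn (%x. g (x + s) - g x) \<le> e" "0 \<le> e"
 shows "L2 (%x. avg t v g x - g x)" "sqn (%x. avg t v g x - g x) \<le> e"
proof -
 have m: "(%y. t *\<^sub>R (v + y)) \<in> borel_fun" by measurable
 have e': "sqn (%x. g (x + t *\<^sub>R (v + y)) - g x) \<le> e" if "rho y \<noteq> 0" for y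
 proof (rule e(1))
  have "norm y \<le> 1" using that rho_zero[of y] by linarith
  then have "norm (v + y) \<le> norm v + 1" using norm_triangle_ineq[of v y] by linarith
  then show "norm (t *\<^sub>R (v + y)) \<le> t * (norm v + 1)" using t by simp
 qed
 note a = sqn_average[OF g rho_measurable rho_nonneg rho_integrable rho_integral m e' e(2)]
 show "L2 (%x. avg t v g x - g x)" "sqn (%x. avg t v g x - g x) \<le> e"
  using a unfolding avg_minus[OF g t] by auto
qed

text \<open>The points at distance greater than t from the complement. The whole space is treated
  separately because \<open>infdist\<close> to the empty set is 0 by convention.\<close>

definition inner_part :: "'n::euclidean_space set => real => 'n set" where
 "inner_part U t = {x. U = UNIV \<or> t < infdist x (- U)}"

lemma open_inner_part: "open (inner_part U t)"
proof (cases "U = UNIV")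
 case False
 then have "inner_part U t = {x. t < infdist x (- U)}" by (simp add: inner_part_def)
 then show ?thesis by (simp add: open_Collect_less continuous_on_infdist)
qed (simp add: inner_part_def)

lemma inner_part_shift:
 assumes "x \<in> inner_part U t" "norm h \<le> t" shows "x + h \<in> U"
proof (rule ccontr)
 assume "x + h \<notin> U"
 then have "infdist x (- U) \<le> dist x (x + h)" "U \<noteq> UNIV" by (auto intro: infdist_le)
 then show False using assms by (auto simp: inner_part_def dist_norm)
qed

lemma inner_part_mono: "s \<le> t ==> inner_part U t \<subseteq> inner_part U s"
 by (auto simp: inner_part_def)

lemma compact_subset_inner_part:
 assumes U: "open U" and S: "compact S" "S \<subseteq> U" obtains t where "t > 0" "S \<subseteq> inner_part U t"
proof (cases "U = UNIV \<or> S = {}")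
 case True
 then show ?thesis using that[of 1] by (auto simp: inner_part_def)
next
 case False
 have "continuous_on S (%x. infdist x (- U))" by (intro continuous_on_infdist continuous_intros)
 then obtain y where y: "y \<in> S" "!!x. x \<in> S ==> infdist y (- U) \<le> infdist x (- U)"
  using continuous_attains_inf[OF S(1)] False by blast
 have "0 < infdist y (- U)"
  using infdist_pos_not_in_closed[of "- U" y] U False S y(1) by auto
 then show ?thesis using y(2) by (intro that[of "infdist y (- U) / 2"]) (force simp: inner_part_def)+
qed

lemma inner_part_exhausts:
 assumes "open U" "x \<in> U" shows "\<exists>n. x \<in> inner_part U (inverse (real (Suc n)))"
proof -
 obtain t where t: "t > 0" "{x} \<subseteq> inner_part U t" using compact_subset_inner_part[OF assms(1), of "{x}"] assms(2) by auto
 obtain n where "inverse (real (Suc n)) < t" using reals_Archimedean[OF t(1)] by blast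
 then show ?thesis using t(2) inner_part_mono[of "inverse (real (Suc n))" t U] by auto
qed

text \<open>At a point farther than t from the complement, the mollifier of radius at most t is a
  test function of \<open>U\<close>, so the mollification of g vanishes there. It also converges to
  g in L2; hence g = 0 on every inner part, and countably many of these exhaust
  \<open>U\<close>.\<close>

lemma fundamental_lemma:
 fixes g :: "'n::euclidean_space => real"
 assumes g: "L2 g" and U: "open U" and z: "!!\<psi>. test_fun U \<psi> ==> (LBINT x. g x * \<psi> x) = 0"
 shows "AE x in lborel. x \<in> U --> g x = 0"
proof -
 have m[measurable]: "g \<in> borel_fun" by (rule L2_measurable[OF g])
 have "AE x in lborel. x \<in> inner_part U t --> g x = 0" if t: "t > 0" for t
 proof -
  let ?W = "inner_part U t"
  have W: "?W \<in> sets borel" using open_inner_part by (rule borel_open)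
  note L = L2_mult_indicator[OF g W]
  have "sqn (%x. ind ?W x *\<^sub>R g x) \<le> e" if e: "e > 0" for e
  proof -
   obtain d where d: "d > 0" "!!s. norm s \<le> d ==> sqn (%x. g (x + s) - g x) \<le> e"
    using shift_cont_L2[OF g] e unfolding shift_cont_def by blast
   define r where "r = min d t"
   have r: "r > 0" "r \<le> t" "r \<le> d" using d t by (auto simp: r_def)
   note a = avg_approx[OF g r(1), of 0 e]
   have a1: "L2 (%x. avg r 0 g x - g x)" "sqn (%x. avg r 0 g x - g x) \<le> e"
    using a d(2) r(3) e by auto
   have "avg r 0 g x = 0" if x: "x \<in> ?W" for x
   proof -
    have "test_fun U (kern r 0 x)"
     by (rule kern_test_fun[OF r(1)], rule inner_part_shift[OF x]) (use r in \<open>auto intro: mult_left_le order_trans[of _ r]\<close>)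
    from z[OF this] show ?thesis by (subst avg_kern[OF r(1) m]) (simp add: mult.commute)
   qed
   then have "sqn (%x. ind ?W x *\<^sub>R g x) \<le> sqn (%x. avg r 0 g x - g x)"
    by (intro sqn_mono[OF a1(1) L2_measurable[OF L(1)]]) (auto simp: indicator_def)
   then show ?thesis using a1(2) by linarith
  qed
  then have "sqn (%x. ind ?W x *\<^sub>R g x) \<le> 0" by (rule field_le_epsilon[of _ 0, simplified])
  then have "(LBINT x. (ind ?W x *\<^sub>R g x)\<^sup>2) = 0"
   using sqn_nonneg[of "%x. ind ?W x *\<^sub>R g x"] unfolding sqn_real by linarith
  then have "AE x in lborel. (ind ?W x *\<^sub>R g x)\<^sup>2 = 0"
   using integral_nonneg_eq_0_iff_AE[OF L2_integrable_real[OF L(1)]] by simp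
  then show ?thesis by eventually_elim auto
 qed
 then have "AE x in lborel. \<forall>n. x \<in> inner_part U (inverse (real (Suc n))) --> g x = 0"
  by (subst AE_all_countable) simp
 then show ?thesis by eventually_elim (use inner_part_exhausts[OF U] in blast)
qed


section \<open>Difference quotients of functions with a weak gradient\<close>

lemma L2_mult_abs_integral_le:
 fixes a b :: "'n::euclidean_space => real"
 assumes "L2 a" "L2 b" shows "(LBINT x. \<bar>a x * b x\<bar>) \<le> (sqn a + sqn b) / 2"
proof -
 have "(LBINT x. \<bar>a x * b x\<bar>) \<le> (LBINT x. ((a x)\<^sup>2 + (b x)\<^sup>2) / 2)"
 proof (rule integral_mono)
  show "integrable lborel (%x. \<bar>a x * b x\<bar>)" using L2_mult_integrable[OF assms] by (rule integrable_abs)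
  show "integrable lborel (%x. ((a x)\<^sup>2 + (b x)\<^sup>2) / 2)" using assms by (simp add: L2_integrable_real)
  show "\<bar>a x * b x\<bar> \<le> ((a x)\<^sup>2 + (b x)\<^sup>2) / 2" for x using norm_inner_le_sq[of "a x" "b x"] by simp
 qed
 also have "\<dots> = (sqn a + sqn b) / 2" using assms by (simp add: sqn_real L2_integrable_real)
 finally show ?thesis .
qed

lemma integrable_shift_product:
 fixes a b :: "'n::euclidean_space => real"
 assumes a: "L2 a" and b: "L2 b" and s[measurable]: "\<sigma> \<in> borel_measurable (borel :: real measure)"
 shows "integrable lborel (%z. ind {0..1} (fst z) * (a (snd z) * b (snd z + \<sigma> (fst z))))"
proof -
 note [measurable] = L2_measurable[OF a] L2_measurable[OF b]
 let ?f = "%z. ind {0..1} (fst z) * (a (snd z) * b (snd z + \<sigma> (fst z)))"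
 have fm[measurable]: "?f \<in> borel_fun" by measurable
 have "integrable (lborel \<Otimes>\<^sub>M lborel) ?f"
 proof (rule lborel_pair.Fubini_integrable)
  show "?f \<in> borel_measurable (lborel \<Otimes>\<^sub>M lborel)" using fm by (rule borel_measurable_pairI)
  show "AE \<theta> in lborel. integrable lborel (%x. ?f (\<theta>, x))"
   using L2_mult_integrable[OF a L2_shift[OF b]] by simp
  show "integrable lborel (%\<theta>. LBINT x. norm (?f (\<theta>, x)))"
  proof (rule integrable_bounded_support[of _ "(sqn a + sqn b) / 2" "{0..1}"])
   show "(%\<theta>. LBINT x. norm (?f (\<theta>, x))) \<in> borel_fun" by measurable
   show "norm (LBINT x. norm (?f (\<theta>, x))) \<le> (sqn a + sqn b) / 2" for \<theta>
    using L2_mult_abs_integral_le[OF a L2_shift[OF b], of "\<sigma> \<theta>"] sqn_shift[OF b, of "\<sigma> \<theta>"]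
     sqn_nonneg[of a] sqn_nonneg[of b]
    by (cases "\<theta> \<in> {0..1}") auto
  qed auto
 qed
 then show ?thesis by (simp add: lborel_prod)
qed

lemma integral_shift_move:
 fixes a b :: "'n::euclidean_space => real"
 assumes "L2 a" "L2 b"
 shows "(LBINT x. a x * b (x + s)) = (LBINT x. a (x - s) * b x)"
 using integral_lborel_shift[of "%x. a (x - s) * b x" s] L2_measurable[OF assms(1)] L2_measurable[OF assms(2)] by simp

abbreviation unit_k :: "real => real" where "unit_k \<equiv> ind {0..1}"

lemma unit_k: "unit_k \<in> borel_fun" "0 \<le> unit_k \<theta>" "integrable lborel unit_k" "(LBINT \<theta>. unit_k \<theta>) = 1"
 by simp_all

text \<open>The difference quotient in direction i is the mean of G \<bullet> i over the segment
  from x to x + s i, for almost every x; D is the deviation of this mean from G x \<bullet> i. The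
  identity is obtained by testing against functions supported in the inner part and moving all
  shifts onto them.\<close>

lemma difference_quotient:
 fixes g :: "'n::euclidean_space => real"
 assumes H: "H1 U g G" and i: "i \<in> Basis" and s: "0 < s" "s \<le> t"
  and e: "!!h. norm h \<le> s ==> sqn (%x. G (x + h) \<bullet> i - G x \<bullet> i) \<le> e" "0 \<le> e"
 obtains D where "L2 D" "sqn D \<le> e"
  "AE x in lborel. x \<in> inner_part U t --> g (x + s *\<^sub>R i) - g x = s * (D x + G x \<bullet> i)"
proof -
 define b where "b x = G x \<bullet> i" for x
 have g: "L2 g" and G: "L2 G" and w: "wgrad U g G" using H by (auto simp: H1_def)
 have b: "L2 b" unfolding b_def[abs_def] by (rule L2_component[OF G i])
 have ni: "norm i = 1" using i by simp
 define D where "D x = (LBINT \<theta>. unit_k \<theta> *\<^sub>R (b (x + (\<theta> * s) *\<^sub>R i) - b x))" for x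
 have ms: "(%\<theta>. (\<theta> * s) *\<^sub>R i) \<in> borel_fun" by measurable
 have ms': "(%\<theta>. (\<theta> * (- s)) *\<^sub>R i) \<in> borel_fun" by measurable
 have ee: "sqn (%x. b (x + (\<theta> * s) *\<^sub>R i) - b x) \<le> e" if "unit_k \<theta> \<noteq> 0" for \<theta>
  unfolding b_def by (rule e(1)) (use that s ni in \<open>auto simp: indicator_def mult_left_le_one_le split: if_splits\<close>)
 note D = sqn_average[OF b unit_k ms ee e(2), folded D_def]
 define h where "h x = (g (x + s *\<^sub>R i) - g x) - s * (D x + b x)" for x
 have Db: "L2 (%x. s * (D x + b x))" by (intro L2_cmult L2_add D b)
 have Dg: "L2 (%x. g (x + s *\<^sub>R i) - g x)" by (intro L2_diff L2_shift g)
 have h: "L2 h" unfolding h_def[abs_def] by (rule L2_diff[OF Dg Db])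
 have "AE x in lborel. x \<in> inner_part U t --> h x = 0"
 proof (rule fundamental_lemma[OF h open_inner_part])
  fix \<xi> assume x: "test_fun (inner_part U t) \<xi>"
  have Lx: "L2 \<xi>" by (rule test_fun_L2[OF x])
  have Ldx: "L2 (%x. dd \<xi> x i)" by (rule test_fun_L2[OF test_fun_dd[OF x]])
  have sx: "smooth_fun \<xi>" by (rule test_fun_smooth[OF x])
  \<comment> \<open>A shift by \<theta> s <= t keeps the support of \<xi> inside \<open>U\<close>,
    where the gradient identity is available.\<close>
  have key: "(LBINT x. \<xi> x * b (x + (\<theta> * s) *\<^sub>R i)) = - (LBINT x. g x * dd \<xi> (x + (\<theta> * (- s)) *\<^sub>R i) i)"
   if th: "\<theta> \<in> {0..1}" for \<theta>
  proof -
   have t: "test_fun U (%x. \<xi> (x - (\<theta> * s) *\<^sub>R i))"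
   proof (rule test_fun_shift[OF x inner_part_shift])
    have "\<theta> * s \<le> 1 * s" using th s by (intro mult_right_mono) auto
    then have "\<theta> * s \<le> t" using s(2) by linarith
    then show "norm ((\<theta> * s) *\<^sub>R i) \<le> t" using th s(1) ni by (simp add: abs_of_nonneg)
   qed
   have "dd (%x. \<xi> (x + (- ((\<theta> * s) *\<^sub>R i)))) x i = dd \<xi> (x + (- ((\<theta> * s) *\<^sub>R i))) i" for x
    by (rule dd_compose_affine[OF bounded_linear_ident sx])
   then have d: "dd (%x. \<xi> (x - (\<theta> * s) *\<^sub>R i)) x i = dd \<xi> (x + (\<theta> * (- s)) *\<^sub>R i) i" for x by simp
   have "(LBINT x. \<xi> x * b (x + (\<theta> * s) *\<^sub>R i)) = (LBINT x. \<xi> (x - (\<theta> * s) *\<^sub>R i) * b x)"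
    by (rule integral_shift_move[OF Lx b])
   also have "\<dots> = - (LBINT x. g x * dd (%x. \<xi> (x - (\<theta> * s) *\<^sub>R i)) x i)"
    using wgradD[OF w t i] by (simp add: b_def mult.commute)
   finally show ?thesis unfolding d .
  qed
  note I1 = integrable_shift_product[OF Lx b ms]
  note I2 = integrable_shift_product[OF g Ldx ms']
  have i0: "integrable lborel (%z::real \<times> 'n. unit_k (fst z) * (\<xi> (snd z) * b (snd z)))"
   using integrable_shift_product[OF Lx b, of "%_. 0"] by simp
  have iD: "integrable lborel (%x. \<xi> x * b x)" "integrable lborel (%x. \<xi> x * D x)"
   by (intro L2_mult_integrable Lx b D)+
  have "(LBINT x. \<xi> x * D x) = (LBINT x. LBINT \<theta>. unit_k \<theta> * (\<xi> x * b (x + (\<theta> * s) *\<^sub>R i)) - unit_k \<theta> * (\<xi> x * b x))"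
   unfolding D_def by (simp add: algebra_simps flip: integral_mult_right_zero)
  also have "\<dots> = (LBINT \<theta>. LBINT x. unit_k \<theta> * (\<xi> x * b (x + (\<theta> * s) *\<^sub>R i)) - unit_k \<theta> * (\<xi> x * b x))"
   using integral_swap[OF lintegrable_diff[OF I1 i0]] by simp
  also have "\<dots> = (LBINT \<theta>. unit_k \<theta> * (LBINT x. \<xi> x * b (x + (\<theta> * s) *\<^sub>R i)) - unit_k \<theta> * (LBINT x. \<xi> x * b x))"
   using L2_mult_integrable[OF Lx L2_shift[OF b]] iD by simp
  also have "\<dots> = (LBINT \<theta>. unit_k \<theta> * (LBINT x. \<xi> x * b (x + (\<theta> * s) *\<^sub>R i))) - (LBINT x. \<xi> x * b x)"
   using integral_slice(2)[OF I1] by (subst lint_diff) auto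
  also have "(LBINT \<theta>. unit_k \<theta> * (LBINT x. \<xi> x * b (x + (\<theta> * s) *\<^sub>R i)))
    = - (LBINT \<theta>. LBINT x. unit_k \<theta> * (g x * dd \<xi> (x + (\<theta> * (- s)) *\<^sub>R i) i))"
   unfolding integral_mult_right_zero lint_minus[symmetric]
   by (intro lint_cong refl) (auto simp: key indicator_def)
  also have "(LBINT \<theta>. LBINT x. unit_k \<theta> * (g x * dd \<xi> (x + (\<theta> * (- s)) *\<^sub>R i) i))
    = (LBINT x. g x * (LBINT \<theta>. unit_k \<theta> * dd \<xi> (x + (\<theta> * (- s)) *\<^sub>R i) i))"
   using integral_swap[OF I2] by (simp add: mult.left_commute[of "unit_k _"])
  finally have DD: "(LBINT x. \<xi> x * D x) = - (LBINT x. g x * (LBINT \<theta>. unit_k \<theta> * dd \<xi> (x + (\<theta> * (- s)) *\<^sub>R i) i)) - (LBINT x. \<xi> x * b x)" .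
  \<comment> \<open>For the test function itself the identity is the fundamental theorem of calculus
    along the segment from x to x - s i.\<close>
  have ftc: "- s * (LBINT \<theta>. unit_k \<theta> * dd \<xi> (x + (\<theta> * (- s)) *\<^sub>R i) i) = \<xi> (x - s *\<^sub>R i) - \<xi> x" for x
  proof -
   have "dd \<xi> y ((- s) *\<^sub>R i) = (- s) * dd \<xi> y i" for y
    using linear_scale[OF has_derivative_linear[OF smooth_has_derivative[OF sx]], of y "- s" i] by simp
   moreover have "(LBINT \<theta>:{0..1}. dd \<xi> (x + \<theta> *\<^sub>R ((- s) *\<^sub>R i)) ((- s) *\<^sub>R i)) = \<xi> (x + (- s) *\<^sub>R i) - \<xi> x"
    by (rule lborel_FTC_directional[OF smooth_continuous[OF smooth_dd[OF sx]] dd_directional[OF sx]])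
   ultimately show ?thesis by (simp add: set_lebesgue_integral_def mult.left_commute flip: integral_mult_right_zero)
  qed
  have "s * ((LBINT x. \<xi> x * D x) + (LBINT x. \<xi> x * b x)) = (LBINT x. g x * (- s * (LBINT \<theta>. unit_k \<theta> * dd \<xi> (x + (\<theta> * (- s)) *\<^sub>R i) i)))"
   unfolding DD by (simp add: mult.left_commute[of _ s])
  also have "\<dots> = (LBINT x. g x * \<xi> (x - s *\<^sub>R i) - g x * \<xi> x)"
   unfolding ftc by (simp add: right_diff_distrib)
  also have "\<dots> = (LBINT x. \<xi> (x - s *\<^sub>R i) * g x) - (LBINT x. g x * \<xi> x)"
   using L2_mult_integrable[OF g L2_shift[OF Lx, of "- (s *\<^sub>R i)"]] L2_mult_integrable[OF g Lx] by (simp add: mult.commute)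
  also have "(LBINT x. \<xi> (x - s *\<^sub>R i) * g x) = (LBINT x. \<xi> x * g (x + s *\<^sub>R i))"
   by (rule integral_shift_move[OF Lx g, symmetric])
  finally have fin: "s * ((LBINT x. \<xi> x * D x) + (LBINT x. \<xi> x * b x)) = (LBINT x. \<xi> x * g (x + s *\<^sub>R i)) - (LBINT x. g x * \<xi> x)" .
  have "(LBINT x. h x * \<xi> x) = (LBINT x. (\<xi> x * g (x + s *\<^sub>R i) - g x * \<xi> x) - s * (\<xi> x * D x + \<xi> x * b x))"
   unfolding h_def by (intro lint_cong refl) (simp add: algebra_simps)
  also have "\<dots> = ((LBINT x. \<xi> x * g (x + s *\<^sub>R i)) - (LBINT x. g x * \<xi> x)) - s * ((LBINT x. \<xi> x * D x) + (LBINT x. \<xi> x * b x))"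
   using iD L2_mult_integrable[OF Lx L2_shift[OF g, of "s *\<^sub>R i"]] L2_mult_integrable[OF g Lx] by simp
  finally show "(LBINT x. h x * \<xi> x) = 0" using fin by simp
 qed
 then have "AE x in lborel. x \<in> inner_part U t --> g (x + s *\<^sub>R i) - g x = s * (D x + G x \<bullet> i)"
  by eventually_elim (auto simp: h_def b_def)
 then show thesis using that D by blast
qed

section \<open>The chain rule\<close>

text \<open>The proof uses difference quotients: \<^term>\<open>m (g x)\<close> times the quotient of \<^term>\<open>g\<close>
 approximates that of \<^term>\<open>q \<circ> g\<close> up to a quadratic error.\<close>

lemma H1_chain_rule:
 fixes g :: "'n::euclidean_space => real"
 assumes U: "open U" and H: "H1 U g G" and dq: "!!s. (q has_real_derivative m s) (at s)"
  and m1: "!!s. \<bar>m s\<bar> \<le> 1" and mL: "!!a b. \<bar>m a - m b\<bar> \<le> \<bar>a - b\<bar>" and q0: "q 0 = 0"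
 shows "H1 U (%x. q (g x)) (%x. m (g x) *\<^sub>R G x)"
proof -
 have g: "L2 g" and G: "L2 G" and w: "wgrad U g G" using H by (auto simp: H1_def)
 have mvt: "\<exists>c. \<bar>c - a\<bar> \<le> \<bar>b - a\<bar> \<and> q b - q a = m c * (b - a)" for a b :: real
 proof (cases a b rule: linorder_cases)
  case less
  obtain z where "a < z" "z < b" "q b - q a = (b - a) * m z" using MVT2[OF less, of q m] dq by auto
  then show ?thesis by (intro exI[of _ z]) (simp add: mult.commute)
 next
  case greater
  obtain z where "b < z" "z < a" "q a - q b = (a - b) * m z" using MVT2[OF greater, of q m] dq by auto
  then show ?thesis by (intro exI[of _ z]) (simp add: algebra_simps)
 qed auto
 have qle: "\<bar>q a\<bar> \<le> \<bar>a\<bar>" for a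
 proof -
  obtain c where "q a - q 0 = m c * (a - 0)" using mvt[where a = 0 and b = a] by blast
  then show ?thesis using q0 m1[of c] by (simp add: abs_mult mult_left_le_one_le)
 qed
 \<comment> \<open>First order Taylor error; the bound is quadratic because the derivative m is
   1-Lipschitz.\<close>
 have qerr: "\<bar>q b - q a - m a * (b - a)\<bar> \<le> (b - a)\<^sup>2" for a b
 proof -
  obtain c where c: "\<bar>c - a\<bar> \<le> \<bar>b - a\<bar>" "q b - q a = m c * (b - a)" using mvt[where a = a and b = b] by blast
  have "\<bar>q b - q a - m a * (b - a)\<bar> = \<bar>m c - m a\<bar> * \<bar>b - a\<bar>"
   unfolding c(2) by (simp add: left_diff_distrib[symmetric] abs_mult)
  also have "\<dots> \<le> \<bar>b - a\<bar> * \<bar>b - a\<bar>" using mL[of c a] c(1) by (intro mult_right_mono) auto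
  finally show ?thesis by (simp add: power2_eq_square)
 qed
 have "continuous_on UNIV q" using dq by (simp add: continuous_on_eq_continuous_at) (metis DERIV_isCont)
 then have qm[measurable]: "q \<in> borel_fun" by (rule borel_measurable_continuous_onI)
 have "1-lipschitz_on UNIV m" using mL by (intro lipschitz_onI) (auto simp: dist_real_def)
 then have "continuous_on UNIV m" by (rule lipschitz_on_continuous_on)
 then have mm[measurable]: "m \<in> borel_fun" by (rule borel_measurable_continuous_onI)
 note [measurable] = L2_measurable[OF g] L2_measurable[OF G]
 have Q: "L2 (%x. q (g x))"
 proof (rule L2_bound)
  show "integrable lborel (%x. (g x)\<^sup>2)" by (rule L2_integrable_real[OF g])
  show "(norm (q (g x)))\<^sup>2 \<le> (g x)\<^sup>2" for x using qle[of "g x"] by (simp add: abs_le_square_iff[symmetric])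
 qed measurable
 have mg: "(%x. m (g x)) \<in> borel_fun" by measurable
 have MG: "L2 (%x. m (g x) *\<^sub>R G x)" by (rule L2_mult_bounded[OF G mg m1])
 have "wgrad U (%x. q (g x)) (%x. m (g x) *\<^sub>R G x)"
  unfolding wgrad_def
 proof (intro allI impI ballI)
  fix \<psi> i assume p: "test_fun U \<psi>" and i: "i \<in> (Basis :: 'n set)"
  let ?S = "closure {x. \<psi> x \<noteq> 0}"
  have ni: "norm i = 1" using i by simp
  obtain t where t: "t > 0" "?S \<subseteq> inner_part U t"
   using compact_subset_inner_part[OF U test_fun_compact[OF p] test_fun_subset[OF p]] .
  obtain C where C: "!!x. \<bar>\<psi> x\<bar> \<le> C" using test_fun_bounded[OF p] by blast
  have C0: "0 \<le> C" using C[of undefined] by linarith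
  have sp: "smooth_fun \<psi>" by (rule test_fun_smooth[OF p])
  have Lp: "L2 \<psi>" and Ldp: "L2 (%x. dd \<psi> x i)" by (rule test_fun_L2[OF p], rule test_fun_L2[OF test_fun_dd[OF p]])
  let ?b = "%x. G x \<bullet> i"
  have b: "L2 ?b" by (rule L2_component[OF G i])
  have Mp: "L2 (%x. m (g x) * \<psi> x)" by (rule L2_mult_bounded_real[OF Lp mg m1])
  \<comment> \<open>The defect in the chain rule tested with \<psi>. It does not depend on s, so
    bounding it by terms that vanish with s proves it to be 0.\<close>
  define X where "X = (LBINT x. q (g x) * dd \<psi> x i) + (LBINT x. m (g x) * \<psi> x * ?b x)"
  \<comment> \<open>The first two terms stem from replacing the difference quotients of \<psi> and
    of g by derivatives, the last one from the Taylor error, which is of order s^2 before the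
    division by s.\<close>
  have main: "\<bar>X\<bar> \<le> sqrt (sqn (%x. q (g x))) * sqrt e + sqrt (sqn (%x. m (g x) * \<psi> x)) * sqrt e + s * (C * (2 * e + 2 * sqn ?b))"
   if s: "0 < s" "s \<le> t" and e: "0 \<le> e"
    and e1: "!!h. norm h \<le> s ==> sqn (%x. G (x + h) \<bullet> i - G x \<bullet> i) \<le> e"
    and e2: "!!h. norm h \<le> s ==> sqn (%x. dd \<psi> (x + h) i - dd \<psi> x i) \<le> e" for s e
  proof -
   obtain D where D: "L2 D" "sqn D \<le> e"
    "AE x in lborel. x \<in> inner_part U t --> g (x + s *\<^sub>R i) - g x = s * (D x + G x \<bullet> i)"
    using difference_quotient[OF H i s e1 e] by blast
   define E where "E x = (LBINT \<theta>. unit_k \<theta> *\<^sub>R (dd \<psi> (x + (\<theta> * (- s)) *\<^sub>R i) i - dd \<psi> x i))" for x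
   have ms: "(%\<theta>. (\<theta> * (- s)) *\<^sub>R i) \<in> borel_fun" by measurable
   have ee: "sqn (%x. dd \<psi> (x + (\<theta> * (- s)) *\<^sub>R i) i - dd \<psi> x i) \<le> e" if "unit_k \<theta> \<noteq> 0" for \<theta>
    by (rule e2) (use that s ni in \<open>auto simp: indicator_def mult_left_le_one_le abs_mult split: if_splits\<close>)
   have E: "L2 E" "sqn E \<le> e"
    unfolding E_def[abs_def] by (rule sqn_average[OF Ldp unit_k ms ee e]; assumption)+
   have ftc: "\<psi> (x - s *\<^sub>R i) - \<psi> x = - s * (E x + dd \<psi> x i)" for x
   proof -
    have lin: "dd \<psi> y ((- s) *\<^sub>R i) = (- s) * dd \<psi> y i" for y
     using linear_scale[OF has_derivative_linear[OF smooth_has_derivative[OF sp]], of y "- s" i] by simp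
    have "continuous_on {0..1} (%\<theta>. dd \<psi> (x + (\<theta> * (- s)) *\<^sub>R i) i)"
     by (rule continuous_on_compose2[OF smooth_continuous[OF smooth_dd[OF sp], of UNIV]]) (auto intro!: continuous_intros)
    from borel_integrable_atLeastAtMost'[OF this]
    have i1: "integrable lborel (%\<theta>. unit_k \<theta> * dd \<psi> (x + (\<theta> * (- s)) *\<^sub>R i) i)" by (simp add: set_integrable_def)
    have "E x = (LBINT \<theta>. unit_k \<theta> * dd \<psi> (x + (\<theta> * (- s)) *\<^sub>R i) i - unit_k \<theta> * dd \<psi> x i)"
     unfolding E_def by (simp add: right_diff_distrib)
    also have "\<dots> = (LBINT \<theta>. unit_k \<theta> * dd \<psi> (x + (\<theta> * (- s)) *\<^sub>R i) i) - dd \<psi> x i"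
     using i1 by (subst lint_diff) auto
    finally have "E x + dd \<psi> x i = (LBINT \<theta>. unit_k \<theta> * dd \<psi> (x + (\<theta> * (- s)) *\<^sub>R i) i)" by simp
    moreover have "(LBINT \<theta>:{0..1}. dd \<psi> (x + \<theta> *\<^sub>R ((- s) *\<^sub>R i)) ((- s) *\<^sub>R i)) = \<psi> (x + (- s) *\<^sub>R i) - \<psi> x"
     by (rule lborel_FTC_directional[OF smooth_continuous[OF smooth_dd[OF sp]] dd_directional[OF sp]])
    then have "- s * (LBINT \<theta>. unit_k \<theta> * dd \<psi> (x + (\<theta> * (- s)) *\<^sub>R i) i) = \<psi> (x - s *\<^sub>R i) - \<psi> x"
     unfolding lin by (simp add: set_lebesgue_integral_def mult.left_commute)
    ultimately show ?thesis by simp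
   qed
   define r where "r x = (q (g (x + s *\<^sub>R i)) - q (g x) - m (g x) * (g (x + s *\<^sub>R i) - g x)) * \<psi> x" for x
   have Dg: "L2 (%x. g (x + s *\<^sub>R i) - g x)" by (intro L2_diff L2_shift g)
   have Qs: "L2 (%x. q (g (x + s *\<^sub>R i)))" using L2_shift[OF Q] .
   have MD: "L2 (%x. m (g x) * (g (x + s *\<^sub>R i) - g x))" by (rule L2_mult_bounded_real[OF Dg mg m1])
   have r: "integrable lborel r" unfolding r_def[abs_def]
    by (intro L2_mult_integrable L2_diff Qs Q MD Lp)
   have L: "L2 (%x. D x + ?b x)" by (rule L2_add[OF D(1) b])
   have aeS: "AE x in lborel. \<psi> x \<noteq> 0 --> g (x + s *\<^sub>R i) - g x = s * (D x + ?b x)"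
    using D(3)
   proof eventually_elim
    case (elim x)
    have "x \<in> inner_part U t" if "\<psi> x \<noteq> 0" using that t(2) closure_subset[of "{x. \<psi> x \<noteq> 0}"] by blast
    then show ?case using elim by blast
   qed
   have rle: "\<bar>LBINT x. r x\<bar> \<le> s * (s * (C * (2 * e + 2 * sqn ?b)))"
   proof -
    have iN: "integrable lborel (%x. s\<^sup>2 * (C * (norm (D x + ?b x))\<^sup>2))"
     using L2_integrable[OF L] by simp
    have "\<bar>LBINT x. r x\<bar> \<le> (LBINT x. \<bar>r x\<bar>)" using integral_norm_bound[of lborel r] by simp
    also have "\<dots> \<le> (LBINT x. s\<^sup>2 * (C * (norm (D x + ?b x))\<^sup>2))"
    proof (rule integral_mono_AE[OF integrable_abs[OF r] iN])
     show "AE x in lborel. \<bar>r x\<bar> \<le> s\<^sup>2 * (C * (norm (D x + ?b x))\<^sup>2)"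
      using aeS
     proof eventually_elim
      case (elim x)
      show ?case
      proof (cases "\<psi> x = 0")
       case False
       then have e: "g (x + s *\<^sub>R i) - g x = s * (D x + ?b x)" using elim by blast
       have "\<bar>r x\<bar> \<le> (g (x + s *\<^sub>R i) - g x)\<^sup>2 * C"
        unfolding r_def abs_mult by (intro mult_mono qerr C) auto
       also have "\<dots> = s\<^sup>2 * (C * (norm (D x + ?b x))\<^sup>2)" unfolding e by (simp add: power_mult_distrib)
       finally show ?thesis .
      qed (use C0 in \<open>simp add: r_def\<close>)
     qed
    qed
    also have "\<dots> = s\<^sup>2 * (C * sqn (%x. D x + ?b x))" by (simp add: sqn_def)
    also have "\<dots> \<le> s\<^sup>2 * (C * (2 * e + 2 * sqn ?b))"
     using sqn_add_le[OF D(1) b] D(2) C0 by (intro mult_left_mono) auto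
    finally show ?thesis by (simp add: power2_eq_square mult.assoc)
   qed
   have iE: "integrable lborel (%x. q (g x) * E x)" "integrable lborel (%x. q (g x) * dd \<psi> x i)"
    "integrable lborel (%x. (m (g x) * \<psi> x) * D x)" "integrable lborel (%x. (m (g x) * \<psi> x) * ?b x)"
    by - (rule L2_mult_integrable[OF Q E(1)], rule L2_mult_integrable[OF Q Ldp],
      rule L2_mult_integrable[OF Mp D(1)], rule L2_mult_integrable[OF Mp b])
   have "- s * ((LBINT x. q (g x) * E x) + (LBINT x. q (g x) * dd \<psi> x i)) = (LBINT x. q (g x) * (\<psi> (x - s *\<^sub>R i) - \<psi> x))"
   proof -
    have "q (g x) * (\<psi> (x - s *\<^sub>R i) - \<psi> x) = - s * (q (g x) * E x + q (g x) * dd \<psi> x i)" for x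
     unfolding ftc by (simp add: algebra_simps)
    then show ?thesis
     by (simp only: integral_mult_right_zero lint_add[OF iE(1,2)])
   qed
   also have "\<dots> = (LBINT x. \<psi> (x - s *\<^sub>R i) * q (g x)) - (LBINT x. \<psi> x * q (g x))"
    using L2_mult_integrable[OF L2_shift[OF Lp, of "- (s *\<^sub>R i)"] Q] L2_mult_integrable[OF Lp Q]
    by (simp add: right_diff_distrib mult.commute)
   also have "(LBINT x. \<psi> (x - s *\<^sub>R i) * q (g x)) = (LBINT x. \<psi> x * q (g (x + s *\<^sub>R i)))"
    by (rule integral_shift_move[OF Lp Q, symmetric])
   also have "(LBINT x. \<psi> x * q (g (x + s *\<^sub>R i))) - (LBINT x. \<psi> x * q (g x))
     = (LBINT x. \<psi> x * q (g (x + s *\<^sub>R i)) - \<psi> x * q (g x))"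
    by (rule lint_diff[OF L2_mult_integrable[OF Lp Qs] L2_mult_integrable[OF Lp Q], symmetric])
   also have "\<dots> = (LBINT x. r x + s * ((m (g x) * \<psi> x) * D x + (m (g x) * \<psi> x) * ?b x))"
   proof (rule integral_cong_AE)
    show "AE x in lborel. \<psi> x * q (g (x + s *\<^sub>R i)) - \<psi> x * q (g x) = r x + s * ((m (g x) * \<psi> x) * D x + (m (g x) * \<psi> x) * ?b x)"
     using aeS
    proof eventually_elim
     case (elim x)
     show ?case
     proof (cases "\<psi> x = 0")
      case False
      then have e: "g (x + s *\<^sub>R i) - g x = s * (D x + ?b x)" using elim by blast
      show ?thesis unfolding r_def e by (simp add: algebra_simps)
     qed (simp add: r_def)
    qed
    show "(%x. \<psi> x * q (g (x + s *\<^sub>R i)) - \<psi> x * q (g x)) \<in> borel_measurable lborel"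
     using L2_mult_integrable[OF Lp Qs] L2_mult_integrable[OF Lp Q] by (intro borel_measurable_diff) auto
    show "(%x. r x + s * ((m (g x) * \<psi> x) * D x + (m (g x) * \<psi> x) * ?b x)) \<in> borel_measurable lborel"
     using r iE L2_measurable[OF Lp] L2_measurable[OF D(1)] by (intro borel_measurable_add borel_measurable_times borel_measurable_const) auto
   qed
   also have "\<dots> = (LBINT x. r x) + s * ((LBINT x. (m (g x) * \<psi> x) * D x) + (LBINT x. (m (g x) * \<psi> x) * ?b x))"
    using r iE(3,4) by simp
   finally have "s * (- X) = (LBINT x. r x) + s * (LBINT x. (m (g x) * \<psi> x) * D x) + s * (LBINT x. q (g x) * E x)"
    unfolding X_def by (simp add: algebra_simps)
   then have "s * \<bar>X\<bar> = \<bar>(LBINT x. r x) + s * (LBINT x. (m (g x) * \<psi> x) * D x) + s * (LBINT x. q (g x) * E x)\<bar>"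
    using s by (metis abs_minus_cancel abs_mult abs_of_pos)
   also have "\<dots> \<le> s * (s * (C * (2 * e + 2 * sqn ?b))) + s * \<bar>LBINT x. (m (g x) * \<psi> x) * D x\<bar> + s * \<bar>LBINT x. q (g x) * E x\<bar>"
    using rle s by (auto simp: abs_mult intro!: order_trans[OF abs_triangle_ineq] add_mono)
   finally have "\<bar>X\<bar> \<le> s * (C * (2 * e + 2 * sqn ?b)) + \<bar>LBINT x. (m (g x) * \<psi> x) * D x\<bar> + \<bar>LBINT x. q (g x) * E x\<bar>"
    unfolding distrib_left[symmetric] using s by simp
   moreover have "\<bar>LBINT x. (m (g x) * \<psi> x) * D x\<bar> \<le> sqrt (sqn (%x. m (g x) * \<psi> x)) * sqrt e"
    using L2_inner_le[OF Mp D(1)] mult_left_mono[OF real_sqrt_le_mono[OF D(2)], of "sqrt (sqn (%x. m (g x) * \<psi> x))"] by simp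
   moreover have "\<bar>LBINT x. q (g x) * E x\<bar> \<le> sqrt (sqn (%x. q (g x))) * sqrt e"
    using L2_inner_le[OF Q E(1)] mult_left_mono[OF real_sqrt_le_mono[OF E(2)], of "sqrt (sqn (%x. q (g x)))"] by simp
   ultimately show ?thesis by linarith
  qed
  define e where "e n = inverse (real (Suc n))" for n
  have e0: "e n > 0" for n by (simp add: e_def)
  have el: "e \<longlonglongrightarrow> 0" unfolding e_def by (rule LIMSEQ_inverse_real_of_nat)
  have bd: "\<bar>X\<bar> \<le> sqrt (sqn (%x. q (g x))) * sqrt (e n) + sqrt (sqn (%x. m (g x) * \<psi> x)) * sqrt (e n) + e n * (C * (2 * e n + 2 * sqn ?b))" for n
  proof -
   obtain d1 where d1: "d1 > 0" "!!h. norm h \<le> d1 ==> sqn (%x. G (x + h) \<bullet> i - G x \<bullet> i) \<le> e n"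
    using shift_cont_L2[OF b] e0[of n] unfolding shift_cont_def by blast
   obtain d2 where d2: "d2 > 0" "!!h. norm h \<le> d2 ==> sqn (%x. dd \<psi> (x + h) i - dd \<psi> x i) \<le> e n"
    using shift_cont_L2[OF Ldp] e0[of n] unfolding shift_cont_def by blast
   \<comment> \<open>One step length for three purposes: both translation errors are at most
     \<open>e n\<close>, shifted supports stay in \<open>U\<close>, and s itself is at most
     \<open>e n\<close>, which makes the Taylor term vanish.\<close>
   define s where "s = min (min d1 d2) (min t (e n))"
   have s: "0 < s" "s \<le> t" "s \<le> e n" "s \<le> d1" "s \<le> d2" using d1 d2 e0[of n] t(1) by (auto simp: s_def)
   have "\<bar>X\<bar> \<le> sqrt (sqn (%x. q (g x))) * sqrt (e n) + sqrt (sqn (%x. m (g x) * \<psi> x)) * sqrt (e n) + s * (C * (2 * e n + 2 * sqn ?b))"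
    using s d1(2) d2(2) less_imp_le[OF e0[of n]] by (intro main) auto
   also have "s * (C * (2 * e n + 2 * sqn ?b)) \<le> e n * (C * (2 * e n + 2 * sqn ?b))"
    using s C0 less_imp_le[OF e0[of n]] by (intro mult_right_mono mult_nonneg_nonneg add_nonneg_nonneg) auto
   finally show ?thesis by simp
  qed
  have "(%n. sqrt (sqn (%x. q (g x))) * sqrt (e n) + sqrt (sqn (%x. m (g x) * \<psi> x)) * sqrt (e n) + e n * (C * (2 * e n + 2 * sqn ?b)))
    \<longlonglongrightarrow> sqrt (sqn (%x. q (g x))) * sqrt 0 + sqrt (sqn (%x. m (g x) * \<psi> x)) * sqrt 0 + 0 * (C * (2 * 0 + 2 * sqn ?b))"
   by (intro tendsto_intros el)
  then have "\<bar>X\<bar> \<le> sqrt (sqn (%x. q (g x))) * sqrt 0 + sqrt (sqn (%x. m (g x) * \<psi> x)) * sqrt 0 + 0 * (C * (2 * 0 + 2 * sqn ?b))"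
   by (rule LIMSEQ_le_const) (use bd in blast)
  then have "X = 0" by simp
  then show "(LBINT x. q (g x) * dd \<psi> x i) = - (LBINT x. ((m (g x) *\<^sub>R G x) \<bullet> i) * \<psi> x)"
   unfolding X_def by (simp add: mult.commute mult.left_commute)
 qed
 then show ?thesis using Q MG by (simp add: H1_def)
qed

section \<open>Smooth boundaries\<close>

lemma dd_gradf: assumes "smooth_fun g" shows "dd g x y = gradf g x \<bullet> y"
proof -
 have lin: "linear (frechet_derivative g (at x))"
  by (rule has_derivative_linear[OF smooth_has_derivative[OF assms]])
 have "dd g x y = dd g x (\<Sum>i\<in>Basis. (y \<bullet> i) *\<^sub>R i)" by (simp add: euclidean_representation)
 also have "\<dots> = (\<Sum>i\<in>Basis. (y \<bullet> i) * dd g x i)"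
  by (simp add: linear_sum[OF lin] linear_scale[OF lin])
 also have "\<dots> = (\<Sum>i\<in>Basis. (gradf g x \<bullet> i) * (y \<bullet> i))"
  by (intro sum.cong refl) (simp add: gradf_inner)
 also have "\<dots> = gradf g x \<bullet> y" by (rule euclidean_inner[symmetric])
 finally show ?thesis .
qed

text \<open>At a boundary point the defining function g decreases strictly in some direction w. A
  large multiple v of w outweighs every unit vector y, so g does not increase along v + y near the
  point and the sublevel set {g < 0} is not left. At interior points v = 0 works.\<close>

lemma smooth_boundary_cone:
 fixes \<Omega> :: "'n::euclidean_space set"
 assumes op: "open \<Omega>" and sb: "smooth_boundary \<Omega>" and p: "p \<in> closure \<Omega>"
 shows "\<exists>r v \<tau>0. 0 < r \<and> 0 < \<tau>0 \<and> (\<forall>x\<in>\<Omega> \<inter> ball p r. \<forall>\<tau>\<in>{0<..<\<tau>0}. \<forall>y. norm y \<le> 1 --> x + \<tau> *\<^sub>R (v + y) \<in> \<Omega>)"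
proof (cases "p \<in> \<Omega>")
 case True
 obtain e where e: "e > 0" "ball p e \<subseteq> \<Omega>" using op True open_contains_ball by blast
 have "x + \<tau> *\<^sub>R (0 + y) \<in> \<Omega>" if "x \<in> \<Omega> \<inter> ball p (e/2)" "\<tau> \<in> {0<..<e/2}" "norm y \<le> 1" for x \<tau> y
 proof -
  have "norm (\<tau> *\<^sub>R y) \<le> \<tau>" using that by (simp add: mult_left_le)
  moreover have "dist p (x + \<tau> *\<^sub>R y) \<le> dist p x + norm (\<tau> *\<^sub>R y)"
   using dist_triangle[of p "x + \<tau> *\<^sub>R y" x] by (simp add: dist_norm)
  moreover have "dist p x < e/2" "\<tau> < e/2" using that by auto
  ultimately have "dist p (x + \<tau> *\<^sub>R y) < e" by linarith
  then show ?thesis using e(2) by auto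
 qed
 then show ?thesis using e(1) by (intro exI[of _ "e/2"] exI[of _ "0::'n"]) auto
next
 case False
 then have "p \<in> frontier \<Omega>" using p op by (simp add: frontier_def interior_open)
 then obtain U g where U: "open U" "p \<in> U" "smooth_fun g" "!!x. x \<in> U ==> frechet_derivative g (at x) \<noteq> (%_. 0)"
  "\<Omega> \<inter> U = {x\<in>U. g x < 0}"
  using sb unfolding smooth_boundary_def by meson
 note sg = U(3)
 obtain w where w: "dd g p w < 0"
 proof -
  obtain w0 where "dd g p w0 \<noteq> 0" using U(4)[OF U(2)] by (auto simp: fun_eq_iff)
  moreover have "dd g p (- w0) = - dd g p w0"
   by (rule linear_neg[OF has_derivative_linear[OF smooth_has_derivative[OF sg]]])
  ultimately show ?thesis using that[of w0] that[of "- w0"] by linarith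
 qed
 define c where "c = - dd g p w"
 define N where "N = norm (gradf g p) + 1"
 have c: "c > 0" using w by (simp add: c_def)
 have N: "N > 0" unfolding N_def by (simp add: add_nonneg_pos)
 define W where "W = U \<inter> {x. dd g x w < - c/2} \<inter> {x. norm (gradf g x) < N}"
 have "open W" unfolding W_def
  by (intro open_Int U open_Collect_less continuous_intros smooth_continuous[OF smooth_dd[OF sg]] gradf_continuous[OF sg])
 moreover have "p \<in> W" unfolding W_def using U(2) c by (auto simp: N_def c_def)
 ultimately obtain R where R: "R > 0" "ball p R \<subseteq> W" using open_contains_ball by blast
 \<comment> \<open>Near p one has dg(w) < - c/2 and |dg(y)| <= N for |y| <= 1. With v = w / \<kappa>
   this gives dg(v) <= - 2 N, hence dg(v + y) <= - N.\<close>
 define \<kappa> where "\<kappa> = c / (4 * N)"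
 have k: "\<kappa> > 0" using c N by (simp add: \<kappa>_def)
 define v where "v = (1/\<kappa>) *\<^sub>R w"
 have neg: "dd g z (v + y) \<le> 0" if z: "z \<in> ball p R" and y: "norm y \<le> 1" for z y
 proof -
  have zW: "dd g z w < - c/2" "norm (gradf g z) < N" using z R(2) by (auto simp: W_def)
  have "dd g z y \<le> N"
  proof -
   have "dd g z y \<le> norm (gradf g z) * norm y" unfolding dd_gradf[OF sg] by (rule norm_cauchy_schwarz)
   also have "\<dots> \<le> N * 1" using zW y N by (intro mult_mono) auto
   finally show ?thesis by simp
  qed
  moreover have "dd g z v = (1/\<kappa>) * dd g z w" unfolding v_def dd_gradf[OF sg] by simp
  moreover have "(1/\<kappa>) * dd g z w \<le> (1/\<kappa>) * (- c/2)" using zW k by (intro mult_left_mono) auto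
  moreover have "(1/\<kappa>) * (- c/2) = - 2 * N" using c N by (simp add: \<kappa>_def field_simps)
  moreover have "dd g z (v + y) = dd g z v + dd g z y" unfolding dd_gradf[OF sg] by (simp add: inner_add_right)
  ultimately show ?thesis using N by linarith
 qed
 \<comment> \<open>Displacements \<tau> (v + y) are shorter than R / 2, so a segment that starts in
   the ball of radius R / 2 stays in the ball of radius R.\<close>
 define \<tau>0 where "\<tau>0 = (R / 2) / (norm v + 1)"
 have v1: "norm v + 1 > 0" by (simp add: add_nonneg_pos)
 have t0: "\<tau>0 > 0" using R(1) v1 by (simp add: \<tau>0_def)
 have "x + \<tau> *\<^sub>R (v + y) \<in> \<Omega>" if x: "x \<in> \<Omega> \<inter> ball p (R/2)" and t: "\<tau> \<in> {0<..<\<tau>0}" and y: "norm y \<le> 1" for x \<tau> y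
 proof -
  have inb: "x + s *\<^sub>R (v + y) \<in> ball p R" if s: "0 \<le> s" "s \<le> \<tau>" for s
  proof -
   have "norm (v + y) \<le> norm v + 1" using norm_triangle_ineq[of v y] y by linarith
   then have "norm (s *\<^sub>R (v + y)) \<le> \<tau> * (norm v + 1)" using s by (simp add: mult_mono)
   also have "\<dots> < \<tau>0 * (norm v + 1)" using t v1 by (intro mult_strict_right_mono) auto
   also have "\<dots> = R/2" unfolding \<tau>0_def by (rule nonzero_eq_divide_eq[THEN iffD1, OF _ refl]) (use v1 in linarith)
   finally have "norm (s *\<^sub>R (v + y)) < R/2" .
   moreover have "dist p (x + s *\<^sub>R (v + y)) \<le> dist p x + norm (s *\<^sub>R (v + y))"
    using dist_triangle[of p "x + s *\<^sub>R (v + y)" x] by (simp add: dist_norm)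
   ultimately show ?thesis using x by simp
  qed
  have "g (x + \<tau> *\<^sub>R (v + y)) \<le> g (x + 0 *\<^sub>R (v + y))"
  proof (rule DERIV_nonpos_imp_nonincreasing[of 0 \<tau> "%s. g (x + s *\<^sub>R (v + y))"])
   show "\<exists>y'. ((%s. g (x + s *\<^sub>R (v + y))) has_real_derivative y') (at s) \<and> y' \<le> 0" if "0 \<le> s" "s \<le> \<tau>" for s
    using dd_directional[OF sg] neg[OF inb[OF that] y] by blast
  qed (use t in auto)
  moreover have "g x < 0"
  proof -
   have "x \<in> ball p R" using x R(1) by simp
   then have "x \<in> \<Omega> \<inter> U" using x R(2) by (auto simp: W_def)
   then show ?thesis unfolding U(5) by simp
  qed
  moreover have "x + \<tau> *\<^sub>R (v + y) \<in> U"
  proof -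
   have "x + \<tau> *\<^sub>R (v + y) \<in> ball p R" using t by (intro inb) auto
   then show ?thesis using R(2) by (auto simp: W_def)
  qed
  ultimately have "x + \<tau> *\<^sub>R (v + y) \<in> \<Omega> \<inter> U" unfolding U(5) by simp
  then show ?thesis by simp
 qed
 then show ?thesis using R(1) t0 by (intro exI[of _ "R/2"] exI[of _ v] exI[of _ \<tau>0]) auto
qed

text \<open>A piece of the boundary has infinitely many disjoint translates in the cone direction, all
 inside one bounded set.\<close>

lemma smooth_boundary_null:
 fixes \<Omega> :: "'n::euclidean_space set"
 assumes op: "open \<Omega>" and bd: "bounded \<Omega>" and sb: "smooth_boundary \<Omega>"
 shows "AE x in lborel. x \<notin> frontier \<Omega>"
proof -
 have piece: "\<exists>r>0. negligible (frontier \<Omega> \<inter> ball p r)" if p: "p \<in> frontier \<Omega>" for p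
 proof -
  have "p \<in> closure \<Omega>" using p by (simp add: frontier_def)
  from smooth_boundary_cone[OF op sb this]
  obtain r v \<tau>0 where r: "0 < r" "0 < \<tau>0"
   and c: "!!x \<tau> y. x \<in> \<Omega> \<inter> ball p r ==> \<tau> \<in> {0<..<\<tau>0} ==> norm y \<le> 1 ==> x + \<tau> *\<^sub>R (v + y) \<in> \<Omega>"
   by blast
  \<comment> \<open>The cone property starts at points of \<Omega>, whereas x is only in the
    closure. A nearby x' in \<Omega> reaches the same end point when the free vector y compensates
    for the difference x - x'.\<close>
  have cl: "x + \<tau> *\<^sub>R v \<in> \<Omega>" if x: "x \<in> closure \<Omega>" "x \<in> ball p r" and t: "\<tau> \<in> {0<..<\<tau>0}" for x \<tau>
  proof -
   have "0 < min \<tau> (r - dist p x)" using x t by simp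
   then obtain x' where y: "x' \<in> \<Omega>" "dist x' x < min \<tau> (r - dist p x)"
    using x(1) unfolding closure_approachable by blast
   then have x': "x' \<in> \<Omega>" "x' \<in> ball p r" "x' \<in> ball x \<tau>"
    using dist_triangle[of p x' x] by (auto simp: dist_commute)
   have "norm ((1/\<tau>) *\<^sub>R (x - x')) \<le> 1" using x'(3) t by (simp add: dist_norm)
   from c[OF _ t this, of x'] have "x' + \<tau> *\<^sub>R (v + (1/\<tau>) *\<^sub>R (x - x')) \<in> \<Omega>" using x' by blast
   moreover have "x' + \<tau> *\<^sub>R (v + (1/\<tau>) *\<^sub>R (x - x')) = x + \<tau> *\<^sub>R v" using t by (simp add: scaleR_add_right)
   ultimately show ?thesis by simp
  qed
  define A where "A = frontier \<Omega> \<inter> ball p r"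
  \<comment> \<open>Distinct lengths in (0, \<tau>0); the 2 keeps the first of them below
    \<tau>0.\<close>
  define s where "s n = \<tau>0 / (real n + 2)" for n
  have s: "s n \<in> {0<..<\<tau>0}" for n
   using r divide_strict_left_mono[of 1 "real n + 2" \<tau>0] by (simp add: s_def add_nonneg_pos)
  have sd: "s m < s n" if "n < m" for m n using that r by (auto simp: s_def field_simps)
  define B where "B n = (+) (s n *\<^sub>R v) ` A" for n
  \<comment> \<open>If two translates met, a point of the boundary piece, moved by (s n - s m) v
    with 0 < s n - s m < \<tau>0, would again be a boundary point; but such a move leads into the
    open set \<Omega>.\<close>
  have disj0: "B n \<inter> B m = {}" if "n < m" for n m
  proof (rule ccontr)
   assume "B n \<inter> B m \<noteq> {}"
   then obtain x x' where x: "x \<in> A" "x' \<in> A" "s n *\<^sub>R v + x = s m *\<^sub>R v + x'" unfolding B_def by blast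
   then have "x' = x + (s n - s m) *\<^sub>R v" by (simp add: scaleR_diff_left algebra_simps)
   moreover have "x + (s n - s m) *\<^sub>R v \<in> \<Omega>"
    using cl[of x "s n - s m"] x(1) sd[OF that] s[of n] s[of m] by (auto simp: A_def frontier_def)
   moreover have "x' \<notin> \<Omega>" using x(2) op by (simp add: A_def frontier_def interior_open)
   ultimately show False by simp
  qed
  then have disj: "disjoint_family B" unfolding disjoint_family_on_def by (metis Int_commute linorder_neqE_nat)
  have Am: "A \<in> sets lebesgue" unfolding A_def by (auto intro!: sets.Int borel_closed)
  have Bm: "B n \<in> sets lebesgue" for n unfolding B_def by (rule lebesgue_sets_translation[OF Am])
  have "bounded (\<Union>n. B n)"
  proof -
   have "norm x \<le> \<tau>0 * norm v + (norm p + r)" if xB: "x \<in> B n" for x n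
   proof -
    obtain a where a: "a \<in> A" "x = s n *\<^sub>R v + a" using xB unfolding B_def by blast
    have "norm a \<le> norm p + r" using a(1) norm_triangle_ineq2[of a p] by (simp add: A_def dist_norm norm_minus_commute)
    moreover have "norm (s n *\<^sub>R v) \<le> \<tau>0 * norm v" using s[of n] by (auto intro: mult_right_mono)
    ultimately show ?thesis unfolding a(2) using norm_triangle_ineq[of "s n *\<^sub>R v" a] by linarith
   qed
   then show ?thesis unfolding bounded_iff by blast
  qed
  moreover have "(\<Union>n. B n) \<in> sets lebesgue" by (rule sets.countable_UN) (use Bm in auto)
  ultimately have "(\<Union>n. B n) \<in> lmeasurable" by (rule bounded_set_imp_lmeasurable)
  then have fin: "emeasure lebesgue (\<Union>n. B n) \<noteq> \<infinity>" by (metis fmeasurableD2 infinity_ennreal_def)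
  \<comment> \<open>All translates have the same measure, and a constant sequence can be summed only
    if it is 0.\<close>
  have "(%n. measure lebesgue (B n)) sums measure lebesgue (\<Union>n. B n)"
   by (rule measure_UNION) (use Bm disj fin in auto)
  moreover have "measure lebesgue (B n) = measure lebesgue A" for n
   unfolding B_def by (rule measure_translation)
  ultimately have "(%n. measure lebesgue A) \<longlonglongrightarrow> 0" using summable_LIMSEQ_zero[OF sums_summable] by simp
  then have "measure lebesgue A = 0" by (simp add: LIMSEQ_const_iff)
  moreover have "A \<in> lmeasurable"
   by (rule bounded_set_imp_lmeasurable[OF _ Am]) (auto simp: A_def intro: bounded_subset[of "ball p r"])
  ultimately have "negligible A" by (simp add: negligible_iff_measure)
  then show ?thesis using r(1) unfolding A_def by blast
 qed
 obtain r where r: "!!p. p \<in> frontier \<Omega> ==> r p > 0" "!!p. p \<in> frontier \<Omega> ==> negligible (frontier \<Omega> \<inter> ball p (r p))"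
  using piece by metis
 have K: "compact (frontier \<Omega>)" using bd by (simp add: compact_frontier_bounded)
 obtain I where I: "I \<subseteq> frontier \<Omega>" "finite I" "frontier \<Omega> \<subseteq> (\<Union>p\<in>I. ball p (r p))"
 proof (rule compactE_image[OF K, of "frontier \<Omega>" "%p. ball p (r p)"])
  show "frontier \<Omega> \<subseteq> (\<Union>p\<in>frontier \<Omega>. ball p (r p))" using r(1) by auto
 qed auto
 have "negligible (\<Union>p\<in>I. frontier \<Omega> \<inter> ball p (r p))"
  using I r(2) by (intro negligible_Union) auto
 moreover have "frontier \<Omega> \<subseteq> (\<Union>p\<in>I. frontier \<Omega> \<inter> ball p (r p))" using I(3) by blast
 ultimately have "negligible (frontier \<Omega>)" by (rule negligible_subset)
 then have "AE x in lebesgue. x \<notin> frontier \<Omega>" by (simp add: AE_not_in negligible_iff_null_sets)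
 then show ?thesis by (simp add: AE_completion_iff)
qed

text \<open>Outer regularity yields an open V around K with V - K of measure less than d. The sum of
  a partition of unity on K, subordinate to balls inside V, is the cut-off.\<close>

lemma smooth_cutoff:
 fixes K :: "'n::euclidean_space set"
 assumes K: "compact K" and d: "0 < d"
 obtains \<eta> where "test_fun UNIV \<eta>" "!!x. 0 \<le> \<eta> x" "!!x. \<eta> x \<le> 1" "!!x. x \<in> K ==> \<eta> x = 1"
  "measure lborel {x. x \<notin> K \<and> \<eta> x \<noteq> 0} \<le> d" "emeasure lborel {x. x \<notin> K \<and> \<eta> x \<noteq> 0} < \<infinity>"
proof -
 have Kb: "K \<in> sets borel" using K by (simp add: borel_compact)
 obtain V where V: "open V" "K \<subseteq> V" "emeasure lborel (V - K) < ennreal d"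
  using outer_regular_lborel[OF Kb d] by blast
 have "\<forall>p\<in>K. \<exists>r>0. ball p r \<subseteq> V" using V open_contains_ball by blast
 then obtain r where r: "!!p. p \<in> K ==> r p > 0" "!!p. p \<in> K ==> ball p (r p) \<subseteq> V" by metis
 obtain I \<zeta> where I: "finite I" "I \<subseteq> K" "!!p. p \<in> I ==> smooth_fun (\<zeta> p)" "!!p x. 0 \<le> \<zeta> p x"
  "!!p x. p \<in> I ==> \<zeta> p x \<noteq> 0 ==> x \<in> ball p (r p)" "!!x. x \<in> K ==> (\<Sum>p\<in>I. \<zeta> p x) = 1"
  "!!x. (\<Sum>p\<in>I. \<zeta> p x) \<le> 1"
  by (rule smooth_partition[of K r, OF K r(1)]) (assumption, rule that, assumption+)
 define \<eta> where "\<eta> x = (\<Sum>p\<in>I. \<zeta> p x)" for x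
 have supp: "\<exists>p\<in>I. x \<in> ball p (r p)" if "\<eta> x \<noteq> 0" for x
  using that I(5) unfolding \<eta>_def by (meson sum.neutral)
 have inV: "{x. x \<notin> K \<and> \<eta> x \<noteq> 0} \<subseteq> V - K" using supp r(2) I(2) by blast
 have sm: "smooth_fun \<eta>" unfolding \<eta>_def[abs_def] by (rule smooth_sum) (rule I(3))
 have t: "test_fun UNIV \<eta>"
 proof (rule test_funI[OF sm])
  show "compact (\<Union>p\<in>I. cball p (r p))" using I(1) by (intro compact_UN) auto
  show "\<eta> x = 0" if "x \<notin> (\<Union>p\<in>I. cball p (r p))" for x
   using supp[of x] that ball_subset_cball by blast
 qed simp
 have le: "emeasure lborel {x. x \<notin> K \<and> \<eta> x \<noteq> 0} \<le> emeasure lborel (V - K)"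
  by (rule emeasure_mono[OF inV]) (use V(1) Kb in auto)
 then have "emeasure lborel {x. x \<notin> K \<and> \<eta> x \<noteq> 0} < ennreal d" using V(3) by (rule le_less_trans)
 then have "measure lborel {x. x \<notin> K \<and> \<eta> x \<noteq> 0} \<le> d" "emeasure lborel {x. x \<notin> K \<and> \<eta> x \<noteq> 0} < \<infinity>"
  using d by (auto simp: measure_def enn2real_leI less_imp_le intro: less_trans[OF _ ennreal_less_top])
 moreover have "!!x. 0 \<le> \<eta> x" unfolding \<eta>_def by (intro sum_nonneg I(4))
 ultimately show thesis using that[OF t] I(6,7) unfolding \<eta>_def by blast
qed

text \<open>Compactness of the closure leaves finitely many cones, so that one length bound \<tau>0
  serves them all.\<close>

lemma cone_partition:
 fixes \<Omega> :: "'n::euclidean_space set"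
 assumes op: "open \<Omega>" and bd: "bounded \<Omega>" and sb: "smooth_boundary \<Omega>"
 obtains I \<zeta> v \<tau>0 where "finite (I :: 'n set)" "0 < \<tau>0" "!!p. p \<in> I ==> test_fun UNIV (\<zeta> p)" "!!p x. 0 \<le> \<zeta> p x"
  "!!x. (\<Sum>p\<in>I. \<zeta> p x) \<le> 1" "!!x. x \<in> \<Omega> ==> (\<Sum>p\<in>I. \<zeta> p x) = 1"
  "!!p x \<tau> y. p \<in> I ==> x \<in> \<Omega> ==> \<zeta> p x \<noteq> 0 ==> 0 < \<tau> ==> \<tau> < \<tau>0 ==> norm y \<le> 1 ==> x + \<tau> *\<^sub>R (v p + y) \<in> \<Omega>"
proof -
 have K: "compact (closure \<Omega>)" using bd by (simp add: compact_closure)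
 have "\<forall>p\<in>closure \<Omega>. \<exists>r v \<tau>0. 0 < r \<and> 0 < \<tau>0 \<and> (\<forall>x\<in>\<Omega> \<inter> ball p r. \<forall>\<tau>\<in>{0<..<\<tau>0}. \<forall>y. norm y \<le> 1 --> x + \<tau> *\<^sub>R (v + y) \<in> \<Omega>)"
  using smooth_boundary_cone[OF op sb] by blast
 then obtain r v t where c: "\<forall>p\<in>closure \<Omega>. 0 < r p \<and> 0 < t p \<and> (\<forall>x\<in>\<Omega> \<inter> ball p (r p). \<forall>\<tau>\<in>{0<..<t p}. \<forall>y. norm y \<le> 1 --> x + \<tau> *\<^sub>R (v p + y) \<in> \<Omega>)"
  unfolding bchoice_iff by blast
 have r: "!!p. p \<in> closure \<Omega> ==> r p > 0" using c by blast
 obtain I \<zeta> where I: "finite I" "I \<subseteq> closure \<Omega>" "!!p. p \<in> I ==> smooth_fun (\<zeta> p)" "!!p x. 0 \<le> \<zeta> p x"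
  "!!p x. p \<in> I ==> \<zeta> p x \<noteq> 0 ==> x \<in> ball p (r p)" "!!x. x \<in> closure \<Omega> ==> (\<Sum>p\<in>I. \<zeta> p x) = 1"
  "!!x. (\<Sum>p\<in>I. \<zeta> p x) \<le> 1"
  by (rule smooth_partition[of "closure \<Omega>" r, OF K r]) (assumption, rule that, assumption+)
 \<comment> \<open>The extra 1 gives the minimum a meaning when I is empty.\<close>
 define \<tau>0 where "\<tau>0 = Min (insert 1 (t ` I))"
 have t0: "0 < \<tau>0" "!!p. p \<in> I ==> \<tau>0 \<le> t p" unfolding \<tau>0_def using I c by auto
 have tf: "test_fun UNIV (\<zeta> p)" if "p \<in> I" for p
 proof (rule test_funI[OF I(3)[OF that]])
  show "compact (cball p (r p))" by simp
  show "\<zeta> p x = 0" if "x \<notin> cball p (r p)" for x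
   using I(5)[OF \<open>p \<in> I\<close>, of x] that ball_subset_cball by blast
 qed simp
 show thesis
 proof (rule that[of I \<tau>0 \<zeta> v, OF I(1) t0(1) tf I(4) I(7)])
  show "(\<Sum>p\<in>I. \<zeta> p x) = 1" if "x \<in> \<Omega>" for x using I(6)[of x] closure_subset[of \<Omega>] that by blast
  show "x + \<tau> *\<^sub>R (v p + y) \<in> \<Omega>" if "p \<in> I" "x \<in> \<Omega>" "\<zeta> p x \<noteq> 0" "0 < \<tau>" "\<tau> < \<tau>0" "norm y \<le> 1" for p x \<tau> y
  proof -
   have p: "p \<in> closure \<Omega>" using that(1) I(2) by (rule rev_subsetD)
   have x: "x \<in> \<Omega> \<inter> ball p (r p)" using that(2) I(5)[OF that(1,3)] by (rule IntI)
   have t: "\<tau> \<in> {0<..<t p}" using that(4,5) t0(2)[OF that(1)] by simp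
   show ?thesis
    by (rule c[rule_format, OF p, THEN conjunct2, THEN conjunct2, rule_format, OF x t that(6)])
  qed
 qed
qed

section \<open>Borel representatives and time cut-offs\<close>

lemma lebesgue_on_borel:
 fixes h :: "'n::euclidean_space => 'b::euclidean_space"
 assumes "h \<in> borel_fun"
 shows "h \<in> borel_measurable (lebesgue_on S)"
 by (rule measurable_restrict_space1) (use assms in \<open>simp add: measurable_completion\<close>)

lemma borel_representative_real:
 fixes g :: "'n::euclidean_space => real"
 assumes g: "g \<in> borel_measurable (lebesgue_on S)" and S: "S \<in> sets borel"
 obtains h where "h \<in> borel_fun" "!!x. x \<notin> S ==> h x = 0" "AE x in lborel. x \<in> S --> h x = g x"
proof -
 have "(%x. g x * ind S x) \<in> borel_measurable lebesgue"
  using g S by (subst (asm) borel_measurable_restrict_space_iff) (auto simp: mult.commute)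
 from completion_ex_borel_measurable_real[OF this]
 obtain h where h: "h \<in> borel_measurable lborel" "AE x in lborel. g x * ind S x = h x" by blast
 show thesis
 proof (rule that[of "%x. ind S x * h x"])
  show "(%x. ind S x * h x) \<in> borel_fun" using h(1) S by simp
  show "AE x in lborel. x \<in> S --> ind S x * h x = g x" using h(2) by eventually_elim auto
 qed auto
qed

lemma borel_representative:
 fixes g :: "'n::euclidean_space => 'b::euclidean_space"
 assumes g: "g \<in> borel_measurable (lebesgue_on S)" and S: "S \<in> sets borel"
 obtains h where "h \<in> borel_fun" "!!x. x \<notin> S ==> h x = 0" "AE x in lborel. x \<in> S --> h x = g x"
proof -
 have "\<exists>h. h \<in> borel_fun \<and> (\<forall>x. x \<notin> S --> h x = 0) \<and> (AE x in lborel. x \<in> S --> h x = g x \<bullet> i)" for i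
 proof -
  have "(%x. g x \<bullet> i) \<in> borel_measurable (lebesgue_on S)" using g by (rule borel_measurable_inner) simp
  then show ?thesis by (rule borel_representative_real[OF _ S]) blast
 qed
 then obtain h where h: "!!i. h i \<in> borel_fun" "!!i x. x \<notin> S ==> h i x = 0"
  "!!i. AE x in lborel. x \<in> S --> h i x = g x \<bullet> i" by metis
 show thesis
 proof (rule that[of "%x. \<Sum>i\<in>Basis. h i x *\<^sub>R i"])
  show "(%x. \<Sum>i\<in>Basis. h i x *\<^sub>R i) \<in> borel_fun" using h(1) by simp
  have "AE x in lborel. \<forall>i\<in>Basis. x \<in> S --> h i x = g x \<bullet> i" using h(3) by (subst AE_ball_countable) (auto simp: countable_finite)
  then show "AE x in lborel. x \<in> S --> (\<Sum>i\<in>Basis. h i x *\<^sub>R i) = g x"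
   by eventually_elim (simp add: euclidean_representation)
 qed (simp add: h(2))
qed

text \<open>The dictionary between integrals for Lebesgue measure restricted to a set, in which weak
  solutions are formulated, and integrals of zero-extended Borel functions over the whole
  space.\<close>

lemma lebesgue_on_integral:
 fixes f h :: "'n::euclidean_space => real"
 assumes S: "S \<in> sets borel" and h: "h \<in> borel_fun" "!!x. x \<notin> S ==> h x = 0"
  and f: "f \<in> borel_measurable (lebesgue_on S)" and ae: "AE x in lborel. x \<in> S --> h x = f x"
 shows "(LINT x|lebesgue_on S. f x) = (LBINT x. h x)"
  and "integrable (lebesgue_on S) f \<longleftrightarrow> integrable lborel h"
proof -
 have fm: "(%x. ind S x *\<^sub>R f x) \<in> borel_measurable lebesgue"
  using f S by (subst (asm) borel_measurable_restrict_space_iff) auto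
 have hm: "h \<in> borel_measurable lebesgue" using h(1) by (simp add: measurable_completion)
 have eq: "AE x in lebesgue. ind S x *\<^sub>R f x = h x"
 proof -
  have "AE x in lborel. ind S x *\<^sub>R f x = h x" using ae by eventually_elim (auto simp: indicator_def h(2))
  then show ?thesis by (rule AE_completion)
 qed
 have "(LINT x|lebesgue_on S. f x) = (LINT x|lebesgue. ind S x *\<^sub>R f x)"
  using S by (intro integral_restrict_space) auto
 also have "\<dots> = (LINT x|lebesgue. h x)" by (rule integral_cong_AE[OF fm hm eq])
 also have "\<dots> = (LBINT x. h x)" using h(1) by (intro integral_completion) simp
 finally show "(LINT x|lebesgue_on S. f x) = (LBINT x. h x)" .
 have "integrable (lebesgue_on S) f \<longleftrightarrow> integrable lebesgue (%x. ind S x *\<^sub>R f x)"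
  using S by (intro integrable_restrict_space) auto
 also have "\<dots> \<longleftrightarrow> integrable lebesgue h" by (rule integrable_cong_AE[OF fm hm eq])
 also have "\<dots> \<longleftrightarrow> integrable lborel h" using h(1) by (intro integrable_completion) simp
 finally show "integrable (lebesgue_on S) f \<longleftrightarrow> integrable lborel h" .
qed

lemma AE_lebesgue_on_iff:
 assumes "S \<in> sets borel"
 shows "(AE x in lebesgue_on S. P x) \<longleftrightarrow> (AE x in lborel. x \<in> S --> P x)"
 using assms by (subst AE_restrict_space_iff) (auto simp: AE_completion_iff)

lemma integrable_product:
 fixes a :: "'m::euclidean_space => real" and b :: "'n::euclidean_space => real"
 assumes a: "integrable lborel a" and b: "integrable lborel b"
 shows "integrable lborel (%z. a (fst z) * b (snd z))"
proof -
 have [measurable]: "a \<in> borel_fun" "b \<in> borel_fun" using a b by auto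
 have m: "(%z. a (fst z) * b (snd z)) \<in> borel_fun" by measurable
 have "integrable (lborel \<Otimes>\<^sub>M lborel) (%z. a (fst z) * b (snd z))"
 proof (rule lborel_pair.Fubini_integrable)
  show "(%z. a (fst z) * b (snd z)) \<in> borel_measurable (lborel \<Otimes>\<^sub>M lborel)" using m by (rule borel_measurable_pairI)
  show "integrable lborel (%x. LBINT y. norm (a (fst (x, y)) * b (snd (x, y))))"
   using a by (simp add: abs_mult)
  show "AE x in lborel. integrable lborel (%y. a (fst (x, y)) * b (snd (x, y)))" using b by simp
 qed
 then show ?thesis by (simp add: lborel_prod)
qed

lemma L2_product:
 fixes a :: "'m::euclidean_space => real" and b :: "'n::euclidean_space => 'b::euclidean_space"
 assumes a: "L2 a" and b: "L2 b"
 shows "L2 (%z. a (fst z) *\<^sub>R b (snd z))"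
 unfolding L2_def
proof
 note [measurable] = L2_measurable[OF a] L2_measurable[OF b]
 show "(%z. a (fst z) *\<^sub>R b (snd z)) \<in> borel_fun" by measurable
 show "integrable lborel (%z. (norm (a (fst z) *\<^sub>R b (snd z)))\<^sup>2)"
  using integrable_product[OF L2_integrable_real[OF a] L2_integrable[OF b]] by (simp add: power_mult_distrib)
qed

lemma cyl_open: "open U ==> open (cyl T U)"
 unfolding cyl_def by (intro open_Times) auto

section \<open>Linear ramps in time as test functions\<close>

definition ramp :: "real => real => real => real" where
 "ramp t k r = max 0 (min 1 ((t + k - r) / k))"

text \<open>The almost everywhere derivative of \<open>ramp t k\<close>, which is 1 up to t, falls
  linearly to 0 on [t, t + k] and stays 0.\<close>

definition ramp' :: "real => real => real => real" where
 "ramp' t k r = - ind {t..t+k} r / k"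

lemma ramp_continuous: "continuous_on A (ramp t k)"
 unfolding ramp_def[abs_def] divide_inverse by (intro continuous_intros)

lemma ramp_measurable [measurable]: "ramp t k \<in> borel_fun" "ramp' t k \<in> borel_fun"
 by (auto intro: borel_measurable_continuous_onI ramp_continuous simp: ramp'_def[abs_def])

lemma ramp_bounds: "0 \<le> ramp t k r" "ramp t k r \<le> 1" "\<bar>ramp t k r\<bar> \<le> 1" "k > 0 ==> \<bar>ramp' t k r\<bar> \<le> 1 / k"
 by (auto simp: ramp_def ramp'_def indicator_def)

text \<open>The ramp is continuous and differentiable except at its two kinks, which the strong form
  of the fundamental theorem of calculus allows.\<close>

lemma ramp_by_parts:
 fixes g :: "real => real"
 assumes k: "k > 0" and g: "test_fun UNIV g"
 shows "(LBINT r. ramp t k r * dd g r 1) = - (LBINT r. ramp' t k r * g r)"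
proof -
 have sg: "smooth_fun g" by (rule test_fun_smooth[OF g])
 have dg: "(g has_real_derivative dd g r 1) (at r)" for r
  using dd_directional[OF sg, of r 1 0] DERIV_shift[of g "dd g r 1" 0 r] by (simp add: add.commute)
 obtain B where B: "!!x. x \<in> closure {x. g x \<noteq> 0} ==> norm x \<le> B"
  using compact_imp_bounded[OF test_fun_compact[OF g]] unfolding bounded_iff by blast
 \<comment> \<open>The interval [a, b] reaches beyond the support of g, so that the boundary terms
   vanish.\<close>
 define a where "a = - (\<bar>B\<bar> + 1)"
 define b where "b = \<bar>B\<bar> + 1"
 have out: "x \<notin> closure {x. g x \<noteq> 0}" if "x \<le> a \<or> b \<le> x" for x
  using B[of x] that by (auto simp: a_def b_def)
 have gz: "g x = 0" "dd g x 1 = 0" if "x \<le> a \<or> b \<le> x" for x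
  using test_fun_zero[OF out[OF that]] test_fun_dd_zero[OF out[OF that]] by auto
 let ?h = "%r. ramp' t k r * g r + ramp t k r * dd g r 1"
 have gi: "integrable lborel (%r. ramp' t k r * g r)"
  using L2_mult_bounded_real[OF test_fun_L2[OF g] ramp_measurable(2) ramp_bounds(4)[OF k]]
  by (intro integrable_L2_bounded_support[OF _ compact_imp_bounded[OF test_fun_compact[OF g]]]) (auto dest: test_fun_zero)
 have di: "integrable lborel (%r. ramp t k r * dd g r 1)"
  using L2_mult_bounded_real[OF test_fun_L2[OF test_fun_dd[OF g]] ramp_measurable(1) ramp_bounds(3)]
  by (intro integrable_L2_bounded_support[OF _ compact_imp_bounded[OF test_fun_compact[OF g]]]) (auto dest: test_fun_dd_zero)
 have "(?h has_integral (ramp t k b * g b - ramp t k a * g a)) {a..b}"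
 proof (rule fundamental_theorem_of_calculus_interior_strong[of "{t, t+k}"])
  show "a \<le> b" by (simp add: a_def b_def)
  show "continuous_on {a..b} (%r. ramp t k r * g r)"
   by (intro continuous_intros ramp_continuous smooth_continuous[OF sg])
  fix r assume r: "r \<in> {a<..<b} - {t, t+k}"
  have dr: "(ramp t k has_real_derivative ramp' t k r) (at r)"
  proof -
   consider "r < t" | "t < r" "r < t + k" | "t + k < r" using r by fastforce
   then show ?thesis
   proof cases
    case 1
    have "((%r. 1) has_real_derivative ramp' t k r) (at r)" using 1 by (simp add: ramp'_def)
    then show ?thesis
     by (rule has_field_derivative_transform_within_open[of _ _ _ "{..<t}"]) (use 1 k in \<open>auto simp: ramp_def min_def max_def field_simps\<close>)
   next
    case 2
    have "((%r. (t + k - r) / k) has_real_derivative ramp' t k r) (at r)"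
     using 2 k by (auto intro!: derivative_eq_intros simp: ramp'_def)
    then show ?thesis
     by (rule has_field_derivative_transform_within_open[of _ _ _ "{t<..<t+k}"]) (use 2 k in \<open>auto simp: ramp_def min_def max_def field_simps\<close>)
   next
    case 3
    have "((%r. 0) has_real_derivative ramp' t k r) (at r)" using 3 by (simp add: ramp'_def)
    then show ?thesis
     by (rule has_field_derivative_transform_within_open[of _ _ _ "{t+k<..}"]) (use 3 k in \<open>auto simp: ramp_def min_def max_def field_simps\<close>)
   qed
  qed
  show "((%r. ramp t k r * g r) has_vector_derivative ?h r) (at r)"
   unfolding has_real_derivative_iff_has_vector_derivative[symmetric]
   by (rule derivative_eq_intros dr dg refl)+ simp
 qed simp
 then have "(?h has_integral 0) {a..b}" using gz(1) by simp
 then have "((%r. if r \<in> {a..b} then ?h r else 0) has_integral 0) UNIV" by (simp only: has_integral_restrict_UNIV)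
 moreover have "(%r. if r \<in> {a..b} then ?h r else 0) = ?h"
  using gz by (auto simp: fun_eq_iff not_le)
 ultimately have "(?h has_integral 0) UNIV" by simp
 moreover have "(?h has_integral (LBINT r. ?h r)) UNIV"
  by (rule has_integral_integral_lborel) (use gi di in auto)
 ultimately have "(LBINT r. ?h r) = 0" using has_integral_unique by blast
 then show ?thesis using gi di by simp
qed

lemma test_fun_slice:
 fixes \<theta> :: "real \<times> 'n::euclidean_space => real"
 assumes t: "test_fun (cyl T U) \<theta>"
 shows "test_fun U (%x. \<theta> (r, x))" "dd (%x. \<theta> (r, x)) x j = dd \<theta> (r, x) (0, j)"
  "test_fun UNIV (%r. \<theta> (r, x))" "dd (%r. \<theta> (r, x)) r 1 = dd \<theta> (r, x) (1, 0)"
proof -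
 note s = test_fun_smooth[OF t]
 let ?K = "closure {z. \<theta> z \<noteq> 0}"
 have K: "compact ?K" by (rule test_fun_compact[OF t])
 have L: "bounded_linear (%x::'n. (0::real, x))" "bounded_linear (%r::real. (r, 0::'n))"
  by (intro bounded_linear_Pair bounded_linear_zero bounded_linear_ident)+
 have s1: "smooth_fun (%x. \<theta> (r, x))" using smooth_compose_affine[OF L(1) s, of "(r, 0)"] by simp
 have s2: "smooth_fun (%r. \<theta> (r, x))" using smooth_compose_affine[OF L(2) s, of "(0, x)"] by simp
 show "dd (%x. \<theta> (r, x)) x j = dd \<theta> (r, x) (0, j)" using dd_compose_affine[OF L(1) s, of "(r, 0)" x j] by simp
 show "dd (%r. \<theta> (r, x)) r 1 = dd \<theta> (r, x) (1, 0)" using dd_compose_affine[OF L(2) s, of "(0, x)" r 1] by simp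
 have c: "compact (snd ` ?K)" "compact (fst ` ?K)"
  by (intro compact_continuous_image K continuous_intros)+
 have sub: "?K \<subseteq> cyl T U" by (rule test_fun_subset[OF t])
 show "test_fun U (%x. \<theta> (r, x))"
 proof (rule test_funI[OF s1 c(1)])
  show "snd ` ?K \<subseteq> U" using sub by (auto simp: cyl_def)
  show "\<theta> (r, x) = 0" if "x \<notin> snd ` ?K" for x
   by (rule test_fun_zero[of _ \<theta>]) (use that in force)
 qed
 show "test_fun UNIV (%r. \<theta> (r, x))"
 proof (rule test_funI[OF s2 c(2)])
  show "\<theta> (r, x) = 0" if "r \<notin> fst ` ?K" for r
   by (rule test_fun_zero[of _ \<theta>]) (use that in force)
 qed simp
qed

lemma L2_sq_int:
 assumes S: "S \<in> sets borel" and g: "g \<in> borel_fun" "L2 (%x. ind S x *\<^sub>R g x)"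
 shows "sq_int_vec S g"
 unfolding sq_int_vec_def
proof
 show "g \<in> borel_measurable (lebesgue_on S)" by (rule lebesgue_on_borel[OF g(1)])
 have "integrable (lebesgue_on S) (%x. (norm (g x))\<^sup>2) \<longleftrightarrow> integrable lborel (%x. (norm (ind S x *\<^sub>R g x))\<^sup>2)"
 proof (rule lebesgue_on_integral(2)[OF S])
  show "(%x. (norm (ind S x *\<^sub>R g x))\<^sup>2) \<in> borel_fun"
   using S g(1) by measurable
  show "(%x. (norm (g x))\<^sup>2) \<in> borel_measurable (lebesgue_on S)"
   using lebesgue_on_borel[OF g(1)] by measurable
 qed auto
 then show "integrable (lebesgue_on S) (%x. (norm (g x))\<^sup>2)" using L2_integrable[OF g(2)] by simp
qed

lemma sq_int_vec_real: "sq_int_vec S (g :: _ => real) \<longleftrightarrow> sq_int S g"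
 by (simp add: sq_int_def sq_int_vec_def)

text \<open>Ramp times spatial Sobolev function is admissible in the space-time formulation. This is
  the only kind of test function that has to be inserted there: shrinking the ramp produces the
  equation integrated over (0, t).\<close>

lemma ramp_H1_test:
 fixes \<psi> :: "'n::euclidean_space => real"
 assumes U: "open U" and H: "H1 U \<psi> \<Psi>" and k: "k > 0"
 shows "H1_test T U (%r x. ramp t k r * \<psi> x) (%r x. ramp' t k r * \<psi> x) (%r x. ramp t k r *\<^sub>R \<Psi> x)"
proof -
 have p: "L2 \<psi>" "L2 \<Psi>" "wgrad U \<psi> \<Psi>" using H by (auto simp: H1_def)
 note [measurable] = L2_measurable[OF p(1)] L2_measurable[OF p(2)]
 let ?C = "cyl T U"
 have Ub: "U \<in> sets borel" using U by simp
 have C: "?C \<in> sets borel" using cyl_open[OF U] by (rule borel_open)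
 have indC: "ind ?C z = (ind {0<..<T} (fst z) * ind U (snd z) :: real)" for z
  by (cases z) (simp add: cyl_def indicator_def)
 have pU: "L2 (%x. ind U x * \<psi> x)" "L2 (%x. ind U x *\<^sub>R \<Psi> x)"
  using L2_mult_indicator(1)[OF p(1) Ub] L2_mult_indicator(1)[OF p(2) Ub] by auto
 have rT: "L2 (%r. ind {0<..<T} r * ramp t k r)"
  by (rule L2_bounded_support[of _ 1 "{0<..<T}"]) (use ramp_bounds(3) in \<open>auto simp: indicator_def\<close>)
 have rT': "L2 (%r. ind {0<..<T} r * ramp' t k r)"
  by (rule L2_bounded_support[of _ "1/k" "{0<..<T}"]) (use ramp_bounds(4)[OF k] k in \<open>auto simp: indicator_def\<close>)
 let ?p = "%z. ramp t k (fst z) * \<psi> (snd z)" and ?pt = "%z. ramp' t k (fst z) * \<psi> (snd z)"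
  and ?px = "%z. ramp t k (fst z) *\<^sub>R \<Psi> (snd z)"
 have Lp: "L2 (%z. ind ?C z *\<^sub>R ?p z)" using L2_product[OF rT pU(1)] by (simp add: indC mult_ac)
 have Lpt: "L2 (%z. ind ?C z *\<^sub>R ?pt z)" using L2_product[OF rT' pU(1)] by (simp add: indC mult_ac)
 have Lpx: "L2 (%z. ind ?C z *\<^sub>R ?px z)" using L2_product[OF rT pU(2)] by (simp add: indC mult_ac)
 have m: "?p \<in> borel_fun" "?pt \<in> borel_fun" "?px \<in> borel_fun" by measurable
 have a: "sq_int ?C ?p" using L2_sq_int[OF C m(1) Lp] by (simp add: sq_int_vec_real)
 have b: "sq_int_vec ?C (%z. (?pt z, ?px z))"
 proof (rule L2_sq_int[OF C])
  show "(%z. (?pt z, ?px z)) \<in> borel_fun" using m by measurable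
  show "L2 (%z. ind ?C z *\<^sub>R (?pt z, ?px z))"
   unfolding L2_def
  proof
   show "(%z. ind ?C z *\<^sub>R (?pt z, ?px z)) \<in> borel_fun" using m C by measurable
   have "(norm (ind ?C z *\<^sub>R (?pt z, ?px z)))\<^sup>2 = (norm (ind ?C z *\<^sub>R ?pt z))\<^sup>2 + (norm (ind ?C z *\<^sub>R ?px z))\<^sup>2" for z
    by (simp add: norm_Pair)
   then show "integrable lborel (%z. (norm (ind ?C z *\<^sub>R (?pt z, ?px z)))\<^sup>2)"
    using L2_integrable[OF Lpt] L2_integrable[OF Lpx] by simp
  qed
 qed
 have c: "weak_grad ?C ?p (%z. (?pt z, ?px z))"
  unfolding weak_grad_def
 proof (intro allI impI ballI)
  fix \<theta> :: "real \<times> 'n => real" and i :: "real \<times> 'n" assume th: "test_fun ?C \<theta>" and i: "i \<in> Basis"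
  have z0: "\<theta> z = 0" "dd \<theta> z v = 0" if "z \<notin> ?C" for z v
  proof -
   have "z \<notin> closure {z. \<theta> z \<noteq> 0}" using that test_fun_subset[OF th] by blast
   then show "\<theta> z = 0" "dd \<theta> z v = 0" by (rule test_fun_zero, rule test_fun_dd_zero)
  qed
  note thd = test_fun_dd[OF th]
  note tm = test_fun_measurable[OF th] test_fun_measurable[OF thd]
  have drop: "ind ?C z *\<^sub>R g z * \<theta> z = g z * \<theta> z" "ind ?C z *\<^sub>R g z * dd \<theta> z v = g z * dd \<theta> z v" for g :: "_ => real" and z v
   using z0(1)[of z] z0(2)[of z v] by (cases "z \<in> ?C"; simp)+
  have I1: "integrable lborel (%z. ?p z * dd \<theta> z v)" for v
   using L2_mult_integrable[OF Lp test_fun_L2[OF test_fun_dd[OF th, of v]]] by (simp only: drop(2)[where g = ?p])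
  have I2: "integrable lborel (%z. ?pt z * \<theta> z)"
   using L2_mult_integrable[OF Lpt test_fun_L2[OF th]] by (simp only: drop(1)[where g = ?pt])
  have I3: "integrable lborel (%z. (?px z \<bullet> j) * \<theta> z)" if "j \<in> Basis" for j
  proof -
   have "L2 (%z. ind ?C z *\<^sub>R (?px z \<bullet> j))" using L2_component[OF Lpx that] by (simp add: mult.assoc)
   from L2_mult_integrable[OF this test_fun_L2[OF th]] show ?thesis by (simp only: drop(1)[where g = "%z. ?px z \<bullet> j"])
  qed
  have l: "(LINT z|lebesgue_on ?C. ?p z * dd \<theta> z i) = (LBINT z. ?p z * dd \<theta> z i)"
   by (rule lebesgue_on_integral(1)[OF C]) (use I1[of i] z0 in \<open>auto intro!: lebesgue_on_borel\<close>)
  have Im: "(%z. ((?pt z, ?px z) \<bullet> i) * \<theta> z) \<in> borel_fun" using m tm by measurable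
  have rr: "(LINT z|lebesgue_on ?C. ((?pt z, ?px z) \<bullet> i) * \<theta> z) = (LBINT z. ((?pt z, ?px z) \<bullet> i) * \<theta> z)"
   by (rule lebesgue_on_integral(1)[OF C Im]) (use z0 Im in \<open>auto intro!: lebesgue_on_borel\<close>)
  have "(LBINT z. ?p z * dd \<theta> z i) = - (LBINT z. ((?pt z, ?px z) \<bullet> i) * \<theta> z)"
  \<comment> \<open>A basis vector of space-time is either spatial, where the weak gradient of
    \<psi> is used slice by slice, or the time direction, where the ramp is integrated by
    parts.\<close>
  proof (cases "fst i = 0")
   case True
   then obtain j where j: "i = (0, j)" "j \<in> Basis" using i by (auto simp: Basis_prod_def)
   have "(LBINT z. ?p z * dd \<theta> z i) = (LBINT r. LBINT x. ramp t k r * (\<psi> x * dd \<theta> (r, x) (0, j)))"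
    using integral_slice(1)[OF I1[of i]] by (simp add: j(1) mult.assoc)
   also have "\<dots> = (LBINT r. - (LBINT x. ((ramp t k r *\<^sub>R \<Psi> x) \<bullet> j) * \<theta> (r, x)))"
    using wgradD[OF p(3) test_fun_slice(1)[OF th] j(2)] by (simp add: test_fun_slice(2)[OF th] mult.assoc)
   also have "\<dots> = - (LBINT z. (?px z \<bullet> j) * \<theta> z)"
    using integral_slice(1)[OF I3[OF j(2)]] by simp
   finally show ?thesis by (simp add: j(1))
  next
   case False
   then have i1: "i = (1, 0)" using i by (auto simp: Basis_prod_def)
   have "(LBINT z. ?p z * dd \<theta> z i) = (LBINT r. LBINT x. ramp t k r * \<psi> x * dd \<theta> (r, x) (1, 0))"
    using integral_slice(1)[OF I1[of i]] by (simp add: i1)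
   also have "\<dots> = (LBINT x. LBINT r. \<psi> x * (ramp t k r * dd \<theta> (r, x) (1, 0)))"
    using integral_swap[OF I1[of "(1, 0)"]] by (simp add: mult_ac)
   also have "\<dots> = (LBINT x. LBINT r. - (ramp' t k r * \<psi> x * \<theta> (r, x)))"
    using ramp_by_parts[OF k test_fun_slice(3)[OF th], of t] by (simp add: test_fun_slice(4)[OF th] mult_ac)
   also have "\<dots> = - (LBINT z. ?pt z * \<theta> z)"
    using integral_swap[OF I2] integral_slice(1)[OF I2] by simp
   finally show ?thesis by (simp add: i1)
  qed
  then show "(LINT z|lebesgue_on ?C. ?p z * dd \<theta> z i) = - (LINT z|lebesgue_on ?C. ((?pt z, ?px z) \<bullet> i) * \<theta> z)"
   unfolding l rr .
 qed
 have d: "C_L2 T U (%r x. ramp t k r * \<psi> x)"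
  unfolding C_L2_def
 proof (intro conjI ballI)
  fix s
  have "L2 (%x. ind U x *\<^sub>R (ramp t k s * \<psi> x))" using L2_cmult[OF pU(1), of "ramp t k s"] by (simp add: mult_ac)
  then show "sq_int U (%x. ramp t k s * \<psi> x)" using L2_sq_int[OF Ub, of "%x. ramp t k s * \<psi> x"] by (simp add: sq_int_vec_real)
  have "((%r. (ramp t k r - ramp t k s)\<^sup>2 * (LINT x|lebesgue_on U. (\<psi> x)\<^sup>2)) \<longlongrightarrow> (ramp t k s - ramp t k s)\<^sup>2 * (LINT x|lebesgue_on U. (\<psi> x)\<^sup>2)) (at s within {0..T})"
   using ramp_continuous[of UNIV t k] by (intro tendsto_intros) (auto simp: continuous_on_eq_continuous_at isCont_def intro: tendsto_within_subset)
  moreover have "(LINT x|lebesgue_on U. (ramp t k r * \<psi> x - ramp t k s * \<psi> x)\<^sup>2) = (ramp t k r - ramp t k s)\<^sup>2 * (LINT x|lebesgue_on U. (\<psi> x)\<^sup>2)" for r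
   by (simp add: left_diff_distrib[symmetric] power_mult_distrib)
  ultimately show "((%r. LINT x|lebesgue_on U. (ramp t k r * \<psi> x - ramp t k s * \<psi> x)\<^sup>2) \<longlongrightarrow> 0) (at s within {0..T})" by simp
 qed
 show ?thesis unfolding H1_test_def H1_with_grad_def using a b c d by blast
qed

section \<open>Weak solutions with Borel representatives\<close>

text \<open>The form in which solutions are used from here on. v and G are Borel in space-time and
  vanish outside the cylinder, v being bounded everywhere; w is the L2-continuous representative,
  defined for all real times, and agrees with v at almost every time in (0, T). The last clause is
  the equation integrated over (0, t), with test functions that do not depend on time.\<close>

definition clean_sol :: "'n::euclidean_space set => ('n => real) => (real => real) => ('n => real) => real
  => (real \<times> 'n => real) => (real \<times> 'n => 'n) => (real => 'n => real) => bool" where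
 "clean_sol U D f u0 T v G w \<longleftrightarrow>
   v \<in> borel_fun \<and> (\<exists>K. \<forall>z. \<bar>v z\<bar> \<le> K) \<and> L2 G \<and>
   (\<forall>z. z \<notin> cyl T U --> v z = 0 \<and> G z = 0) \<and>
   (AE t in lborel. t \<in> {0<..<T} --> wgrad U (%x. v (t, x)) (%x. G (t, x)) \<and> (AE x in lborel. v (t, x) = w t x)) \<and>
   (\<forall>t. L2 (w t)) \<and> (\<forall>t x. x \<notin> U --> w t x = 0) \<and>
   (\<forall>t. ((%s. sqn (%x. w s x - w t x)) \<longlongrightarrow> 0) (at t)) \<and>
   (AE x in lborel. x \<in> U --> w 0 x = u0 x) \<and>
   (\<forall>\<psi> \<Psi> t. H1 U \<psi> \<Psi> \<and> t \<in> {0..<T} -->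
    (LBINT x. w t x * \<psi> x) = (LBINT x. w 0 x * \<psi> x) +
    (LBINT z. ind {0..t} (fst z) * (f (v z) * \<psi> (snd z) - D (snd z) * (G z \<bullet> \<Psi> (snd z)))))"

lemma measurable_AE_lebesgue_on:
 fixes h h' :: "'n::euclidean_space => 'b::euclidean_space"
 assumes h': "h' \<in> borel_fun" and ae: "AE x in lborel. x \<in> U --> h' x = h x" and U: "U \<in> sets borel"
 shows "h \<in> borel_measurable (lebesgue_on U)"
proof -
 have "(%x. ind U x *\<^sub>R h x) \<in> borel_measurable lebesgue"
 proof (rule borel_measurable_AE)
  show "(%x. ind U x *\<^sub>R h' x) \<in> borel_measurable lebesgue"
   using h' U by (intro measurable_completion) simp
  have "AE x in lborel. ind U x *\<^sub>R h' x = ind U x *\<^sub>R h x"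
   using ae by eventually_elim (auto simp: indicator_def)
  then show "AE x in lebesgue. ind U x *\<^sub>R h' x = ind U x *\<^sub>R h x" by (rule AE_completion)
 qed
 then show ?thesis using U by (subst borel_measurable_restrict_space_iff) auto
qed

lemma wgrad_cong_AE:
 assumes w: "weak_grad U g G" and U: "open U"
  and g: "g \<in> borel_measurable (lebesgue_on U)" and G: "G \<in> borel_measurable (lebesgue_on U)"
  and g': "g' \<in> borel_fun" "AE x in lborel. x \<in> U --> g' x = g x"
  and G': "G' \<in> borel_fun" "AE x in lborel. x \<in> U --> G' x = G x"
 shows "wgrad U g' G'"
 unfolding wgrad_def
proof (intro allI impI ballI)
 fix \<psi> i assume p: "test_fun U \<psi>" and i: "i \<in> (Basis :: 'a set)"
 note [measurable] = g'(1) G'(1) test_fun_measurable[OF p] test_fun_measurable[OF test_fun_dd[OF p]]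
 have Ub: "U \<in> sets borel" using U by simp
 have z0: "\<psi> z = 0" "dd \<psi> z v = 0" if "z \<notin> U" for z v
 proof -
  have "z \<notin> closure {z. \<psi> z \<noteq> 0}" using that test_fun_subset[OF p] by blast
  then show "\<psi> z = 0" "dd \<psi> z v = 0" by (rule test_fun_zero, rule test_fun_dd_zero)
 qed
 have "(LBINT x. g' x * dd \<psi> x i) = (LINT x|lebesgue_on U. g x * dd \<psi> x i)"
 proof (rule lebesgue_on_integral(1)[OF Ub, symmetric])
  show "(%x. g x * dd \<psi> x i) \<in> borel_measurable (lebesgue_on U)"
   by (intro borel_measurable_times g lebesgue_on_borel test_fun_measurable[OF test_fun_dd[OF p]])
  show "AE x in lborel. x \<in> U --> g' x * dd \<psi> x i = g x * dd \<psi> x i" using g'(2) by eventually_elim simp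
 qed (use z0 in auto)
 also have "\<dots> = - (LINT x|lebesgue_on U. (G x \<bullet> i) * \<psi> x)" using w p i unfolding weak_grad_def by blast
 also have "(LINT x|lebesgue_on U. (G x \<bullet> i) * \<psi> x) = (LBINT x. (G' x \<bullet> i) * \<psi> x)"
 proof (rule lebesgue_on_integral(1)[OF Ub])
  show "(%x. (G x \<bullet> i) * \<psi> x) \<in> borel_measurable (lebesgue_on U)"
   by (intro borel_measurable_times borel_measurable_inner G borel_measurable_const lebesgue_on_borel test_fun_measurable[OF p])
  show "AE x in lborel. x \<in> U --> (G' x \<bullet> i) * \<psi> x = (G x \<bullet> i) * \<psi> x" using G'(2) by eventually_elim simp
 qed (use z0 in auto)
 finally show "(LBINT x. g' x * dd \<psi> x i) = - (LBINT x. (G' x \<bullet> i) * \<psi> x)" .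
qed

lemma wgrad_cong_borel:
 assumes w: "weak_grad U g G" and U: "open U"
  and g': "g' \<in> borel_fun" "AE x in lborel. x \<in> U --> g' x = g x"
  and G': "G' \<in> borel_fun" "AE x in lborel. x \<in> U --> G' x = G x"
 shows "wgrad U g' G'"
proof (rule wgrad_cong_AE[OF w U _ _ g' G'])
 have Ub: "U \<in> sets borel" using U by simp
 show "g \<in> borel_measurable (lebesgue_on U)" by (rule measurable_AE_lebesgue_on[OF g' Ub])
 show "G \<in> borel_measurable (lebesgue_on U)" by (rule measurable_AE_lebesgue_on[OF G' Ub])
qed

text \<open>Projection of times onto [0, T]. It extends the L2-continuous representative beyond
  [0, T], so that energies become continuous functions on the whole line.\<close>

definition clip :: "real => real => real" where
 "clip T s = max 0 (min T s)"

lemma clip_in: "0 \<le> T ==> clip T s \<in> {0..T}"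
 by (auto simp: clip_def)

lemma clip_id: "s \<in> {0..T} ==> clip T s = s"
 by (auto simp: clip_def)

lemma clip_continuous: "continuous_on A (clip T)"
 unfolding clip_def[abs_def] by (intro continuous_intros)

text \<open>The weak formulation is tested with a ramp that falls on [t, t + k] times \<psi>. The
  term with the time derivative is a mean of the continuous function r -> integral of w r times
  \<psi>, and k -> 0 gives its value at t. The initial datum is recovered from t = 0 and the
  fundamental lemma.\<close>

lemma clean_sol_exists:
 fixes U :: "'n::euclidean_space set"
 assumes U: "open U" "bounded U" and T: "T > 0" and D: "D \<in> borel_fun" "!!x. \<bar>D x\<bar> \<le> C0"
  and f: "continuous_on UNIV f" "f 0 = 0" and u0: "continuous_on (closure U) u0"
  and sol: "weak_sol U D f u0 T u"
 obtains v G w where "clean_sol U D f u0 T v G w" "AE z in lborel. z \<in> cyl T U --> v z = u (fst z) (snd z)"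
proof -
 let ?C = "cyl T U"
 have Ub: "U \<in> sets borel" using U by simp
 have Cb: "?C \<in> sets borel" using cyl_open[OF U(1)] by (rule borel_open)
 have cont: "C_L2 T U u" and um: "(%z. u (fst z) (snd z)) \<in> borel_measurable (lebesgue_on ?C)"
  using sol by (auto simp: weak_sol_def)
 obtain K where K: "AE z in lebesgue_on ?C. \<bar>u (fst z) (snd z)\<bar> \<le> K" using sol unfolding weak_sol_def by blast
 obtain G0 where G0: "sq_int_vec ?C (%z. G0 (fst z) (snd z))"
  and wg: "AE t in lebesgue_on {0<..<T}. weak_grad U (u t) (G0 t)"
  and eq: "!!\<phi> \<Phi>t \<Phi>x. H1_test T U \<phi> \<Phi>t \<Phi>x ==>
      (LINT z|lebesgue_on ?C. - u (fst z) (snd z) * \<Phi>t (fst z) (snd z)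
        + D (snd z) * (G0 (fst z) (snd z) \<bullet> \<Phi>x (fst z) (snd z)) - f (u (fst z) (snd z)) * \<phi> (fst z) (snd z))
      = (LINT x|lebesgue_on U. u0 x * \<phi> 0 x) - (LINT x|lebesgue_on U. u T x * \<phi> T x)"
  using sol unfolding weak_sol_def by blast
 have G0m: "(%z. G0 (fst z) (snd z)) \<in> borel_measurable (lebesgue_on ?C)" using G0 by (simp add: sq_int_vec_def)
 obtain v0 where v0: "v0 \<in> borel_fun" "!!z. z \<notin> ?C ==> v0 z = 0" "AE z in lborel. z \<in> ?C --> v0 z = u (fst z) (snd z)"
  by (rule borel_representative[OF um Cb]) (rule that, assumption+)
 obtain G where G: "G \<in> borel_fun" "!!z. z \<notin> ?C ==> G z = 0" "AE z in lborel. z \<in> ?C --> G z = G0 (fst z) (snd z)"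
  by (rule borel_representative[OF G0m Cb]) (rule that, assumption+)
 \<comment> \<open>Resetting the values above the bound to 0 changes v on a null set and makes it
   bounded everywhere.\<close>
 define v where "v z = (if \<bar>v0 z\<bar> \<le> K then v0 z else 0)" for z
 have vm[measurable]: "v \<in> borel_fun" unfolding v_def[abs_def] using v0(1) by measurable
 have vK: "\<bar>v z\<bar> \<le> \<bar>K\<bar>" for z unfolding v_def by auto
 have vz: "v z = 0" if "z \<notin> ?C" for z using v0(2)[OF that] by (simp add: v_def)
 have vu: "AE z in lborel. z \<in> ?C --> v z = u (fst z) (snd z)"
  using v0(3) K[unfolded AE_lebesgue_on_iff[OF Cb]] by eventually_elim (auto simp: v_def)
 note [measurable] = G(1)
 have GL: "L2 G"
 proof -
  have "integrable (lebesgue_on ?C) (%z. (norm (G0 (fst z) (snd z)))\<^sup>2)" using G0 by (simp add: sq_int_vec_def)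
  moreover have "integrable (lebesgue_on ?C) (%z. (norm (G0 (fst z) (snd z)))\<^sup>2) \<longleftrightarrow> integrable lborel (%z. (norm (G z))\<^sup>2)"
  proof (rule lebesgue_on_integral(2)[OF Cb])
   show "(%z. (norm (G z))\<^sup>2) \<in> borel_fun" by measurable
   show "(%z. (norm (G0 (fst z) (snd z)))\<^sup>2) \<in> borel_measurable (lebesgue_on ?C)" using G0m by measurable
   show "AE z in lborel. z \<in> ?C --> (norm (G z))\<^sup>2 = (norm (G0 (fst z) (snd z)))\<^sup>2" using G(3) by eventually_elim simp
  qed (simp add: G(2))
  ultimately show ?thesis using G(1) by (simp add: L2_def)
 qed
 have "\<exists>h. h \<in> borel_fun \<and> (\<forall>x. x \<notin> U --> h x = 0) \<and> (AE x in lborel. x \<in> U --> h x = u (clip T t) x)" for t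
 proof -
  have "u (clip T t) \<in> borel_measurable (lebesgue_on U)"
   using cont clip_in[of T t] T unfolding C_L2_def sq_int_def by auto
  then show ?thesis by (rule borel_representative[OF _ Ub]) blast
 qed
 then obtain w where w: "!!t. w t \<in> borel_fun" "!!t x. x \<notin> U ==> w t x = 0"
  "!!t. AE x in lborel. x \<in> U --> w t x = u (clip T t) x" by metis
 note [measurable] = w(1)
 have usq: "sq_int U (u (clip T t))" for t using cont clip_in[of T t] T unfolding C_L2_def by auto
 have um': "u (clip T t) \<in> borel_measurable (lebesgue_on U)" for t using usq by (simp add: sq_int_def)
 have wL: "L2 (w t)" for t
 proof -
  have "integrable (lebesgue_on U) (%x. (u (clip T t) x)\<^sup>2) \<longleftrightarrow> integrable lborel (%x. (w t x)\<^sup>2)"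
  proof (rule lebesgue_on_integral(2)[OF Ub])
   show "(%x. (w t x)\<^sup>2) \<in> borel_fun" by measurable
   show "(%x. (u (clip T t) x)\<^sup>2) \<in> borel_measurable (lebesgue_on U)" using um' by measurable
   show "AE x in lborel. x \<in> U --> (w t x)\<^sup>2 = (u (clip T t) x)\<^sup>2" using w(3)[of t] by eventually_elim simp
  qed (simp add: w(2))
  then show ?thesis using usq by (simp add: L2_def sq_int_def)
 qed
 have sqw: "sqn (%x. w s x - w t x) = (LINT x|lebesgue_on U. (u (clip T s) x - u (clip T t) x)\<^sup>2)" for s t
  unfolding sqn_real
 proof (rule lebesgue_on_integral(1)[OF Ub, symmetric])
  show "(%x. (w s x - w t x)\<^sup>2) \<in> borel_fun" by measurable
  show "(%x. (u (clip T s) x - u (clip T t) x)\<^sup>2) \<in> borel_measurable (lebesgue_on U)" using um' by measurable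
  show "AE x in lborel. x \<in> U --> (w s x - w t x)\<^sup>2 = (u (clip T s) x - u (clip T t) x)\<^sup>2"
   using w(3)[of s] w(3)[of t] by eventually_elim simp
 qed (simp add: w(2))
 have wcont: "((%s. sqn (%x. w s x - w t x)) \<longlongrightarrow> 0) (at t)" for t
 proof -
  let ?F = "%s. LINT x|lebesgue_on U. (u s x - u (clip T t) x)\<^sup>2"
  have F0: "?F (clip T t) = 0" by simp
  have "(?F \<longlongrightarrow> ?F (clip T t)) (at (clip T t) within {0..T})"
   unfolding F0 using cont clip_in[of T t] T unfolding C_L2_def by auto
  then have "continuous (at (clip T t) within {0..T}) ?F" by (simp add: continuous_within)
  then have c1: "continuous (at (clip T t) within range (clip T)) ?F"
   by (rule continuous_within_subset) (use clip_in T in auto)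
  have c2: "continuous (at t within UNIV) (clip T)"
   using clip_continuous[of UNIV T] by (simp add: continuous_on_eq_continuous_within)
  have "continuous (at t within UNIV) (%s. ?F (clip T s))"
   by (rule continuous_within_compose2[OF c2 c1])
  then show ?thesis unfolding sqw by (simp add: continuous_within)
 qed
 have AEslice: "AE t in lborel. t \<in> {0<..<T} --> wgrad U (%x. v (t, x)) (%x. G (t, x)) \<and> (AE x in lborel. v (t, x) = w t x)"
 proof -
  have a: "AE t in lborel. AE x in lborel. (t, x) \<in> ?C --> v (t, x) = u t x" using AE_slice[OF vu] by simp
  have b: "AE t in lborel. AE x in lborel. (t, x) \<in> ?C --> G (t, x) = G0 t x" using AE_slice[OF G(3)] by simp
  have c: "AE t in lborel. t \<in> {0<..<T} --> weak_grad U (u t) (G0 t)" using wg by (subst (asm) AE_lebesgue_on_iff) auto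
  show ?thesis using a b c
  proof eventually_elim
   case (elim t)
   show ?case
   proof (intro impI conjI)
    assume t: "t \<in> {0<..<T}"
    have va: "AE x in lborel. x \<in> U --> v (t, x) = u t x" using elim(1) by eventually_elim (use t in \<open>auto simp: cyl_def\<close>)
    have Ga: "AE x in lborel. x \<in> U --> G (t, x) = G0 t x" using elim(2) by eventually_elim (use t in \<open>auto simp: cyl_def\<close>)
    have wgt: "weak_grad U (u t) (G0 t)" using elim(3) t by blast
    show "wgrad U (%x. v (t, x)) (%x. G (t, x))"
     by (rule wgrad_cong_borel[OF wgt U(1) measurable_slice(1)[OF vm] va measurable_slice(1)[OF G(1)] Ga])
    have ct: "clip T t = t" using t by (intro clip_id) auto
    show "AE x in lborel. v (t, x) = w t x"
     using va w(3)[of t]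
    proof eventually_elim
     case (elim x)
     show ?case using elim ct vz[of "(t, x)"] w(2)[of x t] by (cases "x \<in> U") (auto simp: cyl_def)
    qed
   qed
  qed
 qed
 define F where "F \<psi> \<Psi> z = f (v z) * \<psi> (snd z) - D (snd z) * (G z \<bullet> \<Psi> (snd z))" for \<psi> :: "'n => real" and \<Psi> :: "'n => 'n" and z :: "real \<times> 'n"
 have fm[measurable]: "f \<in> borel_fun" using f(1) by (rule borel_measurable_continuous_onI)
 note [measurable] = D(1)
 obtain Kf where Kf: "!!z. \<bar>f (v z)\<bar> \<le> Kf"
 proof -
  have "bounded (f ` {-\<bar>K\<bar>..\<bar>K\<bar>})"
   by (intro compact_imp_bounded compact_continuous_image continuous_on_subset[OF f(1)]) auto
  then obtain B where B: "\<forall>y\<in>f ` {-\<bar>K\<bar>..\<bar>K\<bar>}. norm y \<le> B" unfolding bounded_iff by blast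
  have "v z \<in> {-\<bar>K\<bar>..\<bar>K\<bar>}" for z using vK[of z] by (auto simp: abs_le_iff)
  then have "\<bar>f (v z)\<bar> \<le> B" for z using B by (metis imageI real_norm_def)
  then show ?thesis by (rule that)
 qed
 have bC: "bounded ?C" unfolding cyl_def using U(2) by (intro bounded_Times) auto
 have fvL: "L2 (%z. f (v z))" by (rule L2_bounded_support[OF _ _ bC, of _ Kf]) (use Kf vz f(2) in auto)
 have vL: "L2 v" by (rule L2_bounded_support[OF vm _ bC, of "\<bar>K\<bar>"]) (use vK vz in auto)
 have indT: "L2 (%r. ind {0<..<T} r :: real)" by (rule L2_bounded_support[of _ 1 "{0<..<T}"]) (auto simp: indicator_def)
 have FI: "integrable lborel (F \<psi> \<Psi>)" and FI1: "integrable lborel (%z. v z * \<psi> (snd z))" if H: "H1 U \<psi> \<Psi>" for \<psi> \<Psi>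
 proof -
  have p: "L2 \<psi>" "L2 \<Psi>" using H by (auto simp: H1_def)
  have P: "L2 (%z. ind {0<..<T} (fst z) *\<^sub>R \<psi> (snd z))" "L2 (%z. ind {0<..<T} (fst z) *\<^sub>R \<Psi> (snd z))"
   by (rule L2_product[OF indT p(1)], rule L2_product[OF indT p(2)])
  have DG: "L2 (%z. D (snd z) *\<^sub>R G z)" by (rule L2_mult_bounded[OF GL _ D(2)]) measurable
  have "integrable lborel (%z. f (v z) * (ind {0<..<T} (fst z) *\<^sub>R \<psi> (snd z)) - (D (snd z) *\<^sub>R G z) \<bullet> (ind {0<..<T} (fst z) *\<^sub>R \<Psi> (snd z)))"
   by (intro lintegrable_diff L2_mult_integrable L2_inner_integrable fvL P DG)
  moreover have "f (v z) * (ind {0<..<T} (fst z) *\<^sub>R \<psi> (snd z)) - (D (snd z) *\<^sub>R G z) \<bullet> (ind {0<..<T} (fst z) *\<^sub>R \<Psi> (snd z)) = F \<psi> \<Psi> z" for z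
   using vz[of z] G(2)[of z] f(2) unfolding F_def by (cases "fst z \<in> {0<..<T}") (auto simp: cyl_def mem_Times_iff)
  ultimately show "integrable lborel (F \<psi> \<Psi>)" by (simp only:)
  have "integrable lborel (%z. v z * (ind {0<..<T} (fst z) *\<^sub>R \<psi> (snd z)))"
   by (intro L2_mult_integrable vL P)
  moreover have "v z * (ind {0<..<T} (fst z) *\<^sub>R \<psi> (snd z)) = v z * \<psi> (snd z)" for z
   using vz[of z] by (cases "fst z \<in> {0<..<T}") (auto simp: cyl_def mem_Times_iff)
  ultimately show "integrable lborel (%z. v z * \<psi> (snd z))" by (simp only:)
 qed
 define u1 where "u1 x = ind U x * u0 x" for x
 have u1m: "u1 \<in> borel_fun"
 proof -
  have "(%x. ind (closure U) x *\<^sub>R u0 x) \<in> borel_fun"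
   by (rule borel_measurable_continuous_on_indicator[OF _ u0]) simp
  then have "(%x. ind U x * (ind (closure U) x *\<^sub>R u0 x)) \<in> borel_fun" using Ub by measurable
  moreover have "ind U x * (ind (closure U) x *\<^sub>R u0 x) = u1 x" for x
   using closure_subset[of U] by (auto simp: u1_def indicator_def)
  ultimately show ?thesis by simp
 qed
 have u1L: "L2 u1"
 proof -
  have "bounded (u0 ` closure U)" using U(2) by (intro compact_imp_bounded compact_continuous_image u0) (simp add: compact_closure)
  then obtain B where B: "!!x. x \<in> closure U ==> norm (u0 x) \<le> B" unfolding bounded_iff by blast
  have "norm (u1 x) \<le> \<bar>B\<bar>" for x
   using B[of x] closure_subset[of U] by (cases "x \<in> U") (force simp: u1_def)+
  then show ?thesis by (rule L2_bounded_support[OF u1m _ U(2)]) (simp add: u1_def)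
 qed
 have W: "(LBINT x. w t x * \<psi> x) = (LBINT x. u1 x * \<psi> x) + (LBINT z. ind {0..t} (fst z) * F \<psi> \<Psi> z)"
  if H: "H1 U \<psi> \<Psi>" and t: "t \<in> {0..<T}" for \<psi> \<Psi> t
 proof -
  have p: "L2 \<psi>" "L2 \<Psi>" using H by (auto simp: H1_def)
  note [measurable] = L2_measurable[OF p(1)] L2_measurable[OF p(2)]
  define m where "m r = (LBINT x. w r x * \<psi> x)" for r
  have mc: "continuous_on UNIV m"
  proof -
   have "(m \<longlongrightarrow> m s) (at s)" for s
   proof -
    have b: "norm (m r - m s) \<le> sqrt (sqn (%x. w r x - w s x)) * sqrt (sqn \<psi>)" for r
    proof -
     have "m r - m s = (LBINT x. (w r x - w s x) \<bullet> \<psi> x)"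
      unfolding m_def using L2_mult_integrable[OF wL p(1)] by (simp add: left_diff_distrib)
     then show ?thesis using L2_inner_le[OF L2_diff[OF wL[of r] wL[of s]] p(1)] by simp
    qed
    have "((%r. sqrt (sqn (%x. w r x - w s x)) * sqrt (sqn \<psi>)) \<longlongrightarrow> sqrt 0 * sqrt (sqn \<psi>)) (at s)"
     by (intro tendsto_intros wcont)
    then have "((%r. sqrt (sqn (%x. w r x - w s x)) * sqrt (sqn \<psi>)) \<longlongrightarrow> 0) (at s)" by simp
    then have "((%r. m r - m s) \<longlongrightarrow> 0) (at s)"
     by (rule Lim_null_comparison[OF always_eventually, rotated]) (intro allI b)
    then show ?thesis by (rule LIM_zero_cancel)
   qed
   then show ?thesis by (simp add: continuous_on_eq_continuous_at isCont_def)
  qed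
  \<comment> \<open>The ramp has ended by time T, hence its trace at T is 0 and the final value of u
    drops out of the equation.\<close>
  define k where "k n = (T - t) * inverse (real (Suc n))" for n
  have k0: "k n > 0" and kT: "t + k n \<le> T" for n
  proof -
   have "inverse (real (Suc n)) \<le> 1" by (simp add: inverse_le_1_iff)
   then have "(T - t) * inverse (real (Suc n)) \<le> (T - t) * 1" using t by (intro mult_left_mono) auto
   then show "t + k n \<le> T" by (simp add: k_def)
   show "k n > 0" using t by (simp add: k_def)
  qed
  have klim: "k \<longlonglongrightarrow> 0"
   unfolding k_def using tendsto_mult[OF tendsto_const[of "T - t"] LIMSEQ_inverse_real_of_nat] by simp
  have step: "(LBINT r:{t..t + k n}. m r) / k n = (LBINT x. u1 x * \<psi> x) + (LBINT z. ramp t (k n) (fst z) * F \<psi> \<Psi> z)" for n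
  proof -
   let ?\<rho> = "ramp t (k n)" and ?\<rho>' = "ramp' t (k n)"
   have T0: "?\<rho> T = 0" "?\<rho> 0 = 1" using kT[of n] k0[of n] t by (auto simp: ramp_def min_def max_def field_simps)
   have R: "integrable lborel (%z. ?\<rho> (fst z) * F \<psi> \<Psi> z)"
   proof (rule lintegrable_bound[OF FI[OF H]])
    show "(%z. ?\<rho> (fst z) * F \<psi> \<Psi> z) \<in> borel_measurable lborel" using FI[OF H] by measurable
    show "AE z in lborel. norm (?\<rho> (fst z) * F \<psi> \<Psi> z) \<le> norm (F \<psi> \<Psi> z)"
     using ramp_bounds(3) by (intro AE_I2) (simp add: abs_mult mult_left_le_one_le)
   qed
   have R': "integrable lborel (%z. ?\<rho>' (fst z) * (v z * \<psi> (snd z)))"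
   proof (rule lintegrable_bound[of _ "%z. (1 / k n) * (v z * \<psi> (snd z))"])
    show "integrable lborel (%z. (1 / k n) * (v z * \<psi> (snd z)))" using FI1[OF H] by (rule integrable_mult_right)
    show "(%z. ?\<rho>' (fst z) * (v z * \<psi> (snd z))) \<in> borel_measurable lborel" by measurable
    show "AE z in lborel. norm (?\<rho>' (fst z) * (v z * \<psi> (snd z))) \<le> norm ((1 / k n) * (v z * \<psi> (snd z)))"
    proof (intro AE_I2)
     fix z :: "real \<times> 'n"
     have "\<bar>?\<rho>' (fst z)\<bar> * \<bar>v z * \<psi> (snd z)\<bar> \<le> (1 / k n) * \<bar>v z * \<psi> (snd z)\<bar>"
      by (rule mult_right_mono[OF ramp_bounds(4)[OF k0]]) simp
     then show "norm (?\<rho>' (fst z) * (v z * \<psi> (snd z))) \<le> norm ((1 / k n) * (v z * \<psi> (snd z)))"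
      using k0[of n] by (simp add: abs_mult)
    qed
   qed
   let ?h = "%z. - v z * (?\<rho>' (fst z) * \<psi> (snd z)) + D (snd z) * (G z \<bullet> (?\<rho> (fst z) *\<^sub>R \<Psi> (snd z))) - f (v z) * (?\<rho> (fst z) * \<psi> (snd z))"
   have hm: "?h \<in> borel_fun" by measurable
   have ae: "AE z in lborel. z \<in> ?C --> ?h z = - u (fst z) (snd z) * (?\<rho>' (fst z) * \<psi> (snd z))
        + D (snd z) * (G0 (fst z) (snd z) \<bullet> (?\<rho> (fst z) *\<^sub>R \<Psi> (snd z))) - f (u (fst z) (snd z)) * (?\<rho> (fst z) * \<psi> (snd z))"
    using vu G(3) by eventually_elim simp
   have "(LBINT z. ?h z) = (LINT z|lebesgue_on ?C. - u (fst z) (snd z) * (?\<rho>' (fst z) * \<psi> (snd z))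
        + D (snd z) * (G0 (fst z) (snd z) \<bullet> (?\<rho> (fst z) *\<^sub>R \<Psi> (snd z))) - f (u (fst z) (snd z)) * (?\<rho> (fst z) * \<psi> (snd z)))"
    by (rule lebesgue_on_integral(1)[OF Cb hm _ measurable_AE_lebesgue_on[OF hm ae Cb] ae, symmetric]) (simp add: vz G(2) f(2))
   also have "\<dots> = (LINT x|lebesgue_on U. u0 x * (?\<rho> 0 * \<psi> x)) - (LINT x|lebesgue_on U. u T x * (?\<rho> T * \<psi> x))"
    by (rule eq[OF ramp_H1_test[OF U(1) H k0]])
   also have "\<dots> = (LINT x|lebesgue_on U. u0 x * \<psi> x)" unfolding T0 by simp
   also have "\<dots> = (LBINT x. u1 x * \<psi> x)"
   proof (rule lebesgue_on_integral(1)[OF Ub])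
    show m: "(%x. u1 x * \<psi> x) \<in> borel_fun" using u1m by measurable
    show "AE x in lborel. x \<in> U --> u1 x * \<psi> x = u0 x * \<psi> x" by (intro AE_I2) (simp add: u1_def)
    from measurable_AE_lebesgue_on[OF m this Ub] show "(%x. u0 x * \<psi> x) \<in> borel_measurable (lebesgue_on U)" .
   qed (simp add: u1_def)
   finally have A: "(LBINT z. ?h z) = (LBINT x. u1 x * \<psi> x)" .
   have hz: "?h z = - (?\<rho>' (fst z) * (v z * \<psi> (snd z)) + ?\<rho> (fst z) * F \<psi> \<Psi> z)" for z
    by (simp add: F_def algebra_simps)
   have "(LBINT z. ?h z) = - ((LBINT z. ?\<rho>' (fst z) * (v z * \<psi> (snd z))) + (LBINT z. ?\<rho> (fst z) * F \<psi> \<Psi> z))"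
    unfolding hz lint_minus lint_add[OF R' R] ..
   moreover have "(LBINT z. ?\<rho>' (fst z) * (v z * \<psi> (snd z))) = - ((LBINT r:{t..t + k n}. m r) / k n)"
   proof -
    have "(LBINT z. ?\<rho>' (fst z) * (v z * \<psi> (snd z))) = (LBINT r. ?\<rho>' r * (LBINT x. v (r, x) * \<psi> x))"
     using integral_slice(1)[OF R'] by simp
    also have "\<dots> = (LBINT r. - (1 / k n) * (ind {t..t + k n} r * m r))"
    proof (rule integral_cong_AE)
     show "(%r. ?\<rho>' r * (LBINT x. v (r, x) * \<psi> x)) \<in> borel_measurable lborel"
      using integral_slice(2)[OF R'] by simp
     show "(%r. - (1 / k n) * (ind {t..t + k n} r * m r)) \<in> borel_measurable lborel"
      using borel_measurable_continuous_onI[OF mc] by measurable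
     show "AE r in lborel. ?\<rho>' r * (LBINT x. v (r, x) * \<psi> x) = - (1 / k n) * (ind {t..t + k n} r * m r)"
      \<comment> \<open>The averaging interval is closed and may contain 0 or T, whereas the
        comparison of v with w concerns the open interval.\<close>
      using AEslice AE_lborel_singleton[of 0] AE_lborel_singleton[of T]
     proof eventually_elim
      case (elim r)
      show ?case
      proof (cases "r \<in> {t..t + k n}")
       case True
       then have "r \<in> {0<..<T}" using elim(2,3) t kT[of n] by (auto simp: less_le)
       then have "AE x in lborel. v (r, x) = w r x" using elim(1) by blast
       then have "(LBINT x. v (r, x) * \<psi> x) = m r"
        unfolding m_def by (intro integral_cong_AE) auto
       then show ?thesis using True by (simp add: ramp'_def)
      qed (simp add: ramp'_def)
     qed
    qed
    also have "\<dots> = - ((LBINT r:{t..t + k n}. m r) / k n)"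
     unfolding integral_mult_right_zero by (simp add: set_lebesgue_integral_def)
    finally show ?thesis .
   qed
   ultimately show ?thesis using A by simp
  qed
  obtain M where M: "!!x. x \<in> {t-1<..<T+1} ==> (M has_real_derivative m x) (at x)"
   using continuous_antiderivative[OF mc] by blast
  have Mk: "(LBINT r:{t..t + k n}. m r) = M (t + k n) - M t" for n
   using k0[of n] kT[of n] by (intro lborel_FTC M) (auto intro: continuous_on_subset[OF mc])
  have "((%h. (M (t + h) - M t) / h) \<longlongrightarrow> m t) (at 0)"
   using M[of t] t by (simp add: DERIV_def)
  moreover have "filterlim k (at 0) sequentially"
   unfolding filterlim_at using klim order_less_imp_not_eq2[OF k0] by simp
  ultimately have l1: "(%n. (M (t + k n) - M t) / k n) \<longlonglongrightarrow> m t" by (rule filterlim_compose)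
  have l2: "(%n. LBINT z. ramp t (k n) (fst z) * F \<psi> \<Psi> z) \<longlonglongrightarrow> (LBINT z. ind {0..t} (fst z) * F \<psi> \<Psi> z)"
  proof (rule lint_dominated_convergence[where w = "%z. norm (F \<psi> \<Psi> z)"])
   show "AE z in lborel. (%n. ramp t (k n) (fst z) * F \<psi> \<Psi> z) \<longlonglongrightarrow> ind {0..t} (fst z) * F \<psi> \<Psi> z"
   proof (intro AE_I2)
    fix z :: "real \<times> 'n"
    consider "fst z \<le> t" "0 \<le> fst z" | "fst z < 0" | "t < fst z" by linarith
    then show "(%n. ramp t (k n) (fst z) * F \<psi> \<Psi> z) \<longlonglongrightarrow> ind {0..t} (fst z) * F \<psi> \<Psi> z"
    proof cases
     case 1
     then have "ramp t (k n) (fst z) = 1" for n using k0[of n] by (auto simp: ramp_def min_def max_def field_simps)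
     then show ?thesis using 1 by simp
    next
     case 2
     then have "z \<notin> ?C" by (auto simp: cyl_def mem_Times_iff)
     then have "F \<psi> \<Psi> z = 0" by (simp add: F_def vz G(2) f(2))
     then show ?thesis by simp
    next
     case 3
     have "\<forall>\<^sub>F n in sequentially. k n < fst z - t" using klim 3 by (intro order_tendstoD) auto
     then have "\<forall>\<^sub>F n in sequentially. ramp t (k n) (fst z) * F \<psi> \<Psi> z = ind {0..t} (fst z) * F \<psi> \<Psi> z"
      by eventually_elim (use 3 k0 in \<open>auto simp: ramp_def min_def max_def field_simps\<close>)
     then show ?thesis by (rule tendsto_eventually)
    qed
   qed
   show "AE z in lborel. norm (ramp t (k n) (fst z) * F \<psi> \<Psi> z) \<le> norm (F \<psi> \<Psi> z)" for n
    using ramp_bounds(3) by (intro AE_I2) (simp add: abs_mult mult_left_le_one_le)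
  qed (use FI[OF H] in auto)
  have "(%n. (M (t + k n) - M t) / k n) \<longlonglongrightarrow> (LBINT x. u1 x * \<psi> x) + (LBINT z. ind {0..t} (fst z) * F \<psi> \<Psi> z)"
   using tendsto_add[OF tendsto_const l2] by (simp flip: Mk add: step)
  then show ?thesis using l1 LIMSEQ_unique unfolding m_def by blast
 qed
 have zeroint: "(LBINT z. ind {0..0} (fst z :: real) * F \<psi> \<Psi> z) = 0" for \<psi> \<Psi>
 proof (rule integral_eq_zero_AE)
  show "AE z in lborel. ind {0..0} (fst z :: real) * F \<psi> \<Psi> z = 0"
   using AE_slice'(2)[OF AE_lborel_singleton[of "0::real"], where 'm = 'n] by eventually_elim (auto simp: indicator_def)
 qed
 \<comment> \<open>At t = 0 the time integral is over a null set, so w 0 and the zero extension u1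
   of the initial datum have the same integrals against all test functions.\<close>
 have W0: "(LBINT x. w 0 x * \<psi> x) = (LBINT x. u1 x * \<psi> x)" if "H1 U \<psi> \<Psi>" for \<psi> \<Psi>
  using W[OF that, of 0] T zeroint[of \<psi> \<Psi>] by simp
 have "AE x in lborel. x \<in> U --> w 0 x - u1 x = 0"
 proof (rule fundamental_lemma[OF L2_diff[OF wL u1L] U(1)])
  fix \<psi> assume p: "test_fun U \<psi>"
  show "(LBINT x. (w 0 x - u1 x) * \<psi> x) = 0"
   using W0[OF H1_test_fun[OF p]] L2_mult_integrable[OF wL test_fun_L2[OF p], of 0] L2_mult_integrable[OF u1L test_fun_L2[OF p]]
   by (simp add: left_diff_distrib)
 qed
 then have wu0: "AE x in lborel. x \<in> U --> w 0 x = u0 x" by eventually_elim (simp add: u1_def)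
 have "clean_sol U D f u0 T v G w"
  unfolding clean_sol_def
 proof (intro conjI allI impI)
  show "\<exists>K. \<forall>z. \<bar>v z\<bar> \<le> K" using vK by blast
  show "(LBINT x. w t x * \<psi> x) = (LBINT x. w 0 x * \<psi> x) +
    (LBINT z. ind {0..t} (fst z) * (f (v z) * \<psi> (snd z) - D (snd z) * (G z \<bullet> \<Psi> (snd z))))"
   if "H1 U \<psi> \<Psi> \<and> t \<in> {0..<T}" for \<psi> \<Psi> t
   using W[of \<psi> \<Psi> t] W0[of \<psi> \<Psi>] that by (simp add: F_def)
 qed (use vm GL vz G(2) AEslice wL w(2) wcont wu0 in auto)
 then show thesis using that vu by blast
qed

section \<open>Energy estimates\<close>

lemma L2_Pair:
 fixes a :: "'n::euclidean_space => 'b::euclidean_space" and b :: "'n => 'c::euclidean_space"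
 assumes "L2 a" "L2 b" shows "L2 (%x. (a x, b x))"
proof (rule L2_bound)
 show "(%x. (a x, b x)) \<in> borel_fun" using assms by (auto dest: L2_measurable)
 show "integrable lborel (%x. (norm (a x))\<^sup>2 + (norm (b x))\<^sup>2)" using assms by (simp add: L2_integrable)
 show "(norm (a x, b x))\<^sup>2 \<le> (norm (a x))\<^sup>2 + (norm (b x))\<^sup>2" for x by (simp add: norm_Pair)
qed

lemma clean_solD:
 assumes "clean_sol U D f u0 T v G w"
 shows "v \<in> borel_fun" "\<exists>K. \<forall>z. \<bar>v z\<bar> \<le> K" "L2 G"
  "!!z. z \<notin> cyl T U ==> v z = 0" "!!z. z \<notin> cyl T U ==> G z = 0"
  "AE t in lborel. t \<in> {0<..<T} --> wgrad U (%x. v (t, x)) (%x. G (t, x)) \<and> (AE x in lborel. v (t, x) = w t x)"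
  "!!t. L2 (w t)" "!!t x. x \<notin> U ==> w t x = 0" "!!t. ((%s. sqn (%x. w s x - w t x)) \<longlongrightarrow> 0) (at t)"
  "AE x in lborel. x \<in> U --> w 0 x = u0 x"
  "!!\<psi> \<Psi> t. H1 U \<psi> \<Psi> ==> t \<in> {0..<T} ==>
    (LBINT x. w t x * \<psi> x) = (LBINT x. w 0 x * \<psi> x) +
    (LBINT z. ind {0..t} (fst z) * (f (v z) * \<psi> (snd z) - D (snd z) * (G z \<bullet> \<Psi> (snd z))))"
 using assms unfolding clean_sol_def by blast+

lemma clean_sol_L2:
 assumes c: "clean_sol U D f u0 T v G w" and U: "bounded U" and f: "continuous_on UNIV f" "f 0 = 0"
 shows "L2 v" "L2 (%z. f (v z))"
proof -
 note s = clean_solD[OF c]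
 obtain K where K: "!!z. \<bar>v z\<bar> \<le> K" using s(2) by blast
 have bC: "bounded (cyl T U)" unfolding cyl_def using U by (intro bounded_Times) auto
 show "L2 v" by (rule L2_bounded_support[OF s(1) _ bC s(4), of K]) (use K in auto)
 have fm[measurable]: "f \<in> borel_fun" using f(1) by (rule borel_measurable_continuous_onI)
 note [measurable] = s(1)
 have "bounded (f ` {-K..K})"
  by (intro compact_imp_bounded compact_continuous_image continuous_on_subset[OF f(1)]) auto
 then obtain B where B: "\<forall>y\<in>f ` {-K..K}. norm y \<le> B" unfolding bounded_iff by blast
 have "v z \<in> {-K..K}" for z using K[of z] by (auto simp: abs_le_iff)
 then have "norm (f (v z)) \<le> B" for z using B by blast
 then show "L2 (%z. f (v z))" by (rule L2_bounded_support[OF _ _ bC, rotated]) (use s(4) f(2) in auto)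
qed

text \<open>Turns a convexity inequality for increments, with the factor p (r, x) taken at the later
  time only, into an energy inequality with the equation inserted. z is a comparison function with
  explicit time derivative zt; the equation between times s and r, tested with p at the fixed time
  r, replaces the increment of w.\<close>

lemma sol_energy:
 fixes U :: "'n::euclidean_space set"
 assumes c: "clean_sol U D f u0 T v G w" and U: "open U" "bounded U"
  and D: "D \<in> borel_fun" "!!x. \<bar>D x\<bar> \<le> C0" and f: "continuous_on UNIV f" "f 0 = 0"
  and zt: "zt \<in> borel_fun" "!!y. \<bar>zt y\<bar> \<le> C1"
  and z: "!!s r x. 0 \<le> s ==> s \<le> r ==> r \<le> T' ==> (LBINT \<sigma>:{s..r}. zt (\<sigma>, x)) = z (r, x) - z (s, x)"
  and p: "L2 p" "L2 P" "!!y. y \<notin> cyl T U ==> p y = 0"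
  and pw: "AE t in lborel. t \<in> {0<..<T} --> wgrad U (%x. p (t, x)) (%x. P (t, x))"
  and E: "continuous_on UNIV E"
  and conv: "AE r in lborel. r \<in> {0<..<T'} --> (\<forall>s\<in>{0..r}. E r - E s \<le> (LBINT x. ((w r x - z (r, x)) - (w s x - z (s, x))) * p (r, x)))"
  and T': "T' < T" and t: "t \<in> {0..T'}"
 shows "E t - E 0 \<le> (LBINT y. ind {0..t} (fst y) * ((f (v y) - zt y) * p y - D (snd y) * (G y \<bullet> P y)))"
proof -
 note s = clean_solD[OF c]
 note L = clean_sol_L2[OF c U(2) f]
 note [measurable] = s(1) D(1) zt(1) L2_measurable[OF p(1)] L2_measurable[OF p(2)] L2_measurable[OF s(3)] L2_measurable[OF L(2)]
 have Ub[measurable]: "U \<in> sets borel" using U(1) by simp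
 \<comment> \<open>Restricts zt to a bounded set, hence to L2. The time interval is closed so that
   the restriction is harmless on every slab [q, r], including q = 0.\<close>
 let ?B = "{0..T} \<times> U"
 have Bb: "?B \<in> sets borel" by (intro borel_Times) auto
 define b where "b y = f (v y) - ind ?B y * zt y" for y
 have ztL: "L2 (%y. ind ?B y * zt y)"
 proof (rule L2_bounded_support)
  show "(%y. ind ?B y * zt y) \<in> borel_fun" using Bb by measurable
  show "norm (ind ?B y * zt y) \<le> \<bar>C1\<bar>" for y using zt(2)[of y] by (auto simp: indicator_def)
  show "bounded ?B" using U(2) by (intro bounded_Times) auto
 qed auto
 have bL: "L2 b" unfolding b_def[abs_def] by (rule L2_diff[OF L(2) ztL])
 have DG: "L2 (%y. D (snd y) *\<^sub>R G y)" by (rule L2_mult_bounded[OF s(3) _ D(2)]) measurable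
 \<comment> \<open>Flux and source paired with gradient and value of the test function: V \<bullet>
   R is the integrand of the equation, which fits the pattern of
   \<open>energy_inequality\<close>.\<close>
 define V where "V y = (- (D (snd y) *\<^sub>R G y), b y)" for y
 define R where "R y = (P y, p y)" for y
 have VL: "L2 V" unfolding V_def[abs_def] by (rule L2_Pair[OF L2_minus[OF DG] bL])
 have RL: "L2 R" unfolding R_def[abs_def] by (rule L2_Pair[OF p(2,1)])
 note [measurable] = L2_measurable[OF VL] L2_measurable[OF RL]
 have key: "AE r in lborel. r \<in> {0<..<T'} --> (\<forall>s\<in>{0..r}. E r - E s \<le>
    (LBINT x. (LBINT \<sigma>:{s..r}. V (\<sigma>, x)) \<bullet> R (r, x)))"
  using conv pw L2_slice(1)[OF p(1)] L2_slice(1)[OF p(2)] L2_slice(1)[OF RL]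
 proof eventually_elim
  case (elim r)
  show ?case
  proof (intro impI ballI)
   fix q assume r: "r \<in> {0<..<T'}" and q: "q \<in> {0..r}"
   have rT: "r \<in> {0..<T}" "q \<in> {0..<T}" "r \<in> {0<..<T}" using r q T' by auto
   have H: "H1 U (%x. p (r, x)) (%x. P (r, x))" using elim rT(3) by (simp add: H1_def)
   define g where "g y = f (v y) * p (r, snd y) - D (snd y) * (G y \<bullet> P (r, snd y))" for y
   have indT: "L2 (%\<sigma>. ind {q..r} \<sigma> :: real)" by (rule L2_bounded_support[of _ 1 "{q..r}"]) (auto simp: indicator_def)
   have indT0: "L2 (%\<sigma>. ind {0..r} \<sigma> :: real)" by (rule L2_bounded_support[of _ 1 "{0..r}"]) (auto simp: indicator_def)
   have PP: "L2 (%y. ind {0..r} (fst y) *\<^sub>R p (r, snd y))" "L2 (%y. ind {0..r} (fst y) *\<^sub>R P (r, snd y))"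
    by (rule L2_product[OF indT0 elim(3)], rule L2_product[OF indT0 elim(4)])
   have RR: "L2 (%y. ind {q..r} (fst y) *\<^sub>R R (r, snd y))" by (rule L2_product[OF indT elim(5)])
   have gi: "integrable lborel (%y. ind {0..r} (fst y) * g y)"
   proof -
    have "integrable lborel (%y. f (v y) * (ind {0..r} (fst y) *\<^sub>R p (r, snd y)) - (D (snd y) *\<^sub>R G y) \<bullet> (ind {0..r} (fst y) *\<^sub>R P (r, snd y)))"
     by (intro lintegrable_diff L2_mult_integrable L2_inner_integrable L PP DG)
    then show ?thesis by (simp add: g_def algebra_simps)
   qed
   have gis: "integrable lborel (%y. ind A (fst y) * g y)" if "A \<subseteq> {0..r}" "A \<in> sets borel" for A
   proof (rule lintegrable_bound[OF gi])
    show "(%y. ind A (fst y) * g y) \<in> borel_measurable lborel" using that(2) unfolding g_def by measurable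
    show "AE y in lborel. norm (ind A (fst y) * g y) \<le> norm (ind {0..r} (fst y) * g y)"
     using that(1) by (intro AE_I2) (auto simp: indicator_def)
   qed
   \<comment> \<open>Difference of the integrated equations at r and at q, both tested with p at
     time r.\<close>
   have Wd: "(LBINT x. (w r x - w q x) * p (r, x)) = (LBINT y. ind {q..r} (fst y) * g y)"
   proof -
    have "(LBINT x. (w r x - w q x) * p (r, x)) = (LBINT x. w r x * p (r, x)) - (LBINT x. w q x * p (r, x))"
     using L2_mult_integrable[OF s(7) elim(3)] by (simp add: left_diff_distrib)
    also have "\<dots> = (LBINT y. ind {0..r} (fst y) * g y) - (LBINT y. ind {0..q} (fst y) * g y)"
     unfolding s(11)[OF H rT(1)] s(11)[OF H rT(2)] g_def by simp
    also have "\<dots> = (LBINT y. ind {0..r} (fst y) * g y - ind {0..q} (fst y) * g y)"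
     by (rule lint_diff[OF gi gis, symmetric]) (use q in auto)
    also have "\<dots> = (LBINT y. ind {q..r} (fst y) * g y)"
    proof (rule integral_cong_AE)
     show "(%y. ind {0..r} (fst y) * g y - ind {0..q} (fst y) * g y) \<in> borel_measurable lborel" unfolding g_def by measurable
     show "(%y. ind {q..r} (fst y) * g y) \<in> borel_measurable lborel" unfolding g_def by measurable
     show "AE y in lborel. ind {0..r} (fst y) * g y - ind {0..q} (fst y) * g y = ind {q..r} (fst y) * g y"
      using AE_slice'(2)[OF AE_lborel_singleton[of q], where 'm = 'n]
      by eventually_elim (use q in \<open>auto simp: indicator_def\<close>)
    qed
    finally show ?thesis .
   qed
   have i1: "integrable lborel (%y. V y \<bullet> (ind {q..r} (fst y) *\<^sub>R R (r, snd y)))"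
    by (rule L2_inner_integrable[OF VL RR])
   have iz: "integrable lborel (%y. (ind ?B y * zt y) * (ind {q..r} (fst y) *\<^sub>R p (r, snd y)))"
    by (intro L2_mult_integrable ztL L2_product indT elim(3))
   have Ve: "V y \<bullet> (ind {q..r} (fst y) *\<^sub>R R (r, snd y)) = ind {q..r} (fst y) * g y - (ind ?B y * zt y) * (ind {q..r} (fst y) *\<^sub>R p (r, snd y))" for y
    by (simp add: V_def R_def b_def g_def algebra_simps)
   have "(LBINT x. (LBINT \<sigma>:{q..r}. V (\<sigma>, x)) \<bullet> R (r, x)) = (LBINT x. LBINT \<sigma>. V (\<sigma>, x) \<bullet> (ind {q..r} \<sigma> *\<^sub>R R (r, x)))"
   proof (rule integral_cong_AE)
    show "(%x. (LBINT \<sigma>:{q..r}. V (\<sigma>, x)) \<bullet> R (r, x)) \<in> borel_measurable lborel"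
     unfolding set_lebesgue_integral_def by measurable
    show "(%x. LBINT \<sigma>. V (\<sigma>, x) \<bullet> (ind {q..r} \<sigma> *\<^sub>R R (r, x))) \<in> borel_measurable lborel" by measurable
    show "AE x in lborel. (LBINT \<sigma>:{q..r}. V (\<sigma>, x)) \<bullet> R (r, x) = (LBINT \<sigma>. V (\<sigma>, x) \<bullet> (ind {q..r} \<sigma> *\<^sub>R R (r, x)))"
     using L2_slice(2)[OF VL]
    proof eventually_elim
     case (elim x)
     have "integrable lborel (%\<sigma>. ind {q..r} \<sigma> *\<^sub>R V (\<sigma>, x))" by (rule L2_set_integrable[OF elim]) auto
     then have "(LBINT \<sigma>. ind {q..r} \<sigma> *\<^sub>R V (\<sigma>, x)) \<bullet> R (r, x) = (LBINT \<sigma>. (ind {q..r} \<sigma> *\<^sub>R V (\<sigma>, x)) \<bullet> R (r, x))"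
      by (rule integral_inner_left[symmetric])
     then show ?case by (simp add: set_lebesgue_integral_def)
    qed
   qed
   also have "\<dots> = (LBINT y. V y \<bullet> (ind {q..r} (fst y) *\<^sub>R R (r, snd y)))"
    using integral_swap[OF i1] integral_slice(1)[OF i1] by simp
   also have "\<dots> = (LBINT y. ind {q..r} (fst y) * g y) - (LBINT y. (ind ?B y * zt y) * (ind {q..r} (fst y) *\<^sub>R p (r, snd y)))"
    unfolding Ve by (rule lint_diff[OF gis iz]) (use q in auto)
   also have "(LBINT y. (ind ?B y * zt y) * (ind {q..r} (fst y) *\<^sub>R p (r, snd y)))
     = (LBINT x. LBINT \<sigma>. (ind ?B (\<sigma>, x) * zt (\<sigma>, x)) * (ind {q..r} \<sigma> *\<^sub>R p (r, x)))"
    using integral_swap[OF iz] integral_slice(1)[OF iz] by simp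
   also have "\<dots> = (LBINT x. (z (r, x) - z (q, x)) * p (r, x))"
   proof (rule lint_cong[OF refl])
    fix x
    have "(ind ?B (\<sigma>, x) * zt (\<sigma>, x)) * (ind {q..r} \<sigma> *\<^sub>R p (r, x)) = (ind {q..r} \<sigma> *\<^sub>R zt (\<sigma>, x)) * p (r, x)" for \<sigma>
     using p(3)[of "(r, x)"] rT q by (cases "x \<in> U") (auto simp: indicator_def cyl_def)
    then have "(LBINT \<sigma>. (ind ?B (\<sigma>, x) * zt (\<sigma>, x)) * (ind {q..r} \<sigma> *\<^sub>R p (r, x))) = (LBINT \<sigma>:{q..r}. zt (\<sigma>, x)) * p (r, x)"
     by (simp only: set_lebesgue_integral_def integral_mult_left_zero)
    then show "(LBINT \<sigma>. (ind ?B (\<sigma>, x) * zt (\<sigma>, x)) * (ind {q..r} \<sigma> *\<^sub>R p (r, x))) = (z (r, x) - z (q, x)) * p (r, x)"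
     using z[of q r x] q r by simp
   qed
   finally have A: "(LBINT x. (LBINT \<sigma>:{q..r}. V (\<sigma>, x)) \<bullet> R (r, x)) = (LBINT x. (w r x - w q x) * p (r, x)) - (LBINT x. (z (r, x) - z (q, x)) * p (r, x))"
    unfolding Wd .
   have iw: "integrable lborel (%x. (w r x - w q x) * p (r, x))" by (rule L2_mult_integrable[OF L2_diff[OF s(7) s(7)] elim(3)])
   have iz': "integrable lborel (%x. (z (r, x) - z (q, x)) * p (r, x))"
   proof (rule lintegrable_bound[of _ "%x. (\<bar>C1\<bar> * (r - q)) * (ind U x * \<bar>p (r, x)\<bar>)"])
    have "L2 (%x. ind U x :: real)" by (rule L2_bounded_support[of _ 1 U]) (use U in \<open>auto simp: indicator_def\<close>)
    then have "integrable lborel (%x. ind U x * p (r, x))" by (rule L2_mult_integrable[OF _ elim(3)])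
    then have "integrable lborel (%x. \<bar>ind U x * p (r, x)\<bar>)" by (rule integrable_abs)
    then show "integrable lborel (%x. (\<bar>C1\<bar> * (r - q)) * (ind U x * \<bar>p (r, x)\<bar>))" by (simp add: abs_mult)
    have zz: "z (r, x) - z (q, x) = (LBINT \<sigma>:{q..r}. zt (\<sigma>, x))" for x using z[of q r x] q r by simp
    show "(%x. (z (r, x) - z (q, x)) * p (r, x)) \<in> borel_measurable lborel"
     unfolding zz set_lebesgue_integral_def by measurable
    show "AE x in lborel. norm ((z (r, x) - z (q, x)) * p (r, x)) \<le> norm ((\<bar>C1\<bar> * (r - q)) * (ind U x * \<bar>p (r, x)\<bar>))"
    proof (intro AE_I2)
     fix x
     have "norm (z (r, x) - z (q, x)) \<le> (LBINT \<sigma>. norm (ind {q..r} \<sigma> *\<^sub>R zt (\<sigma>, x)))"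
      unfolding zz set_lebesgue_integral_def by (rule integral_norm_bound)
     also have "\<dots> \<le> (LBINT \<sigma>. \<bar>C1\<bar> * ind {q..r} \<sigma>)"
     proof (rule integral_mono')
      show "integrable lborel (%\<sigma>. \<bar>C1\<bar> * ind {q..r} \<sigma>)" using q by simp
      show "norm (ind {q..r} \<sigma> *\<^sub>R zt (\<sigma>, x)) \<le> \<bar>C1\<bar> * ind {q..r} \<sigma>" for \<sigma>
       using zt(2)[of "(\<sigma>, x)"] by (auto simp: indicator_def)
     qed auto
     finally have "\<bar>z (r, x) - z (q, x)\<bar> \<le> \<bar>C1\<bar> * (r - q)" using q by simp
     then have "\<bar>z (r, x) - z (q, x)\<bar> * \<bar>p (r, x)\<bar> \<le> (\<bar>C1\<bar> * (r - q)) * \<bar>p (r, x)\<bar>" by (rule mult_right_mono) simp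
     moreover have "p (r, x) = 0" if "x \<notin> U" using p(3)[of "(r, x)"] that by (simp add: cyl_def)
     ultimately show "norm ((z (r, x) - z (q, x)) * p (r, x)) \<le> norm ((\<bar>C1\<bar> * (r - q)) * (ind U x * \<bar>p (r, x)\<bar>))"
      using q by (cases "x \<in> U") (auto simp: abs_mult)
    qed
   qed
   have "E r - E q \<le> (LBINT x. ((w r x - z (r, x)) - (w q x - z (q, x))) * p (r, x))" using elim(1) r q by blast
   also have "\<dots> = (LBINT x. (w r x - w q x) * p (r, x) - (z (r, x) - z (q, x)) * p (r, x))"
    by (intro lint_cong refl) (simp add: algebra_simps)
   also have "\<dots> = (LBINT x. (w r x - w q x) * p (r, x)) - (LBINT x. (z (r, x) - z (q, x)) * p (r, x))"
    by (rule lint_diff[OF iw iz'])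
   finally show "E r - E q \<le> (LBINT x. (LBINT \<sigma>:{q..r}. V (\<sigma>, x)) \<bullet> R (r, x))" unfolding A .
  qed
 qed
 have "E t - E 0 \<le> (LBINT y. ind {0..t} (fst y) * (V y \<bullet> R y))"
  by (rule energy_inequality[OF VL RL E key t])
 also have "\<dots> = (LBINT y. ind {0..t} (fst y) * ((f (v y) - zt y) * p y - D (snd y) * (G y \<bullet> P y)))"
 proof (rule lint_cong[OF refl])
  fix y
  have "ind ?B y * zt y * p y = zt y * p y"
   using p(3)[of y] by (cases "y \<in> cyl T U") (auto simp: cyl_def indicator_def)
  then show "ind {0..t} (fst y) * (V y \<bullet> R y) = ind {0..t} (fst y) * ((f (v y) - zt y) * p y - D (snd y) * (G y \<bullet> P y))"
   by (auto simp: V_def R_def b_def algebra_simps)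
 qed
 finally show ?thesis .
qed

text \<open>The growth condition bounds the difference of two energies by the integral of |a - b|^2
  + 2 |b| |a - b|, up to the factor C, and Cauchy-Schwarz reduces this to the L2 distance of the two
  times.\<close>

lemma energy_continuous:
 fixes w :: "real => 'n::euclidean_space => real" and \<Phi> :: "'n => real => real"
 assumes w: "!!t. L2 (w t)" and wc: "!!t. ((%s. sqn (%x. w s x - w t x)) \<longlongrightarrow> 0) (at t)"
  and m: "!!g. g \<in> borel_fun ==> (%x. \<Phi> x (g x)) \<in> borel_fun"
  and le: "!!x a b. \<bar>\<Phi> x a - \<Phi> x b\<bar> \<le> C * ((\<bar>a\<bar> + \<bar>b\<bar>) * \<bar>a - b\<bar>)" and z: "!!x. \<Phi> x 0 = 0" and C: "0 \<le> C"
 shows "continuous_on UNIV (%t. LBINT x. \<Phi> x (w t x))" "integrable lborel (%x. \<Phi> x (w t x))"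
proof -
 have i: "integrable lborel (%x. \<Phi> x (w t x))" for t
 proof (rule lintegrable_bound)
  show "integrable lborel (%x. C * (w t x)\<^sup>2)" using L2_integrable_real[OF w] by simp
  show "(%x. \<Phi> x (w t x)) \<in> borel_measurable lborel" using m[OF L2_measurable[OF w]] by simp
  show "AE x in lborel. norm (\<Phi> x (w t x)) \<le> norm (C * (w t x)\<^sup>2)"
   using le[of _ "w t _" 0] C by (intro AE_I2) (simp add: z power2_eq_square abs_mult)
 qed
 then show "integrable lborel (%x. \<Phi> x (w t x))" .
 have "((%t. LBINT x. \<Phi> x (w t x)) \<longlongrightarrow> (LBINT x. \<Phi> x (w t x))) (at t)" for t
 proof -
  have b: "norm ((LBINT x. \<Phi> x (w s x)) - (LBINT x. \<Phi> x (w t x)))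
    \<le> C * (sqn (%x. w s x - w t x) + 2 * (sqrt (sqn (w t)) * sqrt (sqn (%x. w s x - w t x))))" for s
  proof -
   let ?d = "%x. w s x - w t x"
   have d: "L2 ?d" by (rule L2_diff[OF w w])
   have ad: "L2 (%x. \<bar>?d x\<bar>)" and aw: "L2 (%x. \<bar>w t x\<bar>)"
    using d w[of t] by (auto simp: L2_def)
   have I: "integrable lborel (%x. C * ((?d x)\<^sup>2 + 2 * (\<bar>w t x\<bar> * \<bar>?d x\<bar>)))"
    by (intro integrable_mult_right lintegrable_add L2_integrable_real d L2_mult_integrable aw ad)
   have "norm ((LBINT x. \<Phi> x (w s x)) - (LBINT x. \<Phi> x (w t x))) = norm (LBINT x. \<Phi> x (w s x) - \<Phi> x (w t x))"
    by (simp add: i)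
   also have "\<dots> \<le> (LBINT x. norm (\<Phi> x (w s x) - \<Phi> x (w t x)))" by (rule integral_norm_bound)
   also have "\<dots> \<le> (LBINT x. C * ((?d x)\<^sup>2 + 2 * (\<bar>w t x\<bar> * \<bar>?d x\<bar>)))"
   proof (rule integral_mono[OF _ I])
    show "integrable lborel (%x. norm (\<Phi> x (w s x) - \<Phi> x (w t x)))" by (intro integrable_norm lintegrable_diff i)
    fix x
    have "norm (\<Phi> x (w s x) - \<Phi> x (w t x)) \<le> C * ((\<bar>w s x\<bar> + \<bar>w t x\<bar>) * \<bar>?d x\<bar>)" using le by simp
    also have "\<dots> \<le> C * ((\<bar>?d x\<bar> + 2 * \<bar>w t x\<bar>) * \<bar>?d x\<bar>)"
     using C by (intro mult_left_mono mult_right_mono) auto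
    also have "\<dots> = C * ((?d x)\<^sup>2 + 2 * (\<bar>w t x\<bar> * \<bar>?d x\<bar>))"
     by (simp add: power2_eq_square distrib_right)
    finally show "norm (\<Phi> x (w s x) - \<Phi> x (w t x)) \<le> C * ((?d x)\<^sup>2 + 2 * (\<bar>w t x\<bar> * \<bar>?d x\<bar>))" .
   qed
   also have "\<dots> = C * (sqn ?d + 2 * (LBINT x. \<bar>w t x\<bar> * \<bar>?d x\<bar>))"
    using L2_integrable_real[OF d] L2_mult_integrable[OF aw ad] by (simp add: sqn_real)
   also have "(LBINT x. \<bar>w t x\<bar> * \<bar>?d x\<bar>) \<le> sqrt (sqn (w t)) * sqrt (sqn ?d)"
    using L2_inner_le[OF aw ad] by (simp add: sqn_real)
   finally show ?thesis using C by (simp add: mult_left_mono)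
  qed
  have "((%s. C * (sqn (%x. w s x - w t x) + 2 * (sqrt (sqn (w t)) * sqrt (sqn (%x. w s x - w t x)))))
    \<longlongrightarrow> C * (0 + 2 * (sqrt (sqn (w t)) * sqrt 0))) (at t)"
   by (intro tendsto_intros wc)
  then have "((%s. C * (sqn (%x. w s x - w t x) + 2 * (sqrt (sqn (w t)) * sqrt (sqn (%x. w s x - w t x))))) \<longlongrightarrow> 0) (at t)" by simp
  then have "((%s. (LBINT x. \<Phi> x (w s x)) - (LBINT x. \<Phi> x (w t x))) \<longlongrightarrow> 0) (at t)"
   by (rule Lim_null_comparison[OF always_eventually, rotated]) (intro allI b)
  then show ?thesis by (rule LIM_zero_cancel)
 qed
 then show "continuous_on UNIV (%t. LBINT x. \<Phi> x (w t x))"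
  by (simp add: continuous_on_eq_continuous_at isCont_def)
qed

section \<open>A convex energy of the negative part\<close>

definition neg_pow :: "nat => real => real" where
 "neg_pow n s = (max 0 (- s)) ^ n / fact n"

text \<open>The factorial makes differentiation lower the index by one, with a sign. At 0 the
  difference quotient is, up to a constant, the n-th power of the negative part, which tends to 0
  because n >= 1.\<close>

lemma neg_pow_has_derivative:
 assumes "n \<ge> 1" shows "(neg_pow (Suc n) has_real_derivative - neg_pow n s) (at s)"
proof -
 consider "s < 0" | "s > 0" | "s = 0" by linarith
 then show ?thesis
 proof cases
  case 1
  have "((%s. (- s) ^ Suc n / fact (Suc n)) has_real_derivative (of_nat (Suc n) * (- 1 * (- s) ^ (Suc n - Suc 0))) / fact (Suc n)) (at s)"
   by (intro DERIV_cdivide DERIV_power) (auto intro!: derivative_eq_intros)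
  moreover have "(of_nat (Suc n) * (- 1 * (- s) ^ (Suc n - Suc 0))) / fact (Suc n) = - neg_pow n s"
   using 1 by (simp add: neg_pow_def fact_Suc field_simps del: of_nat_Suc)
  ultimately have "((%s. (- s) ^ Suc n / fact (Suc n)) has_real_derivative - neg_pow n s) (at s)" by simp
  then show ?thesis
   by (rule has_field_derivative_transform_within_open[of _ _ _ "{..<0}"]) (use 1 in \<open>auto simp: neg_pow_def\<close>)
 next
  case 2
  have "((%s. 0) has_real_derivative - neg_pow n s) (at s)" using 2 assms by (simp add: neg_pow_def power_0_left)
  then show ?thesis
   by (rule has_field_derivative_transform_within_open[of _ _ _ "{0<..}"]) (use 2 in \<open>auto simp: neg_pow_def\<close>)
 next
  case 3
  have "isCont (%h::real. - ((max 0 (- h)) ^ n / fact (Suc n))) 0"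
   by (intro continuous_intros) auto
  then have "((%h::real. - ((max 0 (- h)) ^ n / fact (Suc n))) \<longlongrightarrow> 0) (at 0)"
   using assms by (simp add: isCont_def power_0_left)
  moreover have e: "- ((max 0 (- h)) ^ n / fact (Suc n)) = neg_pow (Suc n) h / h" if h: "h \<noteq> 0" for h :: real
  proof (cases "h < 0")
   case True
   then have "neg_pow (Suc n) h / h = (- h * (- h) ^ n / fact (Suc n)) / h" by (simp add: neg_pow_def)
   also have "\<dots> = - ((- h) ^ n / fact (Suc n))" using h by simp
   finally show ?thesis using True by simp
  next
   case False
   then show ?thesis using assms h by (simp add: neg_pow_def power_0_left)
  qed
  then have "\<forall>\<^sub>F h::real in at 0. - ((max 0 (- h)) ^ n / fact (Suc n)) = neg_pow (Suc n) h / h"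
   unfolding eventually_at_filter by (intro always_eventually allI impI)
  ultimately have "((%h. neg_pow (Suc n) h / h) \<longlongrightarrow> 0) (at 0)"
   by (rule Lim_transform_eventually)
  then show ?thesis using 3 assms by (simp add: has_field_derivative_iff neg_pow_def power_0_left)
 qed
qed

text \<open>A convex function with bounded second derivative that vanishes exactly on the nonnegative
 numbers, together with its first two derivatives.\<close>

definition negE :: "real => real" where "negE s = neg_pow 3 s - neg_pow 3 (s + 1)"
definition negE1 :: "real => real" where "negE1 s = neg_pow 2 (s + 1) - neg_pow 2 s"
definition negE2 :: "real => real" where "negE2 s = neg_pow 1 s - neg_pow 1 (s + 1)"

lemma negE_derivative: "(negE has_real_derivative negE1 s) (at s)" "(negE1 has_real_derivative negE2 s) (at s)"
proof -
 have 3: "(neg_pow 3 has_real_derivative - neg_pow 2 s) (at s)" for s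
  using neg_pow_has_derivative[of 2 s] by (simp add: numeral_3_eq_3 numeral_2_eq_2)
 have 2: "(neg_pow 2 has_real_derivative - neg_pow 1 s) (at s)" for s
  using neg_pow_has_derivative[of 1 s] by (simp add: numeral_2_eq_2)
 have e3: "((%s. neg_pow 3 (s + 1)) has_real_derivative - neg_pow 2 (s + 1)) (at s)"
  using DERIV_shift[of "neg_pow 3" "- neg_pow 2 (s + 1)" s 1] 3 by simp
 have e2: "((%s. neg_pow 2 (s + 1)) has_real_derivative - neg_pow 1 (s + 1)) (at s)"
  using DERIV_shift[of "neg_pow 2" "- neg_pow 1 (s + 1)" s 1] 2 by simp
 show "(negE has_real_derivative negE1 s) (at s)"
  unfolding negE_def[abs_def] negE1_def using DERIV_diff[OF 3[of s] e3] by simp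
 show "(negE1 has_real_derivative negE2 s) (at s)"
  unfolding negE1_def[abs_def] negE2_def using DERIV_diff[OF e2 2[of s]] by simp
qed

text \<open>Explains the shifted copies in the definitions: subtracting them caps the second
  derivative at 1. Thus \<open>negE2\<close> is bounded by 1 and 1-Lipschitz, as the chain rule
  demands, and it is nonnegative, which gives convexity.\<close>

lemma negE2_eq: "negE2 s = max 0 (min 1 (- s))"
 by (auto simp: negE2_def neg_pow_def max_def min_def)

lemma negE_cases:
 "0 \<le> s ==> negE s = 0 \<and> negE1 s = 0"
 "-1 \<le> s ==> s \<le> 0 ==> negE s = - (s ^ 3) / 6 \<and> negE1 s = - (s ^ 2) / 2"
 "s \<le> -1 ==> negE s = (3 * s ^ 2 + 3 * s + 1) / 6 \<and> negE1 s = s + 1 / 2"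
 by (auto simp: negE_def negE1_def neg_pow_def max_def fact_numeral power2_eq_square power3_eq_cube field_simps)

text \<open>The third estimate feeds Gronwall's inequality: a reaction term of size |s| times
  \<open>negE1 s\<close> is controlled by the energy. On [-1, 0] the energy is cubic, and there the
  factor 3 is attained.\<close>

lemma negE_props:
 "0 \<le> negE s" "negE s = 0 ==> 0 \<le> s" "\<bar>s\<bar> * \<bar>negE1 s\<bar> \<le> 3 * negE s" "\<bar>negE1 s\<bar> \<le> \<bar>s\<bar>"
proof -
 consider (a) "0 \<le> s" | (b) "-1 \<le> s" "s < 0" | (c) "s \<le> -1" by linarith
 then have "0 \<le> negE s \<and> (negE s = 0 --> 0 \<le> s) \<and> \<bar>s\<bar> * \<bar>negE1 s\<bar> \<le> 3 * negE s \<and> \<bar>negE1 s\<bar> \<le> \<bar>s\<bar>"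
 proof cases
  case a
  then show ?thesis using negE_cases(1)[OF a] by simp
 next
  case b
  then have e: "negE s = - (s ^ 3) / 6" "negE1 s = - (s ^ 2) / 2" using negE_cases(2)[of s] by auto
  have p: "s ^ 3 < 0" using b by (simp add: power3_eq_cube mult_neg_neg mult_pos_neg)
  have "s * s \<le> - s" using mult_right_mono_neg[of "-1" s s] b by simp
  then show ?thesis unfolding e using b p by (simp add: power2_eq_square power3_eq_cube abs_mult)
 next
  case c
  then have e: "negE s = (3 * s ^ 2 + 3 * s + 1) / 6" "negE1 s = s + 1 / 2" using negE_cases(3)[of s] by auto
  have "s * s \<ge> - s" using mult_right_mono_neg[of s "-1" s] c by simp
  moreover have "0 \<le> (s + 1) * (s + 1)" by simp
  ultimately show ?thesis unfolding e using c by (auto simp: power2_eq_square abs_if field_simps)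
 qed
 then show "0 \<le> negE s" "negE s = 0 ==> 0 \<le> s" "\<bar>s\<bar> * \<bar>negE1 s\<bar> \<le> 3 * negE s" "\<bar>negE1 s\<bar> \<le> \<bar>s\<bar>" by auto
qed

lemma negE_mvt: "\<exists>c. min a b \<le> c \<and> c \<le> max a b \<and> negE b - negE a = negE1 c * (b - a)"
proof (cases a b rule: linorder_cases)
 case less
 obtain z where "a < z" "z < b" "negE b - negE a = (b - a) * negE1 z" using MVT2[OF less, of negE negE1] negE_derivative(1) by auto
 then show ?thesis by (intro exI[of _ z]) (simp add: mult.commute)
next
 case greater
 obtain z where "b < z" "z < a" "negE a - negE b = (a - b) * negE1 z" using MVT2[OF greater, of negE negE1] negE_derivative(1) by auto
 then show ?thesis by (intro exI[of _ z]) (simp add: algebra_simps)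
qed auto

lemma negE1_mono: "a \<le> b ==> negE1 a \<le> negE1 b"
 by (rule DERIV_nonneg_imp_nondecreasing[of a b negE1]) (use negE_derivative(2) negE2_eq in \<open>auto intro!: exI[of _ "negE2 _"]\<close>)

lemma negE_convex: "negE b - negE a \<le> negE1 b * (b - a)"
proof -
 obtain c where c: "min a b \<le> c" "c \<le> max a b" "negE b - negE a = negE1 c * (b - a)" using negE_mvt by blast
 show ?thesis
 proof (cases "a \<le> b")
  case True
  then show ?thesis unfolding c(3) using c negE1_mono[of c b] by (intro mult_right_mono) auto
 next
  case False
  then show ?thesis unfolding c(3) using c negE1_mono[of b c] by (intro mult_right_mono_neg) auto
 qed
qed

lemma negE_lipschitz: "\<bar>negE a - negE b\<bar> \<le> 1 * ((\<bar>a\<bar> + \<bar>b\<bar>) * \<bar>a - b\<bar>)"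
proof -
 obtain c where c: "min b a \<le> c" "c \<le> max b a" "negE a - negE b = negE1 c * (a - b)" using negE_mvt by blast
 have "\<bar>negE1 c\<bar> \<le> \<bar>c\<bar>" by (rule negE_props(4))
 also have "\<bar>c\<bar> \<le> \<bar>a\<bar> + \<bar>b\<bar>" using c(1,2) by (auto simp: min_def max_def split: if_splits)
 finally show ?thesis unfolding c(3) by (simp add: abs_mult mult_right_mono)
qed

lemma negE_measurable [measurable]: "negE \<in> borel_fun" "negE1 \<in> borel_fun" "negE2 \<in> borel_fun"
proof -
 show "negE2 \<in> borel_fun" unfolding negE2_eq[abs_def] by measurable
 have "continuous_on UNIV negE" "continuous_on UNIV negE1"
  using DERIV_isCont[OF negE_derivative(1)] DERIV_isCont[OF negE_derivative(2)] by (auto simp: continuous_on_eq_continuous_at)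
 then show "negE \<in> borel_fun" "negE1 \<in> borel_fun" by (auto intro: borel_measurable_continuous_onI)
qed

section \<open>Nonnegativity and the uniform L2 bound\<close>

lemma slice_energy_integral:
 fixes g :: "real \<times> 'n::euclidean_space => real"
 assumes i: "integrable lborel (%y. ind {0..t} (fst y) * g y)"
  and e: "AE r in lborel. r \<in> {0<..<T} --> (LBINT x. g (r, x)) = E r"
  and E: "continuous_on UNIV E" and t: "t < T"
 shows "(LBINT y. ind {0..t} (fst y) * g y) = (LBINT r:{0..t}. E r)"
proof -
 have "(LBINT y. ind {0..t} (fst y) * g y) = (LBINT r. ind {0..t} r * (LBINT x. g (r, x)))"
  using integral_slice(1)[OF i] by simp
 also have "\<dots> = (LBINT r. ind {0..t} r * E r)"
 proof (rule integral_cong_AE)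
  show "(%r. ind {0..t} r * (LBINT x. g (r, x))) \<in> borel_measurable lborel"
   using integral_slice(2)[OF i] by simp
  show "(%r. ind {0..t} r * E r) \<in> borel_measurable lborel"
   using borel_measurable_continuous_onI[OF E] by measurable
  show "AE r in lborel. ind {0..t} r * (LBINT x. g (r, x)) = ind {0..t} r * E r"
   using e AE_lborel_singleton[of 0]
   by eventually_elim (use t in \<open>auto simp: indicator_def\<close>)
 qed
 finally show ?thesis by (simp add: set_lebesgue_integral_def)
qed

lemma integrable_indicator_time:
 fixes g :: "real \<times> 'n::euclidean_space => real"
 assumes "integrable lborel g" shows "integrable lborel (%y. ind {0..t} (fst y) * g y)"
proof (rule lintegrable_bound[OF assms])
 show "(%y. ind {0..t} (fst y) * g y) \<in> borel_measurable lborel" using assms by measurable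
qed (auto simp: indicator_def)

text \<open>The equation is tested with \<open>negE1 (v)\<close>, whose gradient is
  \<open>negE2 (v)\<close> times G. The diffusion then has a good sign, the reaction is at most 3 Lf
  times the energy, and the energy vanishes at time 0; by Gronwall it vanishes always.\<close>

lemma sol_nonneg:
 fixes U :: "'n::euclidean_space set"
 assumes c: "clean_sol U D f u0 T v G w" and U: "open U" "bounded U" and T: "T > 0"
  and D: "D \<in> borel_fun" "!!x. \<bar>D x\<bar> \<le> C0" "!!x. 0 \<le> D x" and f: "continuous_on UNIV f" "f 0 = 0"
  and lip: "!!K. \<exists>L\<ge>0. \<forall>s. \<bar>s\<bar> \<le> K --> \<bar>f s\<bar> \<le> L * \<bar>s\<bar>" and u0: "!!x. x \<in> U ==> 0 \<le> u0 x"
 shows "AE y in lborel. 0 \<le> v y" "!!t. t \<in> {0..<T} ==> AE x in lborel. 0 \<le> w t x"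
proof -
 note s = clean_solD[OF c]
 note L = clean_sol_L2[OF c U(2) f]
 note [measurable] = s(1) D(1) L2_measurable[OF s(3)] L2_measurable[OF L(2)]
 obtain K where K: "!!z. \<bar>v z\<bar> \<le> K" using s(2) by blast
 \<comment> \<open>Lf depends on the bound of this particular solution; the conclusion does not
   contain it, so no uniformity in \<epsilon> is lost.\<close>
 obtain Lf where Lf: "0 \<le> Lf" "!!s. \<bar>s\<bar> \<le> K ==> \<bar>f s\<bar> \<le> Lf * \<bar>s\<bar>" using lip by blast
 define E where "E t = (LBINT x. negE (w t x))" for t
 note ec = energy_continuous[of w "%_. negE" 1, OF s(7) s(9) _ negE_lipschitz]
 have Ec: "continuous_on UNIV E" and Ei: "!!t. integrable lborel (%x. negE (w t x))"
  unfolding E_def[abs_def] using ec negE_cases(1)[of 0] by auto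
 have nl: "L2 (%y. negE1 (v y))"
 proof (rule L2_bound)
  show "integrable lborel (%y. (v y)\<^sup>2)" by (rule L2_integrable_real[OF L(1)])
  show "(norm (negE1 (v y)))\<^sup>2 \<le> (v y)\<^sup>2" for y using negE_props(4)[of "v y"] by (simp add: abs_le_square_iff[symmetric])
 qed measurable
 have m1: "\<bar>negE2 x\<bar> \<le> 1" for x by (auto simp: negE2_eq)
 have mL: "\<bar>negE2 a - negE2 b\<bar> \<le> \<bar>a - b\<bar>" for a b by (auto simp: negE2_eq max_def min_def)
 have mv: "(%y. negE2 (v y)) \<in> borel_fun" by measurable
 have PL: "L2 (%y. negE2 (v y) *\<^sub>R G y)" by (rule L2_mult_bounded[OF s(3) mv m1])
 have pw: "AE t in lborel. t \<in> {0<..<T} --> wgrad U (%x. negE1 (v (t, x))) (%x. negE2 (v (t, x)) *\<^sub>R G (t, x))"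
  using s(6) L2_slice(1)[OF L(1)] L2_slice(1)[OF s(3)]
 proof eventually_elim
  case (elim t)
  show ?case
  proof
   assume t: "t \<in> {0<..<T}"
   have "H1 U (%x. v (t, x)) (%x. G (t, x))" using elim t by (simp add: H1_def)
   from H1_chain_rule[OF U(1) this negE_derivative(2) m1 mL] negE_cases(1)[of 0]
   show "wgrad U (%x. negE1 (v (t, x))) (%x. negE2 (v (t, x)) *\<^sub>R G (t, x))" by (simp add: H1_def)
  qed
 qed
 have nE: "integrable lborel (%y. negE (v y))"
 proof (rule lintegrable_bound[OF L2_integrable_real[OF L(1)]])
  show "AE y in lborel. norm (negE (v y)) \<le> norm ((v y)\<^sup>2)"
   using negE_lipschitz[of "v _" 0] negE_cases(1)[of 0] by (intro AE_I2) (simp add: power2_eq_square abs_mult)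
 qed measurable
 have E0: "E 0 = 0"
 proof -
  have "AE x in lborel. negE (w 0 x) = 0"
   using s(10)
  proof eventually_elim
   case (elim x)
   show ?case using elim s(8)[of x 0] u0[of x] negE_cases(1)[of "w 0 x"] by (cases "x \<in> U") auto
  qed
  then show ?thesis unfolding E_def by (rule integral_eq_zero_AE)
 qed
 have vw: "AE r in lborel. r \<in> {0<..<T} --> (LBINT x. negE (v (r, x))) = E r"
  using s(6)
 proof eventually_elim
  case (elim r)
  show ?case
  proof
   assume "r \<in> {0<..<T}"
   then have ae: "AE x in lborel. v (r, x) = w r x" using elim by blast
   note [measurable] = L2_measurable[OF s(7)]
   show "(LBINT x. negE (v (r, x))) = E r" unfolding E_def
    by (rule integral_cong_AE) (use ae in auto)
  qed
 qed
 have Ez: "E t \<le> 0" if t: "t \<in> {0..<T}" for t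
 proof -
  \<comment> \<open>Any time strictly between t and T serves: the integrated equation is available
    before T only.\<close>
  define T' where "T' = (t + T) / 2"
  have T': "t \<le> T'" "T' < T" "0 \<le> T'" using t by (auto simp: T'_def)
  have conv: "AE r in lborel. r \<in> {0<..<T'} --> (\<forall>q\<in>{0..r}. E r - E q \<le> (LBINT x. ((w r x - 0) - (w q x - 0)) * negE1 (v (r, x))))"
   using s(6) L2_slice(1)[OF nl]
  proof eventually_elim
   case (elim r)
   show ?case
   proof (intro impI ballI)
    fix q assume r: "r \<in> {0<..<T'}" and q: "q \<in> {0..r}"
    have ae: "AE x in lborel. v (r, x) = w r x" using elim(1) r T' by auto
    have "E r - E q = (LBINT x. negE (w r x) - negE (w q x))" unfolding E_def using Ei by simp
    also have "\<dots> \<le> (LBINT x. ((w r x - 0) - (w q x - 0)) * negE1 (v (r, x)))"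
    proof (rule integral_mono_AE)
     show "integrable lborel (%x. negE (w r x) - negE (w q x))" using Ei by simp
     show "integrable lborel (%x. ((w r x - 0) - (w q x - 0)) * negE1 (v (r, x)))"
      using L2_mult_integrable[OF L2_diff[OF s(7) s(7)] elim(2)] by simp
     show "AE x in lborel. negE (w r x) - negE (w q x) \<le> ((w r x - 0) - (w q x - 0)) * negE1 (v (r, x))"
      using ae by eventually_elim (use negE_convex in \<open>simp add: mult.commute\<close>)
    qed
    finally show "E r - E q \<le> (LBINT x. ((w r x - 0) - (w q x - 0)) * negE1 (v (r, x)))" .
   qed
  qed
  have "E \<tau> \<le> 0 + (3 * Lf) * (LBINT r:{0..\<tau>}. E r)" if tau: "\<tau> \<in> {0..T'}" for \<tau>
  proof -
   have "E \<tau> - E 0 \<le> (LBINT y. ind {0..\<tau>} (fst y) * ((f (v y) - 0) * negE1 (v y) - D (snd y) * (G y \<bullet> (negE2 (v y) *\<^sub>R G y))))"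
    by (rule sol_energy[where z = "%_. 0" and zt = "%_. 0" and ?C1.0 = 0, OF c U D(1,2) f _ _ _ nl PL _ pw Ec conv T'(2) tau])
      (use s(4) negE_cases(1)[of 0] in \<open>auto simp: set_lebesgue_integral_def\<close>)
   also have "\<dots> \<le> (LBINT y. ind {0..\<tau>} (fst y) * ((3 * Lf) * negE (v y)))"
   proof (rule integral_mono)
    have DG: "L2 (%y. D (snd y) *\<^sub>R G y)" by (rule L2_mult_bounded[OF s(3) _ D(2)]) measurable
    have "integrable lborel (%y. f (v y) * negE1 (v y) - (D (snd y) *\<^sub>R G y) \<bullet> (negE2 (v y) *\<^sub>R G y))"
     by (intro lintegrable_diff L2_mult_integrable L2_inner_integrable L nl DG PL)
    then have "integrable lborel (%y. (f (v y) - 0) * negE1 (v y) - D (snd y) * (G y \<bullet> (negE2 (v y) *\<^sub>R G y)))"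
     by (simp add: mult_ac)
    then show "integrable lborel (%y. ind {0..\<tau>} (fst y) * ((f (v y) - 0) * negE1 (v y) - D (snd y) * (G y \<bullet> (negE2 (v y) *\<^sub>R G y))))"
     by (rule integrable_indicator_time)
    show "integrable lborel (%y. ind {0..\<tau>} (fst y) * ((3 * Lf) * negE (v y)))"
     by (intro integrable_indicator_time integrable_mult_right nE)
    fix y
    have "f (v y) * negE1 (v y) \<le> \<bar>f (v y)\<bar> * \<bar>negE1 (v y)\<bar>" by (metis abs_ge_self abs_mult)
    also have "\<dots> \<le> (Lf * \<bar>v y\<bar>) * \<bar>negE1 (v y)\<bar>" using Lf(2)[OF K] by (intro mult_right_mono) auto
    also have "\<dots> \<le> Lf * (3 * negE (v y))" using negE_props(3)[of "v y"] Lf(1) by (simp add: mult.assoc mult_left_mono)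
    finally have a: "f (v y) * negE1 (v y) \<le> (3 * Lf) * negE (v y)" by simp
    have "0 \<le> D (snd y) * (G y \<bullet> (negE2 (v y) *\<^sub>R G y))"
     using D(3) by (auto simp: negE2_eq intro!: mult_nonneg_nonneg)
    then show "ind {0..\<tau>} (fst y) * ((f (v y) - 0) * negE1 (v y) - D (snd y) * (G y \<bullet> (negE2 (v y) *\<^sub>R G y))) \<le> ind {0..\<tau>} (fst y) * ((3 * Lf) * negE (v y))"
     using a by (intro mult_left_mono) auto
   qed
   also have "\<dots> = (3 * Lf) * (LBINT y. ind {0..\<tau>} (fst y) * negE (v y))" by (simp add: mult.left_commute)
   also have "(LBINT y. ind {0..\<tau>} (fst y) * negE (v y)) = (LBINT r:{0..\<tau>}. E r)"
    by (rule slice_energy_integral[OF integrable_indicator_time[OF nE] vw Ec]) (use tau T' in auto)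
   finally show ?thesis using E0 by simp
  qed
  from Gronwall[OF Ec _ this, of t] show ?thesis using Lf(1) T' t by simp
 qed
 have wn: "AE x in lborel. 0 \<le> w t x" if t: "t \<in> {0..<T}" for t
 proof -
  have "(LBINT x. negE (w t x)) = 0" using Ez[OF t] negE_props(1) unfolding E_def by (intro antisym integral_nonneg_AE) auto
  then have "AE x in lborel. negE (w t x) = 0" using integral_nonneg_eq_0_iff_AE[OF Ei[of t]] negE_props(1) by simp
  then show ?thesis by eventually_elim (rule negE_props(2))
 qed
 have ae: "AE r in lborel. (LBINT x. negE (v (r, x))) = 0"
  using vw
 proof eventually_elim
  case (elim r)
  show ?case
  proof (cases "r \<in> {0<..<T}")
   case True
   have "0 \<le> (LBINT x. negE (v (r, x)))" using negE_props(1) by (intro integral_nonneg_AE) auto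
   then show ?thesis using elim True Ez[of r] by auto
  next
   case False
   then have "v (r, x) = 0" for x using s(4)[of "(r, x)"] by (auto simp: cyl_def)
   then show ?thesis using negE_cases(1)[of 0] by simp
  qed
 qed
 have "(LBINT y. negE (v y)) = (LBINT r. LBINT x. negE (v (r, x)))" by (rule integral_slice(1)[OF nE])
 also have "\<dots> = 0" by (rule integral_eq_zero_AE[OF ae])
 finally have "AE y in lborel. negE (v y) = 0" using integral_nonneg_eq_0_iff_AE[OF nE] negE_props(1) by simp
 then show "AE y in lborel. 0 \<le> v y" by eventually_elim (rule negE_props(2))
 show "!!t. t \<in> {0..<T} ==> AE x in lborel. 0 \<le> w t x" by (rule wn)
qed


lemma half_square_lipschitz: "\<bar>a\<^sup>2 / 2 - b\<^sup>2 / 2\<bar> \<le> 1 * ((\<bar>a\<bar> + \<bar>b\<bar>) * \<bar>a - b\<bar>)" for a b :: real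
proof -
 have "\<bar>a\<^sup>2 / 2 - b\<^sup>2 / 2\<bar> = \<bar>a + b\<bar> * \<bar>a - b\<bar> / 2" by (simp add: abs_mult[symmetric] power2_eq_square algebra_simps diff_divide_distrib[symmetric])
 also have "\<dots> \<le> (\<bar>a\<bar> + \<bar>b\<bar>) * \<bar>a - b\<bar> / 2" by (intro divide_right_mono mult_right_mono) auto
 also have "\<dots> \<le> (\<bar>a\<bar> + \<bar>b\<bar>) * \<bar>a - b\<bar>" by simp
 finally show ?thesis by simp
qed

text \<open>Testing with v itself. Of the coefficient only its sign enters, so the bound is the same
  for all \<epsilon>. The growth condition on f concerns nonnegative arguments, which is why
  nonnegativity of v comes first.\<close>

lemma sol_L2_bound:
 fixes U :: "'n::euclidean_space set"
 assumes c: "clean_sol U D f u0 T v G w" and U: "open U" "bounded U" and T: "T > 0"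
  and D: "D \<in> borel_fun" "!!x. \<bar>D x\<bar> \<le> C0" "!!x. 0 \<le> D x" and f: "continuous_on UNIV f" "f 0 = 0"
  and lip: "!!s. 0 \<le> s ==> f s * s \<le> L * s\<^sup>2" "0 \<le> L" and pos: "AE y in lborel. 0 \<le> v y" and t: "t \<in> {0..<T}"
 shows "sqn (w t) \<le> sqn (w 0) * exp (2 * L * T)"
proof -
 note s = clean_solD[OF c]
 note L2s = clean_sol_L2[OF c U(2) f]
 note [measurable] = s(1) D(1) L2_measurable[OF s(3)] L2_measurable[OF L2s(2)]
 define E where "E t = (LBINT x. (w t x)\<^sup>2 / 2)" for t
 note ec = energy_continuous[of w "%_ a. a\<^sup>2 / 2" 1, OF s(7) s(9) _ half_square_lipschitz]
 have Ec: "continuous_on UNIV E" unfolding E_def[abs_def] using ec(1) by simp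
 have Ei: "integrable lborel (%x. (w t x)\<^sup>2)" for t by (rule L2_integrable_real[OF s(7)])
 have E2: "sqn (w t) = 2 * E t" for t by (simp add: E_def sqn_real)
 have vi: "integrable lborel (%y. (v y)\<^sup>2 / 2)" using L2_integrable_real[OF L2s(1)] by simp
 define T' where "T' = (t + T) / 2"
 have T': "t \<le> T'" "T' < T" "0 \<le> T'" using t by (auto simp: T'_def)
 have conv: "AE r in lborel. r \<in> {0<..<T'} --> (\<forall>q\<in>{0..r}. E r - E q \<le> (LBINT x. ((w r x - 0) - (w q x - 0)) * v (r, x)))"
  using s(6) L2_slice(1)[OF L2s(1)]
 proof eventually_elim
  case (elim r)
  show ?case
  proof (intro impI ballI)
   fix q assume r: "r \<in> {0<..<T'}" and q: "q \<in> {0..r}"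
   have ae: "AE x in lborel. v (r, x) = w r x" using elim(1) r T' by auto
   have "E r - E q = (LBINT x. (w r x)\<^sup>2 / 2 - (w q x)\<^sup>2 / 2)" unfolding E_def using Ei by simp
   also have "\<dots> \<le> (LBINT x. ((w r x - 0) - (w q x - 0)) * v (r, x))"
   proof (rule integral_mono_AE)
    show "integrable lborel (%x. (w r x)\<^sup>2 / 2 - (w q x)\<^sup>2 / 2)" using Ei by simp
    show "integrable lborel (%x. ((w r x - 0) - (w q x - 0)) * v (r, x))"
     using L2_mult_integrable[OF L2_diff[OF s(7) s(7)] elim(2)] by simp
    show "AE x in lborel. (w r x)\<^sup>2 / 2 - (w q x)\<^sup>2 / 2 \<le> ((w r x - 0) - (w q x - 0)) * v (r, x)"
     using ae
    proof eventually_elim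
     case (elim x)
     show ?case using zero_le_power2[of "w r x - w q x"] unfolding elim by (simp add: power2_eq_square algebra_simps)
    qed
   qed
   finally show "E r - E q \<le> (LBINT x. ((w r x - 0) - (w q x - 0)) * v (r, x))" .
  qed
 qed
 have pw: "AE t in lborel. t \<in> {0<..<T} --> wgrad U (%x. v (t, x)) (%x. G (t, x))"
  using s(6) by eventually_elim auto
 have vw: "AE r in lborel. r \<in> {0<..<T} --> (LBINT x. (v (r, x))\<^sup>2 / 2) = E r"
  using s(6)
 proof eventually_elim
  case (elim r)
  show ?case
  proof
   assume "r \<in> {0<..<T}"
   then have ae: "AE x in lborel. v (r, x) = w r x" using elim by blast
   note [measurable] = L2_measurable[OF s(7)]
   show "(LBINT x. (v (r, x))\<^sup>2 / 2) = E r" unfolding E_def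
    by (rule integral_cong_AE) (use ae in auto)
  qed
 qed
 have "E \<tau> \<le> E 0 + (2 * L) * (LBINT r:{0..\<tau>}. E r)" if tau: "\<tau> \<in> {0..T'}" for \<tau>
 proof -
  have "E \<tau> - E 0 \<le> (LBINT y. ind {0..\<tau>} (fst y) * ((f (v y) - 0) * v y - D (snd y) * (G y \<bullet> G y)))"
   by (rule sol_energy[where z = "%_. 0" and zt = "%_. 0" and ?C1.0 = 0, OF c U D(1,2) f _ _ _ L2s(1) s(3) s(4) pw Ec conv T'(2) tau])
     (auto simp: set_lebesgue_integral_def)
  also have "\<dots> \<le> (LBINT y. ind {0..\<tau>} (fst y) * ((2 * L) * ((v y)\<^sup>2 / 2)))"
  proof (rule integral_mono_AE)
   have DG: "L2 (%y. D (snd y) *\<^sub>R G y)" by (rule L2_mult_bounded[OF s(3) _ D(2)]) measurable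
   have "integrable lborel (%y. f (v y) * v y - (D (snd y) *\<^sub>R G y) \<bullet> G y)"
    by (intro lintegrable_diff L2_mult_integrable L2_inner_integrable L2s DG s(3))
   then have "integrable lborel (%y. (f (v y) - 0) * v y - D (snd y) * (G y \<bullet> G y))" by simp
   then show "integrable lborel (%y. ind {0..\<tau>} (fst y) * ((f (v y) - 0) * v y - D (snd y) * (G y \<bullet> G y)))"
    by (rule integrable_indicator_time)
   show "integrable lborel (%y. ind {0..\<tau>} (fst y) * ((2 * L) * ((v y)\<^sup>2 / 2)))"
    by (intro integrable_indicator_time integrable_mult_right vi)
   show "AE y in lborel. ind {0..\<tau>} (fst y) * ((f (v y) - 0) * v y - D (snd y) * (G y \<bullet> G y)) \<le> ind {0..\<tau>} (fst y) * ((2 * L) * ((v y)\<^sup>2 / 2))"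
    using pos
   proof eventually_elim
    case (elim y)
    have "0 \<le> D (snd y) * (G y \<bullet> G y)" using D(3) by simp
    then show ?case using lip(1)[OF elim] by (intro mult_left_mono) auto
   qed
  qed
  also have "\<dots> = (2 * L) * (LBINT y. ind {0..\<tau>} (fst y) * ((v y)\<^sup>2 / 2))"
   by (subst integral_mult_right_zero[symmetric]) (simp add: mult_ac)
  also have "(LBINT y. ind {0..\<tau>} (fst y) * ((v y)\<^sup>2 / 2)) = (LBINT r:{0..\<tau>}. E r)"
   by (rule slice_energy_integral[where g = "%y. (v y)\<^sup>2 / 2", OF integrable_indicator_time[OF vi] vw Ec]) (use tau T' in auto)
  finally show ?thesis by simp
 qed
 from Gronwall[OF Ec _ this, of t] have "E t \<le> E 0 * exp (2 * L * t)" using lip(2) T' t by simp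
 also have "\<dots> \<le> E 0 * exp (2 * L * T)"
  using t lip(2) E2[of 0] sqn_nonneg[of "w 0"] by (intro mult_left_mono) (auto intro!: mult_left_mono)
 finally show ?thesis by (simp add: E2)
qed

section \<open>Smooth approximation of the Neumann solution\<close>

text \<open>The Steklov average over [t, t + h], rescaled to a parameter in [0, 1]. It looks forward
  in time, so that at t = 0 it uses the solution at positive times only.\<close>

definition stek :: "real => (real \<times> 'n::euclidean_space => 'b::euclidean_space) => real \<times> 'n => 'b" where
 "stek h g z = (LBINT \<theta>. unit_k \<theta> *\<^sub>R g (fst z + h * \<theta>, snd z))"

lemma stek_measurable [measurable]:
 fixes g :: "real \<times> 'n::euclidean_space => 'b::euclidean_space"
 assumes [measurable]: "g \<in> borel_fun"
 shows "stek h g \<in> borel_fun"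
proof -
 have "(%q. unit_k (snd q) *\<^sub>R g (fst (fst q) + h * snd q, snd (fst q))) \<in> borel_measurable (borel :: ((real \<times> 'n) \<times> real) measure)"
  by measurable
 then have "(%(z, \<theta>). unit_k \<theta> *\<^sub>R g (fst z + h * \<theta>, snd z)) \<in> borel_measurable (borel \<Otimes>\<^sub>M lborel)"
  by (simp add: borel_prod case_prod_beta' cong: measurable_cong_sets)
 then show ?thesis unfolding stek_def[abs_def] by (rule sigma_finite_measure.borel_measurable_lebesgue_integral[OF lborel.sigma_finite_measure_axioms])
qed

lemma stek_integrable_bounded:
 fixes g :: "real \<times> 'n::euclidean_space => 'b::euclidean_space"
 assumes [measurable]: "g \<in> borel_fun" and C: "!!z. norm (g z) \<le> C"
 shows "integrable lborel (%\<theta>. unit_k \<theta> *\<^sub>R g (t + h * \<theta>, x))"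
proof (rule integrable_bounded_support[of _ C "{0..1}"])
 show "norm (unit_k \<theta> *\<^sub>R g (t + h * \<theta>, x)) \<le> C" for \<theta>
  using C[of "(t + h * \<theta>, x)"] norm_ge_zero[of "g (t + h * \<theta>, x)"] by (auto simp: indicator_def intro: order_trans[OF norm_ge_zero])
qed (auto simp: indicator_def)

lemma stek_bounded:
 fixes g :: "real \<times> 'n::euclidean_space => 'b::euclidean_space"
 assumes g: "g \<in> borel_fun" "!!z. norm (g z) \<le> C"
 shows "norm (stek h g z) \<le> C"
proof -
 have "norm (stek h g z) \<le> (LBINT \<theta>. norm (unit_k \<theta> *\<^sub>R g (fst z + h * \<theta>, snd z)))"
  unfolding stek_def by (rule integral_norm_bound)
 also have "\<dots> \<le> (LBINT \<theta>. unit_k \<theta> * C)"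
 proof (rule integral_mono)
  show "integrable lborel (%\<theta>. norm (unit_k \<theta> *\<^sub>R g (fst z + h * \<theta>, snd z)))"
   by (rule integrable_norm[OF stek_integrable_bounded[OF g]])
  show "integrable lborel (%\<theta>. unit_k \<theta> * C)" using unit_k(3) by simp
  show "norm (unit_k \<theta> *\<^sub>R g (fst z + h * \<theta>, snd z)) \<le> unit_k \<theta> * C" for \<theta> using g(2) by (auto simp: indicator_def)
 qed
 also have "\<dots> = C" using unit_k(4) by simp
 finally show ?thesis .
qed

lemma stek_integrable_L2:
 fixes g :: "real => 'b::euclidean_space"
 assumes g: "L2 g" and h: "h > 0"
 shows "integrable lborel (%\<theta>. unit_k \<theta> *\<^sub>R g (t + h * \<theta>))"
 using L2_set_integrable[OF L2_affine[OF g h, of t], of "{0..1}"] by simp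

lemma stek_sqn:
 fixes g :: "real \<times> 'n::euclidean_space => 'b::euclidean_space"
 assumes g: "L2 g" and h: "h > 0" and e: "!!s. 0 \<le> s ==> s \<le> h ==> sqn (%z. g (z + (s, 0)) - g z) \<le> e"
 shows "L2 (%z. stek h g z - g z)" "sqn (%z. stek h g z - g z) \<le> e"
proof -
 note [measurable] = L2_measurable[OF g]
 let ?A = "%z. LBINT \<theta>. unit_k \<theta> *\<^sub>R (g (z + (h * \<theta>, 0)) - g z)"
 have e0: "0 \<le> e" using order_trans[OF sqn_nonneg e[of 0]] h by simp
 have sm: "(%\<theta>. (h * \<theta>, 0 :: 'n)) \<in> borel_fun" by measurable
 have k: "sqn (%z. g (z + (h * \<theta>, 0)) - g z) \<le> e" if "unit_k \<theta> \<noteq> 0" for \<theta>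
  by (rule e) (use that h in \<open>auto simp: indicator_def split: if_splits intro: mult_left_le\<close>)
 note A = sqn_average[where k = unit_k and \<sigma> = "%\<theta>. (h * \<theta>, 0)", OF g unit_k sm k e0]
 have ae: "AE z in lborel. stek h g z - g z = ?A z"
  using AE_slice'(1)[OF L2_slice(2)[OF g]]
 proof eventually_elim
  case (elim z)
  note i = stek_integrable_L2[OF elim h, of "fst z"]
  have "?A z = (LBINT \<theta>. unit_k \<theta> *\<^sub>R g (fst z + h * \<theta>, snd z) - unit_k \<theta> *\<^sub>R g z)"
   by (cases z) (simp add: algebra_simps)
  also have "\<dots> = stek h g z - g z"
   unfolding stek_def using i unit_k by (subst lint_diff) auto
  finally show ?case ..
 qed
 have m: "(%z. stek h g z - g z) \<in> borel_fun" by measurable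
 have mA: "?A \<in> borel_fun" using L2_measurable[OF A(1)] .
 show "L2 (%z. stek h g z - g z)" unfolding L2_def
 proof
  show "integrable lborel (%z. (norm (stek h g z - g z))\<^sup>2)"
  proof (subst integrable_cong_AE)
   show "AE z in lborel. (norm (stek h g z - g z))\<^sup>2 = (norm (?A z))\<^sup>2" using ae by eventually_elim simp
   show "integrable lborel (%z. (norm (?A z))\<^sup>2)" using A(1) by (rule L2_integrable)
  qed (use m mA in measurable)
 qed (rule m)
 have "sqn (%z. stek h g z - g z) = sqn ?A" unfolding sqn_def
 proof (rule integral_cong_AE)
  show "AE z in lborel. (norm (stek h g z - g z))\<^sup>2 = (norm (?A z))\<^sup>2" using ae by eventually_elim simp
 qed (use m mA in measurable)
 then show "sqn (%z. stek h g z - g z) \<le> e" using A(2) by simp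
qed

text \<open>Every translation error is at most 4 \<open>sqn g\<close>; splitting off g gives 2 * 4 +
  2 = 10.\<close>

lemma stek_L2:
 fixes g :: "real \<times> 'n::euclidean_space => 'b::euclidean_space"
 assumes g: "L2 g" and h: "h > 0"
 shows "L2 (stek h g)" "sqn (stek h g) \<le> 10 * sqn g"
proof -
 have "sqn (%z. g (z + s) - g z) \<le> 4 * sqn g" for s
  using sqn_diff_le[OF L2_shift[OF g, of s] g] sqn_shift[OF g, of s] by simp
 note A = stek_sqn[OF g h this]
 have eq: "stek h g = (%z. (stek h g z - g z) + g z)" by simp
 show "L2 (stek h g)" by (subst eq) (rule L2_add[OF A(1) g])
 show "sqn (stek h g) \<le> 10 * sqn g" by (subst eq) (use sqn_add_le[OF A(1) g] A(2) in linarith)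
qed

lemma stek_interval:
 fixes g :: "real \<times> 'n::euclidean_space => 'b::euclidean_space"
 assumes [measurable]: "g \<in> borel_fun" and h: "h > 0"
 shows "stek h g (t, x) = (1 / h) *\<^sub>R (LBINT s:{t..t+h}. g (s, x))"
proof -
 have "(LBINT s:{t..t+h}. g (s, x)) = h *\<^sub>R (LBINT \<theta>. ind {t..t+h} (t + h * \<theta>) *\<^sub>R g (t + h * \<theta>, x))"
  unfolding set_lebesgue_integral_def by (subst integral_affine[OF _ h, of _ t]) auto
 also have "(%\<theta>. ind {t..t+h} (t + h * \<theta>) *\<^sub>R g (t + h * \<theta>, x)) = (%\<theta>. unit_k \<theta> *\<^sub>R g (t + h * \<theta>, x))"
  using h by (auto simp: indicator_def fun_eq_iff zero_le_mult_iff mult_le_cancel_left1)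
 finally show ?thesis using h by (simp add: stek_def)
qed

text \<open>The time derivative of a Steklov average is a difference quotient. In integrated form
  this is the additivity of the integral over adjacent intervals.\<close>

lemma stek_ftc:
 fixes g :: "real \<times> 'n::euclidean_space => real"
 assumes [measurable]: "g \<in> borel_fun" and C: "!!z. \<bar>g z\<bar> \<le> C" and h: "h > 0" and sr: "s \<le> r"
 shows "(LBINT \<sigma>:{s..r}. (g (\<sigma> + h, x) - g (\<sigma>, x)) / h) = stek h g (r, x) - stek h g (s, x)"
proof -
 have i: "integrable lborel (%\<sigma>. ind {a..b} \<sigma> * g (\<sigma> + c, x))" for a b c
  by (rule integrable_bounded_support[of _ "\<bar>C\<bar>" "{a..b}"]) (use C in \<open>auto simp: indicator_def abs_mult intro: order_trans[OF C abs_ge_self]\<close>)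
 define J where "J a b = (LBINT \<sigma>. ind {a..b} \<sigma> * g (\<sigma>, x))" for a b
 have split: "J a c = J a b + J b c" if "a \<le> b" "b \<le> c" for a b c
 proof -
  have "J a b + J b c = (LBINT \<sigma>. ind {a..b} \<sigma> * g (\<sigma>, x) + ind {b..c} \<sigma> * g (\<sigma>, x))"
   unfolding J_def using i[of _ _ 0] by simp
  also have "\<dots> = J a c" unfolding J_def
  proof (rule integral_cong_AE)
   have "AE \<sigma> in lborel. \<sigma> \<noteq> b" by (rule AE_lborel_singleton)
   then show "AE \<sigma> in lborel. ind {a..b} \<sigma> * g (\<sigma>, x) + ind {b..c} \<sigma> * g (\<sigma>, x) = ind {a..c} \<sigma> * g (\<sigma>, x)"
    by eventually_elim (use that in \<open>auto simp: indicator_def\<close>)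
  qed measurable
  finally show ?thesis ..
 qed
 have sh: "(LBINT \<sigma>. ind {s..r} \<sigma> * g (\<sigma> + h, x)) = J (s + h) (r + h)"
 proof -
  have "J (s + h) (r + h) = (LBINT \<sigma>. ind {s+h..r+h} (\<sigma> + h) * g (\<sigma> + h, x))"
   unfolding J_def by (subst integral_lborel_shift[where s = h, symmetric]) auto
  also have "\<dots> = (LBINT \<sigma>. ind {s..r} \<sigma> * g (\<sigma> + h, x))"
   by (intro lint_cong) (auto simp: indicator_def)
  finally show ?thesis ..
 qed
 have "(LBINT \<sigma>:{s..r}. (g (\<sigma> + h, x) - g (\<sigma>, x)) / h)
   = (LBINT \<sigma>. (ind {s..r} \<sigma> * g (\<sigma> + h, x) - ind {s..r} \<sigma> * g (\<sigma>, x)) / h)"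
  unfolding set_lebesgue_integral_def by (simp add: algebra_simps)
 also have "\<dots> = (J (s + h) (r + h) - J s r) / h"
  using i[of s r h] i[of s r 0] by (simp add: sh J_def)
 also have "J (s + h) (r + h) - J s r = J r (r + h) - J s (s + h)"
 proof -
  have "J s (r + h) = J s r + J r (r + h)" "J s (r + h) = J s (s + h) + J (s + h) (r + h)"
   using sr h by (auto intro!: split)
  then show ?thesis by simp
 qed
 finally show ?thesis
  unfolding stek_interval[OF assms(1) h] by (simp add: J_def set_lebesgue_integral_def diff_divide_distrib)
qed

lemma stek_wgrad:
 fixes V :: "real \<times> 'n::euclidean_space => real" and G :: "real \<times> 'n => 'n"
 assumes V[measurable]: "V \<in> borel_fun" and VC: "!!z. \<bar>V z\<bar> \<le> C"
  and G[measurable]: "G \<in> borel_fun" and GC: "!!z. norm (G z) \<le> C"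
  and w: "!!t. wgrad U (%x. V (t, x)) (%x. G (t, x))"
 shows "wgrad U (%x. stek h V (t, x)) (%x. stek h G (t, x))"
 unfolding wgrad_def
proof (intro allI impI ballI)
 fix \<psi> :: "'n => real" and i :: 'n assume p: "test_fun U \<psi>" and i: "i \<in> Basis"
 have C0: "0 \<le> C" using VC[of undefined] by linarith
 have sw: "(LBINT x. (LBINT \<theta>. unit_k \<theta> * (a (t + h * \<theta>, x) * q x))) = (LBINT \<theta>. unit_k \<theta> * (LBINT x. a (t + h * \<theta>, x) * q x))"
  if q: "test_fun U q" and a[measurable]: "a \<in> borel_fun" and aC: "!!z. \<bar>a z\<bar> \<le> C" for a q
 proof -
  obtain B where B: "!!x. \<bar>q x\<bar> \<le> B" using test_fun_bounded[OF q] by blast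
  note [measurable] = test_fun_measurable[OF q]
  let ?S = "closure {x. q x \<noteq> 0}"
  have "integrable lborel (%y. unit_k (fst y) * (a (t + h * fst y, snd y) * q (snd y)))"
  proof (rule integrable_bounded_support[of _ "C * B" "{0..1} \<times> ?S"])
   show "norm (unit_k (fst y) * (a (t + h * fst y, snd y) * q (snd y))) \<le> C * B" for y
   proof -
    have "\<bar>a (t + h * fst y, snd y)\<bar> * \<bar>q (snd y)\<bar> \<le> C * B" using aC B C0 by (intro mult_mono) auto
    moreover have "0 \<le> C * B" using C0 B[of undefined] by (intro mult_nonneg_nonneg) auto
    ultimately show ?thesis by (auto simp: indicator_def abs_mult)
   qed
   show "bounded ({0..1::real} \<times> ?S)" using test_fun_compact[OF q] by (intro bounded_Times) (auto intro: compact_imp_bounded)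
   show "unit_k (fst y) * (a (t + h * fst y, snd y) * q (snd y)) = 0" if "y \<notin> {0..1} \<times> ?S" for y
    using that test_fun_zero[of "snd y" q] by (cases y) (auto simp: indicator_def)
  qed measurable
  from integral_swap[OF this] show ?thesis by simp
 qed
 have "(LBINT x. stek h V (t, x) * dd \<psi> x i) = (LBINT x. (LBINT \<theta>. unit_k \<theta> * (V (t + h * \<theta>, x) * dd \<psi> x i)))"
  by (simp add: stek_def mult.assoc[symmetric])
 also have "\<dots> = (LBINT \<theta>. unit_k \<theta> * (LBINT x. V (t + h * \<theta>, x) * dd \<psi> x i))"
  by (rule sw[OF test_fun_dd[OF p] V VC])
 also have "\<dots> = - (LBINT \<theta>. unit_k \<theta> * (LBINT x. (G (t + h * \<theta>, x) \<bullet> i) * \<psi> x))"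
  using wgradD[OF w p i] by simp
 also have "(LBINT \<theta>. unit_k \<theta> * (LBINT x. (G (t + h * \<theta>, x) \<bullet> i) * \<psi> x)) = (LBINT x. (LBINT \<theta>. unit_k \<theta> * ((G (t + h * \<theta>, x) \<bullet> i) * \<psi> x)))"
 proof (rule sw[OF p, symmetric])
  show "\<bar>G z \<bullet> i\<bar> \<le> C" for z using Basis_le_norm[OF i, of "G z"] GC[of z] by linarith
 qed measurable
 also have "\<dots> = (LBINT x. (stek h G (t, x) \<bullet> i) * \<psi> x)"
 proof (intro lint_cong refl)
  fix x
  have "stek h G (t, x) \<bullet> i = (LBINT \<theta>. (unit_k \<theta> *\<^sub>R G (t + h * \<theta>, x)) \<bullet> i)"
   unfolding stek_def using stek_integrable_bounded[OF G GC] by (subst integral_inner_left) auto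
  then show "(LBINT \<theta>. unit_k \<theta> * ((G (t + h * \<theta>, x) \<bullet> i) * \<psi> x)) = (stek h G (t, x) \<bullet> i) * \<psi> x"
   by (simp add: mult.assoc[symmetric])
 qed
 finally show "(LBINT x. stek h V (t, x) * dd \<psi> x i) = - (LBINT x. (stek h G (t, x) \<bullet> i) * \<psi> x)" .
qed

text \<open>The integrated equations at t + h and at t are subtracted and divided by h. The result
  is an equation at a fixed time, with a difference quotient in place of the time
  derivative.\<close>

lemma stek_equation:
 fixes U :: "'n::euclidean_space set"
 assumes c: "clean_sol U D f u0 T v G w" and U: "bounded U" and f: "continuous_on UNIV f" "f 0 = 0"
  and D: "D \<in> borel_fun" "!!x. \<bar>D x\<bar> \<le> C0"
  and h: "h > 0" and H: "H1 U \<psi> \<Psi>" and t: "0 \<le> t" "t + h < T"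
 shows "(LBINT x. (w (t + h) x - w t x) / h * \<psi> x)
  = (LBINT x. stek h (%y. f (v y)) (t, x) * \<psi> x - D x * (stek h G (t, x) \<bullet> \<Psi> x))"
proof -
 note s = clean_solD[OF c]
 note L = clean_sol_L2[OF c U f]
 note [measurable] = s(1) L2_measurable[OF s(3)] L2_measurable[OF L(2)] D(1)
 have pL: "L2 \<psi>" "L2 \<Psi>" using H by (auto simp: H1_def)
 note [measurable] = L2_measurable[OF pL(1)] L2_measurable[OF pL(2)]
 have DP: "L2 (%x. D x *\<^sub>R \<Psi> x)" by (rule L2_mult_bounded[OF pL(2) D])
 define q where "q y = f (v y) * \<psi> (snd y) - D (snd y) * (G y \<bullet> \<Psi> (snd y))" for y
 have indL: "L2 (%\<sigma>. ind {a..b} \<sigma> :: real)" for a b :: real by (rule L2_bounded_support[of _ 1 "{a..b}"]) (auto simp: indicator_def)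
 have i1: "integrable lborel (%y. f (v y) * (ind {a..b} (fst y) *\<^sub>R \<psi> (snd y)))" for a b
  by (rule L2_mult_integrable[OF L(2) L2_product[OF indL pL(1)]])
 have i2: "integrable lborel (%y. G y \<bullet> (ind {a..b} (fst y) *\<^sub>R (D (snd y) *\<^sub>R \<Psi> (snd y))))" for a b
  by (rule L2_inner_integrable[OF s(3) L2_product[OF indL DP]])
 have i: "integrable lborel (%y. ind {a..b} (fst y) * q y)" for a b
  using lintegrable_diff[OF i1[of a b] i2[of a b]] by (simp add: q_def algebra_simps)
 have "(LBINT x. (w (t + h) x - w t x) * \<psi> x) = (LBINT x. w (t + h) x * \<psi> x) - (LBINT x. w t x * \<psi> x)"
  using L2_mult_integrable[OF s(7) pL(1)] by (simp add: left_diff_distrib)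
 also have "\<dots> = (LBINT y. ind {0..t+h} (fst y) * q y) - (LBINT y. ind {0..t} (fst y) * q y)"
  using s(11)[OF H, of "t + h"] s(11)[OF H, of t] t h by (simp add: q_def)
 also have "\<dots> = (LBINT y. ind {0..t+h} (fst y) * q y - ind {0..t} (fst y) * q y)"
  using i by simp
 also have "\<dots> = (LBINT y. ind {t..t+h} (fst y) * q y)"
 proof (rule integral_cong_AE)
  have "AE y in (lborel :: (real \<times> 'n) measure). fst y \<noteq> t" by (rule AE_slice'(2)[OF AE_lborel_singleton])
  then show "AE y in lborel. ind {0..t+h} (fst y) * q y - ind {0..t} (fst y) * q y = ind {t..t+h} (fst y) * q y"
   by eventually_elim (use t h in \<open>auto simp: indicator_def\<close>)
  show "(%y. ind {0..t+h} (fst y) * q y - ind {0..t} (fst y) * q y) \<in> borel_measurable lborel"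
   "(%y. ind {t..t+h} (fst y) * q y) \<in> borel_measurable lborel" unfolding q_def by measurable
 qed
 also have "\<dots> = (LBINT x. LBINT s. ind {t..t+h} s * q (s, x))"
  using integral_slice(1)[OF i] integral_swap[OF i] by simp
 also have "\<dots> = (LBINT x. h * (stek h (%y. f (v y)) (t, x) * \<psi> x - D x * (stek h G (t, x) \<bullet> \<Psi> x)))"
 proof (rule integral_cong_AE)
  have fm: "(%y. f (v y)) \<in> borel_fun" by measurable
  have Gm: "G \<in> borel_fun" by measurable
  show "AE x in lborel. (LBINT s. ind {t..t+h} s * q (s, x)) = h * (stek h (%y. f (v y)) (t, x) * \<psi> x - D x * (stek h G (t, x) \<bullet> \<Psi> x))"
   using L2_slice(2)[OF L(2)] L2_slice(2)[OF s(3)]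
  proof eventually_elim
   case (elim x)
   have j1: "integrable lborel (%s. ind {t..t+h} s *\<^sub>R f (v (s, x)))" by (rule L2_set_integrable[OF elim(1)]) auto
   have j2: "integrable lborel (%s. ind {t..t+h} s *\<^sub>R G (s, x))" by (rule L2_set_integrable[OF elim(2)]) auto
   have "(LBINT s. ind {t..t+h} s * q (s, x)) = (LBINT s. (ind {t..t+h} s *\<^sub>R f (v (s, x))) * \<psi> x - (ind {t..t+h} s *\<^sub>R G (s, x)) \<bullet> (D x *\<^sub>R \<Psi> x))"
    by (intro lint_cong) (auto simp: q_def algebra_simps)
   also have "\<dots> = (LBINT s. ind {t..t+h} s *\<^sub>R f (v (s, x))) * \<psi> x - (LBINT s. ind {t..t+h} s *\<^sub>R G (s, x)) \<bullet> (D x *\<^sub>R \<Psi> x)"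
    unfolding integral_inner_left[of "D x *\<^sub>R \<Psi> x", OF j2, symmetric] integral_mult_left_zero[symmetric]
    by (rule lint_diff[OF integrable_mult_left[OF j1] integrable_inner_left[OF j2]])
   finally have e: "(LBINT s. ind {t..t+h} s * q (s, x)) = \<dots>" .
   show ?case using h unfolding e stek_interval[OF fm h] stek_interval[OF Gm h] set_lebesgue_integral_def
    by (simp add: field_simps)
  qed
  show "(%x. LBINT s. ind {t..t+h} s * q (s, x)) \<in> borel_measurable lborel"
  proof -
   have "(%p. ind {t..t+h} (snd p) * q (snd p, fst p)) \<in> borel_measurable (borel :: ('n \<times> real) measure)"
    unfolding q_def by measurable
   then have "(%(x, s). ind {t..t+h} s * q (s, x)) \<in> borel_measurable (lborel \<Otimes>\<^sub>M lborel)"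
    using borel_measurable_pairI(1) by (simp add: case_prod_beta')
   then show ?thesis by (rule lborel.borel_measurable_lebesgue_integral)
  qed
 qed measurable
 also have "\<dots> = h * (LBINT x. stek h (%y. f (v y)) (t, x) * \<psi> x - D x * (stek h G (t, x) \<bullet> \<Psi> x))" by simp
 finally have "(LBINT x. (w (t + h) x - w t x) * \<psi> x) / h = (LBINT x. stek h (%y. f (v y)) (t, x) * \<psi> x - D x * (stek h G (t, x) \<bullet> \<Psi> x))"
  using h by simp
 then show ?thesis by (simp add: times_divide_eq_left)
qed


text \<open>Differentiation under the integral sign in weak form: Fubini moves the test function
  onto the smooth kernel, where integration by parts is classical.\<close>

lemma kernel_wgrad:
 fixes k :: "'n::euclidean_space => 'n => real" and g :: "'n => real"
 assumes k: "!!y. smooth_fun (%x. k x y)" "(%z. k (fst z) (snd z)) \<in> borel_fun" "!!x y. \<bar>k x y\<bar> \<le> C"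
  and dk: "!!x y i. i \<in> Basis ==> dd (%x. k x y) x i = K x y \<bullet> i" "(%z. K (fst z) (snd z)) \<in> borel_fun" "!!x y. norm (K x y) \<le> C"
  and g[measurable]: "g \<in> borel_fun" and gC: "!!y. \<bar>g y\<bar> \<le> B" and gS: "bounded S" "!!y. y \<notin> S ==> g y = 0"
 shows "wgrad UNIV (%x. LBINT y. k x y * g y) (%x. LBINT y. g y *\<^sub>R K x y)"
 unfolding wgrad_def
proof (intro allI impI ballI)
 fix \<psi> :: "'n => real" and i :: 'n assume p: "test_fun UNIV \<psi>" and i: "i \<in> Basis"
 have C0: "0 \<le> C" "0 \<le> B" using k(3)[of undefined undefined] gC[of undefined] by linarith+
 note [measurable] = k(2) dk(2)
 have Km: "(%y. K x y) \<in> borel_fun" for x using measurable_slice(1)[OF dk(2), of x] by simp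
 have sw: "(LBINT x. (LBINT y. a x y * g y * q x)) = (LBINT y. g y * (LBINT x. a x y * q x))"
  if q: "test_fun UNIV q" and a[measurable]: "(%z. a (fst z) (snd z)) \<in> borel_fun" and aC: "!!x y. \<bar>a x y\<bar> \<le> C" for a q
 proof -
  obtain Q where Q: "!!x. \<bar>q x\<bar> \<le> Q" using test_fun_bounded[OF q] by blast
  have Q0: "0 \<le> Q" using Q[of undefined] by linarith
  note [measurable] = test_fun_measurable[OF q]
  let ?S = "closure {x. q x \<noteq> 0}"
  have "integrable lborel (%z. a (fst z) (snd z) * g (snd z) * q (fst z))"
  proof (rule integrable_bounded_support[of _ "C * B * Q" "?S \<times> S"])
   show "norm (a (fst z) (snd z) * g (snd z) * q (fst z)) \<le> C * B * Q" for z
    unfolding real_norm_def abs_mult using aC gC Q C0 Q0 by (intro mult_mono) auto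
   show "bounded (?S \<times> S)" using test_fun_compact[OF q] gS(1) by (intro bounded_Times) (auto intro: compact_imp_bounded)
   show "a (fst z) (snd z) * g (snd z) * q (fst z) = 0" if "z \<notin> ?S \<times> S" for z
    using that test_fun_zero[of "fst z" q] gS(2)[of "snd z"] by (cases z) auto
  qed measurable
  from integral_swap[OF this] show ?thesis by (simp add: mult_ac)
 qed
 have "(LBINT x. (LBINT y. k x y * g y) * dd \<psi> x i) = (LBINT x. (LBINT y. k x y * g y * dd \<psi> x i))" by simp
 also have "\<dots> = (LBINT y. g y * (LBINT x. k x y * dd \<psi> x i))"
  by (rule sw[OF test_fun_dd[OF p] k(2,3)])
 also have "\<dots> = - (LBINT y. g y * (LBINT x. (K x y \<bullet> i) * \<psi> x))"
  using smooth_test_by_parts[OF k(1) p] dk(1)[OF i] by simp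
 also have "(LBINT y. g y * (LBINT x. (K x y \<bullet> i) * \<psi> x)) = (LBINT x. (LBINT y. (K x y \<bullet> i) * g y * \<psi> x))"
 proof (rule sw[OF p, symmetric])
  show "\<bar>K x y \<bullet> i\<bar> \<le> C" for x y using Basis_le_norm[OF i, of "K x y"] dk(3)[of x y] by linarith
 qed measurable
 also have "\<dots> = (LBINT x. ((LBINT y. g y *\<^sub>R K x y) \<bullet> i) * \<psi> x)"
 proof (intro lint_cong refl)
  fix x
  have "integrable lborel (%y. g y *\<^sub>R K x y)"
  proof (rule integrable_bounded_support[of _ "B * C" S])
   show "norm (g y *\<^sub>R K x y) \<le> B * C" for y using gC dk(3) C0 by (auto intro!: mult_mono)
  qed (use gS Km in auto)
  then have "(LBINT y. g y *\<^sub>R K x y) \<bullet> i = (LBINT y. (g y *\<^sub>R K x y) \<bullet> i)" by (rule integral_inner_left[symmetric])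
  then show "(LBINT y. (K x y \<bullet> i) * g y * \<psi> x) = ((LBINT y. g y *\<^sub>R K x y) \<bullet> i) * \<psi> x"
   by (simp add: mult_ac)
 qed
 finally show "(LBINT x. (LBINT y. k x y * g y) * dd \<psi> x i) = - (LBINT x. ((LBINT y. g y *\<^sub>R K x y) \<bullet> i) * \<psi> x)" .
qed

section \<open>Mollification along the inward cones\<close>

definition pkern :: "'n::euclidean_space set => ('n => 'n => real) => ('n => 'n) => real => 'n => 'n => real" where
 "pkern I \<zeta> \<nu> \<tau> x y = (\<Sum>p\<in>I. \<zeta> p x * kern \<tau> (\<nu> p) x y)"

definition pkern_grad :: "'n::euclidean_space set => ('n => 'n => real) => ('n => 'n) => real => 'n => 'n => 'n" where
 "pkern_grad I \<zeta> \<nu> \<tau> x y = (\<Sum>p\<in>I. \<zeta> p x *\<^sub>R gradf (%x. kern \<tau> (\<nu> p) x y) x + kern \<tau> (\<nu> p) x y *\<^sub>R gradf (\<zeta> p) x)"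

lemma kern_gradf: "gradf (%x. kern t v x y) x = - (inverse (t ^ DIM('n)) / t) *\<^sub>R gradf rho ((1/t) *\<^sub>R (y - x) - v)"
 for x :: "'n::euclidean_space"
proof (rule euclidean_eqI)
 fix i :: 'n assume i: "i \<in> Basis"
 show "gradf (%x. kern t v x y) x \<bullet> i = (- (inverse (t ^ DIM('n)) / t) *\<^sub>R gradf rho ((1/t) *\<^sub>R (y - x) - v)) \<bullet> i"
  unfolding gradf_inner[OF i] kern_dd_fst kern_dd_snd dd_gradf[OF rho_smooth] by (simp add: divide_inverse mult_ac)
qed

lemma gradf_bounded:
 assumes "test_fun U g" obtains C where "!!x. norm (gradf g x) \<le> C" "0 \<le> C"
proof -
 have "\<exists>B. \<forall>x. \<bar>dd g x i\<bar> \<le> B" for i by (rule test_fun_bounded[OF test_fun_dd[OF assms]])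
 then obtain B where B: "!!i x. \<bar>dd g x i\<bar> \<le> B i" by metis
 have le: "norm (gradf g x) \<le> (\<Sum>i\<in>Basis. B i)" for x
  unfolding gradf_def by (rule order_trans[OF norm_sum]) (auto intro!: sum_mono B)
 show ?thesis
  by (rule that[of "\<Sum>i\<in>Basis. B i"], rule le, rule order_trans[OF norm_ge_zero le])
qed

locale cone_smoothing =
 fixes I :: "'n::euclidean_space set" and \<zeta> :: "'n => 'n => real" and \<nu> :: "'n => 'n"
 assumes I: "finite I" and \<zeta>: "!!p. p \<in> I ==> test_fun UNIV (\<zeta> p)" "!!p x. 0 \<le> \<zeta> p x" "!!x. (\<Sum>p\<in>I. \<zeta> p x) \<le> 1"
begin

lemma \<zeta>_measurable: "p \<in> I ==> \<zeta> p \<in> borel_fun" "p \<in> I ==> gradf (\<zeta> p) \<in> borel_fun"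
 using \<zeta>(1) by (auto intro: test_fun_measurable gradf_measurable test_fun_smooth)

lemma \<zeta>_le_1: "p \<in> I ==> \<bar>\<zeta> p x\<bar> \<le> 1"
 using member_le_sum[of p I "%p. \<zeta> p x"] I \<zeta>(2)[of _ x] \<zeta>(3)[of x] by fastforce

lemma \<zeta>_grad_bound: obtains C where "!!p x. p \<in> I ==> norm (gradf (\<zeta> p) x) \<le> C" "0 \<le> C"
proof -
 have "\<forall>p\<in>I. \<exists>C. (\<forall>x. norm (gradf (\<zeta> p) x) \<le> C) \<and> 0 \<le> C" by (metis gradf_bounded[OF \<zeta>(1)])
 then obtain C where C: "!!p x. p \<in> I ==> norm (gradf (\<zeta> p) x) \<le> C p \<and> 0 \<le> C p" by metis
 show ?thesis
 proof (rule that[of "\<Sum>p\<in>I. C p"])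
  show "norm (gradf (\<zeta> p) x) \<le> (\<Sum>p\<in>I. C p)" if "p \<in> I" for p x
   using member_le_sum[of p I C] that C[OF that, of x] C I by fastforce
  show "0 \<le> (\<Sum>p\<in>I. C p)" using C by (intro sum_nonneg) auto
 qed
qed

definition supp :: "'n set" where "supp = (\<Union>p\<in>I. closure {x. \<zeta> p x \<noteq> 0})"

lemma supp: "bounded supp" "x \<notin> supp ==> p \<in> I ==> \<zeta> p x = 0" "x \<notin> supp ==> p \<in> I ==> gradf (\<zeta> p) x = 0"
proof -
 show "bounded supp" unfolding supp_def using I test_fun_compact[OF \<zeta>(1)] by (auto intro: compact_imp_bounded)
 assume "x \<notin> supp" "p \<in> I"
 then have x: "x \<notin> closure {x. \<zeta> p x \<noteq> 0}" by (auto simp: supp_def)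
 show "\<zeta> p x = 0" by (rule test_fun_zero[OF x])
 show "gradf (\<zeta> p) x = 0" unfolding gradf_def using test_fun_dd_zero[OF x] by simp
qed

lemma pkern_smooth: "smooth_fun (%x. pkern I \<zeta> \<nu> \<tau> x y)"
 unfolding pkern_def[abs_def] by (intro smooth_sum smooth_mult kern_smooth_fst test_fun_smooth[OF \<zeta>(1)])

lemma pkern_dd:
 assumes "i \<in> Basis" shows "dd (%x. pkern I \<zeta> \<nu> \<tau> x y) x i = pkern_grad I \<zeta> \<nu> \<tau> x y \<bullet> i"
proof -
 have sm: "smooth_fun (%x. \<zeta> p x * kern \<tau> (\<nu> p) x y)" if "p \<in> I" for p
  using that by (intro smooth_mult kern_smooth_fst test_fun_smooth[OF \<zeta>(1)])
 have "((%x. \<Sum>p\<in>I. \<zeta> p x * kern \<tau> (\<nu> p) x y) has_derivative (%v. \<Sum>p\<in>I. dd (%x. \<zeta> p x * kern \<tau> (\<nu> p) x y) x v)) (at x)"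
  using smooth_has_derivative[OF sm] by (intro has_derivative_sum) (simp add: eta_contract_eq)
 from dd_eq[OF this, of i] show ?thesis
  unfolding pkern_def[abs_def] pkern_grad_def inner_sum_left
  using assms by (simp add: dd_mult[OF test_fun_smooth[OF \<zeta>(1)] kern_smooth_fst] inner_add_left gradf_inner mult_ac)
qed

lemma pkern_measurable: "(%z. pkern I \<zeta> \<nu> \<tau> (fst z) (snd z)) \<in> borel_fun"
proof -
 have "(%z. \<zeta> p (fst z) * kern \<tau> (\<nu> p) (fst z) (snd z)) \<in> borel_fun" if "p \<in> I" for p
 proof -
  note [measurable] = \<zeta>_measurable(1)[OF that] kern_measurable(1)
  show ?thesis by measurable
 qed
 then show ?thesis unfolding pkern_def by (rule borel_measurable_sum)
qed

lemma pkern_grad_measurable: "(%z. pkern_grad I \<zeta> \<nu> \<tau> (fst z) (snd z)) \<in> borel_fun"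
proof -
 have r[measurable]: "gradf rho \<in> borel_measurable (borel :: 'n measure)" by (rule gradf_measurable[OF rho_smooth])
 have "(%z. \<zeta> p (fst z) *\<^sub>R (- (inverse (\<tau> ^ DIM('n)) / \<tau>) *\<^sub>R gradf rho ((1/\<tau>) *\<^sub>R (snd z - fst z) - \<nu> p))
   + kern \<tau> (\<nu> p) (fst z) (snd z) *\<^sub>R gradf (\<zeta> p) (fst z)) \<in> borel_fun" if "p \<in> I" for p
 proof -
  note [measurable] = \<zeta>_measurable[OF that] kern_measurable(1)
  show ?thesis by measurable
 qed
 then show ?thesis unfolding pkern_grad_def kern_gradf by (rule borel_measurable_sum)
qed

text \<open>The bound may depend on \<tau>, through the factors 1/\<tau>^n and 1/\<tau>^(n+1) of the
  kernel and its gradient.\<close>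

lemma pkern_bounded:
 obtains C where "!!x y. \<bar>pkern I \<zeta> \<nu> \<tau> x y\<bar> \<le> C" "!!x y. norm (pkern_grad I \<zeta> \<nu> \<tau> x y) \<le> C"
proof -
 obtain R where R: "!!x::'n. \<bar>rho x\<bar> \<le> R" using test_fun_bounded[OF rho_test_fun] by blast
 obtain R' where R': "!!x::'n. norm (gradf rho x) \<le> R'" "0 \<le> R'" using gradf_bounded[OF rho_test_fun] by blast
 obtain Z where Z: "!!p x. p \<in> I ==> norm (gradf (\<zeta> p) x) \<le> Z" "0 \<le> Z" using \<zeta>_grad_bound by metis
 have R0: "0 \<le> R" using R[of undefined] by linarith
 define a where "a = \<bar>inverse (\<tau> ^ DIM('n))\<bar>"
 define b where "b = \<bar>inverse (\<tau> ^ DIM('n)) / \<tau>\<bar>"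
 have ab: "0 \<le> a" "0 \<le> b" by (auto simp: a_def b_def)
 have k: "\<bar>kern \<tau> v x y\<bar> \<le> R * a" for v x y :: 'n unfolding kern_def abs_mult a_def using R by (intro mult_right_mono) auto
 have k': "norm (gradf (%x. kern \<tau> v x y) x) \<le> b * R'" for v x y :: 'n
  unfolding kern_gradf b_def norm_scaleR abs_minus_cancel by (rule mult_left_mono[OF R'(1)]) simp
 show ?thesis
 proof (rule that[of "(\<Sum>p\<in>I. R * a + (b * R' + R * a * Z))"])
  fix x y
  have 1: "\<bar>\<zeta> p x * kern \<tau> (\<nu> p) x y\<bar> \<le> R * a" if "p \<in> I" for p
   using mult_mono[OF \<zeta>_le_1[OF that] k] by (simp add: abs_mult)
  have n: "0 \<le> b * R' + R * a * Z" "0 \<le> R * a" using ab R0 R' Z by auto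
  show "\<bar>pkern I \<zeta> \<nu> \<tau> x y\<bar> \<le> (\<Sum>p\<in>I. R * a + (b * R' + R * a * Z))"
   unfolding pkern_def
  proof (rule order_trans[OF sum_abs sum_mono])
   show "\<bar>\<zeta> p x * kern \<tau> (\<nu> p) x y\<bar> \<le> R * a + (b * R' + R * a * Z)" if "p \<in> I" for p using 1[OF that] n by linarith
  qed
  have "norm (\<zeta> p x *\<^sub>R gradf (%x. kern \<tau> (\<nu> p) x y) x + kern \<tau> (\<nu> p) x y *\<^sub>R gradf (\<zeta> p) x) \<le> b * R' + R * a * Z" if "p \<in> I" for p
  proof -
   have "norm (\<zeta> p x *\<^sub>R gradf (%x. kern \<tau> (\<nu> p) x y) x) \<le> 1 * (b * R')"
    unfolding norm_scaleR by (intro mult_mono \<zeta>_le_1[OF that] k') auto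
   moreover have "norm (kern \<tau> (\<nu> p) x y *\<^sub>R gradf (\<zeta> p) x) \<le> R * a * Z"
    unfolding norm_scaleR by (intro mult_mono k Z(1)[OF that] n) auto
   ultimately show ?thesis by (intro order_trans[OF norm_triangle_ineq]) linarith
  qed
  note 2 = this
  show "norm (pkern_grad I \<zeta> \<nu> \<tau> x y) \<le> (\<Sum>p\<in>I. R * a + (b * R' + R * a * Z))"
   unfolding pkern_grad_def
  proof (rule order_trans[OF norm_sum sum_mono])
   show "norm (\<zeta> p x *\<^sub>R gradf (%x. kern \<tau> (\<nu> p) x y) x + kern \<tau> (\<nu> p) x y *\<^sub>R gradf (\<zeta> p) x) \<le> R * a + (b * R' + R * a * Z)" if "p \<in> I" for p
    using 2[OF that] n by linarith
  qed
 qed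
qed

text \<open>Each piece of the partition uses its own displaced mean. The formula makes sense at
  every point of space, and this is how the solution on the inner domain is extended.\<close>

definition smo :: "real => (real \<times> 'n => real) => real \<times> 'n => real" where
 "smo \<tau> v z = (LBINT y. pkern I \<zeta> \<nu> \<tau> (snd z) y * v (fst z, y))"

definition smo_grad :: "real => (real \<times> 'n => real) => real \<times> 'n => 'n" where
 "smo_grad \<tau> v z = (LBINT y. v (fst z, y) *\<^sub>R pkern_grad I \<zeta> \<nu> \<tau> (snd z) y)"

text \<open>Error of the p-th mean, written as a mean of increments under purely spatial
  translations of space-time; it is estimated by \<open>sqn_average\<close> before anything is known
  about single time slices.\<close>

definition serr :: "real => 'n => (real \<times> 'n => 'b::euclidean_space) => real \<times> 'n => 'b" where
 "serr \<tau> p g z = (LBINT y. rho y *\<^sub>R (g (z + (0, \<tau> *\<^sub>R (\<nu> p + y))) - g z))"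

lemma smo_zero: "snd z \<notin> supp ==> smo \<tau> v z = 0" "snd z \<notin> supp ==> smo_grad \<tau> v z = 0"
 using supp(2,3) by (simp_all add: smo_def smo_grad_def pkern_def pkern_grad_def)

lemma smo_measurable:
 assumes [measurable]: "v \<in> borel_fun"
 shows "smo \<tau> v \<in> borel_fun" "smo_grad \<tau> v \<in> borel_fun"
proof -
 have vq: "(%q. v (fst (fst q), snd q)) \<in> borel_measurable (borel :: ((real \<times> 'n) \<times> 'n) measure)" by measurable
 have pq: "(%q. (snd (fst q), snd q)) \<in> borel_measurable (borel :: ((real \<times> 'n) \<times> 'n) measure)" by measurable
 have "(%q. pkern I \<zeta> \<nu> \<tau> (snd (fst q)) (snd q) * v (fst (fst q), snd q)) \<in> borel_measurable (borel :: ((real \<times> 'n) \<times> 'n) measure)"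
  by (intro borel_measurable_times vq) (use measurable_compose[OF pq pkern_measurable] in simp)
 from lborel.borel_measurable_lebesgue_integral[of "%z y. pkern I \<zeta> \<nu> \<tau> (snd z) y * v (fst z, y)" lborel] borel_measurable_pairI(1)[OF this]
 show "smo \<tau> v \<in> borel_fun" unfolding smo_def[abs_def] by (simp add: case_prod_beta')
 have "(%q. v (fst (fst q), snd q) *\<^sub>R pkern_grad I \<zeta> \<nu> \<tau> (snd (fst q)) (snd q)) \<in> borel_measurable (borel :: ((real \<times> 'n) \<times> 'n) measure)"
  by (intro borel_measurable_scaleR vq) (use measurable_compose[OF pq pkern_grad_measurable] in simp)
 from lborel.borel_measurable_lebesgue_integral[of "%z y. v (fst z, y) *\<^sub>R pkern_grad I \<zeta> \<nu> \<tau> (snd z) y" lborel] borel_measurable_pairI(1)[OF this]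
 show "smo_grad \<tau> v \<in> borel_fun" unfolding smo_grad_def[abs_def] by (simp add: case_prod_beta')
qed

end

lemma avg_inner:
 fixes g :: "'n::euclidean_space => 'n"
 assumes g: "L2 g" and t: "t > 0"
 shows "avg t v (%y. g y \<bullet> i) x = avg t v g x \<bullet> i"
proof -
 have "integrable lborel (%y. rho y *\<^sub>R g ((x + t *\<^sub>R v) + t *\<^sub>R y))" by (rule rho_L2_integrable[OF L2_affine[OF g t]])
 then have "integrable lborel (%y. rho y *\<^sub>R g (x + t *\<^sub>R (v + y)))" by (simp add: algebra_simps)
 from integral_inner_left[of i, OF this] show ?thesis by (simp add: avg_def)
qed

lemma avg_bounded:
 fixes g :: "'n::euclidean_space => real"
 assumes [measurable]: "g \<in> borel_fun" and C: "!!x. \<bar>g x\<bar> \<le> C"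
 shows "\<bar>avg t v g x\<bar> \<le> C"
proof -
 have i: "integrable lborel (%y::'n. rho y * C)" by (rule integrable_mult_left[OF rho_integrable])
 have "\<bar>avg t v g x\<bar> \<le> (LBINT y. norm (rho y *\<^sub>R g (x + t *\<^sub>R (v + y))))"
  unfolding avg_def real_norm_def[symmetric] by (rule integral_norm_bound)
 also have "\<dots> \<le> (LBINT y. rho (y::'n) * C)"
 proof (rule integral_mono)
  show "norm (rho y *\<^sub>R g (x + t *\<^sub>R (v + y))) \<le> rho y * C"
   for y using C rho_nonneg[of y] by (simp add: abs_mult mult_left_mono)
  then show "integrable lborel (%y. norm (rho y *\<^sub>R g (x + t *\<^sub>R (v + y))))"
   by (intro lintegrable_bound[OF i]) (auto intro: order_trans[OF _ abs_ge_self])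
 qed (rule i)
 also have "\<dots> = C" by (simp add: rho_integral)
 finally show ?thesis .
qed

lemma integrable_test_fun_mult:
 fixes g :: "'n::euclidean_space => real"
 assumes p: "test_fun UNIV p" and [measurable]: "g \<in> borel_fun" and C: "!!x. \<bar>g x\<bar> \<le> C"
 shows "integrable lborel (%y. g y * p y)"
proof (rule lintegrable_bound)
 show "integrable lborel (%y. C * p y)" using test_fun_integrable[OF p] by simp
 note [measurable] = test_fun_measurable[OF p]
 show "(%y. g y * p y) \<in> borel_measurable lborel" by measurable
 show "AE y in lborel. norm (g y * p y) \<le> norm (C * p y)"
  using C by (intro AE_I2) (auto simp: abs_mult intro!: mult_right_mono order_trans[OF C abs_ge_self])
qed

context cone_smoothing
begin

lemma pkern_bounded_ex: "\<exists>C. (\<forall>x y. \<bar>pkern I \<zeta> \<nu> \<tau> x y\<bar> \<le> C) \<and> (\<forall>x y. norm (pkern_grad I \<zeta> \<nu> \<tau> x y) \<le> C)"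
 by (rule pkern_bounded[of \<tau>], intro exI conjI allI, assumption+)

lemma kern_test: "\<tau> > 0 ==> test_fun UNIV (kern \<tau> v x)" for v x :: 'n
 by (rule kern_test_fun) auto

lemma smo_eq:
 assumes \<tau>: "\<tau> > 0" and v: "v \<in> borel_fun" and K: "!!z. \<bar>v z\<bar> \<le> K"
 shows "smo \<tau> v (t, x) = (\<Sum>p\<in>I. \<zeta> p x * avg \<tau> (\<nu> p) (%y. v (t, y)) x)"
proof -
 have vt: "(%y. v (t, y)) \<in> borel_fun" by (rule measurable_slice(1)[OF v])
 have i: "integrable lborel (%y. v (t, y) * kern \<tau> (\<nu> p) x y)" for p
  by (rule integrable_test_fun_mult[OF kern_test[OF \<tau>] vt K])
 have "smo \<tau> v (t, x) = (LBINT y. (\<Sum>p\<in>I. \<zeta> p x * (v (t, y) * kern \<tau> (\<nu> p) x y)))"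
  by (simp add: smo_def pkern_def sum_distrib_left sum_distrib_right mult_ac)
 also have "\<dots> = (\<Sum>p\<in>I. \<zeta> p x * (LBINT y. v (t, y) * kern \<tau> (\<nu> p) x y))"
  using i by (subst lint_sum) auto
 finally show ?thesis by (simp add: avg_kern[OF \<tau> vt] mult_ac)
qed

lemma smo_bounded:
 assumes \<tau>: "\<tau> > 0" and v: "v \<in> borel_fun" and K: "!!z. \<bar>v z\<bar> \<le> K"
 shows "\<bar>smo \<tau> v z\<bar> \<le> K"
proof -
 obtain t x where z: "z = (t, x)" by (cases z)
 have K0: "0 \<le> K" using K[of undefined] by linarith
 have "\<bar>smo \<tau> v z\<bar> \<le> (\<Sum>p\<in>I. \<zeta> p x * K)"
  unfolding z smo_eq[OF assms]
 proof (rule order_trans[OF sum_abs sum_mono])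
  show "\<bar>\<zeta> p x * avg \<tau> (\<nu> p) (%y. v (t, y)) x\<bar> \<le> \<zeta> p x * K" for p
   using avg_bounded[OF measurable_slice(1)[OF v] K] \<zeta>(2)[of p x] by (simp add: abs_mult mult_left_mono)
 qed
 also have "\<dots> \<le> K" unfolding sum_distrib_right[symmetric] by (rule mult_left_le_one_le[OF K0 sum_nonneg \<zeta>(3)]) (rule \<zeta>(2))
 finally show ?thesis .
qed

lemma smo_grad_bounded:
 assumes v[measurable]: "v \<in> borel_fun" and K: "!!z. \<bar>v z\<bar> \<le> K" and S: "bounded S" "!!z. snd z \<notin> S ==> v z = 0"
 obtains C where "!!z. norm (smo_grad \<tau> v z) \<le> C"
proof -
 obtain C where C0: "(\<forall>x y. \<bar>pkern I \<zeta> \<nu> \<tau> x y\<bar> \<le> C) \<and> (\<forall>x y. norm (pkern_grad I \<zeta> \<nu> \<tau> x y) \<le> C)"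
  using pkern_bounded_ex[of \<tau>] by (elim exE)
 then have C: "!!x y. norm (pkern_grad I \<zeta> \<nu> \<tau> x y) \<le> C" by iprover
 obtain r where r0: "\<forall>x\<in>S. norm x \<le> r" using S(1) unfolding bounded_iff by (elim exE)
 then have r: "S \<subseteq> cball 0 r" by auto
 have K0: "0 \<le> K" "0 \<le> C" using order_trans[OF abs_ge_zero K] order_trans[OF norm_ge_zero C] by auto
 have iC: "integrable lborel (%y::'n. (K * C) * ind (cball 0 r) y)" by (rule integrable_indicator_cball)
 have "norm (smo_grad \<tau> v z) \<le> (LBINT y. (K * C) * ind (cball 0 r) (y::'n))" for z
  unfolding smo_grad_def
 proof (rule order_trans[OF integral_norm_bound integral_mono'[OF iC]])
  show "norm (v (fst z, y) *\<^sub>R pkern_grad I \<zeta> \<nu> \<tau> (snd z) y) \<le> (K * C) * ind (cball 0 r) y" for y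
  proof (cases "y \<in> S")
   case True
   then have "ind (cball 0 r) y = (1::real)" using r by auto
   then show ?thesis using mult_mono[OF K C K0(1) norm_ge_zero] by simp
  next
   case False
   then show ?thesis using S(2)[of "(fst z, y)"] K0 by simp
  qed
 qed (use K0 in auto)
 then show ?thesis by (rule that)
qed

lemma smo_wgrad:
 assumes v: "v \<in> borel_fun" and K: "!!z. \<bar>v z\<bar> \<le> K" and S: "bounded S" "!!z. snd z \<notin> S ==> v z = 0"
 shows "wgrad UNIV (%x. smo \<tau> v (t, x)) (%x. smo_grad \<tau> v (t, x))"
proof -
 obtain C where C0: "(\<forall>x y. \<bar>pkern I \<zeta> \<nu> \<tau> x y\<bar> \<le> C) \<and> (\<forall>x y. norm (pkern_grad I \<zeta> \<nu> \<tau> x y) \<le> C)"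
  using pkern_bounded_ex[of \<tau>] by (elim exE)
 then have C: "!!x y. \<bar>pkern I \<zeta> \<nu> \<tau> x y\<bar> \<le> C" "!!x y. norm (pkern_grad I \<zeta> \<nu> \<tau> x y) \<le> C" by iprover+
 have vt: "(%y. v (t, y)) \<in> borel_fun" by (rule measurable_slice(1)[OF v])
 show ?thesis unfolding smo_def smo_grad_def fst_conv snd_conv
  by (rule kernel_wgrad[OF pkern_smooth pkern_measurable C(1) pkern_dd pkern_grad_measurable C(2) vt K S(1)]) (use S(2) in auto)
qed

lemma serr_L2:
 fixes g :: "real \<times> 'n => 'b::euclidean_space"
 assumes g: "L2 g" and \<tau>: "\<tau> > 0" and e: "!!s. norm s \<le> \<tau> * (norm (\<nu> p) + 1) ==> sqn (%z. g (z + (0, s)) - g z) \<le> e" "0 \<le> e"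
 shows "L2 (serr \<tau> p g)" "sqn (serr \<tau> p g) \<le> e"
proof -
 have sm: "(%y. (0 :: real, \<tau> *\<^sub>R (\<nu> p + y))) \<in> borel_fun" by measurable
 have k: "sqn (%z. g (z + (0, \<tau> *\<^sub>R (\<nu> p + y))) - g z) \<le> e" if "rho y \<noteq> 0" for y
 proof (rule e(1))
  have "norm y < 1" using rho_zero[of y] that by (meson not_le)
  then show "norm (\<tau> *\<^sub>R (\<nu> p + y)) \<le> \<tau> * (norm (\<nu> p) + 1)"
   using \<tau> norm_triangle_ineq[of "\<nu> p" y] by (simp add: mult_left_mono)
 qed
 show "L2 (serr \<tau> p g)" "sqn (serr \<tau> p g) \<le> e" unfolding serr_def[abs_def]
  by (rule sqn_average[where k = rho and \<sigma> = "%y. (0, \<tau> *\<^sub>R (\<nu> p + y))", OF g rho_measurable rho_nonneg rho_integrable rho_integral sm k e(2)], assumption)+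
qed

lemma serr_slice:
 assumes "L2 (%y. g (t, y))" "\<tau> > 0"
 shows "serr \<tau> p g (t, x) = avg \<tau> (\<nu> p) (%y. g (t, y)) x - g (t, x)"
 using avg_minus[OF assms, of x "\<nu> p"] by (simp add: serr_def)

text \<open>The combination of translation errors which on \<open>U\<close> turns out to be the
  mollification error. Smallness is visible from this form, the identity with the error is
  \<open>errV_eq\<close>.\<close>

definition errV :: "'n set => real => (real \<times> 'n => real) => real \<times> 'n => real" where
 "errV U \<tau> v z = ind U (snd z) *\<^sub>R (\<Sum>p\<in>I. \<zeta> p (snd z) *\<^sub>R serr \<tau> p v z)"

text \<open>The second summand comes from the gradients of the partition. On \<open>U\<close> these
  add up to 0, so v may be subtracted from every mean and only an error remains, without division by
  \<tau>.\<close>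

definition errG :: "'n set => real => (real \<times> 'n => real) => (real \<times> 'n => 'n) => real \<times> 'n => 'n" where
 "errG U \<tau> v G z = ind U (snd z) *\<^sub>R (\<Sum>p\<in>I. \<zeta> p (snd z) *\<^sub>R serr \<tau> p G z + serr \<tau> p v z *\<^sub>R gradf (\<zeta> p) (snd z))"

lemma err_small:
 assumes v: "L2 v" and G: "L2 G" and U: "U \<in> sets borel" and e: "e > 0"
 obtains \<tau>1 where "\<tau>1 > 0" "!!\<tau>. 0 < \<tau> ==> \<tau> < \<tau>1 ==> L2 (errV U \<tau> v) \<and> sqn (errV U \<tau> v) \<le> e \<and> L2 (errG U \<tau> v G) \<and> sqn (errG U \<tau> v G) \<le> e"
proof -
 obtain Z where Z: "!!p x. p \<in> I ==> norm (gradf (\<zeta> p) x) \<le> Z" "0 \<le> Z" using \<zeta>_grad_bound by metis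
 \<comment> \<open>One factor card I from the square of a sum, another from adding card I equal
   bounds, and 2 + 2 Z^2 from the two summands of \<open>errG\<close>; the 1 keeps N positive when I
   is empty.\<close>
 define N where "N = real (card I) * (real (card I) * (2 + 2 * Z\<^sup>2)) + 1"
 have N: "0 < N" unfolding N_def by (intro add_nonneg_pos mult_nonneg_nonneg) auto
 define e' where "e' = e / N"
 have e': "0 < e'" using e N by (simp add: e'_def)
 obtain d1 where d1: "d1 > 0" "!!s. norm s \<le> d1 ==> sqn (%z. v (z + s) - v z) \<le> e'"
  using shift_cont_L2[OF v] e' unfolding shift_cont_def by blast
 obtain d2 where d2: "d2 > 0" "!!s. norm s \<le> d2 ==> sqn (%z. G (z + s) - G z) \<le> e'"
  using shift_cont_L2[OF G] e' unfolding shift_cont_def by blast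
 define d where "d = min d1 d2"
 \<comment> \<open>Bounds all |\<nu> p| + 1 at once, so that \<tau> < d / R makes every displacement
   shorter than d.\<close>
 define R where "R = (\<Sum>p\<in>I. norm (\<nu> p) + 1) + 1"
 have R: "norm (\<nu> p) + 1 \<le> R" if "p \<in> I" for p
  using member_le_sum[of p I "%p. norm (\<nu> p) + 1"] that I by (simp add: R_def)
 have R0: "0 < R" unfolding R_def by (intro add_nonneg_pos sum_nonneg) auto
 show ?thesis
 proof (rule that[of "d / R"])
  show "d / R > 0" using d1 d2 R0 by (simp add: d_def)
  fix \<tau> assume \<tau>: "0 < \<tau>" "\<tau> < d / R"
  have nd: "norm (0 :: real, s) \<le> d" if "p \<in> I" "norm s \<le> \<tau> * (norm (\<nu> p) + 1)" for p s
  proof -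
   have "norm s \<le> \<tau> * R" using that(2) mult_left_mono[OF R[OF that(1)], of \<tau>] \<tau> by linarith
   also have "\<dots> \<le> d" using \<tau> R0 by (simp add: field_simps)
   finally show ?thesis by (simp add: norm_Pair)
  qed
  have sv: "L2 (serr \<tau> p v)" "sqn (serr \<tau> p v) \<le> e'" and sG: "L2 (serr \<tau> p G)" "sqn (serr \<tau> p G) \<le> e'" if p: "p \<in> I" for p
  proof -
   have 1: "sqn (%z. v (z + (0, s)) - v z) \<le> e'" if "norm s \<le> \<tau> * (norm (\<nu> p) + 1)" for s
    by (rule d1(2)) (use nd[OF p that] in \<open>simp add: d_def\<close>)
   have 2: "sqn (%z. G (z + (0, s)) - G z) \<le> e'" if "norm s \<le> \<tau> * (norm (\<nu> p) + 1)" for s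
    by (rule d2(2)) (use nd[OF p that] in \<open>simp add: d_def\<close>)
   show "L2 (serr \<tau> p v)" "sqn (serr \<tau> p v) \<le> e'" using serr_L2[OF v \<tau>(1) 1] e' by auto
   show "L2 (serr \<tau> p G)" "sqn (serr \<tau> p G) \<le> e'" using serr_L2[OF G \<tau>(1) 2] e' by auto
  qed
  have cm: "(%z. \<zeta> p (snd z)) \<in> borel_measurable (borel :: (real \<times> 'n) measure)"
   "(%z. gradf (\<zeta> p) (snd z)) \<in> borel_measurable (borel :: (real \<times> 'n) measure)" if "p \<in> I" for p
   using \<zeta>_measurable[OF that] by (auto intro: measurable_compose[OF measurable_snd_borel])
  have a: "L2 (%z. \<zeta> p (snd z) *\<^sub>R serr \<tau> p v z)" "sqn (%z. \<zeta> p (snd z) *\<^sub>R serr \<tau> p v z) \<le> e'" if p: "p \<in> I" for p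
   using L2_mult_bounded[OF sv(1) cm(1) \<zeta>_le_1, OF p p p] sqn_mult_bounded[OF sv(1) cm(1) \<zeta>_le_1, OF p p p] sv(2)[OF p] by auto
  have b: "L2 (%z. \<zeta> p (snd z) *\<^sub>R serr \<tau> p G z)" "sqn (%z. \<zeta> p (snd z) *\<^sub>R serr \<tau> p G z) \<le> e'" if p: "p \<in> I" for p
   using L2_mult_bounded[OF sG(1) cm(1) \<zeta>_le_1, OF p p p] sqn_mult_bounded[OF sG(1) cm(1) \<zeta>_le_1, OF p p p] sG(2)[OF p] by auto
  have c: "L2 (%z. serr \<tau> p v z *\<^sub>R gradf (\<zeta> p) (snd z))" "sqn (%z. serr \<tau> p v z *\<^sub>R gradf (\<zeta> p) (snd z)) \<le> Z\<^sup>2 * e'" if p: "p \<in> I" for p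
  proof -
   note L = L2_scaleR[OF sv(1)[OF p], of Z]
   have m: "(%z. serr \<tau> p v z *\<^sub>R gradf (\<zeta> p) (snd z)) \<in> borel_fun"
    using cm(2)[OF p] L2_measurable[OF sv(1)[OF p]] by measurable
   have le: "norm (serr \<tau> p v z *\<^sub>R gradf (\<zeta> p) (snd z)) \<le> norm (Z *\<^sub>R serr \<tau> p v z)" for z
    using mult_right_mono[OF Z(1)[OF p, of "snd z"], of "\<bar>serr \<tau> p v z\<bar>"] Z(2) by (simp add: abs_mult mult.commute)
   show "L2 (%z. serr \<tau> p v z *\<^sub>R gradf (\<zeta> p) (snd z))"
    by (rule L2_bound[OF m L2_integrable[OF L] power_mono[OF le norm_ge_zero]])
   have "sqn (%z. serr \<tau> p v z *\<^sub>R gradf (\<zeta> p) (snd z)) \<le> sqn (%z. Z *\<^sub>R serr \<tau> p v z)" by (rule sqn_mono[OF L m le])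
   also have "\<dots> \<le> Z\<^sup>2 * sqn (serr \<tau> p v)" by (rule sqn_mult_bounded[OF sv(1)[OF p]]) (use Z in auto)
   also have "\<dots> \<le> Z\<^sup>2 * e'" by (rule mult_left_mono[OF sv(2)[OF p]]) simp
   finally show "sqn (%z. serr \<tau> p v z *\<^sub>R gradf (\<zeta> p) (snd z)) \<le> Z\<^sup>2 * e'" .
  qed
  have Us: "{z :: real \<times> 'n. snd z \<in> U} \<in> sets borel" using measurable_sets[OF measurable_snd_borel U] by (simp add: vimage_def)
  have ind: "ind U (snd z) = (ind {z. snd z \<in> U} z :: real)" for z :: "real \<times> 'n" by (simp add: indicator_def)
  have eN: "real (card I) * (real (card I) * ((2 + 2 * Z\<^sup>2) * e')) \<le> e"
  proof -
   have "real (card I) * (real (card I) * ((2 + 2 * Z\<^sup>2) * e')) = (N - 1) * e'" by (simp add: N_def)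
   also have "\<dots> \<le> N * e'" using e' by (simp add: mult_right_mono)
   also have "\<dots> = e" using N by (simp add: e'_def)
   finally show ?thesis .
  qed
  have V1: "L2 (%z. \<Sum>p\<in>I. \<zeta> p (snd z) *\<^sub>R serr \<tau> p v z)" by (rule L2_sum[OF a(1)])
  have V2: "sqn (%z. \<Sum>p\<in>I. \<zeta> p (snd z) *\<^sub>R serr \<tau> p v z) \<le> e"
  proof -
   have "sqn (%z. \<Sum>p\<in>I. \<zeta> p (snd z) *\<^sub>R serr \<tau> p v z) \<le> real (card I) * (\<Sum>p\<in>I. sqn (%z. \<zeta> p (snd z) *\<^sub>R serr \<tau> p v z))"
    by (rule sqn_sum_le[OF I a(1)])
   also have "\<dots> \<le> real (card I) * (\<Sum>p\<in>I. (2 + 2 * Z\<^sup>2) * e')"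
   proof (intro mult_left_mono sum_mono)
    fix p assume "p \<in> I"
    have "e' * 1 \<le> e' * (2 + 2 * Z\<^sup>2)" using e' by (intro mult_left_mono) auto
    then show "sqn (%z. \<zeta> p (snd z) *\<^sub>R serr \<tau> p v z) \<le> (2 + 2 * Z\<^sup>2) * e'" using a(2)[OF \<open>p \<in> I\<close>] by (simp add: mult.commute)
   qed simp
   finally show ?thesis using eN by simp
  qed
  have G1: "L2 (%z. \<Sum>p\<in>I. \<zeta> p (snd z) *\<^sub>R serr \<tau> p G z + serr \<tau> p v z *\<^sub>R gradf (\<zeta> p) (snd z))"
   by (rule L2_sum[OF L2_add[OF b(1) c(1)]])
  have G2: "sqn (%z. \<Sum>p\<in>I. \<zeta> p (snd z) *\<^sub>R serr \<tau> p G z + serr \<tau> p v z *\<^sub>R gradf (\<zeta> p) (snd z)) \<le> e"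
  proof -
   have "sqn (%z. \<Sum>p\<in>I. \<zeta> p (snd z) *\<^sub>R serr \<tau> p G z + serr \<tau> p v z *\<^sub>R gradf (\<zeta> p) (snd z))
     \<le> real (card I) * (\<Sum>p\<in>I. sqn (%z. \<zeta> p (snd z) *\<^sub>R serr \<tau> p G z + serr \<tau> p v z *\<^sub>R gradf (\<zeta> p) (snd z)))"
    by (rule sqn_sum_le[OF I L2_add[OF b(1) c(1)]])
   also have "\<dots> \<le> real (card I) * (\<Sum>p\<in>I. (2 + 2 * Z\<^sup>2) * e')"
   proof (intro mult_left_mono sum_mono)
    fix p assume p: "p \<in> I"
    show "sqn (%z. \<zeta> p (snd z) *\<^sub>R serr \<tau> p G z + serr \<tau> p v z *\<^sub>R gradf (\<zeta> p) (snd z)) \<le> (2 + 2 * Z\<^sup>2) * e'"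
     using sqn_add_le[OF b(1)[OF p] c(1)[OF p]] b(2)[OF p] c(2)[OF p] by (simp add: distrib_right mult.assoc)
   qed simp
   finally show ?thesis using eN by simp
  qed
  show "L2 (errV U \<tau> v) \<and> sqn (errV U \<tau> v) \<le> e \<and> L2 (errG U \<tau> v G) \<and> sqn (errG U \<tau> v G) \<le> e"
   unfolding errV_def[abs_def] errG_def[abs_def] ind
   using L2_mult_indicator[OF V1 Us] L2_mult_indicator[OF G1 Us] V2 G2 by (meson order_trans)
 qed
qed

lemma errV_eq:
 assumes \<tau>: "\<tau> > 0" and v: "v \<in> borel_fun" and K: "!!z. \<bar>v z\<bar> \<le> K" and S: "bounded S" "!!z. snd z \<notin> S ==> v z = 0"
  and U: "x \<in> U" "(\<Sum>p\<in>I. \<zeta> p x) = 1"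
 shows "smo \<tau> v (t, x) - v (t, x) = errV U \<tau> v (t, x)"
proof -
 have Lt: "L2 (%y. v (t, y))"
  by (rule L2_bounded_support[of _ K S]) (use K S measurable_slice(1)[OF v] in auto)
 have "errV U \<tau> v (t, x) = (\<Sum>p\<in>I. \<zeta> p x * avg \<tau> (\<nu> p) (%y. v (t, y)) x) - (\<Sum>p\<in>I. \<zeta> p x) * v (t, x)"
  using U(1) by (simp add: errV_def serr_slice[OF Lt \<tau>] right_diff_distrib sum_subtractf sum_distrib_right)
 then show ?thesis using U(2) by (simp add: smo_eq[OF \<tau> v K])
qed

text \<open>The cone condition confines the averaging ball of each active piece to \<open>U\<close>,
  the only place where G is known to be the gradient of v. Thus differentiating the kernel produces
  the mean of G, plus terms with gradients of the partition.\<close>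

lemma errG_eq:
 assumes \<tau>: "\<tau> > 0" and v: "v \<in> borel_fun" and K: "!!z. \<bar>v z\<bar> \<le> K" and S: "bounded S" "!!z. snd z \<notin> S ==> v z = 0"
  and U: "open U" "!!x. x \<in> U ==> (\<Sum>p\<in>I. \<zeta> p x) = 1" and x: "x \<in> U"
  and cone: "!!p y. p \<in> I ==> \<zeta> p x \<noteq> 0 ==> norm y \<le> 1 ==> x + \<tau> *\<^sub>R (\<nu> p + y) \<in> U"
  and w: "wgrad U (%y. v (t, y)) (%y. G (t, y))" and G: "L2 (%y. G (t, y))"
 shows "smo_grad \<tau> v (t, x) - G (t, x) = errG U \<tau> v G (t, x)"
proof (rule euclidean_eqI)
 fix i :: 'n assume i: "i \<in> Basis"
 have vt: "(%y. v (t, y)) \<in> borel_fun" by (rule measurable_slice(1)[OF v])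
 have Lt: "L2 (%y. v (t, y))" by (rule L2_bounded_support[of _ K S]) (use K S vt in auto)
 \<comment> \<open>The partition sums to 1 on the open set \<open>U\<close>, so the derivative of
   its sum vanishes there.\<close>
 have sum_grad: "(\<Sum>p\<in>I. gradf (\<zeta> p) x \<bullet> i) = 0"
 proof -
  have "((%x. \<Sum>p\<in>I. \<zeta> p x) has_derivative (%u. \<Sum>p\<in>I. dd (\<zeta> p) x u)) (at x)"
   using smooth_has_derivative[OF test_fun_smooth[OF \<zeta>(1)]] by (intro has_derivative_sum) (simp add: eta_contract_eq)
  moreover have "((%x. \<Sum>p\<in>I. \<zeta> p x) has_derivative (%u. 0)) (at x)"
   by (rule has_derivative_transform_within_open[OF has_derivative_const[of 1] U(1) x]) (simp add: U(2))
  ultimately have "(%u. \<Sum>p\<in>I. dd (\<zeta> p) x u) = (%u. 0)" by (rule has_derivative_unique)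
  then show ?thesis by (simp add: gradf_inner[OF i] fun_eq_iff)
 qed
 have ik: "integrable lborel (%y. v (t, y) * kern \<tau> (\<nu> p) x y)" for p
  by (rule integrable_test_fun_mult[OF kern_test[OF \<tau>] vt K])
 have id: "integrable lborel (%y. v (t, y) * dd (%x. kern \<tau> (\<nu> p) x y) x i)" for p
 proof -
  have "test_fun UNIV (%y. dd (kern \<tau> (\<nu> p) x) y i)" by (rule test_fun_dd[OF kern_test[OF \<tau>]])
  from integrable_test_fun_mult[OF this vt K] show ?thesis by (simp add: kern_dd_fst)
 qed
 have ii: "integrable lborel (%y. v (t, y) *\<^sub>R pkern_grad I \<zeta> \<nu> \<tau> x y)"
 proof -
  obtain C where C0: "(\<forall>x y. \<bar>pkern I \<zeta> \<nu> \<tau> x y\<bar> \<le> C) \<and> (\<forall>x y. norm (pkern_grad I \<zeta> \<nu> \<tau> x y) \<le> C)"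
   using pkern_bounded_ex[of \<tau>] by (elim exE)
  then have C: "!!x y. norm (pkern_grad I \<zeta> \<nu> \<tau> x y) \<le> C" by iprover
  show ?thesis
  proof (rule integrable_bounded_support[of _ "K * C" S])
   show "norm (v (t, y) *\<^sub>R pkern_grad I \<zeta> \<nu> \<tau> x y) \<le> K * C" for y
    unfolding norm_scaleR using K C order_trans[OF abs_ge_zero K] by (intro mult_mono) auto
   show "(%y. v (t, y) *\<^sub>R pkern_grad I \<zeta> \<nu> \<tau> x y) \<in> borel_fun"
    using vt measurable_slice(1)[OF pkern_grad_measurable[of \<tau>], of x] by (intro borel_measurable_scaleR) auto
  qed (use S in auto)
 qed
 have "smo_grad \<tau> v (t, x) \<bullet> i = (LBINT y. (v (t, y) *\<^sub>R pkern_grad I \<zeta> \<nu> \<tau> x y) \<bullet> i)"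
  unfolding smo_grad_def fst_conv snd_conv by (rule integral_inner_left[OF ii, symmetric])
 also have "\<dots> = (LBINT y. (\<Sum>p\<in>I. \<zeta> p x * (v (t, y) * dd (%x. kern \<tau> (\<nu> p) x y) x i) + (gradf (\<zeta> p) x \<bullet> i) * (v (t, y) * kern \<tau> (\<nu> p) x y)))"
  by (intro lint_cong refl)
    (simp add: pkern_grad_def inner_sum_left inner_add_left gradf_inner[OF i] sum_distrib_left algebra_simps)
 also have "\<dots> = (\<Sum>p\<in>I. \<zeta> p x * (LBINT y. v (t, y) * dd (%x. kern \<tau> (\<nu> p) x y) x i) + (gradf (\<zeta> p) x \<bullet> i) * (LBINT y. v (t, y) * kern \<tau> (\<nu> p) x y))"
  using ik id by (subst lint_sum) auto
 also have "\<dots> = (\<Sum>p\<in>I. \<zeta> p x * (avg \<tau> (\<nu> p) (%y. G (t, y)) x \<bullet> i) + (gradf (\<zeta> p) x \<bullet> i) * avg \<tau> (\<nu> p) (%y. v (t, y)) x)"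
 proof (intro sum.cong refl arg_cong2[where f = "(+)"])
  fix p assume p: "p \<in> I"
  show "\<zeta> p x * (LBINT y. v (t, y) * dd (%x. kern \<tau> (\<nu> p) x y) x i) = \<zeta> p x * (avg \<tau> (\<nu> p) (%y. G (t, y)) x \<bullet> i)"
  proof (cases "\<zeta> p x = 0")
   case False
   show ?thesis
    using avg_wgrad[OF \<tau> cone[OF p False] i w L2_measurable[OF G]] by (simp add: avg_inner[OF G \<tau>] mult.commute)
  qed simp
  show "(gradf (\<zeta> p) x \<bullet> i) * (LBINT y. v (t, y) * kern \<tau> (\<nu> p) x y) = (gradf (\<zeta> p) x \<bullet> i) * avg \<tau> (\<nu> p) (%y. v (t, y)) x"
   by (simp add: avg_kern[OF \<tau> vt] mult.commute)
 qed
 finally have 1: "smo_grad \<tau> v (t, x) \<bullet> i = \<dots>" .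
 have "errG U \<tau> v G (t, x) \<bullet> i = (\<Sum>p\<in>I. \<zeta> p x * (avg \<tau> (\<nu> p) (%y. G (t, y)) x \<bullet> i - G (t, x) \<bullet> i) + (avg \<tau> (\<nu> p) (%y. v (t, y)) x - v (t, x)) * (gradf (\<zeta> p) x \<bullet> i))"
  using x by (simp add: errG_def serr_slice[OF Lt \<tau>] serr_slice[OF G \<tau>] inner_sum_left inner_add_left inner_diff_left)
 also have "\<dots> = smo_grad \<tau> v (t, x) \<bullet> i - (\<Sum>p\<in>I. \<zeta> p x) * (G (t, x) \<bullet> i) - v (t, x) * (\<Sum>p\<in>I. gradf (\<zeta> p) x \<bullet> i)"
  unfolding 1 by (simp add: sum_distrib_left sum_distrib_right sum_subtractf[symmetric] algebra_simps)
 finally show "(smo_grad \<tau> v (t, x) - G (t, x)) \<bullet> i = errG U \<tau> v G (t, x) \<bullet> i"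
  using sum_grad U(2)[OF x] by (simp add: inner_diff_left)
qed

end

section \<open>The regularised Neumann solution and its residual\<close>

lemma AE_time_shift:
 assumes "AE t in lborel. P (t :: real)" shows "AE t in lborel. P (t + h)"
proof -
 have "AE t in distr lborel borel ((+) h). P t" unfolding lborel_distr_plus by (rule assms)
 from AE_distrD[OF _ this] show ?thesis by (simp add: add.commute)
qed

text \<open>Cauchy-Schwarz in time on an interval of length b - a. It serves to control a Steklov
  average at the single time 0 by space-time norms.\<close>

lemma time_integral_sqn:
 fixes q :: "real \<times> 'n::euclidean_space => real"
 assumes q: "L2 q" and z: "!!s x. s \<notin> {a..b} ==> q (s, x) = 0" and ab: "a \<le> b"
 shows "L2 (%x. LBINT s. q (s, x))" "sqn (%x. LBINT s. q (s, x)) \<le> (b - a) * sqn q"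
proof -
 have qi: "integrable lborel (%y. (q y)\<^sup>2)" by (rule L2_integrable_real[OF q])
 have iL: "L2 (%\<sigma>::real. ind {a..b} \<sigma> :: real)" by (rule L2_bounded_support[of _ 1 "{a..b}"]) (auto simp: indicator_def)
 have iS: "sqn (%\<sigma>::real. ind {a..b} \<sigma> :: real) = b - a"
 proof -
  have "(%\<sigma>::real. (ind {a..b} \<sigma> :: real)\<^sup>2) = ind {a..b}" by (auto simp: indicator_def fun_eq_iff)
  then show ?thesis using ab by (simp add: sqn_real)
 qed
 have ae: "AE x in lborel. (LBINT s. q (s, x))\<^sup>2 \<le> (b - a) * (LBINT s. (q (s, x))\<^sup>2)"
  using L2_slice(2)[OF q]
 proof eventually_elim
  case (elim x)
  have "(LBINT s. q (s, x)) = (LBINT s. ind {a..b} s \<bullet> q (s, x))"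
   using z by (intro lint_cong) (auto simp: indicator_def)
  then have "\<bar>LBINT s. q (s, x)\<bar> \<le> sqrt (b - a) * sqrt (sqn (%s. q (s, x)))"
   using L2_inner_le[OF iL elim] by (simp add: iS)
  then have "\<bar>LBINT s. q (s, x)\<bar>\<^sup>2 \<le> (sqrt (b - a) * sqrt (sqn (%s. q (s, x))))\<^sup>2" by (rule power_mono) simp
  then show ?case using ab by (simp add: power_mult_distrib sqn_real)
 qed
 have qi': "integrable lborel (%z. (q (snd z, fst z))\<^sup>2)"
 proof -
  have "integrable (lborel \<Otimes>\<^sub>M lborel) (%(x, s). (q (s, x))\<^sup>2)"
   using lborel_pair.integrable_product_swap[of "%(s, x). (q (s, x))\<^sup>2"] qi by (simp add: lborel_prod case_prod_beta')
  then show ?thesis by (simp add: lborel_prod case_prod_beta')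
 qed
 have i2: "integrable lborel (%x. LBINT s. (q (s, x))\<^sup>2)" using integral_slice(2)[OF qi'] by simp
 have m: "(%x. LBINT s. q (s, x)) \<in> borel_fun"
 proof -
  note [measurable] = L2_measurable[OF q]
  have "(%z. q (snd z, fst z)) \<in> borel_measurable (borel :: ('n \<times> real) measure)" by measurable
  from lborel.borel_measurable_lebesgue_integral[of "%x s. q (s, x)" lborel] borel_measurable_pairI(1)[OF this]
  show ?thesis by (simp add: case_prod_beta')
 qed
 have i3: "integrable lborel (%x. (b - a) * (LBINT s. (q (s, x))\<^sup>2))" using i2 by simp
 have i4: "integrable lborel (%x. (LBINT s. q (s, x))\<^sup>2)"
 proof (rule lintegrable_bound[OF i3])
  show "AE x in lborel. norm ((LBINT s. q (s, x))\<^sup>2) \<le> norm ((b - a) * (LBINT s. (q (s, x))\<^sup>2))"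
   using ae by eventually_elim (simp add: order_trans[OF _ abs_ge_self])
 qed (use m in measurable)
 show "L2 (%x. LBINT s. q (s, x))" using m i4 by (simp add: L2_def)
 have "sqn (%x. LBINT s. q (s, x)) \<le> (LBINT x. (b - a) * (LBINT s. (q (s, x))\<^sup>2))"
  unfolding sqn_real by (rule integral_mono_AE[OF i4 i3 ae])
 also have "\<dots> = (b - a) * sqn q"
  using integral_swap[OF qi] integral_slice(1)[OF qi] by (simp add: sqn_real)
 finally show "sqn (%x. LBINT s. q (s, x)) \<le> (b - a) * sqn q" .
qed

lemma L2_space_indicator:
 fixes g :: "real \<times> 'n::euclidean_space => 'b::euclidean_space"
 assumes "L2 g" "U \<in> sets borel"
 shows "L2 (%y. ind U (snd y) *\<^sub>R g y)" "sqn (%y. ind U (snd y) *\<^sub>R g y) \<le> sqn g"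
proof -
 have Us: "{z :: real \<times> 'n. snd z \<in> U} \<in> sets borel" using measurable_sets[OF measurable_snd_borel assms(2)] by (simp add: vimage_def)
 have "(ind U (snd z) :: real) = ind {z. snd z \<in> U} z" for z :: "real \<times> 'n" by (simp add: indicator_def)
 then show "L2 (%y. ind U (snd y) *\<^sub>R g y)" "sqn (%y. ind U (snd y) *\<^sub>R g y) \<le> sqn g"
  using L2_mult_indicator[OF assms(1) Us] by simp_all
qed

lemma L2_time_indicator:
 fixes g :: "real \<times> 'n::euclidean_space => 'b::euclidean_space"
 assumes "L2 g" "A \<in> sets borel"
 shows "L2 (%y. ind A (fst y) *\<^sub>R g y)" "sqn (%y. ind A (fst y) *\<^sub>R g y) \<le> sqn g"
proof -
 have Us: "{z :: real \<times> 'n. fst z \<in> A} \<in> sets borel" using measurable_sets[OF measurable_fst_borel assms(2)] by (simp add: vimage_def)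
 have "(ind A (fst z) :: real) = ind {z. fst z \<in> A} z" for z :: "real \<times> 'n" by (simp add: indicator_def)
 then show "L2 (%y. ind A (fst y) *\<^sub>R g y)" "sqn (%y. ind A (fst y) *\<^sub>R g y) \<le> sqn g"
  using L2_mult_indicator[OF assms(1) Us] by simp_all
qed

text \<open>z is the Steklov average of the mollified solution. All weights are nonnegative with
  total mass at most 1, so z inherits the bound K and with it the Lipschitz constant of f. A is the
  averaged error of the gradient; B collects the difference quotient of the mollification error and
  the failure of f to commute with averaging. Both are small because h is fixed before
  \<tau>.\<close>

lemma neumann_approx:
 fixes U :: "'n::euclidean_space set"
 assumes c: "clean_sol U (%_. 1) f u0 T v G w" and U: "open U" "bounded U" "smooth_boundary U" and T: "T > 0"
  and f: "continuous_on UNIV f" "f 0 = 0" and K: "!!y. \<bar>v y\<bar> \<le> K"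
  and lip: "!!a b. \<bar>a\<bar> \<le> K ==> \<bar>b\<bar> \<le> K ==> \<bar>f a - f b\<bar> \<le> L * \<bar>a - b\<bar>"
  and T': "T' < T" and e: "e > 0"
 obtains z zt Gz A B C S where
  "z \<in> borel_fun" "!!y. \<bar>z y\<bar> \<le> K" "zt \<in> borel_fun" "!!y. \<bar>zt y\<bar> \<le> C"
  "Gz \<in> borel_fun" "!!y. norm (Gz y) \<le> C" "bounded S" "!!y. snd y \<notin> S ==> z y = 0" "!!y. snd y \<notin> S ==> Gz y = 0"
  "!!s r x. s \<le> r ==> (LBINT \<sigma>:{s..r}. zt (\<sigma>, x)) = z (r, x) - z (s, x)"
  "!!t. wgrad UNIV (%x. z (t, x)) (%x. Gz (t, x))"
  "L2 A" "L2 B" "sqn A \<le> e" "sqn B \<le> e" "!!y. snd y \<notin> U ==> A y = 0" "!!y. snd y \<notin> U ==> B y = 0"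
  "L2 (%y. ind U (snd y) * (z y - v y))" "sqn (%y. ind U (snd y) * (z y - v y)) \<le> e"
  "sqn (%x. ind U x * (z (0, x) - w 0 x)) \<le> e"
  "AE t in lborel. t \<in> {0<..<T'} --> (\<forall>\<psi> \<Psi>. H1 U \<psi> \<Psi> -->
    (LBINT x. ind U x * (zt (t, x) * \<psi> x + Gz (t, x) \<bullet> \<Psi> x - f (z (t, x)) * \<psi> x))
     = (LBINT x. A (t, x) \<bullet> \<Psi> x + B (t, x) * \<psi> x))"
proof -
 note s = clean_solD[OF c]
 note Ls = clean_sol_L2[OF c U(2) f]
 have v[measurable]: "v \<in> borel_fun" by (rule s(1))
 note [measurable] = L2_measurable[OF s(3)] L2_measurable[OF Ls(2)]
 have Ub[measurable]: "U \<in> sets borel" using U(1) by simp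
 have vU: "v y = 0" if "snd y \<notin> U" for y using s(4)[of y] that by (simp add: cyl_def mem_Times_iff)
 have GU: "G y = 0" if "snd y \<notin> U" for y using s(5)[of y] that by (simp add: cyl_def mem_Times_iff)
 obtain I \<zeta> \<nu> \<tau>0 where cp: "finite (I :: 'n set)" "0 < \<tau>0" "!!p. p \<in> I ==> test_fun UNIV (\<zeta> p)" "!!p x. 0 \<le> \<zeta> p x"
  "!!x. (\<Sum>p\<in>I. \<zeta> p x) \<le> 1" "!!x. x \<in> U ==> (\<Sum>p\<in>I. \<zeta> p x) = 1"
  "!!p x \<tau> y. p \<in> I ==> x \<in> U ==> \<zeta> p x \<noteq> 0 ==> 0 < \<tau> ==> \<tau> < \<tau>0 ==> norm y \<le> 1 ==> x + \<tau> *\<^sub>R (\<nu> p + y) \<in> U"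
  by (rule cone_partition[OF U]) (rule that, assumption+)
 interpret cone_smoothing I \<zeta> \<nu> by unfold_locales (rule cp, (rule cp, assumption)?)+
 \<comment> \<open>Sum of the losses: 22 = 2 * 10 + 2 for z - v on \<open>U\<close>, and 12 + 88 L^2
   = 2 * 4 + 2 * (2 + 2 * 22 L^2) for B.\<close>
 define c0 where "c0 = 22 + 88 * L\<^sup>2"
 have c0: "0 < c0" unfolding c0_def by (intro add_pos_nonneg) auto
 define e1 where "e1 = e / c0"
 have e1: "0 < e1" "22 * e1 \<le> e" "(12 + 88 * L\<^sup>2) * e1 \<le> e"
 proof -
  show "0 < e1" using e c0 by (simp add: e1_def)
  have "e = c0 * e1" using c0 by (simp add: e1_def)
  moreover have "22 * e1 \<le> c0 * e1" "(12 + 88 * L\<^sup>2) * e1 \<le> c0 * e1"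
   using \<open>0 < e1\<close> by (auto intro!: mult_right_mono simp: c0_def)
  ultimately show "22 * e1 \<le> e" "(12 + 88 * L\<^sup>2) * e1 \<le> e" by simp_all
 qed
 obtain d1 where d1: "d1 > 0" "!!s. norm s \<le> d1 ==> sqn (%z. v (z + s) - v z) \<le> e1"
  using shift_cont_L2[OF Ls(1)] e1 unfolding shift_cont_def by blast
 obtain d2 where d2: "d2 > 0" "!!s. norm s \<le> d2 ==> sqn (%z. f (v (z + s)) - f (v z)) \<le> e1"
  using shift_cont_L2[OF Ls(2)] e1 unfolding shift_cont_def by blast
 obtain d3 where d3: "d3 > 0" "!!s. \<bar>s\<bar> < d3 ==> sqn (%x. w s x - w 0 x) \<le> e1"
 proof -
  have "\<forall>\<^sub>F s in at 0. sqn (%x. w s x - w 0 x) < e1" using order_tendstoD(2)[OF s(9)[of 0] e1(1)] .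
  then obtain d where d: "d > 0" "!!s. s \<noteq> 0 ==> dist s 0 < d ==> sqn (%x. w s x - w 0 x) < e1"
   unfolding eventually_at by auto
  have "sqn (%x. w s x - w 0 x) \<le> e1" if "\<bar>s\<bar> < d" for s
   using d(2)[of s] that e1 by (cases "s = 0") (auto simp: sqn_def)
  with d(1) show ?thesis by (rule that)
 qed
 \<comment> \<open>\<open>d1\<close> and \<open>d2\<close> control time shifts of v and f (v),
   \<open>d3 / 2\<close> stays strictly inside the range where w is close to w 0, T - T' keeps t + h
   < T for t < T', and 1 gives h^2 <= h.\<close>
 define h where "h = Min {d1, d2, d3 / 2, T - T', 1, T / 2}"
 have h: "0 < h" "h \<le> d1" "h \<le> d2" "h < d3" "h \<le> T - T'" "h \<le> 1" "h < T"
 proof -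
  show "0 < h" unfolding h_def using d1 d2 d3 T T' by (subst Min_gr_iff) auto
  have "h \<le> d3 / 2" "h \<le> T / 2" unfolding h_def by (rule Min_le, simp, simp)+
  then show "h < d3" "h < T" using d3 T by auto
  show "h \<le> d1" "h \<le> d2" "h \<le> T - T'" "h \<le> 1" unfolding h_def by (rule Min_le, simp, simp)+
 qed
 \<comment> \<open>The budget carries h^2 because B contains the mollification error divided by
   h.\<close>
 obtain \<tau>1 where \<tau>1: "\<tau>1 > 0" "!!\<tau>. 0 < \<tau> ==> \<tau> < \<tau>1 ==> L2 (errV U \<tau> v) \<and> sqn (errV U \<tau> v) \<le> h\<^sup>2 * e1 \<and> L2 (errG U \<tau> v G) \<and> sqn (errG U \<tau> v G) \<le> h\<^sup>2 * e1"
  using err_small[OF Ls(1) s(3) Ub, of "h\<^sup>2 * e1"] h e1 by (metis zero_less_power mult_pos_pos)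
 define \<tau> where "\<tau> = min \<tau>0 \<tau>1 / 2"
 have \<tau>: "0 < \<tau>" "\<tau> < \<tau>0" "\<tau> < \<tau>1" using cp(2) \<tau>1(1) by (auto simp: \<tau>_def)
 define eV where "eV = errV U \<tau> v"
 define eG where "eG = errG U \<tau> v G"
 have eV: "L2 eV" "sqn eV \<le> h\<^sup>2 * e1" and eG: "L2 eG" "sqn eG \<le> h\<^sup>2 * e1" using \<tau>1(2)[OF \<tau>(1,3)] by (auto simp: eV_def eG_def)
 have hh: "h\<^sup>2 * e1 \<le> h * e1" "h * e1 \<le> e1" "h\<^sup>2 * e1 \<le> e1"
 proof -
  have "h\<^sup>2 \<le> h" using h by (simp add: power2_eq_square mult_left_le)
  then show "h\<^sup>2 * e1 \<le> h * e1" using e1 by (intro mult_right_mono) auto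
  show "h * e1 \<le> e1" using e1 h by (simp add: mult_left_le_one_le)
  then show "h\<^sup>2 * e1 \<le> e1" using \<open>h\<^sup>2 * e1 \<le> h * e1\<close> by simp
 qed
 have eV0: "eV y = 0" and eG0: "eG y = 0" if "snd y \<notin> U" for y using that by (auto simp: eV_def eG_def errV_def errG_def)
 note [measurable] = L2_measurable[OF eV(1)] L2_measurable[OF eG(1)]
 define V where "V = smo \<tau> v"
 define GV where "GV = smo_grad \<tau> v"
 have V[measurable]: "V \<in> borel_fun" and GV[measurable]: "GV \<in> borel_fun"
  unfolding V_def GV_def by (rule smo_measurable[OF v])+
 have VK: "\<bar>V y\<bar> \<le> K" for y unfolding V_def by (rule smo_bounded[OF \<tau>(1) v K])
 obtain C1 where C1: "!!y. norm (GV y) \<le> C1"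
  by (rule smo_grad_bounded[OF v K U(2) vU, of \<tau>]) (assumption, rule that, unfold GV_def)
 have Veq: "V y - v y = eV y" if "snd y \<in> U" for y
  using errV_eq[OF \<tau>(1) v K U(2) vU that cp(6)[OF that], of "fst y"] by (simp add: V_def eV_def)
 have GVeq: "AE t in lborel. \<forall>x\<in>U. GV (t, x) - G (t, x) = eG (t, x)"
  using s(6) L2_slice(1)[OF s(3)]
 proof eventually_elim
  case (elim t)
  have w: "wgrad U (%y. v (t, y)) (%y. G (t, y))"
  proof (cases "t \<in> {0<..<T}")
   case False
   then have "v (t, y) = 0" "G (t, y) = 0" for y using s(4,5)[of "(t, y)"] by (auto simp: cyl_def)
   then show ?thesis by (simp add: wgrad_def)
  qed (use elim in auto)
  show ?case unfolding GV_def eG_def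
   by (intro ballI, rule errG_eq[OF \<tau>(1) v K U(2) vU U(1) cp(6) _ cp(7)[OF _ _ _ \<tau>(1,2)] w elim(2)])
 qed
 define z where "z = stek h V"
 define Gz where "Gz = stek h GV"
 define zt where "zt y = (V (fst y + h, snd y) - V y) / h" for y
 define A where "A = stek h eG"
 define fS where "fS = stek h (%y. f (v y))"
 \<comment> \<open>First the part of the time difference quotient due to mollification, then the
   difference between the averaged reaction and the reaction of z.\<close>
 define B where "B y = (eV (y + (h, 0)) - eV y) / h + ind U (snd y) *\<^sub>R (fS y - f (z y))" for y
 have zm[measurable]: "z \<in> borel_fun" "Gz \<in> borel_fun" "zt \<in> borel_fun" "fS \<in> borel_fun"
  unfolding z_def Gz_def zt_def fS_def by measurable
 have fm[measurable]: "f \<in> borel_fun" using f(1) by (rule borel_measurable_continuous_onI)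
 have zK: "\<bar>z y\<bar> \<le> K" for y unfolding z_def using stek_bounded[OF V, of K] VK by simp
 have K0: "0 \<le> K" using order_trans[OF abs_ge_zero K] .
 define C where "C = max C1 (2 * K / h)"
 have ztC: "\<bar>zt y\<bar> \<le> C" for y
 proof -
  have "\<bar>zt y\<bar> = \<bar>V (fst y + h, snd y) - V y\<bar> / h" using h by (simp add: zt_def)
  also have "\<dots> \<le> 2 * K / h" using VK[of "(fst y + h, snd y)"] VK[of y] h by (intro divide_right_mono) auto
  finally show ?thesis by (simp add: C_def)
 qed
 have GzC: "norm (Gz y) \<le> C" for y
  using stek_bounded[OF GV C1, of h y] by (simp add: Gz_def C_def)
 have zS: "z y = 0" "Gz y = 0" if "snd y \<notin> supp" for y
  using that smo_zero by (simp_all add: z_def Gz_def stek_def V_def GV_def)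
 have zid: "(LBINT \<sigma>:{s..r}. zt (\<sigma>, x)) = z (r, x) - z (s, x)" if "s \<le> r" for s r x
  unfolding zt_def z_def fst_conv snd_conv by (rule stek_ftc[OF V VK h(1) that])
 have wz: "wgrad UNIV (%x. z (t, x)) (%x. Gz (t, x))" for t
  unfolding z_def Gz_def
 proof (rule stek_wgrad[OF V _ GV])
  show "\<bar>V y\<bar> \<le> max K C1" "norm (GV y) \<le> max K C1" for y using VK[of y] C1[of y] by auto
  show "wgrad UNIV (%x. V (t, x)) (%x. GV (t, x))" for t unfolding V_def GV_def by (rule smo_wgrad[OF v K U(2) vU])
 qed
 have AL: "L2 A" "sqn A \<le> e"
  unfolding A_def by (rule stek_L2(1)[OF eG(1) h(1)], use stek_L2(2)[OF eG(1) h(1)] eG(2) hh(3) e1 in linarith)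
 have sh1: "sqn (%z. v (z + (s, 0)) - v z) \<le> e1" "sqn (%z. f (v (z + (s, 0))) - f (v z)) \<le> e1" if "0 \<le> s" "s \<le> h" for s
  using d1(2)[of "(s, 0)"] d2(2)[of "(s, 0)"] that h by (auto simp: norm_Pair)
 note vS = stek_sqn[OF Ls(1) h(1) sh1(1)]
 note fvS = stek_sqn[OF Ls(2) h(1) sh1(2), folded fS_def]
 have zv: "ind U (snd y) *\<^sub>R (z y - v y) = ind U (snd y) *\<^sub>R (stek h eV y + (stek h v y - v y))" for y
 proof (cases "snd y \<in> U")
  case True
  have iV: "integrable lborel (%\<theta>. unit_k \<theta> *\<^sub>R V (fst y + h * \<theta>, snd y))" by (rule stek_integrable_bounded[OF V, of K]) (use VK in auto)
  have iv: "integrable lborel (%\<theta>. unit_k \<theta> *\<^sub>R v (fst y + h * \<theta>, snd y))" by (rule stek_integrable_bounded[OF v, of K]) (use K in auto)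
  have "stek h eV y = (LBINT \<theta>. unit_k \<theta> *\<^sub>R V (fst y + h * \<theta>, snd y) - unit_k \<theta> *\<^sub>R v (fst y + h * \<theta>, snd y))"
   unfolding stek_def using True by (intro lint_cong) (auto simp: Veq[symmetric] right_diff_distrib)
  also have "\<dots> = z y - stek h v y" unfolding z_def stek_def by (rule lint_diff[OF iV iv])
  finally show ?thesis by simp
 qed simp
 have sV: "L2 (stek h eV)" "sqn (stek h eV) \<le> 10 * e1"
  by (rule stek_L2(1)[OF eV(1) h(1)], use stek_L2(2)[OF eV(1) h(1)] eV(2) hh(3) in linarith)
 have zvL: "L2 (%y. ind U (snd y) *\<^sub>R (z y - v y))" "sqn (%y. ind U (snd y) *\<^sub>R (z y - v y)) \<le> 22 * e1"
 proof -
  note a = L2_add[OF sV(1) vS(1)]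
  show "L2 (%y. ind U (snd y) *\<^sub>R (z y - v y))" unfolding zv by (rule L2_space_indicator(1)[OF a Ub])
  have "sqn (%y. ind U (snd y) *\<^sub>R (z y - v y)) \<le> sqn (%y. stek h eV y + (stek h v y - v y))"
   unfolding zv by (rule L2_space_indicator(2)[OF a Ub])
  also have "\<dots> \<le> 2 * sqn (stek h eV) + 2 * sqn (%y. stek h v y - v y)" by (rule sqn_add_le[OF sV(1) vS(1)])
  finally show "sqn (%y. ind U (snd y) *\<^sub>R (z y - v y)) \<le> 22 * e1" using sV(2) vS(2) by simp
 qed
 have fz: "L2 (%y. ind U (snd y) *\<^sub>R (f (v y) - f (z y)))" "sqn (%y. ind U (snd y) *\<^sub>R (f (v y) - f (z y))) \<le> L\<^sup>2 * (22 * e1)"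
 proof -
  have m: "(%y. ind U (snd y) *\<^sub>R (f (v y) - f (z y))) \<in> borel_fun" by measurable
  have le: "norm (ind U (snd y) *\<^sub>R (f (v y) - f (z y))) \<le> norm (L *\<^sub>R (ind U (snd y) *\<^sub>R (z y - v y)))" for y
   using lip[OF K zK, of y y] by (auto simp: indicator_def abs_mult abs_minus_commute intro: order_trans[OF _ mult_right_mono[OF abs_ge_self]])
  note ZL = L2_scaleR[OF zvL(1), of L]
  show "L2 (%y. ind U (snd y) *\<^sub>R (f (v y) - f (z y)))" by (rule L2_bound[OF m L2_integrable[OF ZL] power_mono[OF le norm_ge_zero]])
  have "sqn (%y. ind U (snd y) *\<^sub>R (f (v y) - f (z y))) \<le> sqn (%y. L *\<^sub>R (ind U (snd y) *\<^sub>R (z y - v y)))" by (rule sqn_mono[OF ZL m le])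
  also have "\<dots> \<le> \<bar>L\<bar>\<^sup>2 * sqn (%y. ind U (snd y) *\<^sub>R (z y - v y))" by (rule sqn_mult_bounded[OF zvL(1)]) auto
  also have "\<dots> \<le> \<bar>L\<bar>\<^sup>2 * (22 * e1)" by (rule mult_left_mono[OF zvL(2)]) simp
  finally show "sqn (%y. ind U (snd y) *\<^sub>R (f (v y) - f (z y))) \<le> L\<^sup>2 * (22 * e1)" by simp
 qed
 have BL: "L2 B" "sqn B \<le> e"
 proof -
  have Bd: "L2 (%y. eV (y + (h, 0)) - eV y)" "sqn (%y. eV (y + (h, 0)) - eV y) \<le> 4 * (h\<^sup>2 * e1)"
   using L2_diff[OF L2_shift[OF eV(1)] eV(1), of "(h, 0)"] sqn_diff_le[OF L2_shift[OF eV(1)] eV(1), of "(h, 0)"] sqn_shift[OF eV(1), of "(h, 0)"] eV(2) by auto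
  have b1: "L2 (%y. (1 / h) *\<^sub>R (eV (y + (h, 0)) - eV y))" by (rule L2_scaleR[OF Bd(1)])
  have "sqn (%y. (1 / h) *\<^sub>R (eV (y + (h, 0)) - eV y)) \<le> (1 / h)\<^sup>2 * sqn (%y. eV (y + (h, 0)) - eV y)"
   by (rule sqn_mult_bounded[OF Bd(1)]) (use h in auto)
  also have "\<dots> \<le> (1 / h)\<^sup>2 * (4 * (h\<^sup>2 * e1))" by (rule mult_left_mono[OF Bd(2)]) simp
  also have "\<dots> = 4 * e1" using h by (simp add: power2_eq_square)
  finally have b2: "sqn (%y. (1 / h) *\<^sub>R (eV (y + (h, 0)) - eV y)) \<le> 4 * e1" .
  have eq: "ind U (snd y) *\<^sub>R (fS y - f (z y)) = ind U (snd y) *\<^sub>R (fS y - f (v y)) + ind U (snd y) *\<^sub>R (f (v y) - f (z y))" for y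
   by (simp add: algebra_simps)
  note b3 = L2_space_indicator[OF fvS(1) Ub]
  have b4: "L2 (%y. ind U (snd y) *\<^sub>R (fS y - f (z y)))" unfolding eq by (rule L2_add[OF b3(1) fz(1)])
  have b5: "sqn (%y. ind U (snd y) *\<^sub>R (fS y - f (z y))) \<le> 2 * e1 + 2 * (L\<^sup>2 * (22 * e1))"
   unfolding eq using sqn_add_le[OF b3(1) fz(1)] b3(2) fvS(2) fz(2) by linarith
  have Beq: "B = (%y. (1 / h) *\<^sub>R (eV (y + (h, 0)) - eV y) + ind U (snd y) *\<^sub>R (fS y - f (z y)))" by (simp add: B_def fun_eq_iff)
  show "L2 B" unfolding Beq by (rule L2_add[OF b1 b4])
  have "sqn B \<le> 2 * (4 * e1) + 2 * (2 * e1 + 2 * (L\<^sup>2 * (22 * e1)))" unfolding Beq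
   by (rule order_trans[OF sqn_add_le[OF b1 b4]]) (intro add_mono mult_left_mono b2 b5; simp)
  also have "\<dots> = (12 + 88 * L\<^sup>2) * e1" by (simp add: algebra_simps)
  finally show "sqn B \<le> e" using e1(3) by simp
 qed
 have init: "sqn (%x. ind U x * (z (0, x) - w 0 x)) \<le> e"
 proof -
  \<comment> \<open>z (0, x) - w 0 x is a mean over [0, h] of two errors: mollification, q1, and
    change of the solution in time, q2. Each has squared norm at most h e1 in space-time, and
    Cauchy-Schwarz in time supplies the second factor h needed against h^2.\<close>
  define q1 where "q1 y = ind {0..h} (fst y) *\<^sub>R eV y" for y
  define q2 where "q2 y = ind {0..h} (fst y) *\<^sub>R (v y - w 0 (snd y))" for y
  have hb: "{0..h} \<in> sets borel" by simp
  have q1: "L2 q1" "sqn q1 \<le> h * e1" unfolding q1_def[abs_def]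
   by (rule L2_time_indicator(1)[OF eV(1) hb], use L2_time_indicator(2)[OF eV(1) hb] eV(2) hh(1) in linarith)
  have iL: "L2 (%\<sigma>::real. ind {0..h} \<sigma> :: real)" by (rule L2_bounded_support[of _ 1 "{0..h}"]) (auto simp: indicator_def)
  have q2: "L2 q2"
   using L2_diff[OF L2_time_indicator(1)[OF Ls(1) hb] L2_product[OF iL s(7)[of 0]]] by (simp add: q2_def[abs_def] algebra_simps)
  have q2s: "sqn q2 \<le> h * e1"
  proof -
   have "sqn q2 = (LBINT r. sqn (%x. q2 (r, x)))" by (rule L2_slice(4)[OF q2])
   also have "\<dots> \<le> (LBINT r. ind {0..h} r * e1)"
   proof (rule integral_mono_AE)
    show "integrable lborel (%r. sqn (%x. q2 (r, x)))" by (rule L2_slice(3)[OF q2])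
    show "integrable lborel (%r::real. ind {0..h} r * e1)"
     by (rule integrable_bounded_support[of _ e1 "{0..h}"]) (use e1 in \<open>auto simp: indicator_def\<close>)
    show "AE r in lborel. sqn (%x. q2 (r, x)) \<le> ind {0..h} r * e1"
     using s(6) AE_lborel_singleton[of 0]
    proof eventually_elim
     case (elim r)
     show ?case
     proof (cases "r \<in> {0..h}")
      case True
      then have ae: "AE x in lborel. v (r, x) = w r x" using elim h by auto
      note [measurable] = L2_measurable[OF s(7)]
      have "sqn (%x. q2 (r, x)) = sqn (%x. w r x - w 0 x)" unfolding sqn_def
       by (rule integral_cong_AE) (use ae True in \<open>auto simp: q2_def\<close>)
      also have "\<dots> \<le> e1" using d3(2)[of r] True h by auto
      finally show ?thesis using True by simp
     qed (simp add: q2_def sqn_def)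
    qed
   qed
   also have "\<dots> = h * e1" using h by simp
   finally show ?thesis .
  qed
  have q: "L2 (%y. q1 y + q2 y)" by (rule L2_add[OF q1(1) q2])
  have qs: "sqn (%y. q1 y + q2 y) \<le> 4 * (h * e1)" using sqn_add_le[OF q1(1) q2] q1(2) q2s by linarith
  have J: "sqn (%x. LBINT s. q1 (s, x) + q2 (s, x)) \<le> (h - 0) * sqn (%y. q1 y + q2 y)"
   by (rule time_integral_sqn(2)[OF q]) (use h in \<open>auto simp: q1_def q2_def\<close>)
  have JL: "L2 (%x. (1 / h) *\<^sub>R (ind U x *\<^sub>R (z (0, x) - w 0 x)))" and zL: "L2 (%x. ind U x *\<^sub>R (z (0, x) - w 0 x))"
  proof -
   have "L2 (%x. ind U x *\<^sub>R z (0, x))"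
    by (rule L2_bounded_support[of _ K U]) (use zK U(2) K0 measurable_slice(1)[OF zm(1), of 0] in \<open>auto simp: indicator_def intro!: borel_measurable_times\<close>)
   moreover have "L2 (%x. ind U x *\<^sub>R w 0 x)" by (rule L2_mult_indicator(1)[OF s(7) Ub])
   ultimately show "L2 (%x. ind U x *\<^sub>R (z (0, x) - w 0 x))" using L2_diff by (simp add: algebra_simps)
   then show "L2 (%x. (1 / h) *\<^sub>R (ind U x *\<^sub>R (z (0, x) - w 0 x)))" by (rule L2_scaleR)
  qed
  have eq: "h * (ind U x * (z (0, x) - w 0 x)) = ind U x * (LBINT s. q1 (s, x) + q2 (s, x))" for x
  proof (cases "x \<in> U")
   case True
   have "(LBINT s. q1 (s, x) + q2 (s, x)) = (LBINT s. ind {0..h} s *\<^sub>R V (s, x) - ind {0..h} s *\<^sub>R w 0 x)"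
    using True by (intro lint_cong) (auto simp: q1_def q2_def Veq[symmetric] indicator_def)
   also have "\<dots> = (LBINT s. ind {0..h} s *\<^sub>R V (s, x)) - (LBINT s. ind {0..h} s *\<^sub>R w 0 x)"
   proof (rule lint_diff)
    show "integrable lborel (%s. ind {0..h} s *\<^sub>R V (s, x))"
     by (rule integrable_bounded_support[of _ K "{0..h}"]) (use VK K0 measurable_slice(2)[OF V] in \<open>auto simp: indicator_def intro!: borel_measurable_times\<close>)
    show "integrable lborel (%s::real. ind {0..h} s *\<^sub>R w 0 x)"
     by (rule integrable_bounded_support[of _ "\<bar>w 0 x\<bar>" "{0..h}"]) (auto simp: indicator_def)
   qed
   also have "\<dots> = h * z (0, x) - h * w 0 x"
    using stek_interval[OF V h(1), of 0 x] h by (simp add: z_def set_lebesgue_integral_def)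
   finally show ?thesis using True by (simp add: algebra_simps)
  qed simp
  have "h\<^sup>2 * sqn (%x. ind U x * (z (0, x) - w 0 x)) = sqn (%x. h * (ind U x * (z (0, x) - w 0 x)))"
   by (simp add: sqn_real power_mult_distrib)
  also have "\<dots> \<le> sqn (%x. LBINT s. q1 (s, x) + q2 (s, x))"
  proof -
   have m: "(%x. LBINT s. q1 (s, x) + q2 (s, x)) \<in> borel_fun"
   proof -
    note [measurable] = L2_measurable[OF q]
    have "(%z. q1 (snd z, fst z) + q2 (snd z, fst z)) \<in> borel_measurable (borel :: ('n \<times> real) measure)"
     by (rule measurable_compose[of "%z. (snd z, fst z)", OF _ L2_measurable[OF q]]) measurable
    from lborel.borel_measurable_lebesgue_integral[of "%x s. q1 (s, x) + q2 (s, x)" lborel] borel_measurable_pairI(1)[OF this]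
    show ?thesis by (simp add: case_prod_beta')
   qed
   have "integrable lborel (%x. (LBINT s. q1 (s, x) + q2 (s, x))\<^sup>2)"
    using time_integral_sqn(1)[OF q, of 0 h] h by (auto simp: q1_def q2_def intro!: L2_integrable_real)
   then show ?thesis unfolding eq sqn_real
    by (rule integral_mono') (auto simp: indicator_def)
  qed
  also have "\<dots> \<le> h * (4 * (h * e1))" using order_trans[OF J mult_left_mono[OF qs, of "h - 0"]] h by simp
  also have "\<dots> = h\<^sup>2 * (4 * e1)" by (simp add: power2_eq_square)
  finally show ?thesis using h e1 by simp
 qed
 have fS0: "fS y = 0" if "snd y \<notin> U" for y using that vU f(2) by (simp add: fS_def stek_def)
 have res: "AE t in lborel. t \<in> {0<..<T'} --> (\<forall>\<psi> \<Psi>. H1 U \<psi> \<Psi> -->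
    (LBINT x. ind U x * (zt (t, x) * \<psi> x + Gz (t, x) \<bullet> \<Psi> x - f (z (t, x)) * \<psi> x))
     = (LBINT x. A (t, x) \<bullet> \<Psi> x + B (t, x) * \<psi> x))"
  \<comment> \<open>At almost every t the slices of v at t and at t + h both agree with w, so the
    exact difference quotient in \<open>stek_equation\<close> can be compared with zt.\<close>
  using s(6) AE_time_shift[OF s(6), of h] L2_slice(1)[OF AL(1)] L2_slice(1)[OF BL(1)] L2_slice(1)[OF stek_L2(1)[OF s(3) h(1)]]
   L2_slice(1)[OF stek_L2(1)[OF Ls(2) h(1), folded fS_def]]
 proof eventually_elim
  case (elim t)
  show ?case
  proof (intro impI allI)
   fix \<psi> \<Psi> assume t: "t \<in> {0<..<T'}" and H: "H1 U \<psi> \<Psi>"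
   have pL: "L2 \<psi>" "L2 \<Psi>" using H by (auto simp: H1_def)
   note [measurable] = L2_measurable[OF pL(1)] L2_measurable[OF pL(2)] L2_measurable[OF s(7)] L2_measurable[OF AL(1)] L2_measurable[OF BL(1)]
   have tT: "t \<in> {0<..<T}" "t + h \<in> {0<..<T}" "t + h < T" "0 \<le> t" using t h by auto
   have vw: "AE x in lborel. v (t, x) = w t x" "AE x in lborel. v (t + h, x) = w (t + h) x" using elim(1,2) tT by auto
   \<comment> \<open>Pointwise integrand of the averaged equation; its integral is 0, and it is what
     remains when the residual terms are separated.\<close>
   define b where "b x = (w (t + h) x - w t x) / h * \<psi> x - (fS (t, x) * \<psi> x - 1 * (stek h G (t, x) \<bullet> \<Psi> x))" for x
   have i1: "integrable lborel (%x. (w (t + h) x - w t x) / h * \<psi> x)"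
    using L2_mult_integrable[OF L2_cmult[OF L2_diff[OF s(7) s(7)], of "1 / h"] pL(1)] by simp
   have i2: "integrable lborel (%x. fS (t, x) * \<psi> x - 1 * (stek h G (t, x) \<bullet> \<Psi> x))"
    using lintegrable_diff[OF L2_mult_integrable[OF elim(6) pL(1)] L2_inner_integrable[OF elim(5) pL(2)]] by simp
   have b0: "(LBINT x. b x) = 0" unfolding b_def lint_diff[OF i1 i2]
    using stek_equation[OF c U(2) f _ _ h(1) H tT(4,3), of 1] by (simp add: fS_def)
   have ib: "integrable lborel b" unfolding b_def[abs_def] by (rule lintegrable_diff[OF i1 i2])
   have iAB: "integrable lborel (%x. A (t, x) \<bullet> \<Psi> x + B (t, x) * \<psi> x)"
    by (rule lintegrable_add[OF L2_inner_integrable[OF elim(3) pL(2)] L2_mult_integrable[OF elim(4) pL(1)]])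
   have eqae: "AE x in lborel. ind U x * (zt (t, x) * \<psi> x + Gz (t, x) \<bullet> \<Psi> x - f (z (t, x)) * \<psi> x) = (A (t, x) \<bullet> \<Psi> x + B (t, x) * \<psi> x) + b x"
    using vw L2_slice(2)[OF s(3)] L2_slice(2)[OF eG(1)]
   proof eventually_elim
    case (elim x)
    show ?case
    proof (cases "x \<in> U")
     case True
     have Gzx: "Gz (t, x) = A (t, x) + stek h G (t, x)"
     proof -
      have Gm: "G \<in> borel_fun" by measurable
      have em: "eG \<in> borel_fun" by measurable
      have "(LBINT s:{t..t+h}. GV (s, x)) = (LBINT s. ind {t..t+h} s *\<^sub>R eG (s, x) + ind {t..t+h} s *\<^sub>R G (s, x))"
       unfolding set_lebesgue_integral_def
      proof (rule integral_cong_AE)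
       show "AE s in lborel. ind {t..t+h} s *\<^sub>R GV (s, x) = ind {t..t+h} s *\<^sub>R eG (s, x) + ind {t..t+h} s *\<^sub>R G (s, x)"
        using GVeq
       proof eventually_elim
        case (elim s)
        have "GV (s, x) - G (s, x) = eG (s, x)" using elim True by (rule bspec)
        then have "GV (s, x) = eG (s, x) + G (s, x)" by (simp add: diff_eq_eq)
        then show ?case by (simp only: scaleR_add_right)
       qed
      qed measurable
      also have "\<dots> = (LBINT s:{t..t+h}. eG (s, x)) + (LBINT s:{t..t+h}. G (s, x))"
       unfolding set_lebesgue_integral_def
       by (rule lint_add) (auto intro!: L2_set_integrable elim)
      finally show ?thesis
       by (simp add: Gz_def A_def stek_interval[OF GV h(1)] stek_interval[OF Gm h(1)] stek_interval[OF em h(1)] scaleR_add_right)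
     qed
     have ztx: "zt (t, x) = (eV (t + h, x) - eV (t, x)) / h + (w (t + h) x - w t x) / h"
      using Veq[of "(t, x)"] Veq[of "(t + h, x)"] True elim(1,2) by (simp add: zt_def add_divide_distrib[symmetric])
     show ?thesis using True by (simp add: Gzx ztx b_def B_def algebra_simps inner_add_left)
    next
     case False
     have "A (t, x) = 0" "stek h G (t, x) = 0" using False by (simp_all add: A_def stek_def eG0 GU)
     then show ?thesis using False by (simp add: b_def B_def eV0 s(8) fS0)
    qed
   qed
   have "(LBINT x. ind U x * (zt (t, x) * \<psi> x + Gz (t, x) \<bullet> \<Psi> x - f (z (t, x)) * \<psi> x)) = (LBINT x. (A (t, x) \<bullet> \<Psi> x + B (t, x) * \<psi> x) + b x)"
   proof (rule integral_cong_AE[OF _ _ eqae])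
    show "(%x. (A (t, x) \<bullet> \<Psi> x + B (t, x) * \<psi> x) + b x) \<in> borel_measurable lborel"
     using lintegrable_add[OF iAB ib] by (rule borel_measurable_integrable)
   qed measurable
   also have "\<dots> = (LBINT x. A (t, x) \<bullet> \<Psi> x + B (t, x) * \<psi> x)"
    using lint_add[OF iAB ib] b0 by simp
   finally show "(LBINT x. ind U x * (zt (t, x) * \<psi> x + Gz (t, x) \<bullet> \<Psi> x - f (z (t, x)) * \<psi> x)) = (LBINT x. A (t, x) \<bullet> \<Psi> x + B (t, x) * \<psi> x)" .
  qed
 qed
 have AB0: "A y = 0" "B y = 0" if "snd y \<notin> U" for y using that by (simp_all add: A_def B_def stek_def eG0 eV0)
 have zve: "sqn (%y. ind U (snd y) * (z y - v y)) \<le> e" using zvL(2) e1(2) by simp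
 show ?thesis
  by (rule that[OF zm(1) zK zm(3) ztC zm(2) GzC supp(1) zS zid wz AL(1) BL(1) AL(2) BL(2) AB0 zvL(1)[simplified] zve init res])
qed

section \<open>The energy estimate across the layer\<close>

lemma wgrad_cong:
 assumes "wgrad U g G" "!!x. x \<in> U ==> g' x = g x" "!!x. x \<in> U ==> G' x = G x"
 shows "wgrad U g' G'"
 unfolding wgrad_def
proof (intro allI impI ballI)
 fix \<psi> :: "'a => real" and i :: 'a assume p: "test_fun U \<psi>" and i: "i \<in> Basis"
 have z: "\<psi> x = 0" "dd \<psi> x i = 0" if "x \<notin> U" for x
 proof -
  have "x \<notin> closure {x. \<psi> x \<noteq> 0}" using that test_fun_subset[OF p] by blast
  then show "\<psi> x = 0" "dd \<psi> x i = 0" by (rule test_fun_zero, rule test_fun_dd_zero)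
 qed
 have eq: "g' x * dd \<psi> x i = g x * dd \<psi> x i" "(G' x \<bullet> i) * \<psi> x = (G x \<bullet> i) * \<psi> x" for x
  using assms(2,3)[of x] z[of x] by (cases "x \<in> U"; simp)+
 show "(LBINT x. g' x * dd \<psi> x i) = - (LBINT x. (G' x \<bullet> i) * \<psi> x)"
  unfolding eq by (rule wgradD[OF assms(1) p i])
qed

lemma gradf_mult:
 assumes "smooth_fun f" "smooth_fun g"
 shows "gradf (%x. f x * g x) x = f x *\<^sub>R gradf g x + g x *\<^sub>R gradf f x"
 unfolding gradf_def dd_mult[OF assms] by (simp add: scaleR_sum_right scaleR_add_left sum.distrib mult.commute)

lemma gradf_locally_const:
 assumes "open U" "x \<in> U" "!!y. y \<in> U ==> g y = c" shows "gradf g x = 0"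
proof -
 have "(g has_derivative (%u. 0)) (at x)"
  by (rule has_derivative_transform_within_open[OF has_derivative_const[of c] assms(1,2)]) (simp add: assms(3))
 then have "dd g x i = 0" for i by (rule dd_eq)
 then show ?thesis by (simp add: gradf_def)
qed

text \<open>The weight 1/4 on the first vector allows the bound to be used twice against a single
  squared gradient, which happens in the layer.\<close>

lemma inner_young: "\<bar>a \<bullet> b\<bar> \<le> (norm a)\<^sup>2 / 4 + (norm b)\<^sup>2" for a b :: "'a::real_inner"
proof -
 have "0 \<le> (norm a / 2 - norm b)\<^sup>2" by simp
 then have "norm a * norm b \<le> (norm a)\<^sup>2 / 4 + (norm b)\<^sup>2" by (simp add: power2_diff power_divide)
 then show ?thesis using Cauchy_Schwarz_ineq2[of a b] by linarith
qed

lemma mult_young: "a * b \<le> a\<^sup>2 + b\<^sup>2" for a b :: real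
proof -
 have "0 \<le> (a - b)\<^sup>2 + a\<^sup>2 + b\<^sup>2" by simp
 then show ?thesis by (simp add: power2_diff)
qed

text \<open>Diffusion term of the layer, where the coefficient is \<^term>\<open>\<epsilon>\<close>: only the gradients of the fixed
 comparison function and of the cut-off survive.\<close>
lemma layer_gradient_bound:
 fixes g g' h :: "'a::real_inner"
 assumes c: "\<bar>c\<bar> \<le> 1" and g': "norm g' \<le> C" and h: "norm h \<le> Z"
 shows "- (g \<bullet> ((c * c) *\<^sub>R (g - g') + d *\<^sub>R ((2 * c) *\<^sub>R h))) \<le> C\<^sup>2 + 4 * Z\<^sup>2 * d\<^sup>2"
proof -
 have 1: "\<bar>(c *\<^sub>R g) \<bullet> (c *\<^sub>R g')\<bar> \<le> (norm (c *\<^sub>R g))\<^sup>2 / 4 + (norm (c *\<^sub>R g'))\<^sup>2" by (rule inner_young)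
 have 2: "\<bar>(c *\<^sub>R g) \<bullet> ((2 * d) *\<^sub>R h)\<bar> \<le> (norm (c *\<^sub>R g))\<^sup>2 / 4 + (norm ((2 * d) *\<^sub>R h))\<^sup>2" by (rule inner_young)
 have 3: "(norm (c *\<^sub>R g'))\<^sup>2 \<le> C\<^sup>2"
 proof (rule power_mono)
  have "\<bar>c\<bar> * norm g' \<le> 1 * norm g'" using c by (intro mult_right_mono) auto
  then show "norm (c *\<^sub>R g') \<le> C" using g' by simp
 qed simp
 have 4: "(norm ((2 * d) *\<^sub>R h))\<^sup>2 \<le> 4 * Z\<^sup>2 * d\<^sup>2"
 proof -
  have "(norm ((2 * d) *\<^sub>R h))\<^sup>2 = 4 * d\<^sup>2 * (norm h)\<^sup>2" by (simp add: power_mult_distrib)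
  also have "\<dots> \<le> 4 * d\<^sup>2 * Z\<^sup>2" using h by (intro mult_left_mono power_mono) auto
  finally show ?thesis by (simp add: mult_ac)
 qed
 have "- (g \<bullet> ((c * c) *\<^sub>R (g - g') + d *\<^sub>R ((2 * c) *\<^sub>R h)))
   = - (norm (c *\<^sub>R g))\<^sup>2 + (c *\<^sub>R g) \<bullet> (c *\<^sub>R g') - (c *\<^sub>R g) \<bullet> ((2 * d) *\<^sub>R h)"
  by (simp add: power_mult_distrib power2_norm_eq_inner inner_add_right inner_diff_right algebra_simps power2_eq_square[of c])
 then show ?thesis using 1 2 3 4 zero_le_power2[of "norm (c *\<^sub>R g)"] by linarith
qed

lemma cyl_integral:
 fixes X :: "'n::euclidean_space set"
 assumes X: "X \<in> sets borel" "emeasure lborel X < \<infinity>" and T: "0 \<le> T"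
 shows "integrable lborel (%y. ind {0<..<T} (fst y) * ind X (snd y) :: real)"
  "(LBINT y. ind {0<..<T} (fst y) * ind X (snd y)) = T * measure lborel X"
proof -
 have a: "integrable lborel (ind {0<..<T} :: real => real)" "integrable lborel (ind X :: 'n => real)"
  using X T by (auto intro!: integrable_real_indicator)
 show i: "integrable lborel (%y. ind {0<..<T} (fst y) * ind X (snd y) :: real)"
  by (rule integrable_product[OF a])
 show "(LBINT y. ind {0<..<T} (fst y) * ind X (snd y)) = T * measure lborel X"
  using integral_slice(1)[OF i] X T by simp
qed

text \<open>On the inner domain X = 1 and the coefficient is 1, so the residual equation of z can be
  subtracted and leaves A and B. In the layer z solves no equation: its reaction and time derivative
  are merely bounded, which costs C^2 times the measure of the layer, and the diffusion is
  multiplied by \<epsilon>. The estimate is pointwise in space-time before it is integrated.\<close>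

lemma layer_energy:
 fixes \<Omega> \<Omega>1 :: "'n::euclidean_space set"
 assumes c: "clean_sol \<Omega> (Deps \<Omega>1 \<epsilon>) f u0 T v G w" and \<Omega>: "open \<Omega>" "bounded \<Omega>" and \<Omega>1: "open \<Omega>1" "\<Omega>1 \<subseteq> \<Omega>"
  and null: "AE x in lborel. x \<notin> frontier \<Omega>1" and T: "T > 0" and \<epsilon>: "0 < \<epsilon>" "\<epsilon> \<le> 1"
  and f: "continuous_on UNIV f" "f 0 = 0" and pos: "AE y in lborel. 0 \<le> v y"
  and Kb: "!!t. t \<in> {0..<T} ==> sqn (w t) \<le> Kb" and u0: "!!x. x \<in> \<Omega> ==> \<bar>u0 x\<bar> \<le> M"
  and z: "z \<in> borel_fun" "!!y. \<bar>z y\<bar> \<le> K" "zt \<in> borel_fun" "!!y. \<bar>zt y\<bar> \<le> C"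
  "Gz \<in> borel_fun" "!!y. norm (Gz y) \<le> C" "bounded S" "!!y. snd y \<notin> S ==> z y = 0" "!!y. snd y \<notin> S ==> Gz y = 0"
  "!!s r x. s \<le> r ==> (LBINT \<sigma>:{s..r}. zt (\<sigma>, x)) = z (r, x) - z (s, x)"
  "!!t. wgrad UNIV (%x. z (t, x)) (%x. Gz (t, x))"
  and AB: "L2 A" "L2 B" "sqn A \<le> e" "sqn B \<le> e" "!!y. snd y \<notin> \<Omega>1 ==> A y = 0" "!!y. snd y \<notin> \<Omega>1 ==> B y = 0"
  and init: "sqn (%x. ind \<Omega>1 x * (z (0, x) - w 0 x)) \<le> e"
  and res: "AE t in lborel. t \<in> {0<..<T'} --> (\<forall>\<psi> \<Psi>. H1 \<Omega>1 \<psi> \<Psi> -->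
    (LBINT x. ind \<Omega>1 x * (zt (t, x) * \<psi> x + Gz (t, x) \<bullet> \<Psi> x - f (z (t, x)) * \<psi> x))
     = (LBINT x. A (t, x) \<bullet> \<Psi> x + B (t, x) * \<psi> x))"
  and osl: "!!a b. 0 \<le> a ==> \<bar>b\<bar> \<le> K ==> (f a - f b) * (a - b) \<le> L * (a - b)\<^sup>2" "0 \<le> L" and fC: "!!b. \<bar>b\<bar> \<le> K ==> \<bar>f b\<bar> \<le> C"
  and X: "test_fun UNIV X" "!!x. 0 \<le> X x" "!!x. X x \<le> 1" "!!x. x \<in> closure \<Omega>1 ==> X x = 1" "!!x. norm (gradf X x) \<le> Z"
  and lay: "measure lborel {x. x \<notin> closure \<Omega>1 \<and> X x \<noteq> 0} \<le> \<delta>" "emeasure lborel {x. x \<notin> closure \<Omega>1 \<and> X x \<noteq> 0} < \<infinity>"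
  and T': "0 \<le> T'" "T' < T"
 defines "W \<equiv> %t x. ind \<Omega> x * X x * (w t x - z (t, x))"
 shows "L2 (W t)" and "t \<in> {0..T'} ==> sqn (W t) / 2 \<le>
   (5 / 2 * e + ((M + K)\<^sup>2 + 4 * T * C\<^sup>2) * \<delta> + \<epsilon> * (T * (C\<^sup>2 * measure lborel \<Omega> + 4 * Z\<^sup>2 * (2 * Kb + 2 * K\<^sup>2 * measure lborel \<Omega>)))) * exp ((2 * L + 2) * t)"
  (is "_ ==> _ \<le> ?c0 * _")
proof -
 note s = clean_solD[OF c]
 note Ls = clean_sol_L2[OF c \<Omega>(2) f]
 let ?D = "Deps \<Omega>1 \<epsilon>"
 have [measurable]: "\<Omega> \<in> sets borel" "\<Omega>1 \<in> sets borel" "closure \<Omega>1 \<in> sets borel" using \<Omega> \<Omega>1 by auto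
 have Dm[measurable]: "?D \<in> borel_fun" unfolding Deps_def[abs_def] by measurable
 have D1: "\<bar>?D x\<bar> \<le> 1" for x using \<epsilon> by (simp add: Deps_def)
 have Xs: "smooth_fun X" by (rule test_fun_smooth[OF X(1)])
 have fm[measurable]: "f \<in> borel_fun" using f(1) by (rule borel_measurable_continuous_onI)
 note [measurable] = s(1) L2_measurable[OF s(3)] L2_measurable[OF Ls(2)] z(1,3,5) test_fun_measurable[OF X(1)] gradf_measurable[OF Xs]
  L2_measurable[OF AB(1)] L2_measurable[OF AB(2)] L2_measurable[OF s(7)]
 have K0: "0 \<le> K" and C0: "0 \<le> C" and Z0: "0 \<le> Z" using order_trans[OF abs_ge_zero z(2)] order_trans[OF abs_ge_zero z(4)] order_trans[OF norm_ge_zero X(5)] by auto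
 have Kb0: "0 \<le> Kb" using Kb[of 0] T order_trans[OF sqn_nonneg] by auto
 have \<Omega>f: "emeasure lborel \<Omega> < \<infinity>" using \<Omega>(2) by (rule emeasure_bounded_finite)
 \<comment> \<open>Cuts z and its derivatives to the cylinder, which makes them square integrable; v
   and G are not affected, since they vanish outside it.\<close>
 define ic where "ic y = (ind {0<..<T} (fst y) * ind \<Omega> (snd y) :: real)" for y :: "real \<times> 'n"
 have icm[measurable]: "ic \<in> borel_fun" unfolding ic_def by measurable
 have ic01: "ic y = 0 \<or> ic y = 1" "0 \<le> ic y" "\<bar>ic y\<bar> \<le> 1" for y by (auto simp: ic_def indicator_def)
 have ic0: "ic y = 0" if "y \<notin> cyl T \<Omega>" for y using that by (cases y) (auto simp: ic_def cyl_def indicator_def)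
 have cb: "bounded (cyl T \<Omega>)" unfolding cyl_def using \<Omega>(2) by (intro bounded_Times) auto
 have icL: "L2 (%y. ic y *\<^sub>R q y)" if q: "q \<in> borel_fun" "!!y. norm (q y) \<le> B0" for q :: "real \<times> 'n => 'd::euclidean_space" and B0
 proof (rule L2_bounded_support[of _ B0 "cyl T \<Omega>"])
  show "norm (ic y *\<^sub>R q y) \<le> B0" for y
   using ic01(1)[of y] q(2)[of y] order_trans[OF norm_ge_zero q(2)[of y]] by auto
 qed (use q cb ic0 in auto)
 define d where "d y = ic y *\<^sub>R v y - ic y *\<^sub>R z y" for y
 define gd where "gd y = ic y *\<^sub>R G y - ic y *\<^sub>R Gz y" for y
 have icv: "ic y *\<^sub>R v y = v y" "ic y *\<^sub>R G y = G y" for y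
  using s(4,5)[of y] by (cases "y \<in> cyl T \<Omega>"; cases y; auto simp: ic_def cyl_def)+
 have zL: "L2 (%y. ic y *\<^sub>R z y)" and ztL: "L2 (%y. ic y *\<^sub>R zt y)" and GzL: "L2 (%y. ic y *\<^sub>R Gz y)" and fzL: "L2 (%y. ic y *\<^sub>R f (z y))"
 proof -
  have n: "norm (z y) \<le> K" "norm (zt y) \<le> C" "norm (f (z y)) \<le> C" for y using z(2,4) fC by auto
  have m: "(%y. f (z y)) \<in> borel_fun" by measurable
  show "L2 (%y. ic y *\<^sub>R z y)" by (rule icL[OF z(1) n(1)])
  show "L2 (%y. ic y *\<^sub>R zt y)" by (rule icL[OF z(3) n(2)])
  show "L2 (%y. ic y *\<^sub>R Gz y)" by (rule icL[OF z(5,6)])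
  show "L2 (%y. ic y *\<^sub>R f (z y))" by (rule icL[OF m n(3)])
 qed
 have dL: "L2 d" and gdL: "L2 gd" unfolding d_def[abs_def] gd_def[abs_def] icv by (rule L2_diff Ls(1) zL s(3) GzL)+
 define p where "p y = (X (snd y) * X (snd y)) *\<^sub>R d y" for y
 \<comment> \<open>The gradient of X^2 (v - z). The factor X left in the cross term can be paired
   with G.\<close>
 define P where "P y = (X (snd y) * X (snd y)) *\<^sub>R gd y + d y *\<^sub>R ((2 * X (snd y)) *\<^sub>R gradf X (snd y))" for y
 have XX: "\<bar>X x * X x\<bar> \<le> 1" for x using X(2,3)[of x] by (simp add: mult_le_one)
 have X2: "\<bar>X x\<bar> \<le> 1" for x using X(2,3)[of x] by simp
 have mXX: "(%y. X (snd y) * X (snd y)) \<in> borel_measurable (borel :: (real \<times> 'n) measure)" by measurable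
 have pL: "L2 p" unfolding p_def[abs_def] by (rule L2_mult_bounded[OF dL mXX XX])
 have dX: "L2 (%y. d y *\<^sub>R ((2 * X (snd y)) *\<^sub>R gradf X (snd y)))"
 proof (rule L2_bound[OF _ L2_integrable[OF L2_scaleR[OF dL, of "2 * Z"]] power_mono[OF _ norm_ge_zero]])
  have [measurable]: "d \<in> borel_fun" using dL by (rule L2_measurable)
  show "(%y. d y *\<^sub>R ((2 * X (snd y)) *\<^sub>R gradf X (snd y))) \<in> borel_fun" by measurable
  fix y :: "real \<times> 'n"
  have "\<bar>X (snd y)\<bar> * norm (gradf X (snd y)) \<le> 1 * Z" by (rule mult_mono[OF X2 X(5)]) auto
  then have "\<bar>d y\<bar> * (2 * (\<bar>X (snd y)\<bar> * norm (gradf X (snd y)))) \<le> \<bar>d y\<bar> * (2 * Z)" by (intro mult_left_mono) auto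
  then show "norm (d y *\<^sub>R ((2 * X (snd y)) *\<^sub>R gradf X (snd y))) \<le> norm ((2 * Z) *\<^sub>R d y)"
   using Z0 by (simp add: abs_mult mult_ac)
 qed
 have PL: "L2 P" unfolding P_def[abs_def] by (rule L2_add[OF L2_mult_bounded[OF gdL mXX XX] dX])
 note [measurable] = L2_measurable[OF dL] L2_measurable[OF gdL] L2_measurable[OF pL] L2_measurable[OF PL]
 have p0: "p y = 0" if "y \<notin> cyl T \<Omega>" for y using ic0[OF that] by (simp add: p_def d_def)
 obtain CX where CX: "!!x. norm (gradf (%x. X x * X x) x) \<le> CX" "0 \<le> CX"
  using gradf_bounded[OF test_fun_mult[OF X(1) Xs]] by metis
 have pw: "AE t in lborel. t \<in> {0<..<T} --> wgrad \<Omega> (%x. p (t, x)) (%x. P (t, x))"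
  using s(6) L2_slice(1)[OF Ls(1)] L2_slice(1)[OF s(3)]
 proof eventually_elim
  case (elim t)
  show ?case
  proof
   assume t: "t \<in> {0<..<T}"
   have Hv: "H1 \<Omega> (%x. v (t, x)) (%x. G (t, x))" using elim t by (simp add: H1_def)
   have "L2 (%x. z (t, x))" by (rule L2_bounded_support[of _ K S]) (use z measurable_slice(1)[OF z(1)] in auto)
   moreover have "L2 (%x. Gz (t, x))" by (rule L2_bounded_support[of _ C S]) (use z measurable_slice(1)[OF z(5)] in auto)
   ultimately have Hz: "H1 \<Omega> (%x. z (t, x)) (%x. Gz (t, x))" using wgrad_mono[OF z(11)] by (simp add: H1_def)
   have "H1 \<Omega> (%x. (X x * X x) * (v (t, x) - z (t, x))) (%x. (X x * X x) *\<^sub>R (G (t, x) - Gz (t, x)) + (v (t, x) - z (t, x)) *\<^sub>R gradf (%x. X x * X x) x)"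
   proof (rule H1_mult_smooth[OF H1_diff[OF Hv Hz] smooth_mult[OF Xs Xs], of "max 1 CX"])
    show "\<bar>X x * X x\<bar> \<le> max 1 CX" "norm (gradf (%x. X x * X x) x) \<le> max 1 CX" for x using XX[of x] CX(1)[of x] by auto
   qed
   then have "wgrad \<Omega> (%x. (X x * X x) * (v (t, x) - z (t, x))) (%x. (X x * X x) *\<^sub>R (G (t, x) - Gz (t, x)) + (v (t, x) - z (t, x)) *\<^sub>R gradf (%x. X x * X x) x)"
    by (simp add: H1_def)
   then show "wgrad \<Omega> (%x. p (t, x)) (%x. P (t, x))"
   proof (rule wgrad_cong)
    fix x assume x: "x \<in> \<Omega>"
    have "ic (t, x) = 1" using x t by (simp add: ic_def)
    then show "p (t, x) = (X x * X x) * (v (t, x) - z (t, x))"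
     "P (t, x) = (X x * X x) *\<^sub>R (G (t, x) - Gz (t, x)) + (v (t, x) - z (t, x)) *\<^sub>R gradf (%x. X x * X x) x"
     by (simp_all add: p_def P_def d_def gd_def gradf_mult[OF Xs Xs] scaleR_add_left[symmetric])
   qed
  qed
 qed
 have cm: "(%x. ind \<Omega> x * X x) \<in> borel_fun" by measurable
 have c1: "\<bar>ind \<Omega> x * X x\<bar> \<le> 1" for x using X2[of x] by (auto simp: indicator_def)
 have zsL: "L2 (%x. (ind \<Omega> x * X x) *\<^sub>R (a x :: real))" if a: "a \<in> borel_fun" "!!x. \<bar>a x\<bar> \<le> b" for a b
 proof (rule L2_bounded_support[of _ b \<Omega>])
  show "norm ((ind \<Omega> x * X x) *\<^sub>R a x) \<le> b" for x
   using mult_mono[OF c1[of x] a(2)[of x]] by (simp add: abs_mult)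
 qed (use a \<Omega> cm in auto)
 have zsl: "(%x. z (t, x)) \<in> borel_fun" for t by (rule measurable_slice(1)[OF z(1)])
 have WL: "L2 (W t)" for t
  using L2_diff[OF L2_mult_bounded[OF s(7)[of t] cm c1] zsL[OF zsl z(2)]] by (simp add: W_def algebra_simps)
 have zlip: "\<bar>z (r, x) - z (q, x)\<bar> \<le> C * \<bar>r - q\<bar>" for r q x
 proof -
  have 1: "\<bar>z (r, x) - z (q, x)\<bar> \<le> C * (r - q)" if "q \<le> r" for r q
  proof -
   have i: "integrable lborel (%\<sigma>. ind {q..r} \<sigma> * C)" by (rule integrable_bounded_support[of _ C "{q..r}"]) (use C0 in \<open>auto simp: indicator_def\<close>)
   have "\<bar>z (r, x) - z (q, x)\<bar> \<le> (LBINT \<sigma>. norm (ind {q..r} \<sigma> *\<^sub>R zt (\<sigma>, x)))"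
    unfolding z(10)[OF that, symmetric] set_lebesgue_integral_def real_norm_def[symmetric] by (rule integral_norm_bound)
   also have "\<dots> \<le> (LBINT \<sigma>. ind {q..r} \<sigma> * C)"
    by (rule integral_mono'[OF i]) (use z(4) C0 in \<open>auto simp: indicator_def\<close>)
   also have "\<dots> = C * (r - q)" using that by simp
   finally show ?thesis .
  qed
  show ?thesis using 1[of q r] 1[of r q] by (cases "q \<le> r") (auto simp: abs_minus_commute)
 qed
 have Wc: "((%r. sqn (%x. W r x - W t x)) \<longlongrightarrow> 0) (at t)" for t
 proof (rule tendsto_sandwich[OF _ _ tendsto_const])
  have le: "sqn (%x. W r x - W t x) \<le> 2 * sqn (%x. w r x - w t x) + 2 * ((C * \<bar>r - t\<bar>)\<^sup>2 * measure lborel \<Omega>)" for r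
  proof -
   have eq: "W r x - W t x = (ind \<Omega> x * X x) *\<^sub>R (w r x - w t x) - (ind \<Omega> x * X x) *\<^sub>R (z (r, x) - z (t, x))" for x
    by (simp add: W_def algebra_simps)
   have a: "L2 (%x. (ind \<Omega> x * X x) *\<^sub>R (w r x - w t x))" "sqn (%x. (ind \<Omega> x * X x) *\<^sub>R (w r x - w t x)) \<le> 1\<^sup>2 * sqn (%x. w r x - w t x)"
    by (rule L2_mult_bounded[OF L2_diff[OF s(7) s(7)] cm c1], rule sqn_mult_bounded[OF L2_diff[OF s(7) s(7)] cm c1])
   have zm: "(%x. z (r, x) - z (t, x)) \<in> borel_fun" using zsl by measurable
   note b = zsL[OF zm zlip]
   have i: "integrable lborel (%x. ind \<Omega> x * (C * \<bar>r - t\<bar>)\<^sup>2)" using \<Omega>f by (intro integrable_mult_left integrable_real_indicator) auto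
   have "sqn (%x. (ind \<Omega> x * X x) *\<^sub>R (z (r, x) - z (t, x))) \<le> (LBINT x. ind \<Omega> x * (C * \<bar>r - t\<bar>)\<^sup>2)"
    unfolding sqn_def
   proof (rule integral_mono'[OF i])
    fix x
    have "norm ((ind \<Omega> x * X x) *\<^sub>R (z (r, x) - z (t, x))) \<le> C * \<bar>r - t\<bar>" if "x \<in> \<Omega>"
     using mult_mono[OF c1[of x] zlip[of r x t]] C0 by (simp add: abs_mult)
    from power_mono[OF this norm_ge_zero, of 2]
    show "(norm ((ind \<Omega> x * X x) *\<^sub>R (z (r, x) - z (t, x))))\<^sup>2 \<le> ind \<Omega> x * (C * \<bar>r - t\<bar>)\<^sup>2"
     by (cases "x \<in> \<Omega>") auto
   qed auto
   also have "\<dots> = (C * \<bar>r - t\<bar>)\<^sup>2 * measure lborel \<Omega>" by simp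
   finally have bb: "sqn (%x. (ind \<Omega> x * X x) *\<^sub>R (z (r, x) - z (t, x))) \<le> (C * \<bar>r - t\<bar>)\<^sup>2 * measure lborel \<Omega>" .
   show ?thesis unfolding eq using sqn_diff_le[OF a(1) b] a(2) bb by simp
  qed
  show "\<forall>\<^sub>F r in at t. sqn (%x. W r x - W t x) \<le> 2 * sqn (%x. w r x - w t x) + 2 * ((C * \<bar>r - t\<bar>)\<^sup>2 * measure lborel \<Omega>)"
   by (rule always_eventually) (use le in blast)
  have "((%r. 2 * sqn (%x. w r x - w t x) + 2 * ((C * \<bar>r - t\<bar>)\<^sup>2 * measure lborel \<Omega>)) \<longlongrightarrow> 2 * 0 + 2 * ((C * \<bar>t - t\<bar>)\<^sup>2 * measure lborel \<Omega>)) (at t)"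
   by (intro tendsto_intros s(9))
  then show "((%r. 2 * sqn (%x. w r x - w t x) + 2 * ((C * \<bar>r - t\<bar>)\<^sup>2 * measure lborel \<Omega>)) \<longlongrightarrow> 0) (at t)" by simp
 qed simp
 define E where "E t = (LBINT x. (W t x)\<^sup>2 / 2)" for t
 have E2: "E t = sqn (W t) / 2" for t by (simp add: E_def sqn_real)
 have Ec: "continuous_on UNIV E" unfolding E_def[abs_def]
  using energy_continuous(1)[of W "%_ a. a\<^sup>2 / 2" 1, OF WL Wc _ half_square_lipschitz] by simp
 have Ei: "integrable lborel (%x. (W t x)\<^sup>2)" for t by (rule L2_integrable_real[OF WL])
 have conv: "AE r in lborel. r \<in> {0<..<T'} --> (\<forall>q\<in>{0..r}. E r - E q \<le> (LBINT x. ((w r x - z (r, x)) - (w q x - z (q, x))) * p (r, x)))"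
  using s(6)
 proof eventually_elim
  case (elim r)
  show ?case
  proof (intro impI ballI)
   fix q assume r: "r \<in> {0<..<T'}" and q: "q \<in> {0..r}"
   have ae: "AE x in lborel. v (r, x) = w r x" using elim(1) r T' by auto
   have "E r - E q = (LBINT x. (W r x)\<^sup>2 / 2 - (W q x)\<^sup>2 / 2)" unfolding E_def using Ei by simp
   also have "\<dots> \<le> (LBINT x. (W r x - W q x) * W r x)"
   proof (rule integral_mono)
    show "integrable lborel (%x. (W r x)\<^sup>2 / 2 - (W q x)\<^sup>2 / 2)" using Ei by simp
    show "integrable lborel (%x. (W r x - W q x) * W r x)" by (rule L2_mult_integrable[OF L2_diff[OF WL WL] WL])
    show "(W r x)\<^sup>2 / 2 - (W q x)\<^sup>2 / 2 \<le> (W r x - W q x) * W r x" for x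
     using zero_le_power2[of "W r x - W q x"] by (simp add: power2_eq_square algebra_simps)
   qed
   also have "\<dots> = (LBINT x. ((w r x - z (r, x)) - (w q x - z (q, x))) * p (r, x))"
   proof (rule integral_cong_AE)
    note [measurable] = L2_measurable[OF WL] zsl
    show "(%x. (W r x - W q x) * W r x) \<in> borel_measurable lborel" by measurable
    have "(%x. p (r, x)) \<in> borel_fun" by (rule measurable_slice(1)[OF L2_measurable[OF pL]])
    then show "(%x. ((w r x - z (r, x)) - (w q x - z (q, x))) * p (r, x)) \<in> borel_measurable lborel" by measurable
    show "AE x in lborel. (W r x - W q x) * W r x = ((w r x - z (r, x)) - (w q x - z (q, x))) * p (r, x)"
     using ae by eventually_elim (use r T' in \<open>auto simp: W_def p_def d_def ic_def indicator_def algebra_simps\<close>)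
   qed
   finally show "E r - E q \<le> (LBINT x. ((w r x - z (r, x)) - (w q x - z (q, x))) * p (r, x))" .
  qed
 qed
 define g where "g y = (X (snd y) * d y)\<^sup>2 / 2" for y
 have Xd: "L2 (%y. X (snd y) *\<^sub>R d y)" by (rule L2_mult_bounded[OF dL _ X2]) measurable
 have gi: "integrable lborel g" unfolding g_def[abs_def] using L2_integrable_real[OF Xd[simplified]] by simp
 have gE: "AE r in lborel. r \<in> {0<..<T} --> (LBINT x. g (r, x)) = E r"
  using s(6)
 proof eventually_elim
  case (elim r)
  show ?case
  proof
   assume r: "r \<in> {0<..<T}"
   then have ae: "AE x in lborel. v (r, x) = w r x" using elim by blast
   show "(LBINT x. g (r, x)) = E r" unfolding E_def
   proof (rule integral_cong_AE)
    show "(%x. g (r, x)) \<in> borel_measurable lborel"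
     using measurable_slice(1)[of g] gi by (auto dest: borel_measurable_integrable)
    show "(%x. (W r x)\<^sup>2 / 2) \<in> borel_measurable lborel" using L2_measurable[OF WL] by measurable
    show "AE x in lborel. g (r, x) = (W r x)\<^sup>2 / 2"
     using ae by eventually_elim (use r s(8) in \<open>auto simp: g_def W_def d_def ic_def indicator_def\<close>)
   qed
  qed
 qed
 \<comment> \<open>Q1 and Q2 are the two sides of the residual equation of z tested with p. Their
   time integrals agree, so Q1 - Q2 may be added to the integrand; only after that a pointwise bound
   holds on the inner domain.\<close>
 define Q1 where "Q1 y = ind \<Omega>1 (snd y) *\<^sub>R ((ic y *\<^sub>R zt y) * p y + (ic y *\<^sub>R Gz y) \<bullet> P y - (ic y *\<^sub>R f (z y)) * p y)" for y
 define Q2 where "Q2 y = A y \<bullet> P y + B y * p y" for y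
 have Q1i: "integrable lborel Q1"
 proof -
  have O1: "{y :: real \<times> 'n. snd y \<in> \<Omega>1} \<in> sets borel" using measurable_sets[OF measurable_snd_borel, of \<Omega>1] by (simp add: vimage_def)
  have "integrable lborel (%y. (ic y *\<^sub>R zt y) * p y + (ic y *\<^sub>R Gz y) \<bullet> P y - (ic y *\<^sub>R f (z y)) * p y)"
   by (intro lintegrable_add lintegrable_diff L2_mult_integrable L2_inner_integrable ztL GzL fzL pL PL)
  then have "integrable lborel (%y. ind {y. snd y \<in> \<Omega>1} y *\<^sub>R ((ic y *\<^sub>R zt y) * p y + (ic y *\<^sub>R Gz y) \<bullet> P y - (ic y *\<^sub>R f (z y)) * p y))"
   using O1 by (intro integrable_mult_indicator) auto
  moreover have "(ind {y. snd y \<in> \<Omega>1} y :: real) = ind \<Omega>1 (snd y)" for y :: "real \<times> 'n" by (simp add: indicator_def)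
  ultimately show ?thesis unfolding Q1_def[abs_def] by simp
 qed
 have Q2i: "integrable lborel Q2" unfolding Q2_def[abs_def]
  by (intro lintegrable_add L2_mult_integrable L2_inner_integrable AB pL PL)
 have Q12: "(LBINT y. ind {0..\<tau>} (fst y) * Q1 y) = (LBINT y. ind {0..\<tau>} (fst y) * Q2 y)" if "\<tau> \<le> T'" for \<tau>
  unfolding integral_slice(1)[OF integrable_indicator_time[OF Q1i]] integral_slice(1)[OF integrable_indicator_time[OF Q2i]]
 proof (rule integral_cong_AE)
  show "(%r. LBINT x. ind {0..\<tau>} (fst (r, x)) * Q1 (r, x)) \<in> borel_measurable lborel"
   by (rule borel_measurable_integrable[OF integral_slice(2)[OF integrable_indicator_time[OF Q1i]]])
  show "(%r. LBINT x. ind {0..\<tau>} (fst (r, x)) * Q2 (r, x)) \<in> borel_measurable lborel"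
   by (rule borel_measurable_integrable[OF integral_slice(2)[OF integrable_indicator_time[OF Q2i]]])
  show "AE r in lborel. (LBINT x. ind {0..\<tau>} (fst (r, x)) * Q1 (r, x)) = (LBINT x. ind {0..\<tau>} (fst (r, x)) * Q2 (r, x))"
   \<comment> \<open>The residual equation concerns the open interval (0, T'), so its two end points
     are discarded as null sets.\<close>
   using res pw L2_slice(1)[OF pL] L2_slice(1)[OF PL] AE_lborel_singleton[of 0] AE_lborel_singleton[of T']
  proof eventually_elim
   case (elim r)
   show ?case
   proof (cases "r \<in> {0..\<tau>}")
    case True
    then have r: "r \<in> {0<..<T'}" "r \<in> {0<..<T}" using elim(5,6) that T' by auto
    have "H1 \<Omega>1 (%x. p (r, x)) (%x. P (r, x))" using elim(2-4) r wgrad_mono[OF _ \<Omega>1(2)] by (simp add: H1_def)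
    then have eq: "(LBINT x. ind \<Omega>1 x * (zt (r, x) * p (r, x) + Gz (r, x) \<bullet> P (r, x) - f (z (r, x)) * p (r, x)))
     = (LBINT x. A (r, x) \<bullet> P (r, x) + B (r, x) * p (r, x))" using elim(1) r(1) by blast
    have "ind \<Omega>1 x * (zt (r, x) * p (r, x) + Gz (r, x) \<bullet> P (r, x) - f (z (r, x)) * p (r, x)) = Q1 (r, x)" for x
     using \<Omega>1(2) r(2) by (auto simp: Q1_def ic_def indicator_def)
    then show ?thesis using eq True by (simp add: Q2_def)
   qed simp
  qed
 qed
 define Y where "Y = {x. x \<notin> closure \<Omega>1 \<and> X x \<noteq> 0}"
 have Yb: "Y \<in> sets borel" unfolding Y_def by measurable
 define F where "F y = (f (v y) - zt y) * p y - ?D (snd y) * (G y \<bullet> P y)" for y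
 \<comment> \<open>The inhomogeneous part for Gronwall's inequality: residual, layer and
   \<epsilon>-terms. It is nonnegative everywhere, hence may be integrated over all times.\<close>
 define rest where "rest y = ((norm (A y))\<^sup>2 + (B y)\<^sup>2) + (4 * C\<^sup>2 * (ind {0<..<T} (fst y) * ind Y (snd y))
   + \<epsilon> * (C\<^sup>2 * (ind {0<..<T} (fst y) * ind \<Omega> (snd y)) + 4 * Z\<^sup>2 * (d y)\<^sup>2))" for y
 have key: "AE y in lborel. F y + Q1 y - Q2 y \<le> (2 * L + 2) * g y + rest y"
  using pos AE_slice'(1)[OF null]
 proof eventually_elim
  case (elim y)
  have rest1: "(norm (A y))\<^sup>2 + (B y)\<^sup>2 \<le> rest y" "0 \<le> rest y" "4 * C\<^sup>2 * (ind {0<..<T} (fst y) * ind Y (snd y)) + \<epsilon> * (C\<^sup>2 * (ind {0<..<T} (fst y) * ind \<Omega> (snd y)) + 4 * Z\<^sup>2 * (d y)\<^sup>2) \<le> rest y"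
   using \<epsilon> by (auto simp: rest_def indicator_def intro!: add_nonneg_nonneg mult_nonneg_nonneg)
  have g0: "0 \<le> (2 * L + 2) * g y" using osl(2) by (simp add: g_def)
  show ?case
  proof (cases "y \<in> cyl T \<Omega>")
   case False
   have "F y = 0" "Q1 y = 0" "Q2 y = 0" using ic0[OF False] by (auto simp: F_def Q1_def Q2_def p_def P_def d_def gd_def)
   then show ?thesis using rest1 g0 by simp
  next
   case True
   have ic1: "ic y = 1" using True by (cases y) (simp add: ic_def cyl_def)
   have d: "d y = v y - z y" and gd: "gd y = G y - Gz y" using ic1 by (simp_all add: d_def gd_def)
   have ol: "(f (v y) - f (z y)) * d y \<le> L * (d y)\<^sup>2" unfolding d by (rule osl(1)[OF elim(1) z(2)])
   show ?thesis
   proof (cases "snd y \<in> \<Omega>1")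
    case True
    have X1: "X x = 1" if "x \<in> \<Omega>1" for x using X(4) closure_subset that by blast
    have Xy: "X (snd y) = 1" "gradf X (snd y) = 0" using X1[OF True] gradf_locally_const[OF \<Omega>1(1) True X1] by auto
    have Dy: "?D (snd y) = 1" using True closure_subset by (auto simp: Deps_def)
    have pP: "p y = d y" "P y = gd y" using Xy by (simp_all add: p_def P_def)
    have "F y + Q1 y - Q2 y = (f (v y) - f (z y)) * d y - (G y - Gz y) \<bullet> gd y - A y \<bullet> gd y - B y * d y"
     using True ic1 by (simp add: F_def Q1_def Q2_def pP Dy inner_diff_left algebra_simps)
    \<comment> \<open>A quarter of the squared gradient difference pays for A, and d^2 pays for
      B.\<close>
    also have "\<dots> \<le> L * (d y)\<^sup>2 - (norm (gd y))\<^sup>2 + ((norm (gd y))\<^sup>2 / 4 + (norm (A y))\<^sup>2) + ((B y)\<^sup>2 + (d y)\<^sup>2)"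
     using ol inner_young[of "gd y" "A y"] mult_young[of "- B y" "d y"] unfolding gd[symmetric]
     by (simp add: power2_norm_eq_inner inner_commute)
    also have "\<dots> \<le> (2 * L + 2) * g y + ((norm (A y))\<^sup>2 + (B y)\<^sup>2)"
    proof -
     have "(2 * L + 2) * g y = L * (d y)\<^sup>2 + (d y)\<^sup>2" by (simp add: g_def Xy field_simps)
     then show ?thesis using zero_le_power2[of "norm (gd y)"] by linarith
    qed
    finally show ?thesis using rest1(1) by linarith
   next
    case False
    \<comment> \<open>The coefficient is 1 on the closed inner domain; its boundary is a null set,
      so outside the open domain the coefficient is \<epsilon> almost everywhere.\<close>
    have nc: "snd y \<notin> closure \<Omega>1" using False elim(2) \<Omega>1(1) by (simp add: frontier_def interior_open)
    have Dy: "?D (snd y) = \<epsilon>" using nc by (simp add: Deps_def)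
    have Q0: "Q1 y = 0" "Q2 y = 0" using False AB(5,6)[of y] by (simp_all add: Q1_def Q2_def)
    let ?c = "X (snd y)"
    have cc: "0 \<le> ?c * ?c" "?c * ?c \<le> 1" using XX[of "snd y"] by auto
    \<comment> \<open>f (v) is not bounded uniformly in \<epsilon>. Inserting f (z) leaves a
      difference handled by the one-sided estimate and two quantities bounded by C.\<close>
    have a1: "(f (v y) - zt y) * d y \<le> (L + 1) * (d y)\<^sup>2 + 4 * C\<^sup>2"
    proof -
     have "(f (z y) - zt y) * d y \<le> (f (z y) - zt y)\<^sup>2 + (d y)\<^sup>2" by (rule mult_young)
     moreover have "(f (z y) - zt y)\<^sup>2 \<le> 4 * C\<^sup>2"
     proof -
      have "\<bar>f (z y) - zt y\<bar> \<le> 2 * C" using fC[OF z(2), of y] z(4)[of y] by linarith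
      then have "\<bar>f (z y) - zt y\<bar>\<^sup>2 \<le> (2 * C)\<^sup>2" by (rule power_mono) simp
      then show ?thesis by (simp add: power_mult_distrib)
     qed
     ultimately show ?thesis using ol by (simp add: algebra_simps)
    qed
    have a2: "(f (v y) - zt y) * p y \<le> (2 * L + 2) * g y + 4 * C\<^sup>2 * (ind {0<..<T} (fst y) * ind Y (snd y))"
    proof (cases "?c = 0")
     case True
     then show ?thesis using C0 by (simp add: p_def g_def)
    next
     case False
     then have i1: "(ind {0<..<T} (fst y) * ind Y (snd y) :: real) = 1" using nc \<open>y \<in> cyl T \<Omega>\<close> by (cases y) (auto simp: Y_def cyl_def)
     have "(f (v y) - zt y) * p y = (?c * ?c) * ((f (v y) - zt y) * d y)" by (simp add: p_def mult_ac)
     moreover have "(?c * ?c) * ((f (v y) - zt y) * d y) \<le> (?c * ?c) * ((L + 1) * (d y)\<^sup>2 + 4 * C\<^sup>2)" by (rule mult_left_mono[OF a1 cc(1)])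
     moreover have "(?c * ?c) * ((L + 1) * (d y)\<^sup>2 + 4 * C\<^sup>2) = (2 * L + 2) * g y + (?c * ?c) * (4 * C\<^sup>2)" by (simp add: g_def power2_eq_square algebra_simps)
     moreover have "(?c * ?c) * (4 * C\<^sup>2) \<le> 1 * (4 * C\<^sup>2)" by (rule mult_right_mono[OF cc(2)]) simp
     ultimately show ?thesis unfolding i1 by linarith
    qed
    have a3: "- (G y \<bullet> P y) \<le> C\<^sup>2 + 4 * Z\<^sup>2 * (d y)\<^sup>2"
     unfolding P_def gd by (rule layer_gradient_bound[OF X2 z(6) X(5)])
    have "(ind {0<..<T} (fst y) * ind \<Omega> (snd y) :: real) = 1" using ic1 by (simp add: ic_def)
    then have a4: "- (\<epsilon> * (G y \<bullet> P y)) \<le> \<epsilon> * (C\<^sup>2 * (ind {0<..<T} (fst y) * ind \<Omega> (snd y)) + 4 * Z\<^sup>2 * (d y)\<^sup>2)"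
     using mult_left_mono[OF a3, of \<epsilon>] \<epsilon> by simp
    show ?thesis using a2 a4 rest1(3) unfolding F_def Dy Q0 by linarith
   qed
  qed
 qed
 have DP: "L2 (%y. ?D (snd y) *\<^sub>R G y)" by (rule L2_mult_bounded[OF s(3) _ D1]) measurable
 have Fi: "integrable lborel F"
 proof -
  have "integrable lborel (%y. f (v y) * p y - (ic y *\<^sub>R zt y) * p y - (?D (snd y) *\<^sub>R G y) \<bullet> P y)"
   by (intro lintegrable_diff L2_mult_integrable L2_inner_integrable Ls(2) ztL DP pL PL)
  moreover have "f (v y) * p y - (ic y *\<^sub>R zt y) * p y - (?D (snd y) *\<^sub>R G y) \<bullet> P y = F y" for y
   using ic01(1)[of y] by (auto simp: F_def p_def d_def left_diff_distrib)
  ultimately show ?thesis by simp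
 qed
 note cY = cyl_integral[OF Yb lay(2)[folded Y_def] less_imp_le[OF T]] and c\<Omega> = cyl_integral[OF _ \<Omega>f less_imp_le[OF T]]
 have ri: "integrable lborel rest" unfolding rest_def[abs_def]
  using L2_integrable[OF AB(1)] L2_integrable_real[OF AB(2)] L2_integrable_real[OF dL] cY(1) c\<Omega>(1)
  by (intro lintegrable_add integrable_mult_right) auto
 \<comment> \<open>Only the integral of d^2 is needed with the factor \<epsilon>, and the uniform L2
   bound of the solution suffices for it.\<close>
 have vT: "sqn v \<le> T * Kb"
 proof -
  have "sqn v = (LBINT r. sqn (%x. v (r, x)))" by (rule L2_slice(4)[OF Ls(1)])
  also have "\<dots> \<le> (LBINT r. ind {0<..<T} r * Kb)"
  proof (rule integral_mono_AE)
   show "integrable lborel (%r. sqn (%x. v (r, x)))" by (rule L2_slice(3)[OF Ls(1)])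
   show "integrable lborel (%r::real. ind {0<..<T} r * Kb)" using T by (intro integrable_mult_left integrable_real_indicator) auto
   show "AE r in lborel. sqn (%x. v (r, x)) \<le> ind {0<..<T} r * Kb"
    using s(6)
   proof eventually_elim
    case (elim r)
    show ?case
    proof (cases "r \<in> {0<..<T}")
     case True
     have "sqn (%x. v (r, x)) = sqn (w r)" unfolding sqn_def
     proof (rule integral_cong_AE)
      have ae: "AE x in lborel. v (r, x) = w r x" using elim True by blast
      then show "AE x in lborel. (norm (v (r, x)))\<^sup>2 = (norm (w r x))\<^sup>2" by eventually_elim simp
     qed measurable
     then show ?thesis using Kb[of r] True by simp
    next
     case False
     then have "v (r, x) = 0" for x using s(4)[of "(r, x)"] by (auto simp: cyl_def)
     then show ?thesis using False by (simp add: sqn_def)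
    qed
   qed
  qed
  also have "\<dots> = T * Kb" using T by simp
  finally show ?thesis .
 qed
 have dS: "(LBINT y. (d y)\<^sup>2) \<le> T * (2 * Kb + 2 * K\<^sup>2 * measure lborel \<Omega>)"
 proof -
  have "sqn (%y. ic y *\<^sub>R z y) \<le> (LBINT y. K\<^sup>2 * ic y)"
   unfolding sqn_def
  proof (rule integral_mono')
   show "integrable lborel (%y. K\<^sup>2 * ic y)" using c\<Omega>(1) by (auto simp: ic_def)
   show "(norm (ic y *\<^sub>R z y))\<^sup>2 \<le> K\<^sup>2 * ic y" for y
    using ic01(1)[of y] power_mono[OF z(2)[of y], of 2] by auto
  qed (use ic01 in auto)
  also have "\<dots> = K\<^sup>2 * (T * measure lborel \<Omega>)" using c\<Omega>(2) by (simp add: ic_def)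
  finally have "sqn d \<le> 2 * (T * Kb) + 2 * (K\<^sup>2 * (T * measure lborel \<Omega>))"
   unfolding d_def[abs_def] icv using sqn_diff_le[OF Ls(1) zL] vT by simp
  then show ?thesis by (simp add: sqn_real algebra_simps)
 qed
 have rS: "(LBINT y. rest y) \<le> 2 * e + 4 * T * C\<^sup>2 * \<delta> + \<epsilon> * (T * (C\<^sup>2 * measure lborel \<Omega> + 4 * Z\<^sup>2 * (2 * Kb + 2 * K\<^sup>2 * measure lborel \<Omega>)))"
 proof -
  have "(LBINT y. rest y) = (sqn A + sqn B) + (4 * C\<^sup>2 * (T * measure lborel Y) + \<epsilon> * (C\<^sup>2 * (T * measure lborel \<Omega>) + 4 * Z\<^sup>2 * (LBINT y. (d y)\<^sup>2)))"
   unfolding rest_def sqn_def real_norm_def power2_abs cY(2)[symmetric] c\<Omega>(2)[OF \<open>\<Omega> \<in> sets borel\<close>, symmetric]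
   using L2_integrable[OF AB(1)] L2_integrable_real[OF AB(2)] L2_integrable_real[OF dL] cY(1) c\<Omega>(1)[OF \<open>\<Omega> \<in> sets borel\<close>] by simp
  also have "\<dots> \<le> (e + e) + (4 * C\<^sup>2 * (T * \<delta>) + \<epsilon> * (C\<^sup>2 * (T * measure lborel \<Omega>) + 4 * Z\<^sup>2 * (T * (2 * Kb + 2 * K\<^sup>2 * measure lborel \<Omega>))))"
   by (intro add_mono mult_left_mono AB(3,4) lay(1)[folded Y_def] dS order_refl) (use T \<epsilon> in auto)
  also have "\<dots> = 2 * e + 4 * T * C\<^sup>2 * \<delta> + \<epsilon> * (T * (C\<^sup>2 * measure lborel \<Omega> + 4 * Z\<^sup>2 * (2 * Kb + 2 * K\<^sup>2 * measure lborel \<Omega>)))"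
   by (simp add: algebra_simps)
  finally show ?thesis .
 qed
 \<comment> \<open>At time 0 both solutions start from u0. On the inner domain the error is that of
   z; in the layer |w 0 - z| <= M + K and the measure is small.\<close>
 have E0: "E 0 \<le> e / 2 + (M + K)\<^sup>2 * \<delta>"
 proof -
  have zi: "L2 (%x. ind \<Omega>1 x * (z (0, x) - w 0 x))"
  proof -
   have a: "L2 (%x. ind \<Omega>1 x *\<^sub>R ((ind \<Omega> x * X x) *\<^sub>R z (0, x)))" by (rule L2_mult_indicator(1)[OF zsL[OF zsl z(2)]]) simp
   have b: "L2 (%x. ind \<Omega>1 x *\<^sub>R w 0 x)" by (rule L2_mult_indicator(1)[OF s(7)]) simp
   have "ind \<Omega>1 x *\<^sub>R ((ind \<Omega> x * X x) *\<^sub>R z (0, x)) - ind \<Omega>1 x *\<^sub>R w 0 x = ind \<Omega>1 x * (z (0, x) - w 0 x)" for x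
   proof (cases "x \<in> \<Omega>1")
    case True
    then have "X x = 1" "x \<in> \<Omega>" using X(4)[of x] closure_subset[of \<Omega>1] \<Omega>1(2) by auto
    then show ?thesis using True by simp
   qed simp
   then show ?thesis using L2_diff[OF a b] by simp
  qed
  have iY: "integrable lborel (%x. (M + K)\<^sup>2 * ind Y x)" using Yb lay(2) unfolding Y_def[symmetric] by (intro integrable_mult_right integrable_real_indicator) auto
  have "sqn (W 0) \<le> (LBINT x. (ind \<Omega>1 x * (z (0, x) - w 0 x))\<^sup>2 + (M + K)\<^sup>2 * ind Y x)"
   unfolding sqn_real
  proof (rule integral_mono_AE)
   show "integrable lborel (%x. (ind \<Omega>1 x * (z (0, x) - w 0 x))\<^sup>2 + (M + K)\<^sup>2 * ind Y x)"
    by (rule lintegrable_add[OF L2_integrable_real[OF zi] iY])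
   show "AE x in lborel. (W 0 x)\<^sup>2 \<le> (ind \<Omega>1 x * (z (0, x) - w 0 x))\<^sup>2 + (M + K)\<^sup>2 * ind Y x"
    using s(10) null
   proof eventually_elim
    case (elim x)
    show ?case
    proof (cases "x \<in> \<Omega>1")
     case True
     then have "X x = 1" "x \<in> \<Omega>" "x \<notin> Y" using X(4)[of x] closure_subset[of \<Omega>1] \<Omega>1(2) by (auto simp: Y_def)
     then show ?thesis using True by (simp add: W_def power2_commute)
    next
     case False
     have nc: "x \<notin> closure \<Omega>1" using False elim(2) \<Omega>1(1) by (simp add: frontier_def interior_open)
     show ?thesis
     proof (cases "x \<in> \<Omega> \<and> X x \<noteq> 0")
      case True
      have "\<bar>w 0 x - z (0, x)\<bar> \<le> M + K" using elim(1) True u0[of x] z(2)[of "(0, x)"] by auto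
      then have "\<bar>X x\<bar> * \<bar>w 0 x - z (0, x)\<bar> \<le> 1 * (M + K)" by (intro mult_mono X2) auto
      then have "\<bar>W 0 x\<bar> \<le> M + K" using True by (simp add: W_def abs_mult)
      then have "\<bar>W 0 x\<bar>\<^sup>2 \<le> (M + K)\<^sup>2" by (rule power_mono) simp
      then show ?thesis using True False nc by (simp add: Y_def)
     qed (auto simp: W_def)
    qed
   qed
  qed (rule Ei)
  also have "\<dots> = sqn (%x. ind \<Omega>1 x * (z (0, x) - w 0 x)) + (M + K)\<^sup>2 * measure lborel Y"
   using L2_integrable_real[OF zi] iY by (simp add: sqn_real)
  also have "\<dots> \<le> e + (M + K)\<^sup>2 * \<delta>" by (intro add_mono init mult_left_mono lay(1)[folded Y_def]) auto
  finally have "sqn (W 0) \<le> e + (M + K)\<^sup>2 * \<delta>" .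
  moreover have "0 \<le> (M + K)\<^sup>2 * \<delta>" using order_trans[OF measure_nonneg lay(1)] by simp
  ultimately show ?thesis by (simp add: E2)
 qed
 have ineq: "E \<tau> \<le> ?c0 + (2 * L + 2) * (LBINT r:{0..\<tau>}. E r)" if tau: "\<tau> \<in> {0..T'}" for \<tau>
 proof -
  have zid: "(LBINT \<sigma>:{q..r}. zt (\<sigma>, x)) = z (r, x) - z (q, x)" if "0 \<le> q" "q \<le> r" "r \<le> T'" for q r x by (rule z(10)[OF that(2)])
  have "E \<tau> - E 0 \<le> (LBINT y. ind {0..\<tau>} (fst y) * F y)"
   unfolding F_def by (rule sol_energy[OF c \<Omega> Dm D1 f z(3,4) zid pL PL p0 pw Ec conv T'(2) tau])
  also have "\<dots> = (LBINT y. ind {0..\<tau>} (fst y) * (F y + Q1 y - Q2 y))"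
  proof -
   have "(LBINT y. ind {0..\<tau>} (fst y) * (F y + Q1 y - Q2 y))
    = (LBINT y. ind {0..\<tau>} (fst y) * F y + ind {0..\<tau>} (fst y) * Q1 y - ind {0..\<tau>} (fst y) * Q2 y)"
    by (simp add: algebra_simps)
   also have "\<dots> = (LBINT y. ind {0..\<tau>} (fst y) * F y) + (LBINT y. ind {0..\<tau>} (fst y) * Q1 y) - (LBINT y. ind {0..\<tau>} (fst y) * Q2 y)"
    using integrable_indicator_time[OF Fi] integrable_indicator_time[OF Q1i] integrable_indicator_time[OF Q2i] by simp
   finally show ?thesis using Q12[of \<tau>] tau by simp
  qed
  also have "\<dots> \<le> (LBINT y. (2 * L + 2) * (ind {0..\<tau>} (fst y) * g y) + rest y)"
  proof (rule integral_mono_AE)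
   show "integrable lborel (%y. ind {0..\<tau>} (fst y) * (F y + Q1 y - Q2 y))"
    by (intro integrable_indicator_time lintegrable_add lintegrable_diff Fi Q1i Q2i)
   show "integrable lborel (%y. (2 * L + 2) * (ind {0..\<tau>} (fst y) * g y) + rest y)"
    by (intro lintegrable_add integrable_mult_right integrable_indicator_time gi ri)
   show "AE y in lborel. ind {0..\<tau>} (fst y) * (F y + Q1 y - Q2 y) \<le> (2 * L + 2) * (ind {0..\<tau>} (fst y) * g y) + rest y"
    using key
   proof eventually_elim
    case (elim y)
    have "0 \<le> rest y" using \<epsilon> by (auto simp: rest_def indicator_def intro!: add_nonneg_nonneg mult_nonneg_nonneg)
    then show ?case using elim by (cases "fst y \<in> {0..\<tau>}") auto
   qed
  qed
  also have "\<dots> = (2 * L + 2) * (LBINT y. ind {0..\<tau>} (fst y) * g y) + (LBINT y. rest y)"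
   using integrable_indicator_time[OF gi] ri by simp
  also have "(LBINT y. ind {0..\<tau>} (fst y) * g y) = (LBINT r:{0..\<tau>}. E r)"
   by (rule slice_energy_integral[OF integrable_indicator_time[OF gi] gE Ec]) (use tau T' in auto)
  finally have "E \<tau> \<le> E 0 + ((2 * L + 2) * (LBINT r:{0..\<tau>}. E r) + (LBINT y. rest y))" by simp
  also have "\<dots> \<le> ?c0 + (2 * L + 2) * (LBINT r:{0..\<tau>}. E r)" using E0 rS by (simp add: algebra_simps)
  finally show ?thesis .
 qed
 show "L2 (W t)" by (rule WL)
 show "sqn (W t) / 2 \<le> ?c0 * exp ((2 * L + 2) * t)" if "t \<in> {0..T'}"
  using Gronwall[OF Ec _ ineq that] osl(2) by (simp add: E2)
qed

section \<open>Convergence\<close>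

text \<open>What is used of the bistable structure: local Lipschitz continuity, which follows from a
  continuous derivative on compact intervals, the zero at 0, and the sign beyond 1.\<close>

lemma bistableD:
 assumes "bistable f \<alpha>"
 shows "continuous_on UNIV f" "f 0 = 0" "!!u. 1 < u ==> f u < 0"
  and "!!K. \<exists>L\<ge>0. \<forall>a b. \<bar>a\<bar> \<le> K --> \<bar>b\<bar> \<le> K --> \<bar>f a - f b\<bar> \<le> L * \<bar>a - b\<bar>"
proof -
 have C1: "f C1_differentiable_on UNIV" and z: "f 0 = 0" and neg: "!!u. 1 < u ==> f u < 0"
  using assms by (auto simp: bistable_def)
 show "f 0 = 0" "!!u. 1 < u ==> f u < 0" by (rule z, rule neg)
 obtain D where D: "!!x. (f has_vector_derivative D x) (at x)" "continuous_on UNIV D"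
  using C1 unfolding C1_differentiable_on_def by auto
 show "continuous_on UNIV f" using D(1) by (meson continuous_at_imp_continuous_on has_vector_derivative_continuous)
 fix K :: real
 have "compact (D ` {- K..K})" by (intro compact_continuous_image continuous_on_subset[OF D(2)]) auto
 then have "bounded (D ` {- K..K})" by (rule compact_imp_bounded)
 then obtain B where "\<forall>y\<in>D ` {- K..K}. norm y \<le> B" unfolding bounded_iff by (elim exE)
 then have B: "norm (D x) \<le> B" if "x \<in> {- K..K}" for x using that by blast
 have "\<bar>f a - f b\<bar> \<le> \<bar>B\<bar> * \<bar>a - b\<bar>" if "\<bar>a\<bar> \<le> K" "\<bar>b\<bar> \<le> K" for a b
 proof -
  have "norm (f a - f b) \<le> \<bar>B\<bar> * norm (a - b)"
  proof (rule differentiable_bound[of "{- K..K}" f "%x h. h *\<^sub>R D x"])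
   show "(f has_derivative (%h. h *\<^sub>R D x)) (at x within {- K..K})" for x
    using D(1)[of x] unfolding has_vector_derivative_def by (rule has_derivative_at_withinI)
   show "onorm (%h. h *\<^sub>R D x) \<le> \<bar>B\<bar>" if "x \<in> {- K..K}" for x
   proof (rule onorm_le)
    fix h :: real
    have "\<bar>h\<bar> * \<bar>D x\<bar> \<le> \<bar>h\<bar> * \<bar>B\<bar>" using B[OF that] by (intro mult_left_mono) auto
    then show "norm (h *\<^sub>R D x) \<le> \<bar>B\<bar> * norm h" by (simp add: abs_mult mult.commute)
   qed
  qed (use that in auto)
  then show ?thesis by simp
 qed
 then show "\<exists>L\<ge>0. \<forall>a b. \<bar>a\<bar> \<le> K --> \<bar>b\<bar> \<le> K --> \<bar>f a - f b\<bar> \<le> L * \<bar>a - b\<bar>" by (intro exI[of _ "\<bar>B\<bar>"]) auto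
qed

text \<open>For large \<^term>\<open>a\<close> only the sign of \<^term>\<open>f\<close> on \<^term>\<open>{1<..}\<close> is available, but then \<^term>\<open>a - b \<ge> 1\<close>.\<close>
lemma bistable_one_sided:
 assumes "bistable f \<alpha>"
 obtains L where "0 \<le> L" "!!a b. 0 \<le> a ==> \<bar>b\<bar> \<le> K ==> (f a - f b) * (a - b) \<le> L * (a - b)\<^sup>2"
proof -
 note bi = bistableD[OF assms]
 \<comment> \<open>For a > R one has a > 1, so f a < 0, and also a - b >= 1 because R >= K + 1 and
   |b| <= K.\<close>
 define R where "R = max K 1 + 1"
 have R: "2 \<le> R" "K + 1 \<le> R" by (auto simp: R_def)
 obtain L where L: "0 \<le> L" "!!a b. \<bar>a\<bar> \<le> R ==> \<bar>b\<bar> \<le> R ==> \<bar>f a - f b\<bar> \<le> L * \<bar>a - b\<bar>" using bi(4)[of R] by blast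
 show ?thesis
 proof (rule that[of "L * R"])
  show "0 \<le> L * R" using L(1) R by simp
  fix a b :: real assume a: "0 \<le> a" and b: "\<bar>b\<bar> \<le> K"
  show "(f a - f b) * (a - b) \<le> L * R * (a - b)\<^sup>2"
  proof (cases "a \<le> R")
   case True
   have "(f a - f b) * (a - b) \<le> \<bar>f a - f b\<bar> * \<bar>a - b\<bar>" by (simp add: abs_mult[symmetric])
   also have "\<dots> \<le> (L * \<bar>a - b\<bar>) * \<bar>a - b\<bar>" using L(2)[of a b] True a b R by (intro mult_right_mono) auto
   also have "\<dots> = (L * 1) * (a - b)\<^sup>2" by (simp add: power2_eq_square)
   also have "\<dots> \<le> L * R * (a - b)\<^sup>2" using L(1) R by (intro mult_right_mono mult_left_mono) auto
   finally show ?thesis .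
  next
   case False
   have fb: "\<bar>f b\<bar> \<le> L * R"
   proof -
    have "\<bar>f b\<bar> \<le> L * \<bar>b\<bar>" using L(2)[of b 0] b R bi(2) by auto
    also have "\<dots> \<le> L * R" using L(1) b R by (intro mult_left_mono) auto
    finally show ?thesis .
   qed
   have ab: "1 \<le> a - b" using False b R by auto
   have "f a - f b \<le> \<bar>f b\<bar>" using bi(3)[of a] False R by auto
   then have "(f a - f b) * (a - b) \<le> (L * R) * (a - b)" using fb ab by (intro mult_right_mono) auto
   also have "\<dots> \<le> (L * R) * (a - b)\<^sup>2" using ab L(1) R mult_left_mono[OF ab, of "a - b"] by (intro mult_left_mono) (auto simp: power2_eq_square)
   finally show ?thesis .
  qed
 qed
qed

text \<open>The threshold \<open>\<epsilon>0\<close> is built from the data and from the limit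
  solution only, hence it serves all solutions of the \<epsilon>-problems at once. The final budget
  is e/4 for the residual, e/8 each for the layer and for \<epsilon>, e/4 for the last time slab and
  e/4 for the distance of z from the limit solution.\<close>

lemma clean_sols_close:
 fixes \<Omega> \<Omega>1 :: "'n::euclidean_space set"
 assumes \<Omega>: "open \<Omega>" "bounded \<Omega>" and \<Omega>1: "open \<Omega>1" "smooth_boundary \<Omega>1" "closure \<Omega>1 \<subseteq> \<Omega>"
  and T: "T > 0" and u0: "!!x. x \<in> \<Omega> ==> 0 \<le> u0 x \<and> u0 x \<le> M" and f: "bistable f \<alpha>"
  and c1: "clean_sol \<Omega>1 (%_. 1) f u0 T v1 G1 w1" and e: "e > 0"
 obtains \<epsilon>0 where "\<epsilon>0 > 0" "!!\<epsilon> v G w. 0 < \<epsilon> ==> \<epsilon> < \<epsilon>0 ==> clean_sol \<Omega> (Deps \<Omega>1 \<epsilon>) f u0 T v G w ==>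
   sqn (%y. ind \<Omega>1 (snd y) * (v y - v1 y)) \<le> e"
proof -
 note bi = bistableD[OF f]
 have sub: "\<Omega>1 \<subseteq> \<Omega>" using closure_subset \<Omega>1(3) by blast
 have bd1: "bounded \<Omega>1" using \<Omega>(2) sub by (rule bounded_subset)
 have [measurable]: "\<Omega> \<in> sets borel" "\<Omega>1 \<in> sets borel" using \<Omega> \<Omega>1 by auto
 have \<Omega>f: "emeasure lborel \<Omega> < \<infinity>" using \<Omega>(2) by (rule emeasure_bounded_finite)
 note s1 = clean_solD[OF c1]
 note Ls1 = clean_sol_L2[OF c1 bd1 bi(1,2)]
 obtain K where K: "!!y. \<bar>v1 y\<bar> \<le> K" using s1(2) by blast
 have K0: "0 \<le> K" using order_trans[OF abs_ge_zero K] .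
 obtain Lf where Lf: "0 \<le> Lf" "!!a b. \<bar>a\<bar> \<le> K ==> \<bar>b\<bar> \<le> K ==> \<bar>f a - f b\<bar> \<le> Lf * \<bar>a - b\<bar>" using bi(4)[of K] by blast
 obtain L where L: "0 \<le> L" "!!a b. 0 \<le> a ==> \<bar>b\<bar> \<le> K ==> (f a - f b) * (a - b) \<le> L * (a - b)\<^sup>2"
  by (rule bistable_one_sided[OF f, of K]) (rule that, assumption+)
 have fs: "f s * s \<le> L * s\<^sup>2" if "0 \<le> s" for s using L(2)[OF that, of 0] bi(2) K0 by simp
 have lip0: "\<exists>L\<ge>0. \<forall>s. \<bar>s\<bar> \<le> R --> \<bar>f s\<bar> \<le> L * \<bar>s\<bar>" for R
 proof -
  obtain l where l: "l \<ge> 0" "!!a b. \<bar>a\<bar> \<le> R ==> \<bar>b\<bar> \<le> R ==> \<bar>f a - f b\<bar> \<le> l * \<bar>a - b\<bar>" using bi(4)[of R] by blast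
  have "\<bar>f s\<bar> \<le> l * \<bar>s\<bar>" if "\<bar>s\<bar> \<le> R" for s using l(2)[OF that, of 0] that bi(2) by auto
  then show ?thesis using l(1) by auto
 qed
 define \<mu> where "\<mu> = measure lborel \<Omega>"
 have \<mu>0: "0 \<le> \<mu>" by (simp add: \<mu>_def)
 define Kb where "Kb = M\<^sup>2 * \<mu> * exp (2 * L * T)"
 have Kb0: "0 \<le> Kb" using \<mu>0 by (simp add: Kb_def)
 define q0 where "q0 = 2 * Kb + 2 * K\<^sup>2 * \<mu>"
 have q0: "0 \<le> q0" using Kb0 \<mu>0 by (simp add: q0_def)
 \<comment> \<open>On the inner domain q0 bounds the squared L2 distance of the two solutions at
   almost every time, so a slab of this length contributes at most e/4.\<close>
 define T' where "T' = T - min (T / 2) (e / (4 * (q0 + 1)))"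
 have T': "0 < T'" "T' < T" "(T - T') * q0 \<le> e / 4"
 proof -
  have "0 < e / (4 * (q0 + 1))" using e q0 by simp
  moreover have "min (T / 2) (e / (4 * (q0 + 1))) \<le> T / 2" by (rule min.cobounded1)
  ultimately show "0 < T'" "T' < T" unfolding T'_def using T by linarith+
  have "(T - T') * q0 \<le> (e / (4 * (q0 + 1))) * q0" using q0 by (intro mult_right_mono) (auto simp: T'_def)
  also have "\<dots> \<le> (e / (4 * (q0 + 1))) * (q0 + 1)" using e q0 by (intro mult_left_mono) auto
  also have "\<dots> = e / 4" using q0 by (simp add: field_simps)
  finally show "(T - T') * q0 \<le> e / 4" .
 qed
 define XT where "XT = exp ((2 * L + 2) * T)"
 have XT: "0 < XT" by (simp add: XT_def)
 \<comment> \<open>Chosen so that both 2 e' and 10 T XT e' are at most e/4.\<close>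
 define e' where "e' = e / (8 + 40 * T * XT)"
 have den: "0 < 8 + 40 * T * XT" using T XT by (intro add_pos_nonneg) auto
 have e': "0 < e'" "2 * e' \<le> e / 4" "10 * T * XT * e' \<le> e / 4"
 proof -
  show p: "0 < e'" using e den by (simp add: e'_def)
  have "e = e' * (8 + 40 * T * XT)" using den by (simp add: e'_def)
  then have eq: "e = 8 * e' + 40 * T * XT * e'" by (simp add: algebra_simps)
  have "0 \<le> T * XT * e'" using T XT p by simp
  then show "2 * e' \<le> e / 4" "10 * T * XT * e' \<le> e / 4" using eq p by auto
 qed
 obtain z zt Gz A B C1 S where z: "z \<in> borel_fun" "!!y. \<bar>z y\<bar> \<le> K" "zt \<in> borel_fun" "!!y. \<bar>zt y\<bar> \<le> C1"
  "Gz \<in> borel_fun" "!!y. norm (Gz y) \<le> C1" "bounded S" "!!y. snd y \<notin> S ==> z y = 0" "!!y. snd y \<notin> S ==> Gz y = 0"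
  "!!s r x. s \<le> r ==> (LBINT \<sigma>:{s..r}. zt (\<sigma>, x)) = z (r, x) - z (s, x)"
  "!!t. wgrad UNIV (%x. z (t, x)) (%x. Gz (t, x))"
  and AB: "L2 A" "L2 B" "sqn A \<le> e'" "sqn B \<le> e'" "!!y. snd y \<notin> \<Omega>1 ==> A y = 0" "!!y. snd y \<notin> \<Omega>1 ==> B y = 0"
  and zv: "L2 (%y. ind \<Omega>1 (snd y) * (z y - v1 y))" "sqn (%y. ind \<Omega>1 (snd y) * (z y - v1 y)) \<le> e'"
  and init: "sqn (%x. ind \<Omega>1 x * (z (0, x) - w1 0 x)) \<le> e'"
  and res: "AE t in lborel. t \<in> {0<..<T'} --> (\<forall>\<psi> \<Psi>. H1 \<Omega>1 \<psi> \<Psi> -->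
    (LBINT x. ind \<Omega>1 x * (zt (t, x) * \<psi> x + Gz (t, x) \<bullet> \<Psi> x - f (z (t, x)) * \<psi> x))
     = (LBINT x. A (t, x) \<bullet> \<Psi> x + B (t, x) * \<psi> x))"
  by (rule neumann_approx[OF c1 \<Omega>1(1) bd1 \<Omega>1(2) T bi(1,2) K Lf(2) T'(2) e'(1)]) (assumption, assumption, rule that, assumption+)
 define C where "C = max C1 (Lf * K)"
 have C: "\<bar>zt y\<bar> \<le> C" "norm (Gz y) \<le> C" for y using z(4,6)[of y] by (auto simp: C_def)
 have fC: "\<bar>f b\<bar> \<le> C" if "\<bar>b\<bar> \<le> K" for b
 proof -
  have "\<bar>f b\<bar> \<le> Lf * \<bar>b\<bar>" using Lf(2)[OF that, of 0] bi(2) K0 by simp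
  also have "\<dots> \<le> Lf * K" using that Lf(1) by (rule mult_left_mono)
  finally show ?thesis by (simp add: C_def)
 qed
 \<comment> \<open>The coefficient of the layer measure after Gronwall and integration in time; it
   depends on z through C, so the width of the layer is fixed after z.\<close>
 define q1 where "q1 = 4 * T * XT * ((M + K)\<^sup>2 + 4 * T * C\<^sup>2)"
 have q1: "0 \<le> q1" using T XT by (simp add: q1_def)
 define \<delta> where "\<delta> = e / (8 * (q1 + 1))"
 have \<delta>: "0 < \<delta>" "q1 * \<delta> \<le> e / 8"
 proof -
  show p: "0 < \<delta>" using e q1 by (simp add: \<delta>_def)
  have "q1 * \<delta> \<le> (q1 + 1) * \<delta>" using p by (intro mult_right_mono) auto
  also have "\<dots> = e / 8" using q1 by (simp add: \<delta>_def field_simps)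
  finally show "q1 * \<delta> \<le> e / 8" .
 qed
 have cK: "compact (closure \<Omega>1)" using bd1 by simp
 obtain X where X: "test_fun UNIV X" "!!x. 0 \<le> X x" "!!x. X x \<le> 1" "!!x. x \<in> closure \<Omega>1 ==> X x = 1"
  and lay: "measure lborel {x. x \<notin> closure \<Omega>1 \<and> X x \<noteq> 0} \<le> \<delta>" "emeasure lborel {x. x \<notin> closure \<Omega>1 \<and> X x \<noteq> 0} < \<infinity>"
  by (rule smooth_cutoff[OF cK \<delta>(1)]) (rule that, assumption+)
 obtain Z where Z: "!!x. norm (gradf X x) \<le> Z" "0 \<le> Z" by (rule gradf_bounded[OF X(1)]) (rule that, assumption+)
 define r2 where "r2 = T * (C\<^sup>2 * \<mu> + 4 * Z\<^sup>2 * (2 * Kb + 2 * K\<^sup>2 * \<mu>))"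
 \<comment> \<open>The coefficient of \<epsilon>; it contains the gradient bound Z of the cut-off,
   so \<epsilon> is chosen last.\<close>
 define q2 where "q2 = 4 * T * XT * r2"
 have r2: "0 \<le> r2" using T Kb0 \<mu>0 by (simp add: r2_def)
 have q2: "0 \<le> q2" using T XT r2 by (simp add: q2_def)
 define \<epsilon>0 where "\<epsilon>0 = min 1 (e / (8 * (q2 + 1)))"
 have \<epsilon>0: "0 < \<epsilon>0" using e q2 by (simp add: \<epsilon>0_def)
 show ?thesis
 proof (rule that[OF \<epsilon>0])
  fix \<epsilon> v G w assume \<epsilon>: "0 < \<epsilon>" "\<epsilon> < \<epsilon>0" and c: "clean_sol \<Omega> (Deps \<Omega>1 \<epsilon>) f u0 T v G w"
  have \<epsilon>1: "\<epsilon> \<le> 1" using \<epsilon> by (simp add: \<epsilon>0_def)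
  have \<epsilon>q: "q2 * \<epsilon> \<le> e / 8"
  proof -
   have "q2 * \<epsilon> \<le> (q2 + 1) * (e / (8 * (q2 + 1)))" using \<epsilon> q2 by (intro mult_mono) (auto simp: \<epsilon>0_def)
   also have "\<dots> = e / 8" using q2 by (simp add: field_simps)
   finally show ?thesis .
  qed
  note s = clean_solD[OF c]
  note Ls = clean_sol_L2[OF c \<Omega>(2) bi(1,2)]
  have Dm: "Deps \<Omega>1 \<epsilon> \<in> borel_fun"
  proof -
   have [measurable]: "closure \<Omega>1 \<in> sets borel" by simp
   show ?thesis unfolding Deps_def[abs_def] by measurable
  qed
  have D1: "\<bar>Deps \<Omega>1 \<epsilon> x\<bar> \<le> 1" "0 \<le> Deps \<Omega>1 \<epsilon> x" for x using \<epsilon> \<epsilon>1 by (simp_all add: Deps_def)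
  have pos: "AE y in lborel. 0 \<le> v y"
   by (rule sol_nonneg(1)[OF c \<Omega> T Dm D1 bi(1,2) lip0]) (use u0 in auto)
  have w0: "sqn (w 0) \<le> M\<^sup>2 * \<mu>"
  proof -
   have i: "integrable lborel (%x. M\<^sup>2 * ind \<Omega> x)" using \<Omega>f by (intro integrable_mult_right integrable_real_indicator) auto
   have "sqn (w 0) \<le> (LBINT x. M\<^sup>2 * ind \<Omega> x)" unfolding sqn_real
   proof (rule integral_mono_AE[OF L2_integrable_real[OF s(7)] i])
    show "AE x in lborel. (w 0 x)\<^sup>2 \<le> M\<^sup>2 * ind \<Omega> x"
     using s(10)
    proof eventually_elim
     case (elim x)
     show ?case
     proof (cases "x \<in> \<Omega>")
      case True
      then show ?thesis using elim u0[OF True] by (auto intro: power_mono)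
     qed (simp add: s(8))
    qed
   qed
   also have "\<dots> = M\<^sup>2 * \<mu>" by (simp add: \<mu>_def)
   finally show ?thesis .
  qed
  have Kb: "sqn (w t) \<le> Kb" if "t \<in> {0..<T}" for t
  proof -
   have "sqn (w t) \<le> sqn (w 0) * exp (2 * L * T)"
    by (rule sol_L2_bound[OF c \<Omega> T Dm D1 bi(1,2) fs L(1) pos that])
   also have "\<dots> \<le> Kb" unfolding Kb_def using w0 by (rule mult_right_mono) simp
   finally show ?thesis .
  qed
  have init': "sqn (%x. ind \<Omega>1 x * (z (0, x) - w 0 x)) \<le> e'"
  proof -
   have "sqn (%x. ind \<Omega>1 x * (z (0, x) - w 0 x)) = sqn (%x. ind \<Omega>1 x * (z (0, x) - w1 0 x))"
    unfolding sqn_def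
   proof (rule integral_cong_AE)
    note [measurable] = L2_measurable[OF s(7)] L2_measurable[OF s1(7)] measurable_slice(1)[OF z(1), of 0]
    show "(%x. (norm (ind \<Omega>1 x * (z (0, x) - w 0 x)))\<^sup>2) \<in> borel_measurable lborel"
     "(%x. (norm (ind \<Omega>1 x * (z (0, x) - w1 0 x)))\<^sup>2) \<in> borel_measurable lborel" by measurable
    show "AE x in lborel. (norm (ind \<Omega>1 x * (z (0, x) - w 0 x)))\<^sup>2 = (norm (ind \<Omega>1 x * (z (0, x) - w1 0 x)))\<^sup>2"
     using s(10) s1(10)
    proof eventually_elim
     case (elim x)
     show ?case using elim sub by (cases "x \<in> \<Omega>1") auto
    qed
   qed
   then show ?thesis using init by simp
  qed
  have u0M: "\<bar>u0 x\<bar> \<le> M" if "x \<in> \<Omega>" for x using u0[OF that] by simp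
  note null = smooth_boundary_null[OF \<Omega>1(1) bd1 \<Omega>1(2)]
  define W where "W t x = ind \<Omega> x * X x * (w t x - z (t, x))" for t x
  have WL: "L2 (W t)" for t
   unfolding W_def[abs_def]
   by (rule layer_energy(1)[OF c \<Omega> \<Omega>1(1) sub null T \<epsilon>(1) \<epsilon>1 bi(1,2) pos Kb u0M
     z(1,2,3) C(1) z(5) C(2) z(7-11) AB init' res L(2,1) fC X Z(1) lay less_imp_le[OF T'(1)] T'(2)])
  have We: "t \<in> {0..T'} ==> sqn (W t) / 2 \<le> (5 / 2 * e' + ((M + K)\<^sup>2 + 4 * T * C\<^sup>2) * \<delta> + \<epsilon> * r2) * exp ((2 * L + 2) * t)" for t
   unfolding W_def[abs_def] r2_def \<mu>_def
   by (rule layer_energy(2)[OF c \<Omega> \<Omega>1(1) sub null T \<epsilon>(1) \<epsilon>1 bi(1,2) pos Kb[unfolded \<mu>_def] u0M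
     z(1,2,3) C(1) z(5) C(2) z(7-11) AB init' res L(2,1) fC X Z(1) lay less_imp_le[OF T'(1)] T'(2)])
  define b where "b = (5 / 2 * e' + ((M + K)\<^sup>2 + 4 * T * C\<^sup>2) * \<delta> + \<epsilon> * r2) * XT"
  have Wb: "sqn (W t) \<le> 2 * b" if "t \<in> {0..T'}" for t
  proof -
   have "sqn (W t) / 2 \<le> (5 / 2 * e' + ((M + K)\<^sup>2 + 4 * T * C\<^sup>2) * \<delta> + \<epsilon> * r2) * exp ((2 * L + 2) * t)"
    by (rule We[OF that])
   also have "\<dots> \<le> b" unfolding b_def XT_def
    using that T' L(1) e' \<delta> \<epsilon> r2 T by (intro mult_left_mono) (auto intro!: mult_left_mono add_nonneg_nonneg mult_nonneg_nonneg)
   finally show ?thesis by simp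
  qed
  have b0: "0 \<le> b" using Wb[of 0] T'(1) order_trans[OF sqn_nonneg] by fastforce
  define h where "h y = ind \<Omega>1 (snd y) * (v y - v1 y)" for y
  have hL: "L2 h" using L2_space_indicator(1)[OF L2_diff[OF Ls(1) Ls1(1)], of \<Omega>1] by (simp add: h_def[abs_def])
  define q where "q y = ind \<Omega>1 (snd y) * (z y - v1 y)" for y
  have qL: "L2 q" "sqn q \<le> e'" using zv by (simp_all add: q_def[abs_def])
  \<comment> \<open>A majorant of the distance on time slices: before T' the energy estimate (the
    factor 4 is 2 * 2, from splitting through z and from the halved energy), after T' the crude
    bound q0, and always the distance of z from the limit solution.\<close>
  define J where "J r = ind {0<..T'} r * (4 * b) + ind {T'<..<T} r * q0 + 2 * sqn (%x. q (r, x))" for r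
  have J0: "2 * sqn (%x. q (r, x)) \<le> J r" for r using b0 q0 by (simp add: J_def)
  have hJ: "AE r in lborel. sqn (%x. h (r, x)) \<le> J r"
   using s(6) L2_slice(1)[OF hL] L2_slice(1)[OF qL(1)]
  proof eventually_elim
   case (elim r)
   consider "r \<notin> {0<..<T}" | "r \<in> {0<..T'}" "r \<in> {0<..<T}" | "r \<in> {T'<..<T}" "r \<in> {0<..<T}" using T' by fastforce
   then show ?case
   proof cases
    case 1
    then have "h (r, x) = 0" for x using s(4)[of "(r, x)"] s1(4)[of "(r, x)"] by (auto simp: h_def cyl_def)
    then have "sqn (%x. h (r, x)) = 0" by (simp add: sqn_def)
    then show ?thesis using J0[of r] sqn_nonneg[of "%x. q (r, x)"] by linarith
   next
    case 2
    then have ae: "AE x in lborel. v (r, x) = w r x" using elim(1) by blast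
    have "sqn (%x. h (r, x)) \<le> (LBINT x. 2 * (W r x)\<^sup>2 + 2 * (q (r, x))\<^sup>2)" unfolding sqn_real
    proof (rule integral_mono_AE[OF L2_integrable_real[OF elim(2)]])
     show "integrable lborel (%x. 2 * (W r x)\<^sup>2 + 2 * (q (r, x))\<^sup>2)"
      using L2_integrable_real[OF WL] L2_integrable_real[OF elim(3)] by simp
     show "AE x in lborel. (h (r, x))\<^sup>2 \<le> 2 * (W r x)\<^sup>2 + 2 * (q (r, x))\<^sup>2"
      using ae
     proof eventually_elim
      case (elim x)
      show ?case
      proof (cases "x \<in> \<Omega>1")
       case True
       then have "X x = 1" "x \<in> \<Omega>" using X(4)[of x] closure_subset[of \<Omega>1] sub by auto
       then have "h (r, x) = W r x + q (r, x)" using True elim by (simp add: h_def W_def q_def)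
       then show ?thesis using norm_add_sq_le[of "W r x" "q (r, x)"] by simp
      qed (simp add: h_def)
     qed
    qed
    also have "\<dots> = 2 * sqn (W r) + 2 * sqn (%x. q (r, x))"
     using L2_integrable_real[OF WL] L2_integrable_real[OF elim(3)] by (simp add: sqn_real)
    also have "\<dots> \<le> J r" using Wb[of r] 2 by (simp add: J_def)
    finally show ?thesis .
   next
    case 3
    then have ae: "AE x in lborel. v (r, x) = w r x" using elim(1) by blast
    have i: "integrable lborel (%x. 2 * K\<^sup>2 * ind \<Omega> x)" using \<Omega>f by (intro integrable_mult_right integrable_real_indicator) auto
    have "sqn (%x. h (r, x)) \<le> (LBINT x. 2 * (w r x)\<^sup>2 + 2 * K\<^sup>2 * ind \<Omega> x)" unfolding sqn_real
    proof (rule integral_mono_AE[OF L2_integrable_real[OF elim(2)]])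
     show "integrable lborel (%x. 2 * (w r x)\<^sup>2 + 2 * K\<^sup>2 * ind \<Omega> x)"
      by (rule lintegrable_add[OF integrable_mult_right[OF L2_integrable_real[OF s(7)]] i])
     show "AE x in lborel. (h (r, x))\<^sup>2 \<le> 2 * (w r x)\<^sup>2 + 2 * K\<^sup>2 * ind \<Omega> x"
      using ae
     proof eventually_elim
      case (elim x)
      show ?case
      proof (cases "x \<in> \<Omega>1")
       case True
       have "(w r x + (- v1 (r, x)))\<^sup>2 \<le> 2 * (w r x)\<^sup>2 + 2 * (v1 (r, x))\<^sup>2"
        using norm_add_sq_le[of "w r x" "- v1 (r, x)"] by simp
       moreover have "(v1 (r, x))\<^sup>2 \<le> K\<^sup>2" using power_mono[OF K[of "(r, x)"] abs_ge_zero, of 2] by simp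
       ultimately show ?thesis using True sub elim by (auto simp: h_def)
      qed (simp add: h_def)
     qed
    qed
    also have "\<dots> = 2 * sqn (w r) + 2 * K\<^sup>2 * \<mu>"
     using L2_integrable_real[OF s(7)] i by (simp add: sqn_real \<mu>_def)
    also have "\<dots> \<le> q0" using Kb[of r] 3 by (simp add: q0_def)
    also have "\<dots> \<le> J r" using 3 b0 by (simp add: J_def)
    finally show ?thesis .
   qed
  qed
  have iJ: "integrable lborel (%r::real. ind {0<..T'} r * (4 * b))" "integrable lborel (%r::real. ind {T'<..<T} r * q0)"
   using T' by (auto intro!: integrable_mult_left integrable_real_indicator)
  have iq: "integrable lborel (%r. 2 * sqn (%x. q (r, x)))" using L2_slice(3)[OF qL(1)] by simp
  have "sqn h = (LBINT r. sqn (%x. h (r, x)))" by (rule L2_slice(4)[OF hL])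
  also have "\<dots> \<le> (LBINT r. J r)"
   unfolding J_def by (rule integral_mono_AE[OF L2_slice(3)[OF hL] _ hJ[unfolded J_def]]) (intro lintegrable_add iJ iq)
  also have "\<dots> = T' * (4 * b) + (T - T') * q0 + 2 * sqn q"
   unfolding J_def using iJ iq T' L2_slice(4)[OF qL(1)] by simp
  also have "\<dots> \<le> e"
  proof -
   have "T' * (4 * b) \<le> T * (4 * b)" using T' b0 by (intro mult_right_mono) auto
   also have "\<dots> = 10 * T * XT * e' + q1 * \<delta> + q2 * \<epsilon>" by (simp add: b_def q1_def q2_def algebra_simps)
   also have "\<dots> \<le> e / 4 + e / 8 + e / 8" using e'(3) \<delta>(2) \<epsilon>q by linarith
   finally show ?thesis using T'(3) qL(2) e'(2) by linarith
  qed
  finally show "sqn (%y. ind \<Omega>1 (snd y) * (v y - v1 y)) \<le> e" by (simp add: h_def[abs_def])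
 qed
qed

theorem theorem1p2:
  fixes \<Omega> \<Omega>1 :: "'a::euclidean_space set"
    and T M \<alpha> :: real
    and u0 :: "'a \<Rightarrow> real"
    and f :: "real \<Rightarrow> real"
    and ueps :: "real \<Rightarrow> real \<Rightarrow> 'a \<Rightarrow> real"
    and u :: "real \<Rightarrow> 'a \<Rightarrow> real"
  assumes "open \<Omega>" "bounded \<Omega>" "smooth_boundary \<Omega>"
    and "open \<Omega>1" "connected \<Omega>1" "smooth_boundary \<Omega>1" "closure \<Omega>1 \<subseteq> \<Omega>"
    and "connected (\<Omega> - closure \<Omega>1)"
    and "T > 0"
    and "M \<ge> 1" "continuous_on (closure \<Omega>) u0" "\<forall>x\<in>\<Omega>. 0 \<le> u0 x \<and> u0 x \<le> M"
    and "bistable f \<alpha>"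
    and "\<forall>\<epsilon>>0. weak_sol \<Omega> (Deps \<Omega>1 \<epsilon>) f u0 T (ueps \<epsilon>)"
    and "weak_sol \<Omega>1 (\<lambda>_. 1) f u0 T u"
  shows "((\<lambda>\<epsilon>. LINT z|lebesgue_on (cyl T \<Omega>1). (ueps \<epsilon> (fst z) (snd z) - u (fst z) (snd z))\<^sup>2)
           \<longlongrightarrow> 0) (at_right 0)"
proof -
 note bi = bistableD[OF assms(13)]
 have sub: "\<Omega>1 \<subseteq> \<Omega>" using closure_subset assms(7) by blast
 have bd1: "bounded \<Omega>1" using assms(2) sub by (rule bounded_subset)
 have cl: "closure \<Omega>1 \<subseteq> closure \<Omega>" using assms(7) closure_subset by blast
 have one: "(%_. 1) \<in> borel_fun" "\<bar>1\<bar> \<le> (1::real)" by simp_all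
 obtain v1 G1 w1 where c1: "clean_sol \<Omega>1 (%_. 1) f u0 T v1 G1 w1" and v1: "AE z in lborel. z \<in> cyl T \<Omega>1 --> v1 z = u (fst z) (snd z)"
  by (rule clean_sol_exists[OF assms(4) bd1 assms(9) one bi(1,2) continuous_on_subset[OF assms(11) cl] assms(15)]) (rule that, assumption+)
 have u0: "0 \<le> u0 x \<and> u0 x \<le> M" if "x \<in> \<Omega>" for x using assms(12) that by blast
 have Cb: "cyl T \<Omega>1 \<in> sets borel" using cyl_open[OF assms(4)] by (rule borel_open)
 note s1 = clean_solD[OF c1]
 show ?thesis unfolding tendsto_iff
 proof (intro allI impI)
  fix e :: real assume e: "e > 0"
  \<comment> \<open>Half of e, because the definition of the limit asks for a strict
    inequality.\<close>
  obtain \<epsilon>0 where \<epsilon>0: "\<epsilon>0 > 0" "!!\<epsilon> v G w. 0 < \<epsilon> ==> \<epsilon> < \<epsilon>0 ==> clean_sol \<Omega> (Deps \<Omega>1 \<epsilon>) f u0 T v G w ==>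
    sqn (%y. ind \<Omega>1 (snd y) * (v y - v1 y)) \<le> e / 2"
   by (rule clean_sols_close[OF assms(1,2,4,6,7,9) u0 assms(13) c1, of "e / 2"]) (use e in \<open>assumption | simp | rule that\<close>)+
  have "dist (LINT z|lebesgue_on (cyl T \<Omega>1). (ueps \<epsilon> (fst z) (snd z) - u (fst z) (snd z))\<^sup>2) 0 < e" if \<epsilon>: "0 < \<epsilon>" "\<epsilon> < \<epsilon>0" for \<epsilon>
  proof -
   have [measurable]: "closure \<Omega>1 \<in> sets borel" by simp
   have Dm: "Deps \<Omega>1 \<epsilon> \<in> borel_fun" unfolding Deps_def[abs_def] by measurable
   have D1: "\<bar>Deps \<Omega>1 \<epsilon> x\<bar> \<le> max 1 \<epsilon>" for x using \<epsilon> by (simp add: Deps_def)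
   have sol: "weak_sol \<Omega> (Deps \<Omega>1 \<epsilon>) f u0 T (ueps \<epsilon>)" using assms(14) \<epsilon>(1) by blast
   \<comment> \<open>Each \<epsilon> has its own representatives; on the inner cylinder they agree
     almost everywhere with the given solution, so the integral in question is the
     \<open>sqn\<close> estimated before.\<close>
   obtain v G w where c: "clean_sol \<Omega> (Deps \<Omega>1 \<epsilon>) f u0 T v G w" and v: "AE z in lborel. z \<in> cyl T \<Omega> --> v z = ueps \<epsilon> (fst z) (snd z)"
    by (rule clean_sol_exists[OF assms(1,2,9) Dm D1 bi(1,2) assms(11) sol]) (rule that, assumption+)
   note s = clean_solD[OF c]
   note [measurable] = s(1) s1(1)
   have [measurable]: "\<Omega>1 \<in> sets borel" using assms(4) by simp
   define h where "h y = (ind \<Omega>1 (snd y) * (v y - v1 y))\<^sup>2" for y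
   have hm: "h \<in> borel_fun" unfolding h_def by measurable
   have h0: "h y = 0" if "y \<notin> cyl T \<Omega>1" for y
   proof (cases "snd y \<in> \<Omega>1")
    case True
    then have "y \<notin> cyl T \<Omega>" using that by (auto simp: cyl_def mem_Times_iff)
    then show ?thesis using s(4)[of y] s1(4)[OF that] by (simp add: h_def)
   qed (simp add: h_def)
   have ae: "AE z in lborel. z \<in> cyl T \<Omega>1 --> h z = (ueps \<epsilon> (fst z) (snd z) - u (fst z) (snd z))\<^sup>2"
    using v v1 by eventually_elim (use sub in \<open>auto simp: h_def cyl_def\<close>)
   have fm: "(%z. (ueps \<epsilon> (fst z) (snd z) - u (fst z) (snd z))\<^sup>2) \<in> borel_measurable (lebesgue_on (cyl T \<Omega>1))"
    by (rule measurable_AE_lebesgue_on[OF hm ae Cb])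
   have "(LINT z|lebesgue_on (cyl T \<Omega>1). (ueps \<epsilon> (fst z) (snd z) - u (fst z) (snd z))\<^sup>2) = (LBINT z. h z)"
    by (rule lebesgue_on_integral(1)[OF Cb hm h0 fm ae])
   also have "\<dots> = sqn (%y. ind \<Omega>1 (snd y) * (v y - v1 y))" by (simp add: sqn_real h_def)
   finally have eq: "(LINT z|lebesgue_on (cyl T \<Omega>1). (ueps \<epsilon> (fst z) (snd z) - u (fst z) (snd z))\<^sup>2) = \<dots>" .
   show ?thesis unfolding eq using \<epsilon>0(2)[OF \<epsilon> c] e by simp
  qed
  then show "\<forall>\<^sub>F \<epsilon> in at_right 0. dist (LINT z|lebesgue_on (cyl T \<Omega>1). (ueps \<epsilon> (fst z) (snd z) - u (fst z) (snd z))\<^sup>2) 0 < e"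
   unfolding eventually_at_right_field using \<epsilon>0(1) by blast
 qed
qed

end
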